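(* Let $i\in\{0,1\}$ and let the setting and standing assumptions described in the context hold (superscript $i$ dropped). Assume that: (1) there are $b_0\ge 1$, $l\ge 0$ with $n_0(x,s):=\int_0^s b(x,m,s)\,dm\le b_0(1+s^l)$ for a.a. $x\in\Omega$ and $s\ge0$; (2) $\int_0^s\beta(m,s)\,dm\le\beta_0(1+s^l)$ for any $s\ge 0$ and some constant $\beta_0$; (3) there are $r_0\ge 0$, $s_0\ge 0$ such that the set $\{[0,1]\ni z\mapsto sz^{r_0}\beta(zs,s)\}_{s\ge s_0}$ is equi-integrable in $L_1([0,1],dz)$; (4) $b(x,m,s)\le\beta(m,s)$ for a.e. $x\in\Omega$ and $0\le m\le s$; (5) $\mathcal T_0$ is independent of $m$ (i.e. $\mathcal T_{0,m}$ and $D(T_{0,m})$ do not depend on $m$). Then, for any $r\ge r_1$ and $\mu\in[0,1]$, there are constants $M^{(\mu)}_r$ and $\omega_r$ (with $\omega_r$ independent of $\mu$) such that for any $t>0$ and $f\in\mathcal X_r$ $$\|G_{\mathbf K}(t)f\|_{\mathcal X_r^{(\mu)}}\le\|G_{\mathfrak K}(t)f\|_{\mathcal X_r^{(\mu)}}\le\frac{M_r^{(\mu)}}{t^\mu}e^{\omega_rt}\|f\|_{\mathcal X_r}.$$ If, moreover, there are positive constants $a_0,\gamma$ and $m_0\ge1$ such that $\alpha_1(m)\ge a_0m^\gamma$ for $m\ge m_0$, then, for $q:=\mu\gamma\le\gamma$, there is a constant $C_1$ such that for $t>0$ $$\|G_{\mathbf K}(t)f\|_{\mathcal X_{r+q}}\le\|G_{\mathfrak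 K}(t)f\|_{\mathcal X_{r+q}}\le C_1\|G_{\mathfrak K}(t)f\|_{\mathcal X_r^{(\mu)}}\le C_1\frac{M_r^{(\mu)}}{t^\mu}e^{\omega_rt}\|f\|_{\mathcal X_r},\qquad f\in\mathcal X_r.$$
   Context: Spaces. $N\ge1$, $\mathbb R_+=[0,\infty)$; $\Omega\subset\mathbb R^N$ is a bounded open set with $C^2$ boundary or $\Omega=\mathbb R^N$. $X_x^1=L_1(\Omega,dx)$; $X^0_x=C_0(\Omega)$ with the supremum norm, where $C_0(\Omega)=C(\overline\Omega)$ if $\Omega$ is bounded and $C_0(\mathbb R^N)$ is the space of continuous functions tending to $0$ at infinity. For $r\ge0$, $dm_r=(1+m^r)\,dm$ and $\mathcal X_r=\mathcal X^i_r=L_1(\mathbb R_+,X^i_x,dm_r)$ is the Bochner space with norm $\int_0^\infty\|u(\cdot,m)\|_{X^i_x}(1+m^r)\,dm$; its elements are identified with functions $u(x,m)$ and $u(m):=u(\cdot,m)$. Properties for $m\in\mathbb R_+$ are meant for a.e. $m$. A positive $C_0$-semigroup is substochastic if it is contractive. Rate. $a\ge0$, $a\in L_{\infty,loc}(\Omega\times\mathbb R_+)$ if $i=1$ and $a\in L_{\infty,loc}(\mathbb R_+,C_b(\Omega))$ if $i=0$ ($C_b(\Omega)$: bounded continuous functions), and there are $\alpha_1,\alpha_2\in L_{\infty,loc}(\mathbb R_+)$ and $0<M<\infty$ with $\alpha_1(m)\le a(x,m)\le\alpha_2(m)\le M\alpha_1(m)$. Transport. $(\mathcal T_{0,m})_{m\in\mathbb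 R_+}$ is a family of linear expressions acting on functions of $x$, $[\mathcal T_0u](x,m)=[\mathcal T_{0,m}u(\cdot,m)](x)$; for each $m$, the restriction $T_{0,m}$ of $\mathcal T_{0,m}$ to a domain $D(T_{0,m})\subset X_x^i$ generates a substochastic semigroup $(G_{T_{0,m}}(t))_{t\ge0}$ on $X_x^i$. $\mathbf T_0=\mathcal T_0$ on $D(\mathbf T_0)=\{u\in\mathcal X_r: u(m)\in D(T_{0,m}),\ \mathcal T_0u\in\mathcal X_r\}$. Standing assumption (A1): $(\mathbf T_0,D(\mathbf T_0))$ generates a substochastic semigroup on $\mathcal X_r$ given by $[G_{\mathbf T_0}(t)u](x,m)=[G_{T_{0,m}}(t)u(m)](x)$. $\mathbf Au=-au$ on $D(\mathbf A)=\{u\in\mathcal X_r: au\in\mathcal X_r\}$; $\mathbf T=\mathbf T_0+\mathbf A$ on $D(\mathbf T)=D(\mathbf T_0)\cap D(\mathbf A)$. Fragmentation. $b\ge0$ is measurable with $b(x,m,s)=0$ for $m>s$; $[\mathbf Bu](x,m)=\int_m^\infty b(x,m,s)a(x,s)u(x,s)\,ds$, and $\mathbf K=\mathbf T+\mathbf B$ on $D(\mathbf T)$. Majorising problem. $\beta\ge 0$ is measurable on $\mathbb R_+^2$ with support in $\{(m,s):m\le s\}$; $\mathfrak Au=-\alpha_1u$, $[\mathfrak Bu](x,m)=\int_m^\infty\alpha_2(s)\beta(m,s)u(x,s)\,ds$, both on $D(\mathfrak A)=\{u\in\mathcal X_r:\alpha_1u\in\mathcal X_r\}=D(\mathbf A)$;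 $\mathfrak F=\mathfrak A+\mathfrak B$ on $D(\mathfrak A)$; $\mathfrak K=\mathbf T_0+\mathfrak A+\mathfrak B$ on $D(\mathbf T_0)\cap D(\mathfrak A)=D(\mathbf T)$. Threshold $r_1$. $r_1>\max\{l,r_0\}$ is a number, which exists under hypotheses (1)-(5), such that for all $r\ge r_1$: $\|\mathfrak BR(\lambda,\mathbf T_0+\mathfrak A)\|_{L(\mathcal X_r)}<1$ for all sufficiently large $\lambda$, $(\mathfrak F,D(\mathfrak A))$ generates a positive analytic semigroup $(G_{\mathfrak F}(t))_{t\ge0}$ on $\mathcal X_r$, and $\mathfrak K$, $\mathbf K$ with domain $D(\mathbf T)$ generate positive $C_0$-semigroups $(G_{\mathfrak K}(t))_{t\ge0}$, $(G_{\mathbf K}(t))_{t\ge0}$ on $\mathcal X_r$. Intermediate spaces. For $\mu\in[0,1]$, $\mathcal X_r^{(\mu)}=\{f\in\mathcal X_r:\ \|f\|_{\mathcal X_r^{(\mu)}}:=\int_0^\infty\|f(m)\|_{X_x^i}(\omega+\alpha_1(m))^\mu\,dm_r<\infty\}$, where $\omega>1$ is a fixed number greater than the type (growth bound) of $(G_{\mathfrak F}(t))_{t\ge0}$. A bounded set $\mathcal E\subset L_1([0,1],dz)$ is equi-integrable if for any $\varepsilon>0$ there is $\delta>0$ such that $\sup_{f\in\mathcal E}\int_{\Theta_0}|f|\,dz<\varepsilon$ for every measurable $\Theta_0\subset[0,1]$ of measure less than $\delta$.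
   Formalization: The comparisons of the norms of G_K(t)f and G_frakK(t)f (first inequality of each chain) are stated only for f ≥ 0, since they fail for sign-changing f; the final upper bounds for both semigroups are stated for all f in X_r, the bound for G_K(t)f separately. *)

theory Defs
  imports "HOL-Analysis.Analysis"
begin

text \<open>Elements of a function space are represented by functions; two representatives stand
  for the same element when the norm of their difference is \<open>0\<close> (\<open>fs_eq\<close>).  Norms take values
  in \<^typ>\<open>ennreal\<close>, so that they are meaningful for functions outside the space as well.
  The field \<open>cone\<close> holds the nonnegative functions.\<close>

record 'p fspace =
  elems :: "('p \<Rightarrow> real) set"
  nrm :: "('p \<Rightarrow> real) \<Rightarrow> ennreal"
  cone :: "('p \<Rightarrow> real) set"

definition fs_eq :: "'p fspace \<Rightarrow> ('p \<Rightarrow> real) \<Rightarrow> ('p \<Rightarrow> real) \<Rightarrow> bool" where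
  "fs_eq X f g \<longleftrightarrow> nrm X (\<lambda>p. f p - g p) = 0"


section \<open>Operators and semigroups\<close>

text \<open>An unbounded operator is given by its graph, a set of pairs of representatives; its
  domain is \<^term>\<open>Domain A\<close>.\<close>

type_synonym 'p operator = "(('p \<Rightarrow> real) \<times> ('p \<Rightarrow> real)) set"

definition restriction_to ::
  "'p fspace \<Rightarrow> ('p \<Rightarrow> real) set \<Rightarrow> (('p \<Rightarrow> real) \<Rightarrow> 'p \<Rightarrow> real) \<Rightarrow> 'p operator" where
  "restriction_to X D T = {(f, g). f \<in> elems X \<and> f \<in> D \<and> g \<in> elems X \<and> fs_eq X g (T f)}"

definition op_sum :: "'p fspace \<Rightarrow> 'p operator \<Rightarrow> 'p operator \<Rightarrow> 'p operator" where
  "op_sum X A B = {(u, w). w \<in> elems X \<and>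
     (\<exists>v v'. (u, v) \<in> A \<and> (u, v') \<in> B \<and> fs_eq X w (\<lambda>p. v p + v' p))}"

definition linear_expr_on ::
  "'p fspace \<Rightarrow> ('p \<Rightarrow> real) set \<Rightarrow> (('p \<Rightarrow> real) \<Rightarrow> 'p \<Rightarrow> real) \<Rightarrow> bool" where
  "linear_expr_on X D T \<longleftrightarrow> (\<forall>f\<in>D. \<forall>g\<in>D. \<forall>c d.
     (\<lambda>p. c * f p + d * g p) \<in> D \<and>
     fs_eq X (T (\<lambda>p. c * f p + d * g p)) (\<lambda>p. c * T f p + d * T g p))"

definition bounded_operator :: "'p fspace \<Rightarrow> (('p \<Rightarrow> real) \<Rightarrow> 'p \<Rightarrow> real) \<Rightarrow> bool" where
  "bounded_operator X S \<longleftrightarrow>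
     (\<forall>f\<in>elems X. S f \<in> elems X) \<and> linear_expr_on X (elems X) S \<and>
     (\<exists>C. \<forall>f\<in>elems X. nrm X (S f) \<le> ennreal C * nrm X f)"

definition C0_semigroup :: "'p fspace \<Rightarrow> (real \<Rightarrow> ('p \<Rightarrow> real) \<Rightarrow> 'p \<Rightarrow> real) \<Rightarrow> bool" where
  "C0_semigroup X G \<longleftrightarrow>
     (\<forall>t\<ge>0. bounded_operator X (G t)) \<and>
     (\<forall>f\<in>elems X. fs_eq X (G 0 f) f) \<and>
     (\<forall>s\<ge>0. \<forall>t\<ge>0. \<forall>f\<in>elems X. fs_eq X (G (s + t) f) (G s (G t f))) \<and>
     (\<forall>f\<in>elems X. ((\<lambda>t. nrm X (\<lambda>p. G t f p - f p)) \<longlongrightarrow> 0) (at_right 0))"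

definition positive_semigroup :: "'p fspace \<Rightarrow> (real \<Rightarrow> ('p \<Rightarrow> real) \<Rightarrow> 'p \<Rightarrow> real) \<Rightarrow> bool" where
  "positive_semigroup X G \<longleftrightarrow>
     C0_semigroup X G \<and> (\<forall>t\<ge>0. \<forall>f\<in>elems X \<inter> cone X. G t f \<in> cone X)"

definition substochastic_semigroup ::
  "'p fspace \<Rightarrow> (real \<Rightarrow> ('p \<Rightarrow> real) \<Rightarrow> 'p \<Rightarrow> real) \<Rightarrow> bool" where
  "substochastic_semigroup X G \<longleftrightarrow>
     positive_semigroup X G \<and> (\<forall>t\<ge>0. \<forall>f\<in>elems X. nrm X (G t f) \<le> nrm X f)"

definition generator :: "'p fspace \<Rightarrow> (real \<Rightarrow> ('p \<Rightarrow> real) \<Rightarrow> 'p \<Rightarrow> real) \<Rightarrow> 'p operator" where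
  "generator X G = {(f, g). f \<in> elems X \<and> g \<in> elems X \<and>
     ((\<lambda>h. nrm X (\<lambda>p. (G h f p - f p) / h - g p)) \<longlongrightarrow> 0) (at_right 0)}"

definition generates ::
  "'p fspace \<Rightarrow> 'p operator \<Rightarrow> (real \<Rightarrow> ('p \<Rightarrow> real) \<Rightarrow> 'p \<Rightarrow> real) \<Rightarrow> bool" where
  "generates X A G \<longleftrightarrow> C0_semigroup X G \<and> generator X G = A"

text \<open>The type of a semigroup; it may be \<open>-\<infinity>\<close>.\<close>

definition growth_bound :: "'p fspace \<Rightarrow> (real \<Rightarrow> ('p \<Rightarrow> real) \<Rightarrow> 'p \<Rightarrow> real) \<Rightarrow> ereal" where
  "growth_bound X G = Inf {ereal w |w.
     \<exists>C. \<forall>t\<ge>0. \<forall>f\<in>elems X. nrm X (G t f) \<le> ennreal (C * exp (w * t)) * nrm X f}"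

definition resolvent :: "'p fspace \<Rightarrow> 'p operator \<Rightarrow> real \<Rightarrow> 'p operator" where
  "resolvent X A \<kappa> = {(f, u). f \<in> elems X \<and>
     (\<exists>w. (u, w) \<in> A \<and> fs_eq X (\<lambda>p. \<kappa> * u p - w p) f)}"

text \<open>Since \<^term>\<open>A\<close> is linear, the norm bound contains the injectivity of \<open>\<kappa> - A\<close>.\<close>

definition resolvent_set :: "'p fspace \<Rightarrow> 'p operator \<Rightarrow> real set" where
  "resolvent_set X A = {\<kappa>. Domain (resolvent X A \<kappa>) = elems X \<and>
     (\<exists>C. \<forall>(f, u)\<in>resolvent X A \<kappa>. nrm X u \<le> ennreal C * nrm X f)}"

definition op_norm :: "'p fspace \<Rightarrow> 'p operator \<Rightarrow> ennreal" where
  "op_norm X P = (SUP (f, v)\<in>{(f, v)\<in>P. nrm X f \<le> 1}. nrm X v)"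


subsection \<open>Analytic semigroups, via the complexification of the Banach lattice\<close>

definition celems :: "'p fspace \<Rightarrow> ('p \<Rightarrow> complex) set" where
  "celems X = {f. (\<lambda>p. Re (f p)) \<in> elems X \<and> (\<lambda>p. Im (f p)) \<in> elems X}"

definition cnrm :: "'p fspace \<Rightarrow> ('p \<Rightarrow> complex) \<Rightarrow> ennreal" where
  "cnrm X f = nrm X (\<lambda>p. cmod (f p))"

definition cbounded_operator :: "'p fspace \<Rightarrow> (('p \<Rightarrow> complex) \<Rightarrow> 'p \<Rightarrow> complex) \<Rightarrow> bool" where
  "cbounded_operator X S \<longleftrightarrow>
     (\<forall>f\<in>celems X. S f \<in> celems X) \<and>
     (\<forall>f\<in>celems X. \<forall>g\<in>celems X. \<forall>c d.
        cnrm X (\<lambda>p. S (\<lambda>p. c * f p + d * g p) p - (c * S f p + d * S g p)) = 0) \<and>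
     (\<exists>C. \<forall>f\<in>celems X. cnrm X (S f) \<le> ennreal C * cnrm X f)"

definition sector :: "real \<Rightarrow> complex set" where
  "sector \<theta> = {z. z \<noteq> 0 \<and> \<bar>Arg z\<bar> < \<theta>}"

definition analytic_semigroup ::
  "'p fspace \<Rightarrow> (real \<Rightarrow> ('p \<Rightarrow> real) \<Rightarrow> 'p \<Rightarrow> real) \<Rightarrow> bool" where
  "analytic_semigroup X G \<longleftrightarrow> C0_semigroup X G \<and>
     (\<exists>\<theta> S. 0 < \<theta> \<and> \<theta> \<le> pi / 2 \<and>
       (\<forall>z\<in>sector \<theta>. cbounded_operator X (S z)) \<and>
       (\<forall>z\<in>sector \<theta>. \<forall>w\<in>sector \<theta>. \<forall>f\<in>celems X.
          cnrm X (\<lambda>p. S (z + w) f p - S z (S w f) p) = 0) \<and>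
       (\<forall>z\<in>sector \<theta>. \<exists>D. cbounded_operator X D \<and>
          (\<forall>\<epsilon>>0. \<exists>\<delta>>0. \<forall>h. h \<noteq> 0 \<longrightarrow> cmod h < \<delta> \<longrightarrow> z + h \<in> sector \<theta> \<longrightarrow> (\<forall>f\<in>celems X.
             cnrm X (\<lambda>p. (S (z + h) f p - S z f p) / h - D f p) \<le> ennreal \<epsilon> * cnrm X f))) \<and>
       (\<forall>\<theta>'. 0 < \<theta>' \<longrightarrow> \<theta>' < \<theta> \<longrightarrow> (\<forall>f\<in>celems X.
          ((\<lambda>z. cnrm X (\<lambda>p. S z f p - f p)) \<longlongrightarrow> 0) (at 0 within sector \<theta>'))) \<and>
       (\<forall>t>0. \<forall>f\<in>celems X. cnrm X (\<lambda>p. S (complex_of_real t) f p -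
          Complex (G t (\<lambda>p. Re (f p)) p) (G t (\<lambda>p. Im (f p)) p)) = 0))"


section \<open>Domains and spaces\<close>

definition C2_function :: "(real^'n \<Rightarrow> real) \<Rightarrow> bool" where
  "C2_function g \<longleftrightarrow> (\<exists>(Dg :: real^'n \<Rightarrow> real^'n) (H :: real^'n \<Rightarrow> (real^'n) \<Rightarrow>\<^sub>L (real^'n)).
     (\<forall>y. (g has_derivative (\<lambda>h. Dg y \<bullet> h)) (at y)) \<and>
     (\<forall>y. (Dg has_derivative blinfun_apply (H y)) (at y)) \<and>
     continuous_on UNIV H)"

text \<open>Near every boundary point, and in suitably rotated coordinates with last axis \<^term>\<open>e\<close>,
  the set is the part above the graph of a \<open>C\<^sup>2\<close> function of the remaining coordinates, i.e. of
  a function that is constant in direction \<^term>\<open>e\<close>.\<close>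

definition C2_boundary :: "(real^'n) set \<Rightarrow> bool" where
  "C2_boundary \<Omega> \<longleftrightarrow> (\<forall>x\<in>frontier \<Omega>. \<exists>\<rho>>0. \<exists>e g. norm e = 1 \<and> C2_function g \<and>
     (\<forall>y c. g (y + c *\<^sub>R e) = g y) \<and>
     \<Omega> \<inter> ball x \<rho> = {y \<in> ball x \<rho>. g y < y \<bullet> e})"

definition L1_space :: "(real^'n) set \<Rightarrow> (real^'n) fspace" where
  "L1_space \<Omega> = \<lparr>
     elems = {f. integrable (lebesgue_on \<Omega>) f},
     nrm = (\<lambda>f. \<integral>\<^sup>+x. ennreal \<bar>f x\<bar> \<partial>lebesgue_on \<Omega>),
     cone = {f. AE x in lebesgue_on \<Omega>. 0 \<le> f x}\<rparr>"

definition C0_space :: "(real^'n) set \<Rightarrow> (real^'n) fspace" where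
  "C0_space \<Omega> = \<lparr>
     elems = {f. continuous_on (closure \<Omega>) f \<and> (\<Omega> = UNIV \<longrightarrow> (f \<longlongrightarrow> 0) at_infinity)},
     nrm = (\<lambda>f. SUP x\<in>closure \<Omega>. ennreal \<bar>f x\<bar>),
     cone = {f. \<forall>x\<in>closure \<Omega>. 0 \<le> f x}\<rparr>"

definition Cb_space :: "(real^'n) set \<Rightarrow> (real^'n) fspace" where
  "Cb_space \<Omega> = \<lparr>
     elems = {f. continuous_on \<Omega> f \<and> bounded (f ` \<Omega>)},
     nrm = (\<lambda>f. SUP x\<in>\<Omega>. ennreal \<bar>f x\<bar>),
     cone = {f. \<forall>x\<in>\<Omega>. 0 \<le> f x}\<rparr>"

definition X_x :: "nat \<Rightarrow> (real^'n) set \<Rightarrow> (real^'n) fspace" where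
  "X_x i \<Omega> = (if i = 1 then L1_space \<Omega> else C0_space \<Omega>)"

text \<open>The measure \<open>dm\<^sub>r = (1 + m\<^sup>r) dm\<close> on \<open>[0,\<infinity>)\<close>.  (The convention \<open>0 powr 0 = 0\<close> only
  concerns the null set \<open>{0}\<close>.)\<close>

definition dm :: "real \<Rightarrow> real measure" where
  "dm r = density (lebesgue_on {0..}) (\<lambda>m. ennreal (1 + m powr r))"

definition strongly_measurable :: "'m measure \<Rightarrow> 'p fspace \<Rightarrow> ('m \<Rightarrow> 'p \<Rightarrow> real) \<Rightarrow> bool" where
  "strongly_measurable M X u \<longleftrightarrow> (AE m in M. u m \<in> elems X) \<and>
     (\<exists>s. (\<forall>n. simple_function M (s n)) \<and> (\<forall>n. \<forall>m\<in>space M. s n m \<in> elems X) \<and>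
       (AE m in M. (\<lambda>n. nrm X (\<lambda>x. s n m x - u m x)) \<longlonglongrightarrow> 0))"

text \<open>The Bochner space \<open>L\<^sub>1(\<real>\<^sub>+, X\<^sub>x, dm\<^sub>r)\<close>, its elements written as functions \<open>u (x, m)\<close>.
  For \<open>i = 0\<close> joint measurability of \<^term>\<open>u\<close> follows from strong measurability.  For \<open>i = 1\<close>
  each element has jointly measurable representatives, and only these are admitted:
  otherwise integrals in \<open>m\<close> at fixed \<open>x\<close> would depend on the choice of a representative of
  \<open>u(\<cdot>,m)\<close> for each \<open>m\<close>.\<close>

definition X_r :: "nat \<Rightarrow> (real^'n) set \<Rightarrow> real \<Rightarrow> ((real^'n) \<times> real) fspace" where
  "X_r i \<Omega> r = \<lparr>
     elems = {u. strongly_measurable (dm r) (X_x i \<Omega>) (\<lambda>m x. u (x, m)) \<and>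
       u \<in> borel_measurable (lebesgue_on (\<Omega> \<times> {0..})) \<and>
       (\<integral>\<^sup>+m. nrm (X_x i \<Omega>) (\<lambda>x. u (x, m)) \<partial>dm r) < \<infinity>},
     nrm = (\<lambda>u. \<integral>\<^sup>+m. nrm (X_x i \<Omega>) (\<lambda>x. u (x, m)) \<partial>dm r),
     cone = {u. AE m in dm r. (\<lambda>x. u (x, m)) \<in> cone (X_x i \<Omega>)}\<rparr>"

text \<open>The norm of \<open>\<X>\<^sub>r\<^bsup>(\<mu>)\<^esup>\<close>; this space consists of the elements of \<open>\<X>\<^sub>r\<close> at which it is
  finite.\<close>

definition interp_norm ::
  "nat \<Rightarrow> (real^'n) set \<Rightarrow> real \<Rightarrow> (real \<Rightarrow> real) \<Rightarrow> real \<Rightarrow> real \<Rightarrow> ((real^'n) \<times> real \<Rightarrow> real) \<Rightarrow> ennreal" where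
  "interp_norm i \<Omega> r \<alpha>1 \<omega> \<mu> f =
     (\<integral>\<^sup>+m. nrm (X_x i \<Omega>) (\<lambda>x. f (x, m)) * ennreal ((\<omega> + \<alpha>1 m) powr \<mu>) \<partial>dm r)"


section \<open>Coefficients\<close>

definition Linf_loc :: "('p::euclidean_space) set \<Rightarrow> ('p \<Rightarrow> real) set" where
  "Linf_loc S = {f. f \<in> borel_measurable (lebesgue_on S) \<and>
     (\<forall>K. compact K \<longrightarrow> K \<subseteq> S \<longrightarrow> (\<exists>C. AE p in lebesgue_on K. \<bar>f p\<bar> \<le> C))}"

definition Linf_loc_vec :: "real set \<Rightarrow> 'p fspace \<Rightarrow> (real \<Rightarrow> 'p \<Rightarrow> real) set" where
  "Linf_loc_vec S X = {u. strongly_measurable (lebesgue_on S) X u \<and>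
     (\<forall>K. compact K \<longrightarrow> K \<subseteq> S \<longrightarrow> (\<exists>C. AE m in lebesgue_on K. nrm X (u m) \<le> ennreal C))}"

definition rate_assumption ::
  "nat \<Rightarrow> (real^'n) set \<Rightarrow> (real^'n \<Rightarrow> real \<Rightarrow> real) \<Rightarrow> (real \<Rightarrow> real) \<Rightarrow> (real \<Rightarrow> real) \<Rightarrow> real \<Rightarrow> bool" where
  "rate_assumption i \<Omega> a \<alpha>1 \<alpha>2 M \<longleftrightarrow>
     (i = 1 \<longrightarrow> (\<lambda>(x, m). a x m) \<in> Linf_loc (\<Omega> \<times> {0..})) \<and>
     (i = 0 \<longrightarrow> (\<lambda>m x. a x m) \<in> Linf_loc_vec {0..} (Cb_space \<Omega>)) \<and>
     \<alpha>1 \<in> Linf_loc {0..} \<and> \<alpha>2 \<in> Linf_loc {0..} \<and> 0 < M \<and>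
     (AE (x, m) in lebesgue_on (\<Omega> \<times> {0..}). 0 \<le> a x m \<and> \<alpha>1 m \<le> a x m \<and> a x m \<le> \<alpha>2 m) \<and>
     (AE m in lebesgue_on {0..}. \<alpha>2 m \<le> M * \<alpha>1 m)"

definition kernel_b :: "(real^'n) set \<Rightarrow> (real^'n \<Rightarrow> real \<Rightarrow> real \<Rightarrow> real) \<Rightarrow> bool" where
  "kernel_b \<Omega> b \<longleftrightarrow>
     (\<lambda>(x, m, s). b x m s) \<in> borel_measurable (lebesgue_on (\<Omega> \<times> {0..} \<times> {0..})) \<and>
     (\<forall>x\<in>\<Omega>. \<forall>m\<ge>0. \<forall>s\<ge>0. 0 \<le> b x m s \<and> (m > s \<longrightarrow> b x m s = 0))"

definition kernel_beta :: "(real \<Rightarrow> real \<Rightarrow> real) \<Rightarrow> bool" where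
  "kernel_beta \<beta> \<longleftrightarrow>
     (\<lambda>(m, s). \<beta> m s) \<in> borel_measurable (lebesgue_on ({0..} \<times> {0..})) \<and>
     (\<forall>m\<ge>0. \<forall>s\<ge>0. 0 \<le> \<beta> m s \<and> (m > s \<longrightarrow> \<beta> m s = 0))"

definition equi_integrable :: "(real \<Rightarrow> real) set \<Rightarrow> bool" where
  "equi_integrable E \<longleftrightarrow>
     (\<forall>f\<in>E. integrable (lebesgue_on {0..1}) f) \<and>
     (SUP f\<in>E. \<integral>\<^sup>+z. ennreal \<bar>f z\<bar> \<partial>lebesgue_on {0..1}) < \<infinity> \<and>
     (\<forall>\<epsilon>>0. \<exists>\<delta>>0. \<forall>\<Theta>\<in>sets (lebesgue_on {0..1}). emeasure (lebesgue_on {0..1}) \<Theta> < ennreal \<delta> \<longrightarrow>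
        (SUP f\<in>E. \<integral>\<^sup>+z\<in>\<Theta>. ennreal \<bar>f z\<bar> \<partial>lebesgue_on {0..1}) < ennreal \<epsilon>)"


section \<open>The operators of the problem\<close>

text \<open>In the graphs below the value \<^term>\<open>v\<close> is required to lie in \<open>\<X>\<^sub>r\<close>, so the domain
  conditions of the form \<open>\<dots> \<in> \<X>\<^sub>r\<close> are built in.\<close>

definition T0_op ::
  "nat \<Rightarrow> (real^'n) set \<Rightarrow> real \<Rightarrow> (real \<Rightarrow> (real^'n \<Rightarrow> real) \<Rightarrow> real^'n \<Rightarrow> real) \<Rightarrow>
   (real \<Rightarrow> (real^'n \<Rightarrow> real) set) \<Rightarrow> ((real^'n) \<times> real) operator" where
  "T0_op i \<Omega> r T0 D0 = {(u, v). u \<in> elems (X_r i \<Omega> r) \<and> v \<in> elems (X_r i \<Omega> r) \<and>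
     (AE m in lebesgue_on {0..}. (\<lambda>x. u (x, m)) \<in> D0 m \<and>
        fs_eq (X_x i \<Omega>) (\<lambda>x. v (x, m)) (T0 m (\<lambda>x. u (x, m))))}"

definition absorption_op ::
  "nat \<Rightarrow> (real^'n) set \<Rightarrow> real \<Rightarrow> (real^'n \<Rightarrow> real \<Rightarrow> real) \<Rightarrow> ((real^'n) \<times> real) operator" where
  "absorption_op i \<Omega> r a = {(u, v). u \<in> elems (X_r i \<Omega> r) \<and> v \<in> elems (X_r i \<Omega> r) \<and>
     (AE m in lebesgue_on {0..}. AE x in lebesgue_on \<Omega>. v (x, m) = - a x m * u (x, m))}"

text \<open>The gain operator \<open>u \<mapsto> \<integral>\<^sub>m\<^sup>\<infinity> k(x,m,s) u(x,s) ds\<close> on the largest set of \<open>u \<in> D\<close> on which it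
  is meaningful; that this set is all of \<open>D\<close> is a separate condition (see
  \<open>threshold\<close> below).\<close>

definition gain_op ::
  "nat \<Rightarrow> (real^'n) set \<Rightarrow> real \<Rightarrow> ((real^'n) \<times> real \<Rightarrow> real) set \<Rightarrow>
   (real^'n \<Rightarrow> real \<Rightarrow> real \<Rightarrow> real) \<Rightarrow> ((real^'n) \<times> real) operator" where
  "gain_op i \<Omega> r D k = {(u, v). u \<in> D \<and> u \<in> elems (X_r i \<Omega> r) \<and> v \<in> elems (X_r i \<Omega> r) \<and>
     (AE m in lebesgue_on {0..}. AE x in lebesgue_on \<Omega>.
        set_integrable lebesgue {m..} (\<lambda>s. k x m s * u (x, s)) \<and>
        v (x, m) = (LINT s:{m..}|lebesgue. k x m s * u (x, s)))}"

definition T_op where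
  "T_op i \<Omega> r T0 D0 a = op_sum (X_r i \<Omega> r) (T0_op i \<Omega> r T0 D0) (absorption_op i \<Omega> r a)"

definition K_op where
  "K_op i \<Omega> r T0 D0 a b = op_sum (X_r i \<Omega> r) (T_op i \<Omega> r T0 D0 a)
     (gain_op i \<Omega> r (Domain (T_op i \<Omega> r T0 D0 a)) (\<lambda>x m s. b x m s * a x s))"

definition maj_A_op where
  "maj_A_op i \<Omega> r \<alpha>1 = absorption_op i \<Omega> r (\<lambda>x. \<alpha>1)"

definition maj_B_op where
  "maj_B_op i \<Omega> r \<alpha>1 \<alpha>2 \<beta> =
     gain_op i \<Omega> r (Domain (maj_A_op i \<Omega> r \<alpha>1)) (\<lambda>x m s. \<alpha>2 s * \<beta> m s)"

definition maj_F_op where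
  "maj_F_op i \<Omega> r \<alpha>1 \<alpha>2 \<beta> =
     op_sum (X_r i \<Omega> r) (maj_A_op i \<Omega> r \<alpha>1) (maj_B_op i \<Omega> r \<alpha>1 \<alpha>2 \<beta>)"

text \<open>\<open>T\<^sub>0 + \<AA>\<close>, on the intersection of the two domains.\<close>

definition maj_T_op where
  "maj_T_op i \<Omega> r T0 D0 \<alpha>1 = op_sum (X_r i \<Omega> r) (T0_op i \<Omega> r T0 D0) (maj_A_op i \<Omega> r \<alpha>1)"

definition maj_K_op where
  "maj_K_op i \<Omega> r T0 D0 \<alpha>1 \<alpha>2 \<beta> =
     op_sum (X_r i \<Omega> r) (maj_T_op i \<Omega> r T0 D0 \<alpha>1) (maj_B_op i \<Omega> r \<alpha>1 \<alpha>2 \<beta>)"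


section \<open>Standing assumptions\<close>

definition transport_assumption ::
  "nat \<Rightarrow> (real^'n) set \<Rightarrow> (real \<Rightarrow> (real^'n \<Rightarrow> real) \<Rightarrow> real^'n \<Rightarrow> real) \<Rightarrow>
   (real \<Rightarrow> (real^'n \<Rightarrow> real) set) \<Rightarrow> (real \<Rightarrow> real \<Rightarrow> (real^'n \<Rightarrow> real) \<Rightarrow> real^'n \<Rightarrow> real) \<Rightarrow> bool" where
  "transport_assumption i \<Omega> T0 D0 GTm \<longleftrightarrow> (AE m in lebesgue_on {0..}.
     D0 m \<subseteq> elems (X_x i \<Omega>) \<and> linear_expr_on (X_x i \<Omega>) (D0 m) (T0 m) \<and>
     Domain (restriction_to (X_x i \<Omega>) (D0 m) (T0 m)) = D0 m \<and>
     generates (X_x i \<Omega>) (restriction_to (X_x i \<Omega>) (D0 m) (T0 m)) (GTm m) \<and>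
     substochastic_semigroup (X_x i \<Omega>) (GTm m))"

definition assumption_A1 ::
  "nat \<Rightarrow> (real^'n) set \<Rightarrow> (real \<Rightarrow> (real^'n \<Rightarrow> real) \<Rightarrow> real^'n \<Rightarrow> real) \<Rightarrow>
   (real \<Rightarrow> (real^'n \<Rightarrow> real) set) \<Rightarrow> (real \<Rightarrow> real \<Rightarrow> (real^'n \<Rightarrow> real) \<Rightarrow> real^'n \<Rightarrow> real) \<Rightarrow> bool" where
  "assumption_A1 i \<Omega> T0 D0 GTm \<longleftrightarrow> (\<forall>r\<ge>0. \<exists>G.
     substochastic_semigroup (X_r i \<Omega> r) G \<and> generates (X_r i \<Omega> r) (T0_op i \<Omega> r T0 D0) G \<and>
     (\<forall>t\<ge>0. \<forall>u\<in>elems (X_r i \<Omega> r). AE m in lebesgue_on {0..}.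
        fs_eq (X_x i \<Omega>) (\<lambda>x. G t u (x, m)) (GTm m t (\<lambda>x. u (x, m)))))"

text \<open>The defining property of \<open>r\<^sub>1\<close>.  The equations on \<^const>\<open>Domain\<close> say that the gain terms
  map the respective domains into \<open>\<X>\<^sub>r\<close>, so that each operator is defined on its intended domain.
  Note that \<^term>\<open>R O S\<close> applies \<^term>\<open>R\<close> first.\<close>

definition threshold where
  "threshold i \<Omega> T0 D0 a b \<alpha>1 \<alpha>2 \<beta> GF GKmaj GK l r0 r1 \<longleftrightarrow> r1 > max l r0 \<and> (\<forall>r\<ge>r1.
     (\<forall>\<^sub>F \<kappa> in at_top. \<kappa> \<in> resolvent_set (X_r i \<Omega> r) (maj_T_op i \<Omega> r T0 D0 \<alpha>1) \<and>
        Domain (resolvent (X_r i \<Omega> r) (maj_T_op i \<Omega> r T0 D0 \<alpha>1) \<kappa> O maj_B_op i \<Omega> r \<alpha>1 \<alpha>2 \<beta>)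
          = elems (X_r i \<Omega> r) \<and>
        op_norm (X_r i \<Omega> r)
          (resolvent (X_r i \<Omega> r) (maj_T_op i \<Omega> r T0 D0 \<alpha>1) \<kappa> O maj_B_op i \<Omega> r \<alpha>1 \<alpha>2 \<beta>) < 1) \<and>
     (Domain (maj_F_op i \<Omega> r \<alpha>1 \<alpha>2 \<beta>) = Domain (maj_A_op i \<Omega> r \<alpha>1) \<and>
        generates (X_r i \<Omega> r) (maj_F_op i \<Omega> r \<alpha>1 \<alpha>2 \<beta>) (GF r) \<and>
        positive_semigroup (X_r i \<Omega> r) (GF r) \<and> analytic_semigroup (X_r i \<Omega> r) (GF r)) \<and>
     (Domain (maj_K_op i \<Omega> r T0 D0 \<alpha>1 \<alpha>2 \<beta>) = Domain (maj_T_op i \<Omega> r T0 D0 \<alpha>1) \<and>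
        generates (X_r i \<Omega> r) (maj_K_op i \<Omega> r T0 D0 \<alpha>1 \<alpha>2 \<beta>) (GKmaj r) \<and>
        positive_semigroup (X_r i \<Omega> r) (GKmaj r)) \<and>
     (Domain (K_op i \<Omega> r T0 D0 a b) = Domain (T_op i \<Omega> r T0 D0 a) \<and>
        generates (X_r i \<Omega> r) (K_op i \<Omega> r T0 D0 a b) (GK r) \<and>
        positive_semigroup (X_r i \<Omega> r) (GK r)))"

end

(* Write G_0 for the transport semigroup on X_r and G_F, G_maj, G_K for those of F, of the
   majorising problem and of K.  As the transport does not depend on m, G_0 commutes with F, so
   G_maj(t) = G_0(t) G_F(t) and the contractivity of G_0 in x gives
   |G_maj(t) f (m)| <= |G_F(t) f (m)| for almost every m.  On nonnegative f, G_K(t) f <= G_maj(t) f: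
   the derivative of s |-> G_maj(t-s) G_K(s) f is G_maj(t-s) (K - K_maj) G_K(s) f <= 0.
   By Cauchy's estimate the analytic semigroup G_F satisfies |F G_F(t) f| <= C |f| / t near 0, and
   uniform boundedness on D(F) bounds |alpha_1 u| by |u| + |F u|; hence t |alpha_1 G_F(t) f| is
   controlled by |f|.  The interpolation y^mu <= t^(1-mu) y + t^(-mu), used with
   y = omega + alpha_1(m), gives the estimate in the intermediate spaces, and alpha_1(m) >= a0 m^gamma
   turns their weight into the moment of order r + mu gamma. *)

theory Submission
  imports "HOL-Complex_Analysis.Complex_Analysis" "HOL-Library.Function_Algebras" Defs
begin

section \<open>Seminorms, norming functionals and uniform boundedness\<close>

text \<open>Elements are functions, not classes, so identities hold only up to vectors of norm 0,
  and the functional analysis is carried out on a subspace V with a seminorm N. Vector-valued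
  calculus is reduced to scalar functions by testing with norming functionals: integrals of orbits,
  Cauchy's estimate and the commutation of G_0 with F all rest on this. The commutation is the
  delicate point, since the gain integral is taken pointwise in x whereas G_0 acts on whole slices
  u(.,m); functionals have to be moved under that integral first. One comparison lemma with a free
  sublinear functional q is used throughout: q equal to the norm yields intertwining and uniqueness
  of semigroups, q equal to the norm of the positive part yields the order relation between G_K and
  G_maj. That relation compares norms for f >= 0 only; for arbitrary f the estimate of G_K goes
  through |G_K(t) f| <= G_maj(t) |f|. The growth rate is omega + 1, where the additional 1 absorbs
  factors t that arise away from t = 0; one multiplicative constant then serves every mu.\<close>

locale seminormed =
  fixes V :: "'v::real_vector set" and N :: "'v \<Rightarrow> real"
  assumes subspace_V: "subspace V"
    and N_add: "x \<in> V \<Longrightarrow> y \<in> V \<Longrightarrow> N (x + y) \<le> N x + N y"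
    and N_scale: "x \<in> V \<Longrightarrow> N (c *\<^sub>R x) = \<bar>c\<bar> * N x"
begin

lemma V_closed [simp, intro]:
  "0 \<in> V" "x \<in> V \<Longrightarrow> y \<in> V \<Longrightarrow> x + y \<in> V" "x \<in> V \<Longrightarrow> y \<in> V \<Longrightarrow> x - y \<in> V"
  "x \<in> V \<Longrightarrow> - x \<in> V" "x \<in> V \<Longrightarrow> c *\<^sub>R x \<in> V"
  using subspace_V by (auto intro: subspace_0 subspace_add subspace_diff subspace_neg subspace_scale)

lemma V_sum: "(\<And>i. i \<in> I \<Longrightarrow> f i \<in> V) \<Longrightarrow> sum f I \<in> V"
  using subspace_V by (rule subspace_sum)

lemma N_zero [simp]: "N 0 = 0"
  using N_scale[of 0 0] by simp

lemma N_minus [simp]: "x \<in> V \<Longrightarrow> N (- x) = N x"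
  using N_scale[of x "-1"] by simp

lemma N_nonneg: "x \<in> V \<Longrightarrow> 0 \<le> N x"
  using N_add[of x "- x"] by simp

lemma N_diff: "x \<in> V \<Longrightarrow> y \<in> V \<Longrightarrow> N (x - y) \<le> N x + N y"
  using N_add[of x "- y"] by simp

lemma N_commute: "x \<in> V \<Longrightarrow> y \<in> V \<Longrightarrow> N (x - y) = N (y - x)"
  using N_minus[of "x - y"] by simp

lemma N_triangle: "x \<in> V \<Longrightarrow> y \<in> V \<Longrightarrow> z \<in> V \<Longrightarrow> N (x - z) \<le> N (x - y) + N (y - z)"
  using N_add[of "x - y" "y - z"] by simp

lemma N_abs_diff: "x \<in> V \<Longrightarrow> y \<in> V \<Longrightarrow> \<bar>N x - N y\<bar> \<le> N (x - y)"
  using N_add[of "x - y" y] N_add[of "y - x" x] N_commute[of x y] by (auto simp: abs_le_iff)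

lemma N_eq: "x \<in> V \<Longrightarrow> y \<in> V \<Longrightarrow> N (x - y) = 0 \<Longrightarrow> N x = N y"
  using N_abs_diff[of x y] by simp

text \<open>The unit ball of the dual of V. The bound by N forces \<open>\<phi>\<close> to vanish on
  vectors of seminorm 0, so \<open>\<phi>\<close> takes a single value on each class.\<close>

definition unit_functional :: "('v \<Rightarrow> real) \<Rightarrow> bool" where
  "unit_functional \<phi> \<longleftrightarrow>
     (\<forall>x\<in>V. \<forall>y\<in>V. \<forall>a b. \<phi> (a *\<^sub>R x + b *\<^sub>R y) = a * \<phi> x + b * \<phi> y) \<and> (\<forall>x\<in>V. \<bar>\<phi> x\<bar> \<le> N x)"

lemma unit_functionalD:
  assumes "unit_functional \<phi>" "x \<in> V" "y \<in> V"
  shows "\<phi> (a *\<^sub>R x + b *\<^sub>R y) = a * \<phi> x + b * \<phi> y" "\<phi> (x + y) = \<phi> x + \<phi> y" "\<phi> (x - y) = \<phi> x - \<phi> y"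
    "\<phi> (c *\<^sub>R x) = c * \<phi> x" "\<bar>\<phi> x\<bar> \<le> N x" "\<phi> 0 = 0"
proof -
  have *: "\<And>x y a b. x \<in> V \<Longrightarrow> y \<in> V \<Longrightarrow> \<phi> (a *\<^sub>R x + b *\<^sub>R y) = a * \<phi> x + b * \<phi> y"
    and "\<And>x. x \<in> V \<Longrightarrow> \<bar>\<phi> x\<bar> \<le> N x"
    using assms(1) by (auto simp: unit_functional_def)
  then show "\<bar>\<phi> x\<bar> \<le> N x" using assms by auto
  show "\<phi> (a *\<^sub>R x + b *\<^sub>R y) = a * \<phi> x + b * \<phi> y" using * assms by auto
  show "\<phi> (x + y) = \<phi> x + \<phi> y" using *[of x y 1 1] assms by simp
  show "\<phi> (x - y) = \<phi> x - \<phi> y" using *[of x y 1 "-1"] assms by simp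
  show "\<phi> (c *\<^sub>R x) = c * \<phi> x" using *[of x x c 0] assms by simp
  show "\<phi> 0 = 0" using *[of x x 0 0] assms by simp
qed

lemma unit_functional_sum:
  assumes "unit_functional \<phi>" "finite I" "\<And>i. i \<in> I \<Longrightarrow> f i \<in> V"
  shows "\<phi> (sum f I) = (\<Sum>i\<in>I. \<phi> (f i))"
  using assms(2,3)
proof (induction I rule: finite_induct)
  case empty
  then show ?case using unit_functionalD(6)[OF assms(1), of 0 0] by simp
next
  case (insert a F)
  then show ?case using unit_functionalD(2)[OF assms(1), of "f a" "sum f F"] V_sum[of F f] by simp
qed

section \<open>Existence of norming functionals (Hahn-Banach)\<close>

definition sublinear_below :: "('v \<Rightarrow> real) set" where
  "sublinear_below = {q. (\<forall>x\<in>V. \<forall>y\<in>V. q (x + y) \<le> q x + q y) \<and>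
     (\<forall>x\<in>V. \<forall>c>0. q (c *\<^sub>R x) \<le> c * q x) \<and> (\<forall>x\<in>V. q x \<le> N x) \<and> (\<forall>x. x \<notin> V \<longrightarrow> q x = 0)}"

lemma sublinear_belowD:
  assumes "q \<in> sublinear_below" "x \<in> V"
  shows "y \<in> V \<Longrightarrow> q (x + y) \<le> q x + q y" "c > 0 \<Longrightarrow> q (c *\<^sub>R x) = c * q x" "q x \<le> N x"
    "q 0 = 0" "- q (- x) \<le> q x" "- N x \<le> q x"
proof -
  have q: "\<And>x y. x \<in> V \<Longrightarrow> y \<in> V \<Longrightarrow> q (x + y) \<le> q x + q y"
    "\<And>x c. x \<in> V \<Longrightarrow> c > 0 \<Longrightarrow> q (c *\<^sub>R x) \<le> c * q x" "\<And>x. x \<in> V \<Longrightarrow> q x \<le> N x"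
    using assms(1) by (auto simp: sublinear_below_def)
  show "y \<in> V \<Longrightarrow> q (x + y) \<le> q x + q y" and "q x \<le> N x" using q assms(2) by auto
  show "q (c *\<^sub>R x) = c * q x" if "c > 0"
  proof (rule antisym)
    show "q (c *\<^sub>R x) \<le> c * q x" using q(2) assms(2) that by auto
    have "q (inverse c *\<^sub>R (c *\<^sub>R x)) \<le> inverse c * q (c *\<^sub>R x)"
      using q(2)[of "c *\<^sub>R x" "inverse c"] assms(2) that by auto
    then show "c * q x \<le> q (c *\<^sub>R x)" using that by (simp add: field_simps)
  qed
  show z: "q 0 = 0" using q(1)[of 0 0] q(3)[of 0] by simp
  show "- q (- x) \<le> q x" using q(1)[of x "- x"] z assms(2) by simp
  then show "- N x \<le> q x" using q(3)[of "- x"] assms(2) by simp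
qed

text \<open>A lowering step: a minimal \<open>q\<close> has to coincide with \<open>q'\<close>, and
  then \<open>q x \<le> q (x + y) - q y\<close> together with subadditivity makes it additive. The
  functional is the infimum over t >= 0 of q(x + t y) - t q(y); subadditivity bounds it below by
  -q(-x), and the choices t = 0 and t = 1 give the listed inequalities.\<close>

lemma sublinear_below_lower:
  assumes q: "q \<in> sublinear_below" and y: "y \<in> V"
  obtains q' where "q' \<in> sublinear_below" "q' \<le> q" "q' (- y) \<le> - q y"
    "\<And>x. x \<in> V \<Longrightarrow> q' x \<le> q (x + y) - q y"
proof -
  define g where "g x t = q (x + t *\<^sub>R y) - t * q y" for x t
  define q' where "q' x = (if x \<in> V then (INF t\<in>{0..}. g x t) else 0)" for x
  have qt: "q (t *\<^sub>R y) = t * q y" if "t \<ge> 0" for t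
    using that sublinear_belowD(2)[OF q y, of t] sublinear_belowD(4)[OF q y] by (cases "t = 0") auto
  have "- q (- x) \<le> g x t" if "x \<in> V" "t \<ge> 0" for x t
    using sublinear_belowD(1)[OF q, of "x + t *\<^sub>R y" "- x"] that qt[of t] y by (simp add: g_def)
  then have bdd: "bdd_below (g x ` {0..})" if "x \<in> V" for x
    using that by (intro bdd_belowI2[of _ "- q (- x)"]) auto
  have low: "q' x \<le> g x t" if "x \<in> V" "t \<ge> 0" for x t
    unfolding q'_def using that bdd by (auto intro: cINF_lower)
  have great: "c \<le> q' x" if "x \<in> V" "\<And>t. t \<ge> 0 \<Longrightarrow> c \<le> g x t" for x c
    unfolding q'_def using that by (auto intro: cINF_greatest)
  have le: "q' x \<le> q x" if "x \<in> V" for x using low[OF that, of 0] by (simp add: g_def)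
  have add: "q' (x1 + x2) \<le> q' x1 + q' x2" if x: "x1 \<in> V" "x2 \<in> V" for x1 x2
  proof -
    have st: "q' (x1 + x2) \<le> g x1 s + g x2 t" if "s \<ge> 0" "t \<ge> 0" for s t
    proof -
      have "q' (x1 + x2) \<le> g (x1 + x2) (s + t)" using low x that by auto
      also have "\<dots> \<le> g x1 s + g x2 t"
        using sublinear_belowD(1)[OF q, of "x1 + s *\<^sub>R y" "x2 + t *\<^sub>R y"] x y
        by (simp add: g_def algebra_simps)
      finally show ?thesis .
    qed
    have "q' (x1 + x2) - g x2 t \<le> q' x1" if "t \<ge> 0" for t
      using st that by (intro great x) (simp add: algebra_simps)
    then have "q' (x1 + x2) - q' x1 \<le> q' x2" by (intro great x) (simp add: algebra_simps)
    then show ?thesis by simp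
  qed
  have sc: "q' (c *\<^sub>R x) \<le> c * q' x" if x: "x \<in> V" "c > 0" for x c
  proof -
    have "q' (c *\<^sub>R x) / c \<le> q' x"
    proof (rule great[OF x(1)])
      fix t :: real assume t: "t \<ge> 0"
      have "q' (c *\<^sub>R x) \<le> g (c *\<^sub>R x) (c * t)" using low x t by auto
      also have "\<dots> = c * g x t"
        using sublinear_belowD(2)[OF q, of "x + t *\<^sub>R y" c] x y by (simp add: g_def algebra_simps)
      finally show "q' (c *\<^sub>R x) / c \<le> g x t" using x by (simp add: field_simps)
    qed
    then show ?thesis using x by (simp add: field_simps)
  qed
  show thesis
  proof (rule that[of q'])
    have "q' x \<le> N x" if "x \<in> V" for x using le[OF that] sublinear_belowD(3)[OF q that] by simp
    then show "q' \<in> sublinear_below" using add sc by (auto simp: sublinear_below_def q'_def)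
    show "q' \<le> q"
    proof (rule le_funI)
      fix x show "q' x \<le> q x" using le[of x] q by (cases "x \<in> V") (auto simp: q'_def sublinear_below_def)
    qed
    show "q' (- y) \<le> - q y"
      using low[of "- y" 1] sublinear_belowD(4)[OF q y] y by (simp add: g_def)
    show "q' x \<le> q (x + y) - q y" if "x \<in> V" for x using low[OF that, of 1] by (simp add: g_def)
  qed
qed

text \<open>Hahn-Banach without extension from a subspace: a sublinear functional \<open>m\<close>
  below N that is minimal subject to \<open>m (- v) \<le> - N v\<close> is linear, and linearity
  turns this constraint into \<open>m v \<ge> N v\<close>.\<close>

lemma norming_functional:
  assumes v: "v \<in> V"
  obtains \<phi> where "unit_functional \<phi>" "\<phi> v = N v"
proof -
  define A where "A = {q \<in> sublinear_below. q (- v) \<le> - N v}"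
  \<comment> \<open>Members of \<open>sublinear_below\<close> are 0 off V, so that their pointwise
    order as functions compares values on V only.\<close>
  define N0 where "N0 x = (if x \<in> V then N x else 0)" for x
  have "N0 \<in> sublinear_below"
    by (auto simp: sublinear_below_def N0_def N_add N_scale)
  \<comment> \<open>Lowering the seminorm at v itself produces a member of \<open>A\<close>, which
    covers the empty chain in Zorn's lemma.\<close>
  from sublinear_below_lower[OF this v] obtain q0 where q0: "q0 \<in> A"
    unfolding A_def N0_def using v by auto
  have "\<exists>m\<in>A. \<forall>a\<in>A. a \<le> m \<longrightarrow> a = m"
  proof (rule predicate_Zorn)
    show "partial_order_on A (relation_of (\<lambda>x y. y \<le> x) A)"
      by (rule partial_order_on_relation_ofI) auto
    fix C assume "C \<in> Chains (relation_of (\<lambda>x y. y \<le> x) A)"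
    then have C: "C \<subseteq> A" "\<And>a b. a \<in> C \<Longrightarrow> b \<in> C \<Longrightarrow> a \<le> b \<or> b \<le> a"
      by (auto simp: Chains_def relation_of_def)
    show "\<exists>u\<in>A. \<forall>a\<in>C. u \<le> a"
    proof (cases "C = {}")
      case True then show ?thesis using q0 by auto
    next
      case False
      define u where "u x = (if x \<in> V then (INF q\<in>C. q x) else 0)" for x
      have CS: "q \<in> sublinear_below" if "q \<in> C" for q using C that by (auto simp: A_def)
      have bdd: "bdd_below ((\<lambda>q. q x) ` C)" if "x \<in> V" for x
        using sublinear_belowD(6)[OF CS that] by (intro bdd_belowI2[of _ "- N x"]) auto
      have low: "u x \<le> q x" if "x \<in> V" "q \<in> C" for x q
        unfolding u_def using that bdd by (auto intro: cINF_lower)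
      have great: "c \<le> u x" if "x \<in> V" "\<And>q. q \<in> C \<Longrightarrow> c \<le> q x" for x c
        unfolding u_def using that False by (auto intro: cINF_greatest)
      \<comment> \<open>The infimum over a chain stays subadditive: of two members the smaller one
        serves for both arguments.\<close>
      have add: "u (x + y) \<le> u x + u y" if xy: "x \<in> V" "y \<in> V" for x y
      proof -
        have st: "u (x + y) \<le> q1 x + q2 y" if q: "q1 \<in> C" "q2 \<in> C" for q1 q2
        proof -
          obtain q where q': "q \<in> C" "q \<le> q1" "q \<le> q2" using C(2)[OF q] q by auto
          have "u (x + y) \<le> q (x + y)" using low xy q' by auto
          also have "\<dots> \<le> q x + q y" using sublinear_belowD(1)[OF CS] xy q' by auto
          also have "\<dots> \<le> q1 x + q2 y" using q' by (simp add: le_fun_def add_mono)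
          finally show ?thesis .
        qed
        have "u (x + y) - q2 y \<le> u x" if "q2 \<in> C" for q2
          using st that by (intro great xy) (simp add: algebra_simps)
        then have "u (x + y) - u x \<le> u y" by (intro great xy) (simp add: algebra_simps)
        then show ?thesis by simp
      qed
      have sc: "u (c *\<^sub>R x) \<le> c * u x" if x: "x \<in> V" "c > 0" for x c
      proof -
        have "u (c *\<^sub>R x) / c \<le> u x"
        proof (rule great[OF x(1)])
          fix q assume q: "q \<in> C"
          have "u (c *\<^sub>R x) \<le> q (c *\<^sub>R x)" using low x q by auto
          also have "\<dots> = c * q x" using sublinear_belowD(2)[OF CS] x q by auto
          finally show "u (c *\<^sub>R x) / c \<le> q x" using x by (simp add: field_simps)
        qed
        then show ?thesis using x by (simp add: field_simps)
      qed
      obtain q1 where q1: "q1 \<in> C" using False by auto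
      have "u x \<le> N x" if "x \<in> V" for x
        using low[OF that q1] sublinear_belowD(3)[OF CS[OF q1] that] by simp
      moreover have "u (- v) \<le> - N v" using low[of "- v" q1] q1 v C by (auto simp: A_def)
      ultimately have "u \<in> A" using add sc by (auto simp: A_def sublinear_below_def u_def)
      moreover have "u \<le> q" if "q \<in> C" for q
      proof (rule le_funI)
        fix x show "u x \<le> q x" using low[of x q] that CS[OF that]
          by (cases "x \<in> V") (auto simp: u_def sublinear_below_def)
      qed
      ultimately show ?thesis by auto
    qed
  qed
  then obtain m where m: "m \<in> A" "\<And>a. a \<in> A \<Longrightarrow> a \<le> m \<Longrightarrow> a = m" by auto
  have mS: "m \<in> sublinear_below" using m by (auto simp: A_def)
  have add: "m (x + y) = m x + m y" if "x \<in> V" "y \<in> V" for x y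
  proof -
    obtain q' where q': "q' \<in> sublinear_below" "q' \<le> m" "\<And>x. x \<in> V \<Longrightarrow> q' x \<le> m (x + y) - m y"
      using sublinear_below_lower[OF mS \<open>y \<in> V\<close>] by metis
    have "q' (- v) \<le> - N v" using q'(2) m(1) by (auto simp: le_fun_def A_def intro: order_trans)
    then have "q' = m" using m(2) q' by (auto simp: A_def)
    then show ?thesis using q'(3)[of x] that sublinear_belowD(1)[OF mS, of x y] by force
  qed
  have neg: "m (- x) = - m x" if "x \<in> V" for x
    using add[of x "- x"] that sublinear_belowD(4)[OF mS that] by simp
  have sc: "m (c *\<^sub>R x) = c * m x" if "x \<in> V" for c x
  proof -
    consider "c > 0" | "c = 0" | "c < 0" by linarith
    then show ?thesis
    proof cases
      case 3
      have "m ((- c) *\<^sub>R (- x)) = (- c) * m (- x)"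
        using sublinear_belowD(2)[OF mS, of "- x" "- c"] that 3 by simp
      then show ?thesis using neg that by simp
    qed (use that sublinear_belowD(2,4)[OF mS that] in auto)
  qed
  have ab: "\<bar>m x\<bar> \<le> N x" if "x \<in> V" for x
    using sublinear_belowD(3)[OF mS that] sublinear_belowD(6)[OF mS that] by (auto simp: abs_le_iff)
  have "unit_functional m" unfolding unit_functional_def using add sc ab by auto
  moreover have "m v = N v" using m(1) neg[OF v] ab[OF v] by (auto simp: A_def)
  ultimately show thesis by (rule that)
qed

end

section \<open>Completeness through absolutely summable series, and uniform boundedness\<close>

locale seminormed_complete = seminormed V N for V :: "'v::real_vector set" and N +
  assumes complete: "(\<And>n. x n \<in> V) \<Longrightarrow> summable (\<lambda>n. N (x n)) \<Longrightarrow>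
      \<exists>s\<in>V. (\<lambda>n. N (s - (\<Sum>k<n. x k))) \<longlonglongrightarrow> 0"
begin

lemma Cauchy_limit:
  assumes xV: "\<And>n. x n \<in> V"
    and C: "\<And>e. e > 0 \<Longrightarrow> \<exists>M. \<forall>m\<ge>M. \<forall>n\<ge>M. N (x m - x n) < e"
  obtains s where "s \<in> V" "(\<lambda>n. N (x n - s)) \<longlonglongrightarrow> 0"
proof -
  have "\<exists>M. \<forall>k. (\<forall>m\<ge>M k. \<forall>n\<ge>M k. N (x m - x n) < (1/2)^k)"
    using C by (intro choice allI) auto
  then obtain M where M: "\<And>k m n. m \<ge> M k \<Longrightarrow> n \<ge> M k \<Longrightarrow> N (x m - x n) < (1/2)^k" by blast
  \<comment> \<open>The maximum makes the indices monotone, so that \<open>L k\<close> and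
    \<open>L (Suc k)\<close> both lie beyond \<open>M k\<close>.\<close>
  define L where "L k = Max (M ` {..k})" for k
  have LM: "L k \<ge> M k" for k unfolding L_def by (intro Max_ge) auto
  have Lmono: "L k \<le> L (Suc k)" for k unfolding L_def by (intro Max_mono) auto
  define y where "y k = x (L (Suc k)) - x (L k)" for k
  have yb: "N (y k) \<le> (1/2)^k" for k
    unfolding y_def using M[of k "L (Suc k)" "L k"] LM[of k] Lmono[of k] by simp
  \<comment> \<open>Completeness is given for absolutely summable series, hence the passage to the
    increments \<open>y\<close> along a subsequence that is Cauchy at the rate 2^-k.\<close>
  have "summable (\<lambda>k. N (y k))"
    by (rule summable_comparison_test'[of "\<lambda>k. (1/2::real)^k" 0]) (use yb N_nonneg xV in \<open>auto simp: y_def\<close>)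
  then obtain s0 where s0: "s0 \<in> V" "(\<lambda>n. N (s0 - (\<Sum>k<n. y k))) \<longlonglongrightarrow> 0"
    using complete[of y] xV by (auto simp: y_def)
  have sy: "(\<Sum>k<n. y k) = x (L n) - x (L 0)" for n
    unfolding y_def by (rule sum_lessThan_telescope)
  define s where "s = s0 + x (L 0)"
  have sV: "s \<in> V" using s0 xV by (auto simp: s_def)
  have lim: "(\<lambda>n. N (s - x (L n))) \<longlonglongrightarrow> 0"
    using s0(2) unfolding sy s_def by (simp add: algebra_simps)
  have "(\<lambda>n. N (x n - s)) \<longlonglongrightarrow> 0"
  proof (rule LIMSEQ_I)
    fix e :: real assume e: "e > 0"
    obtain k0 where k0: "\<And>k. k \<ge> k0 \<Longrightarrow> N (s - x (L k)) < e/2"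
      using LIMSEQ_D[OF lim, of "e/2"] e by (metis abs_less_iff diff_zero half_gt_zero real_norm_def)
    obtain k1 where k1: "(1/2::real)^k1 < e/2" using e real_arch_pow_inv[of "e/2" "1/2"] by auto
    define k where "k = max k0 k1"
    have "(1/2::real)^k \<le> (1/2)^k1" unfolding k_def by (intro power_decreasing) auto
    then have pk: "(1/2::real)^k < e/2" using k1 by (rule le_less_trans)
    show "\<exists>no. \<forall>n\<ge>no. norm (N (x n - s) - 0) < e"
    proof (intro exI allI impI)
      fix n assume n: "n \<ge> L k"
      have "N (x n - s) \<le> N (x n - x (L k)) + N (x (L k) - s)" using xV sV by (intro N_triangle)
      also have "\<dots> < (1/2)^k + e/2"
        using M[of k n "L k"] LM[of k] n k0[of k] N_commute[of "x (L k)" s] xV sV by (auto simp: k_def)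
      finally show "norm (N (x n - s) - 0) < e" using pk N_nonneg[of "x n - s"] xV sV by auto
    qed
  qed
  with sV show thesis by (rule that)
qed

text \<open>Following Sokal, without Baire's theorem.\<close>

lemma uniform_boundedness:
  assumes p_add: "\<And>i x y. i \<in> I \<Longrightarrow> x \<in> V \<Longrightarrow> y \<in> V \<Longrightarrow> p i (x + y) \<le> p i x + p i y"
    and p_scale: "\<And>i c x. i \<in> I \<Longrightarrow> x \<in> V \<Longrightarrow> p i (c *\<^sub>R x) = \<bar>c\<bar> * p i x"
    and p_bdd: "\<And>i. i \<in> I \<Longrightarrow> \<exists>C. \<forall>x\<in>V. p i x \<le> C * N x"
    and pw: "\<And>x. x \<in> V \<Longrightarrow> \<exists>B. \<forall>i\<in>I. p i x \<le> B"
  shows "\<exists>B\<ge>0. \<forall>i\<in>I. \<forall>x\<in>V. p i x \<le> B * N x"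
proof (rule ccontr)
  assume no: "\<not> ?thesis"
  have pneg: "p i (- x) = p i x" if "i \<in> I" "x \<in> V" for i x using p_scale[OF that, of "-1"] by simp
  \<comment> \<open>The least admissible constant of \<open>p i\<close>, that is its operator norm;
    the bounds assumed for the single \<open>p i\<close> make the set nonempty.\<close>
  define K where "K i = Inf {c. c \<ge> 0 \<and> (\<forall>x\<in>V. p i x \<le> c * N x)}" for i
  have ne: "{c. c \<ge> 0 \<and> (\<forall>x\<in>V. p i x \<le> c * N x)} \<noteq> {}" if i: "i \<in> I" for i
  proof -
    obtain C where C: "\<forall>x\<in>V. p i x \<le> C * N x" using p_bdd[OF i] by auto
    have "C * N x \<le> \<bar>C\<bar> * N x" if "x \<in> V" for x using N_nonneg[OF that] by (simp add: mult_right_mono)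
    then have "\<bar>C\<bar> \<in> {c. c \<ge> 0 \<and> (\<forall>x\<in>V. p i x \<le> c * N x)}" using C by force
    then show ?thesis by blast
  qed
  have bb: "bdd_below {c. c \<ge> 0 \<and> (\<forall>x\<in>V. p i x \<le> c * N x)}" for i by (rule bdd_belowI[of _ 0]) auto
  have K0: "K i \<ge> 0" if "i \<in> I" for i unfolding K_def using ne[OF that] by (intro cInf_greatest) auto
  have Kb: "p i x \<le> K i * N x" if ix: "i \<in> I" "x \<in> V" for i x
  proof (cases "N x = 0")
    case True
    then show ?thesis using p_bdd[OF ix(1)] ix by fastforce
  next
    case False
    then have Nx: "N x > 0" using N_nonneg[OF ix(2)] by simp
    have "p i x / N x \<le> K i" unfolding K_def using ne[OF ix(1)] ix Nx
      by (intro cInf_greatest) (auto simp: field_simps)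
    then show ?thesis using Nx by (simp add: field_simps)
  qed
  have Klow: "\<exists>x\<in>V. p i x > c * N x" if "i \<in> I" "0 \<le> c" "c < K i" for i c
  proof (rule ccontr)
    assume "\<not> ?thesis"
    then have "K i \<le> c" unfolding K_def using that by (intro cInf_lower bb) (auto simp: not_less)
    then show False using that by simp
  qed
  \<comment> \<open>Without a common bound the constants are unbounded. The growth 4^n is chosen to
    beat the size 3^-n of the vectors \<open>y n\<close> below.\<close>
  have "\<exists>i. i \<in> I \<and> K i > 4^n" for n :: nat
  proof (rule ccontr)
    assume H: "\<not> ?thesis"
    have "p i x \<le> 4^n * N x" if "i \<in> I" "x \<in> V" for i x
      using Kb[OF that] H that N_nonneg[OF that(2)] by (meson mult_right_mono not_less order_trans)
    then show False using no zero_le_power[of "4::real" n] by fastforce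
  qed
  then obtain j where j: "\<And>n. j n \<in> I" "\<And>n. K (j n) > 4^n" by metis
  have "\<exists>y. y \<in> V \<and> N y = (1/3)^n \<and> p (j n) y \<ge> 2/3 * K (j n) * (1/3)^n" for n
  proof -
    have Kp: "K (j n) > 0" using j(2)[of n] zero_less_power[of "4::real" n] by linarith
    obtain x where x: "x \<in> V" "p (j n) x > 2/3 * K (j n) * N x"
      using Klow[OF j(1), of "2/3 * K (j n)" n] Kp by auto
    have Nx: "N x > 0"
      using x Kb[OF j(1), of x n] N_nonneg[OF x(1)] by (cases "N x = 0") auto
    define y where "y = ((1/3)^n / N x) *\<^sub>R x"
    have "N y = (1/3)^n" using Nx x by (simp add: y_def N_scale)
    moreover have "p (j n) y \<ge> 2/3 * K (j n) * (1/3)^n"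
    proof -
      have "p (j n) y = (1/3)^n / N x * p (j n) x" unfolding y_def using p_scale[OF j(1) x(1)] Nx by simp
      also have "\<dots> \<ge> (1/3)^n / N x * (2/3 * K (j n) * N x)" using x Nx by (intro mult_left_mono) auto
      finally show ?thesis using Nx by (simp add: field_simps)
    qed
    ultimately show ?thesis using x by (intro exI[of _ y]) (auto simp: y_def)
  qed
  then obtain y where y: "\<And>n. y n \<in> V" "\<And>n. N (y n) = (1/3)^n"
    "\<And>n. p (j n) (y n) \<ge> 2/3 * K (j n) * (1/3)^n" by metis
  \<comment> \<open>Since \<open>2 * p (y n) \<le> p (x + y n) + p (x - y n)\<close>, one of the two
    signs does not lose against \<open>p (y n)\<close>, whatever x is.\<close>
  have "\<exists>e. (e = 1 \<or> e = -1) \<and> p (j n) (x + e *\<^sub>R y n) \<ge> p (j n) (y n)" if "x \<in> V" for x n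
  proof (rule ccontr)
    assume H: "\<not> ?thesis"
    from H have a: "p (j n) (x + y n) < p (j n) (y n)" "p (j n) (x - y n) < p (j n) (y n)"
      by (auto dest: spec[of _ 1] spec[of _ "-1"])
    have "2 * p (j n) (y n) = p (j n) (2 *\<^sub>R y n)" using p_scale[OF j(1) y(1)] by simp
    also have "2 *\<^sub>R y n = (x + y n) + - (x - y n)" by (simp add: scaleR_2)
    also have "p (j n) \<dots> \<le> p (j n) (x + y n) + p (j n) (- (x - y n))"
      using that y by (intro p_add j) auto
    also have "\<dots> = p (j n) (x + y n) + p (j n) (x - y n)" using pneg[OF j(1), of "x - y n"] that y by auto
    finally show False using a by simp
  qed
  then obtain e where e: "\<And>x n. x \<in> V \<Longrightarrow> e x n = 1 \<or> e x n = (-1::real)"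
    "\<And>x n. x \<in> V \<Longrightarrow> p (j n) (x + e x n *\<^sub>R y n) \<ge> p (j n) (y n)" by metis
  define X where "X = rec_nat (0::'v) (\<lambda>n x. x + e x n *\<^sub>R y n)"
  have X: "X 0 = 0" "\<And>n. X (Suc n) = X n + e (X n) n *\<^sub>R y n" by (auto simp: X_def)
  have XV: "X n \<in> V" for n by (induction n) (auto simp: X y)
  define z where "z n = e (X n) n *\<^sub>R y n" for n
  have zV: "z n \<in> V" for n by (auto simp: z_def y)
  have Nz: "N (z n) = (1/3)^n" for n using e(1)[OF XV[of n], of n] y by (auto simp: z_def N_scale)
  have Xs: "X n = (\<Sum>k<n. z k)" for n by (induction n) (auto simp: X z_def)
  have "summable (\<lambda>n. N (z n))" unfolding Nz by (rule summable_geometric) auto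
  then obtain s where s: "s \<in> V" "(\<lambda>n. N (s - X n)) \<longlonglongrightarrow> 0" using complete[of z] zV by (auto simp: Xs)
  \<comment> \<open>The geometric sum of 3^-n, 3^-(n+1), ...; in the limit the partial sum
    \<open>X n\<close> misses s by at most 3^-n * 3/2.\<close>
  have tail: "N (X (n + k) - X n) \<le> (1/3)^n * 3/2 * (1 - (1/3)^k)" for n k
  proof (induction k)
    case (Suc k)
    have "N (X (n + Suc k) - X n) \<le> N (X (n + Suc k) - X (n + k)) + N (X (n + k) - X n)"
      using XV by (intro N_triangle)
    also have "N (X (n + Suc k) - X (n + k)) = (1/3)^(n+k)" using Nz[of "n+k"] by (simp add: X z_def)
    finally show ?case using Suc by (simp add: power_add algebra_simps)
  qed (simp add: )
  have st: "N (s - X n) \<le> (1/3)^n * 3/2" for n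
  proof (rule tendsto_lowerbound)
    have "(\<lambda>k. N (s - X (k + n))) \<longlonglongrightarrow> 0" using s(2) by (rule LIMSEQ_ignore_initial_segment)
    then show "(\<lambda>k. N (s - X (k + n)) + (1/3)^n * 3/2) \<longlonglongrightarrow> (1/3)^n * 3/2"
      using tendsto_add[OF _ tendsto_const] by fastforce
    have "N (s - X n) \<le> N (s - X (k + n)) + (1/3)^n * 3/2" for k
    proof -
      have "N (s - X n) \<le> N (s - X (k + n)) + N (X (k + n) - X n)" using s XV by (intro N_triangle)
      moreover have "(1/3)^n * 3/2 * (1 - (1/3)^k) \<le> (1/3::real)^n * 3/2 * 1"
        by (intro mult_left_mono) auto
      ultimately show ?thesis using tail[of n k] unfolding add.commute[of n k] by linarith
    qed
    then show "\<forall>\<^sub>F k in sequentially. N (s - X n) \<le> N (s - X (k + n)) + (1/3)^n * 3/2" by simp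
  qed simp
  obtain B where B: "\<And>i. i \<in> I \<Longrightarrow> p i s \<le> B" using pw[OF s(1)] by auto
  \<comment> \<open>At stage n + 1 the gain is 2/3 of \<open>K (j n) * 3^-n\<close>, and the
    remaining tail costs at most 3^-(n+1) * 3/2, that is one half of it. The surplus 1/6 survives in
    \<open>p (j n) s\<close> and grows like (4/3)^n.\<close>
  have "(4/3)^n / 6 \<le> B" for n :: nat
  proof -
    let ?K = "K (j n) * (1/3)^n"
    have "X (Suc n) = s + (X (Suc n) - s)" by simp
    then have "p (j n) (X (Suc n)) \<le> p (j n) s + p (j n) (X (Suc n) - s)"
      using p_add[OF j(1), of s "X (Suc n) - s"] s XV by (metis V_closed(3))
    moreover have "p (j n) (X (Suc n)) \<ge> 2/3 * ?K"
      using e(2)[OF XV[of n], of n] y(3)[of n] by (simp add: X)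
    moreover have "p (j n) (X (Suc n) - s) \<le> K (j n) * ((1/3)^Suc n * 3/2)"
    proof -
      have "p (j n) (X (Suc n) - s) \<le> K (j n) * N (X (Suc n) - s)" using Kb[OF j(1)] XV s by auto
      also have "\<dots> \<le> K (j n) * ((1/3)^Suc n * 3/2)"
        using st[of "Suc n"] N_commute[of s "X (Suc n)"] XV s K0[OF j(1)] by (intro mult_left_mono) auto
      finally show ?thesis .
    qed
    moreover have "K (j n) * ((1/3)^Suc n * 3/2) = ?K / 2" by simp
    ultimately have "?K / 6 \<le> B" using B[OF j(1), of n] by linarith
    moreover have "4^n * (1/3)^n \<le> ?K" using j(2)[of n] by (intro mult_right_mono) auto
    ultimately show ?thesis by (simp add: power_divide)
  qed
  then have "(4/3)^n \<le> 6 * B" for n :: nat using divide_le_eq[of "(4/3)^n" 6 B] by (simp add: mult.commute)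
  moreover obtain n where "(4/3::real)^n > 6 * B" using real_arch_pow[of "4/3" "6 * B"] by auto
  ultimately show False by (meson not_less)
qed

end

section \<open>Semigroups of operators on seminormed spaces\<close>

text \<open>A mean value inequality for the upper right derivative. If g increased, a line of small
  positive slope e from (0, g 0) would still end below g t; the last time at which g lies below that
  line is before t, and \<open>D\<close> with this e pushes it further.\<close>

lemma right_derivative_nonpos:
  fixes g :: "real \<Rightarrow> real"
  assumes t: "0 \<le> t" and cont: "continuous_on {0..t} g"
    and D: "\<And>\<tau> e. 0 \<le> \<tau> \<Longrightarrow> \<tau> < t \<Longrightarrow> e > 0 \<Longrightarrow>
      \<exists>d>0. \<forall>h. 0 < h \<longrightarrow> h < d \<longrightarrow> \<tau> + h \<le> t \<longrightarrow> g (\<tau> + h) \<le> g \<tau> + e * h"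
  shows "g t \<le> g 0"
proof (rule ccontr)
  assume "\<not> ?thesis"
  then have less: "g 0 < g t" by simp
  then have t0: "t > 0" using t by (cases "t = 0") simp_all
  define e where "e = (g t - g 0) / (2 * t)"
  have e: "e > 0" "g 0 + e * t < g t" using less t0 by (simp_all add: e_def field_simps)
  define S where "S = {\<tau> \<in> {0..t}. g \<tau> \<le> g 0 + e * \<tau>}"
  have "closed S" unfolding S_def
    by (intro continuous_on_closed_Collect_le cont continuous_intros)
  then have "compact (S \<inter> {0..t})" by (rule closed_Int_compact) simp
  moreover have "S \<inter> {0..t} = S" by (auto simp: S_def)
  ultimately have "compact S" by simp
  moreover have "0 \<in> S" using t by (auto simp: S_def)
  ultimately obtain c where c: "c \<in> S" "\<And>x. x \<in> S \<Longrightarrow> x \<le> c"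
    using continuous_attains_sup[of S "\<lambda>x. x"] by auto
  have ct: "c < t" using c(1) e(2) by (cases "c = t") (auto simp: S_def)
  obtain d where d: "d > 0" "\<And>h. 0 < h \<Longrightarrow> h < d \<Longrightarrow> c + h \<le> t \<Longrightarrow> g (c + h) \<le> g c + e * h"
    using D[of c e] c(1) ct e(1) by (auto simp: S_def)
  define h where "h = min (d/2) (t - c)"
  have h: "0 < h" "h < d" "c + h \<le> t" using d ct by (auto simp: h_def)
  have "c + h \<in> S" using d(2)[OF h] c(1) h by (auto simp: S_def algebra_simps)
  then show False using c(2) h by fastforce
qed

section \<open>Operators and semigroups on representatives\<close>

context seminormed
begin

text \<open>Equality of the classes of x and y. Membership in V is part of it, so that chains of
  equivalences carry it along.\<close>

definition eqv :: "'v \<Rightarrow> 'v \<Rightarrow> bool" (infix "\<doteq>" 50) where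
  "x \<doteq> y \<longleftrightarrow> x \<in> V \<and> y \<in> V \<and> N (x - y) = 0"

lemma eqvI: "x \<in> V \<Longrightarrow> y \<in> V \<Longrightarrow> N (x - y) = 0 \<Longrightarrow> x \<doteq> y" by (simp add: eqv_def)
lemma eqvD: "x \<doteq> y \<Longrightarrow> x \<in> V" "x \<doteq> y \<Longrightarrow> y \<in> V" "x \<doteq> y \<Longrightarrow> N (x - y) = 0"
  by (simp_all add: eqv_def)
lemma eqv_refl [simp]: "x \<in> V \<Longrightarrow> x \<doteq> x" by (simp add: eqv_def)
lemma eqv_sym: "x \<doteq> y \<Longrightarrow> y \<doteq> x" using N_commute by (auto simp: eqv_def)
lemma eqv_trans [trans]: "x \<doteq> y \<Longrightarrow> y \<doteq> z \<Longrightarrow> x \<doteq> z"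
  unfolding eqv_def using N_triangle[of x y z] N_nonneg[of "x - z"] by auto
lemma eqv_scale: "x \<doteq> y \<Longrightarrow> c *\<^sub>R x \<doteq> c *\<^sub>R y"
  unfolding eqv_def using N_scale[of "x - y" c] by (auto simp: scaleR_diff_right)
lemma eqv_add: "x \<doteq> y \<Longrightarrow> x' \<doteq> y' \<Longrightarrow> x + x' \<doteq> y + y'"
  unfolding eqv_def using N_add[of "x - y" "x' - y'"] N_nonneg[of "x + x' - (y + y')"]
  by (auto simp: algebra_simps)
lemma eqv_diff: "x \<doteq> y \<Longrightarrow> x' \<doteq> y' \<Longrightarrow> x - x' \<doteq> y - y'"
  using eqv_add[of x y "- x'" "- y'"] eqv_scale[of x' y' "-1"] by simp
lemma eqv_N: "x \<doteq> y \<Longrightarrow> N x = N y"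
  unfolding eqv_def using N_eq by blast

text \<open>An operator picks some representative of its value, so its linearity can be required
  only up to seminorm 0.\<close>

definition bounded_op :: "('v \<Rightarrow> 'v) \<Rightarrow> bool" where
  "bounded_op P \<longleftrightarrow> (\<forall>x\<in>V. P x \<in> V) \<and>
     (\<forall>x\<in>V. \<forall>y\<in>V. \<forall>c d. N (P (c *\<^sub>R x + d *\<^sub>R y) - (c *\<^sub>R P x + d *\<^sub>R P y)) = 0) \<and>
     (\<exists>C. \<forall>x\<in>V. N (P x) \<le> C * N x)"

lemma bounded_op_id: "bounded_op (\<lambda>x. x)"
  unfolding bounded_op_def by (auto intro!: exI[of _ 1])

lemma bounded_opV: "bounded_op P \<Longrightarrow> x \<in> V \<Longrightarrow> P x \<in> V"
  by (auto simp: bounded_op_def)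

lemma bounded_op_lin: "bounded_op P \<Longrightarrow> x \<in> V \<Longrightarrow> y \<in> V \<Longrightarrow> P (c *\<^sub>R x + d *\<^sub>R y) \<doteq> c *\<^sub>R P x + d *\<^sub>R P y"
  by (auto simp: bounded_op_def eqv_def)

lemma bounded_op_add: "bounded_op P \<Longrightarrow> x \<in> V \<Longrightarrow> y \<in> V \<Longrightarrow> P (x + y) \<doteq> P x + P y"
  using bounded_op_lin[of P x y 1 1] by simp

lemma bounded_op_diff: "bounded_op P \<Longrightarrow> x \<in> V \<Longrightarrow> y \<in> V \<Longrightarrow> P (x - y) \<doteq> P x - P y"
  using bounded_op_lin[of P x y 1 "-1"] by simp

lemma bounded_op_scale: "bounded_op P \<Longrightarrow> x \<in> V \<Longrightarrow> P (c *\<^sub>R x) \<doteq> c *\<^sub>R P x"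
  using bounded_op_lin[of P x x c 0] by simp

lemma bounded_op_bound:
  assumes "bounded_op P"
  obtains C where "C \<ge> 0" "\<And>x. x \<in> V \<Longrightarrow> N (P x) \<le> C * N x"
proof -
  obtain C where "\<forall>x\<in>V. N (P x) \<le> C * N x" using assms by (auto simp: bounded_op_def)
  then have C: "\<And>x. x \<in> V \<Longrightarrow> N (P x) \<le> C * N x" by blast
  have "N (P x) \<le> \<bar>C\<bar> * N x" if "x \<in> V" for x
    using C[OF that] mult_right_mono[OF abs_ge_self[of C] N_nonneg[OF that]] by linarith
  then show thesis using that[of "\<bar>C\<bar>"] by simp
qed

lemma bounded_op_Lipschitz:
  assumes "bounded_op P" "x \<in> V" "y \<in> V" "\<And>z. z \<in> V \<Longrightarrow> N (P z) \<le> C * N z"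
  shows "N (P x - P y) \<le> C * N (x - y)"
  using eqv_N[OF bounded_op_diff[OF assms(1-3)]] assms(4)[of "x - y"] assms(2,3) by simp

lemma bounded_op_cong:
  assumes "bounded_op P" "x \<doteq> y" shows "P x \<doteq> P y"
proof -
  have V: "x \<in> V" "y \<in> V" "N (x - y) = 0" using assms by (auto simp: eqv_def)
  obtain C where C: "C \<ge> 0" "\<And>x. x \<in> V \<Longrightarrow> N (P x) \<le> C * N x" using bounded_op_bound[OF assms(1)] by blast
  have "N (P x - P y) \<le> 0" using bounded_op_Lipschitz[OF assms(1) V(1,2) C(2)] V by simp
  then show ?thesis
    using N_nonneg[of "P x - P y"] bounded_opV[OF assms(1)] V by (auto simp: eqv_def)
qed

lemma bounded_op_comp:
  assumes "bounded_op P" "bounded_op Q" shows "bounded_op (\<lambda>x. P (Q x))"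
proof -
  obtain C where C: "C \<ge> 0" "\<And>x. x \<in> V \<Longrightarrow> N (P x) \<le> C * N x" using bounded_op_bound[OF assms(1)] by blast
  obtain D where D: "D \<ge> 0" "\<And>x. x \<in> V \<Longrightarrow> N (Q x) \<le> D * N x" using bounded_op_bound[OF assms(2)] by blast
  have "N (P (Q x)) \<le> (C * D) * N x" if "x \<in> V" for x
  proof -
    have "N (P (Q x)) \<le> C * N (Q x)" using C bounded_opV[OF assms(2)] that by auto
    also have "\<dots> \<le> C * (D * N x)" using D that C by (intro mult_left_mono) auto
    finally show ?thesis by simp
  qed
  moreover have "P (Q (c *\<^sub>R x + d *\<^sub>R y)) \<doteq> c *\<^sub>R P (Q x) + d *\<^sub>R P (Q y)" if "x \<in> V" "y \<in> V" for x y c d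
    using eqv_trans[OF bounded_op_cong[OF assms(1) bounded_op_lin[OF assms(2)]] bounded_op_lin[OF assms(1)]]
      bounded_opV[OF assms(2)] that by blast
  ultimately show ?thesis unfolding bounded_op_def using assms bounded_opV by (auto simp: eqv_def)
qed

definition semigroup :: "(real \<Rightarrow> 'v \<Rightarrow> 'v) \<Rightarrow> bool" where
  "semigroup G \<longleftrightarrow> (\<forall>t\<ge>0. bounded_op (G t)) \<and> (\<forall>x\<in>V. N (G 0 x - x) = 0) \<and>
     (\<forall>s\<ge>0. \<forall>t\<ge>0. \<forall>x\<in>V. N (G (s + t) x - G s (G t x)) = 0) \<and>
     (\<forall>x\<in>V. ((\<lambda>t. N (G t x - x)) \<longlongrightarrow> 0) (at_right 0))"

definition gen :: "(real \<Rightarrow> 'v \<Rightarrow> 'v) \<Rightarrow> ('v \<times> 'v) set" where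
  "gen G = {(x, y). x \<in> V \<and> y \<in> V \<and> ((\<lambda>h. N ((1 / h) *\<^sub>R (G h x - x) - y)) \<longlongrightarrow> 0) (at_right 0)}"

lemma sg_op: "semigroup G \<Longrightarrow> t \<ge> 0 \<Longrightarrow> bounded_op (G t)"
  by (auto simp: semigroup_def)

lemma sgV: "semigroup G \<Longrightarrow> t \<ge> 0 \<Longrightarrow> x \<in> V \<Longrightarrow> G t x \<in> V"
  using sg_op bounded_opV by blast

lemma sg_zero: "semigroup G \<Longrightarrow> x \<in> V \<Longrightarrow> G 0 x \<doteq> x"
  using sgV[of G 0 x] by (auto simp: semigroup_def eqv_def)

lemma sg_plus: "semigroup G \<Longrightarrow> s \<ge> 0 \<Longrightarrow> t \<ge> 0 \<Longrightarrow> x \<in> V \<Longrightarrow> G (s + t) x \<doteq> G s (G t x)"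
  using sgV[of G "s + t" x] sgV[of G s "G t x"] sgV[of G t x] by (auto simp: semigroup_def eqv_def)

lemma sg_cont0:
  assumes "semigroup G" "x \<in> V" "e > 0"
  obtains d where "d > 0" "\<And>t. 0 \<le> t \<Longrightarrow> t < d \<Longrightarrow> N (G t x - x) < e"
proof -
  have "((\<lambda>t. N (G t x - x)) \<longlongrightarrow> 0) (at_right 0)" using assms by (auto simp: semigroup_def)
  then have "\<forall>\<^sub>F t in at_right 0. dist (N (G t x - x)) 0 < e" using assms(3) by (rule tendstoD)
  then obtain d where d: "d > 0" "\<And>t. 0 < t \<Longrightarrow> t < d \<Longrightarrow> \<bar>N (G t x - x)\<bar> < e"
    by (auto simp: eventually_at_right_field dist_real_def)
  have "N (G t x - x) < e" if "0 \<le> t" "t < d" for t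
    using that d(2)[of t] eqvD(3)[OF sg_zero[OF assms(1,2)]] assms(3) by (cases "t = 0") auto
  with d(1) show thesis by (rule that)
qed

text \<open>Clearing the denominator h leaves a remainder of size \<open>e * h\<close>, a form that
  adds, scales and passes through bounded operators.\<close>

lemma gen_iff:
  assumes "\<And>t. t \<ge> 0 \<Longrightarrow> G t x \<in> V"
  shows "(x, y) \<in> gen G \<longleftrightarrow> x \<in> V \<and> y \<in> V \<and>
    (\<forall>e>0. \<exists>d>0. \<forall>h. 0 < h \<longrightarrow> h < d \<longrightarrow> N (G h x - x - h *\<^sub>R y) \<le> e * h)"
proof (cases "x \<in> V \<and> y \<in> V")
  case True
  have eq: "N ((1 / h) *\<^sub>R (G h x - x) - y) = N (G h x - x - h *\<^sub>R y) / h" if "h > 0" for h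
  proof -
    have "(1 / h) *\<^sub>R (G h x - x) - y = (1 / h) *\<^sub>R (G h x - x - h *\<^sub>R y)"
      using that by (simp add: scaleR_diff_right)
    then show ?thesis using N_scale[of "G h x - x - h *\<^sub>R y" "1/h"] assms[of h] True that by simp
  qed
  have nn: "0 \<le> N (G h x - x - h *\<^sub>R y)" if "h > 0" for h using assms[of h] True that by (intro N_nonneg) auto
  show ?thesis (is "?L \<longleftrightarrow> ?R")
  proof
    assume ?L
    then have l: "((\<lambda>h. N ((1 / h) *\<^sub>R (G h x - x) - y)) \<longlongrightarrow> 0) (at_right 0)" by (auto simp: gen_def)
    have "\<exists>d>0. \<forall>h. 0 < h \<longrightarrow> h < d \<longrightarrow> N (G h x - x - h *\<^sub>R y) \<le> e * h" if "e > 0" for e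
    proof -
      from tendstoD[OF l that] obtain d where d: "d > 0"
        "\<And>h. 0 < h \<Longrightarrow> h < d \<Longrightarrow> \<bar>N ((1 / h) *\<^sub>R (G h x - x) - y)\<bar> < e"
        by (auto simp: eventually_at_right_field dist_real_def)
      have "N (G h x - x - h *\<^sub>R y) \<le> e * h" if "0 < h" "h < d" for h
      proof -
        have "N (G h x - x - h *\<^sub>R y) / h < e"
          using d(2)[OF that] unfolding eq[OF that(1)] by (simp only: abs_less_iff)
        then show ?thesis using that by (simp only: pos_divide_less_eq less_imp_le)
      qed
      then show ?thesis using d(1) by blast
    qed
    then show ?R using True by blast
  next
    assume R: ?R
    have "((\<lambda>h. N ((1 / h) *\<^sub>R (G h x - x) - y)) \<longlongrightarrow> 0) (at_right 0)"
    proof (rule tendstoI)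
      fix e :: real assume "e > 0"
      then obtain d where d: "d > 0" "\<And>h. 0 < h \<Longrightarrow> h < d \<Longrightarrow> N (G h x - x - h *\<^sub>R y) \<le> e/2 * h"
        using R[THEN conjunct2, THEN conjunct2, rule_format, of "e/2"] by auto
      have "dist (N ((1 / h) *\<^sub>R (G h x - x) - y)) 0 < e" if "0 < h" "h < d" for h
      proof -
        have "N (G h x - x - h *\<^sub>R y) / h \<le> e/2" using d(2)[OF that] that by (simp add: field_simps)
        moreover have "0 \<le> N (G h x - x - h *\<^sub>R y) / h" using nn[OF that(1)] that by simp
        ultimately show ?thesis
          using \<open>e > 0\<close> unfolding eq[OF that(1)] dist_real_def by linarith
      qed
      then show "\<forall>\<^sub>F h in at_right 0. dist (N ((1 / h) *\<^sub>R (G h x - x) - y)) 0 < e"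
        using d(1) by (auto simp: eventually_at_right_field)
    qed
    then show ?L using True by (simp add: gen_def)
  qed
qed (auto simp: gen_def)

lemma gen_iff_sg:
  assumes "semigroup G" "x \<in> V"
  shows "(x, y) \<in> gen G \<longleftrightarrow> y \<in> V \<and>
    (\<forall>e>0. \<exists>d>0. \<forall>h. 0 < h \<longrightarrow> h < d \<longrightarrow> N (G h x - x - h *\<^sub>R y) \<le> e * h)"
  by (subst gen_iff) (use sgV[OF assms(1)] assms(2) in auto)

lemma gen_V: "(x, y) \<in> gen G \<Longrightarrow> x \<in> V" "(x, y) \<in> gen G \<Longrightarrow> y \<in> V"
  by (auto simp: gen_def)

lemma gen_eps:
  assumes "semigroup G" "(x, y) \<in> gen G" "e > 0"
  obtains d where "d > 0" "\<And>h. 0 < h \<Longrightarrow> h < d \<Longrightarrow> N (G h x - x - h *\<^sub>R y) \<le> e * h"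
proof -
  have "\<exists>d>0. \<forall>h. 0 < h \<longrightarrow> h < d \<longrightarrow> N (G h x - x - h *\<^sub>R y) \<le> e * h"
    using gen_iff_sg[OF assms(1) gen_V(1)[OF assms(2)], of y] assms(2,3) by blast
  then show thesis using that by blast
qed

lemma genI:
  assumes "semigroup G" "x \<in> V" "y \<in> V"
    "\<And>e. e > 0 \<Longrightarrow> \<exists>d>0. \<forall>h. 0 < h \<longrightarrow> h < d \<longrightarrow> N (G h x - x - h *\<^sub>R y) \<le> e * h"
  shows "(x, y) \<in> gen G"
  using gen_iff_sg[OF assms(1,2)] assms(3,4) by simp

lemma gen_unique:
  assumes "semigroup G" "(x, y) \<in> gen G" "(x, y') \<in> gen G"
  shows "y \<doteq> y'"
proof -
  have V: "x \<in> V" "y \<in> V" "y' \<in> V" using assms gen_V by auto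
  have "N (y - y') \<le> e" if "e > 0" for e
  proof -
    obtain d where d: "d > 0" "\<And>h. 0 < h \<Longrightarrow> h < d \<Longrightarrow> N (G h x - x - h *\<^sub>R y) \<le> e/2 * h"
      using gen_eps[OF assms(1,2), of "e/2"] \<open>e > 0\<close> by auto
    obtain d' where d': "d' > 0" "\<And>h. 0 < h \<Longrightarrow> h < d' \<Longrightarrow> N (G h x - x - h *\<^sub>R y') \<le> e/2 * h"
      using gen_eps[OF assms(1,3), of "e/2"] \<open>e > 0\<close> by auto
    define h where "h = min d d' / 2"
    have h: "0 < h" "h < d" "h < d'" using d d' by (auto simp: h_def)
    have GV: "G h x \<in> V" using sgV[OF assms(1)] V h by auto
    have "h * N (y - y') = N (h *\<^sub>R (y - y'))" using N_scale[of "y - y'" h] V h by simp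
    also have "h *\<^sub>R (y - y') = (G h x - x - h *\<^sub>R y') - (G h x - x - h *\<^sub>R y)" by (simp add: algebra_simps)
    also have "N \<dots> \<le> N (G h x - x - h *\<^sub>R y') + N (G h x - x - h *\<^sub>R y)" using V GV by (intro N_diff) auto
    also have "\<dots> \<le> e * h" using d(2)[OF h(1,2)] d'(2)[OF h(1,3)] by simp
    finally show ?thesis using h by (simp add: mult.commute)
  qed
  then have "N (y - y') \<le> 0" by (rule field_le_epsilon) simp
  then show ?thesis using N_nonneg[of "y - y'"] V by (auto simp: eqv_def)
qed

lemma gen_cong:
  assumes G: "semigroup G" "(x, y) \<in> gen G" "y \<doteq> y'"
  shows "(x, y') \<in> gen G"
proof (rule genI[OF G(1)])
  show V: "x \<in> V" "y' \<in> V" using assms gen_V by (auto simp: eqv_def)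
  fix e :: real assume "e > 0"
  then obtain d where d: "d > 0" "\<And>h. 0 < h \<Longrightarrow> h < d \<Longrightarrow> N (G h x - x - h *\<^sub>R y) \<le> e * h"
    using gen_eps[OF G(1,2) \<open>e > 0\<close>] by blast
  have "N (G h x - x - h *\<^sub>R y') \<le> e * h" if "0 < h" "h < d" for h
    using eqv_N[OF eqv_diff[OF eqv_refl eqv_scale[OF G(3)], of "G h x - x" h]] sgV[OF G(1) _ V(1), of h] V that d(2)[OF that]
    by (metis V_closed(3) less_imp_le)
  then show "\<exists>d>0. \<forall>h. 0 < h \<longrightarrow> h < d \<longrightarrow> N (G h x - x - h *\<^sub>R y') \<le> e * h" using d(1) by blast
qed

lemma bounded_op_comb3:
  assumes P: "bounded_op P" and V: "x \<in> V" "y \<in> V" "z \<in> V"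
  shows "P (x - y - h *\<^sub>R z) \<doteq> P x - P y - h *\<^sub>R P z"
  using eqv_trans[OF bounded_op_diff[OF P, of "x - y" "h *\<^sub>R z"]
      eqv_diff[OF bounded_op_diff[OF P, of x y] bounded_op_scale[OF P, of z h]]] V by auto

lemma gen_orbit:
  assumes G: "semigroup G" "(x, y) \<in> gen G" and t: "t \<ge> 0"
  shows "(G t x, G t y) \<in> gen G"
proof (rule genI[OF G(1)])
  have V: "x \<in> V" "y \<in> V" using assms gen_V by auto
  show "G t x \<in> V" "G t y \<in> V" using V sgV[OF G(1) t] by auto
  obtain C where C: "C \<ge> 0" "\<And>x. x \<in> V \<Longrightarrow> N (G t x) \<le> C * N x"
    using bounded_op_bound[OF sg_op[OF G(1) t]] by blast
  fix e :: real assume e: "e > 0"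
  obtain d where d: "d > 0" "\<And>h. 0 < h \<Longrightarrow> h < d \<Longrightarrow> N (G h x - x - h *\<^sub>R y) \<le> e/(C+1) * h"
    using gen_eps[OF G(1,2), of "e/(C+1)"] e C by auto
  have "N (G h (G t x) - G t x - h *\<^sub>R G t y) \<le> e * h" if h: "0 < h" "h < d" for h
  proof -
    have GV: "G h x \<in> V" using sgV[OF G(1)] h V by auto
    have "G h (G t x) \<doteq> G (h + t) x" using eqv_sym[OF sg_plus[OF G(1)]] h t V by auto
    also have "G (h + t) x \<doteq> G t (G h x)" using sg_plus[OF G(1), of t h x] h t V by (simp add: add.commute)
    finally have 1: "G h (G t x) \<doteq> G t (G h x)" .
    have "G h (G t x) - G t x - h *\<^sub>R G t y \<doteq> G t (G h x) - G t x - h *\<^sub>R G t y"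
      by (intro eqv_diff 1 eqv_refl V_closed) (use V sgV[OF G(1) t] in auto)
    also have "\<dots> \<doteq> G t (G h x - x - h *\<^sub>R y)"
      using eqv_sym[OF bounded_op_comb3[OF sg_op[OF G(1) t]]] GV V by auto
    finally have "N (G h (G t x) - G t x - h *\<^sub>R G t y) = N (G t (G h x - x - h *\<^sub>R y))" by (rule eqv_N)
    also have "\<dots> \<le> C * N (G h x - x - h *\<^sub>R y)" using C GV V by auto
    also have "\<dots> \<le> C * (e/(C+1) * h)" using C d(2)[OF h] by (intro mult_left_mono) auto
    also have "\<dots> \<le> e * h" using C(1) h e by (simp add: field_simps)
    finally show ?thesis .
  qed
  then show "\<exists>d>0. \<forall>h. 0 < h \<longrightarrow> h < d \<longrightarrow> N (G h (G t x) - G t x - h *\<^sub>R G t y) \<le> e * h"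
    using d(1) by blast
qed

end

section \<open>Local boundedness and continuity of orbits\<close>

context seminormed_complete
begin

text \<open>Otherwise there are times t n tending to 0 at which the norms of the operators exceed n.
  Strong continuity keeps each orbit bounded along these times, and uniform boundedness gives a
  contradiction.\<close>

lemma sg_bounded_near_0:
  assumes G: "semigroup G"
  obtains d B where "d > 0" "B \<ge> 1" "\<And>t x. 0 \<le> t \<Longrightarrow> t \<le> d \<Longrightarrow> x \<in> V \<Longrightarrow> N (G t x) \<le> B * N x"
proof -
  have "\<exists>d>0. \<exists>B\<ge>1. \<forall>t x. 0 \<le> t \<longrightarrow> t \<le> d \<longrightarrow> x \<in> V \<longrightarrow> N (G t x) \<le> B * N x"
  proof (rule ccontr)
  assume H0: "\<not> ?thesis"
  have H: "\<not> (\<forall>t x. 0 \<le> t \<longrightarrow> t \<le> d \<longrightarrow> x \<in> V \<longrightarrow> N (G t x) \<le> B * N x)" if "d > 0" "B \<ge> 1" for d B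
    using H0 that by blast
  have "\<exists>t x. 0 \<le> t \<and> t \<le> 1 / real (Suc n) \<and> x \<in> V \<and> N (G t x) > real (Suc n) * N x" for n
    using H[of "1 / real (Suc n)" "real (Suc n)"] by (auto simp: not_le)
  then obtain t x where tx: "\<And>n. 0 \<le> t n" "\<And>n. t n \<le> 1 / real (Suc n)" "\<And>n. x n \<in> V"
    "\<And>n. N (G (t n) (x n)) > real (Suc n) * N (x n)" by metis
  have t0: "t \<longlonglongrightarrow> 0"
    by (rule real_tendsto_sandwich[of "\<lambda>_. 0" t _ "\<lambda>n. 1 / real (Suc n)"])
      (use tx LIMSEQ_inverse_real_of_nat in \<open>auto simp: inverse_eq_divide\<close>)
  have "\<exists>B\<ge>0. \<forall>i\<in>UNIV. \<forall>x\<in>V. N (G (t i) x) \<le> B * N x"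
  proof (rule uniform_boundedness)
    fix i x y assume V: "x \<in> V" "y \<in> V"
    note op = sg_op[OF G tx(1)[of i]]
    show "N (G (t i) (x + y)) \<le> N (G (t i) x) + N (G (t i) y)"
      using eqv_N[OF bounded_op_add[OF op V]] N_add[of "G (t i) x" "G (t i) y"] bounded_opV[OF op] V by simp
    show "N (G (t i) (c *\<^sub>R x)) = \<bar>c\<bar> * N (G (t i) x)" for c
      using eqv_N[OF bounded_op_scale[OF op V(1), of c]] N_scale[of "G (t i) x" c] bounded_opV[OF op] V by simp
  next
    fix i show "\<exists>C. \<forall>x\<in>V. N (G (t i) x) \<le> C * N x" using sg_op[OF G tx(1)[of i]] by (auto simp: bounded_op_def)
  next
    fix x assume V: "x \<in> V"
    have GV: "G (t n) x \<in> V" for n using sgV[OF G tx(1) V] .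
    have "(\<lambda>n. N (G (t n) x - x)) \<longlonglongrightarrow> 0"
    proof (rule LIMSEQ_I)
      fix r :: real assume "0 < r"
      then obtain d where d: "d > 0" "\<And>t. 0 \<le> t \<Longrightarrow> t < d \<Longrightarrow> N (G t x - x) < r" using sg_cont0[OF G V \<open>0 < r\<close>] by blast
      obtain no where "\<And>n. n \<ge> no \<Longrightarrow> t n < d" using LIMSEQ_D[OF t0 d(1)] tx(1) by auto
      then show "\<exists>no. \<forall>n\<ge>no. norm (N (G (t n) x - x) - 0) < r"
        using d(2) tx(1) N_nonneg[OF V_closed(3)[OF GV V]] by (auto intro!: exI[of _ no])
    qed
    then have "Bseq (\<lambda>n. N (G (t n) x - x))" by (intro convergent_imp_Bseq convergentI)
    then obtain B where B: "\<And>n. N (G (t n) x - x) \<le> B" by (auto simp: Bseq_def abs_le_iff)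
    have "N (G (t n) x) \<le> B + N x" for n
      using N_add[of "G (t n) x - x" x] B[of n] GV[of n] V by simp
    then show "\<exists>B. \<forall>i\<in>UNIV. N (G (t i) x) \<le> B" by blast
  qed
  then obtain B where B: "\<And>i x. x \<in> V \<Longrightarrow> N (G (t i) x) \<le> B * N x" by blast
  obtain n where n: "real n > B" using reals_Archimedean2 by blast
  have "B * N (x n) \<le> real (Suc n) * N (x n)" using n N_nonneg[OF tx(3)] by (intro mult_right_mono) auto
  then show False using B[OF tx(3), of n n] tx(4)[of n] by simp
  qed
  then show thesis using that by blast
qed

lemma sg_locally_bounded:
  assumes G: "semigroup G"
  obtains C where "C \<ge> 1" "\<And>t x. 0 \<le> t \<Longrightarrow> t \<le> T \<Longrightarrow> x \<in> V \<Longrightarrow> N (G t x) \<le> C * N x"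
proof -
  obtain d B where dB: "d > 0" "B \<ge> 1" "\<And>t x. 0 \<le> t \<Longrightarrow> t \<le> d \<Longrightarrow> x \<in> V \<Longrightarrow> N (G t x) \<le> B * N x"
    using sg_bounded_near_0[OF G] by blast
  have *: "\<forall>t x. 0 \<le> t \<longrightarrow> t \<le> real n * d \<longrightarrow> x \<in> V \<longrightarrow> N (G t x) \<le> B ^ Suc n * N x" for n
  proof (induction n)
    case 0
    then show ?case using dB by simp
  next
    case (Suc n)
    show ?case
    proof (intro allI impI)
      fix t x assume t: "0 \<le> t" "t \<le> real (Suc n) * d" and x: "x \<in> V"
      \<comment> \<open>With this s the remaining time is at most \<open>n * d\<close>, also when t
        is shorter than one step d.\<close>
      define s where "s = min d t"
      have s: "0 \<le> s" "s \<le> d" "0 \<le> t - s" "t - s \<le> real n * d"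
        using t dB by (auto simp: s_def min_def algebra_simps)
      have "N (G t x) = N (G (t - s) (G s x))" using eqv_N[OF sg_plus[OF G s(3,1) x]] by simp
      also have "\<dots> \<le> B ^ Suc n * N (G s x)" using Suc s sgV[OF G s(1) x] by blast
      also have "\<dots> \<le> B ^ Suc n * (B * N x)" using dB s x by (intro mult_left_mono) auto
      finally show "N (G t x) \<le> B ^ Suc (Suc n) * N x" by (simp add: mult_ac)
    qed
  qed
  obtain n where n: "real n > T / d" using reals_Archimedean2 by blast
  have "T \<le> real n * d" using n dB by (simp add: field_simps)
  then have "N (G t x) \<le> B ^ Suc n * N x" if "0 \<le> t" "t \<le> T" "x \<in> V" for t x
    using * that by (meson order_trans)
  moreover have "B ^ Suc n \<ge> 1" using dB(2) by (rule one_le_power)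
  ultimately show thesis by (rule that[rotated])
qed

text \<open>For s <= t the difference is \<open>G s (G (t - s) x - x)\<close> up to a null vector,
  so right continuity at 0 and the local bound give continuity from both sides, uniformly on
  [0, T].\<close>

lemma sg_uniformly_continuous:
  assumes G: "semigroup G" and x: "x \<in> V" and e: "e > 0"
  obtains d where "d > 0" "\<And>s t. 0 \<le> s \<Longrightarrow> s \<le> T \<Longrightarrow> 0 \<le> t \<Longrightarrow> t \<le> T \<Longrightarrow> \<bar>s - t\<bar> < d \<Longrightarrow> N (G s x - G t x) < e"
proof -
  obtain C where C: "C \<ge> 1" "\<And>t x. 0 \<le> t \<Longrightarrow> t \<le> T \<Longrightarrow> x \<in> V \<Longrightarrow> N (G t x) \<le> C * N x"
    using sg_locally_bounded[OF G] by blast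
  obtain d where d: "d > 0" "\<And>t. 0 \<le> t \<Longrightarrow> t < d \<Longrightarrow> N (G t x - x) < e / C"
    using sg_cont0[OF G x, of "e / C"] e C(1) by auto
  have *: "N (G t x - G s x) < e" if "0 \<le> s" "s \<le> t" "t \<le> T" "t - s < d" for s t
  proof -
    have ts: "0 \<le> t - s" using that by simp
    have V: "G (t - s) x \<in> V" "G s x \<in> V" using sgV[OF G _ x] that by auto
    have "G t x \<doteq> G s (G (t - s) x)" using sg_plus[OF G that(1) ts x] by simp
    then have "G t x - G s x \<doteq> G s (G (t - s) x) - G s x" using V by (intro eqv_diff) auto
    also have "\<dots> \<doteq> G s (G (t - s) x - x)"
      using eqv_sym[OF bounded_op_diff[OF sg_op[OF G that(1)] V(1) x]] .
    finally have "N (G t x - G s x) = N (G s (G (t - s) x - x))" by (rule eqv_N)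
    also have "\<dots> \<le> C * N (G (t - s) x - x)" using C(2) that V x by auto
    also have "\<dots> < C * (e / C)" using d(2)[of "t - s"] that C(1) by (intro mult_strict_left_mono) auto
    finally show ?thesis using C(1) by simp
  qed
  have "N (G s x - G t x) < e" if "0 \<le> s" "s \<le> T" "0 \<le> t" "t \<le> T" "\<bar>s - t\<bar> < d" for s t
    using *[of s t] *[of t s] that N_commute[of "G s x" "G t x"] sgV[OF G _ x] by (cases "s \<le> t") auto
  with d(1) show thesis by (rule that)
qed

end

section \<open>Comparison of semigroups through a sublinear functional\<close>

context seminormed
begin

text \<open>The condition \<open>q x \<le> 0\<close> describes a convex cone, closed because q is
  Lipschitz with respect to N. Instances are N itself, for equalities, the norms of the positive and
  negative parts, for order relations, and 0, for no restriction at all.\<close>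

definition sublin :: "('v \<Rightarrow> real) \<Rightarrow> bool" where
  "sublin q \<longleftrightarrow> (\<forall>x\<in>V. \<forall>y\<in>V. q (x + y) \<le> q x + q y) \<and> (\<forall>x\<in>V. \<forall>c\<ge>0. q (c *\<^sub>R x) \<le> c * q x) \<and> (\<forall>x\<in>V. q x \<le> N x)"

lemma sublinD:
  assumes "sublin q" "x \<in> V" shows "y \<in> V \<Longrightarrow> q (x + y) \<le> q x + q y" "c \<ge> 0 \<Longrightarrow> q (c *\<^sub>R x) \<le> c * q x" "q x \<le> N x"
  using assms by (auto simp: sublin_def)

lemma sublin_diff:
  assumes "sublin q" "x \<in> V" "y \<in> V" shows "q x \<le> q y + N (x - y)" "\<bar>q x - q y\<bar> \<le> N (x - y)"
proof -
  have *: "q x \<le> q y + N (x - y)" if "x \<in> V" "y \<in> V" for x y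
    using sublinD(1)[OF assms(1), of y "x - y"] sublinD(3)[OF assms(1), of "x - y"] that by simp
  then show "q x \<le> q y + N (x - y)" using assms by auto
  show "\<bar>q x - q y\<bar> \<le> N (x - y)" using *[of x y] *[of y x] assms N_commute[of x y] by (auto simp: abs_le_iff)
qed

lemma sublin_N: "sublin N"
  by (auto simp: sublin_def N_add N_scale)

lemma sublin_eqv: "sublin q \<Longrightarrow> x \<doteq> y \<Longrightarrow> q x = q y"
  using sublin_diff(2)[of q x y] by (auto simp: eqv_def)

end

context seminormed_complete
begin

text \<open>The derivative of \<open>\<tau> \<mapsto> G2 (t - \<tau>) (P (G1 \<tau> f))\<close> is \<open>G2 (t - \<tau>)\<close> applied to the
  commutator of \<open>P\<close> with the generators.\<close>

lemma semigroup_comparison: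
  assumes G1: "semigroup G1" and G2: "semigroup G2" and P: "bounded_op P" and q: "sublin q"
    and f: "(f, v0) \<in> gen G1"
    and H: "\<And>\<tau>. \<tau> \<ge> 0 \<Longrightarrow> \<exists>v'. (P (G1 \<tau> f), v') \<in> gen G2 \<and> (\<forall>s\<ge>0. q (G2 s (P (G1 \<tau> v0) - v')) \<le> 0)"
    and t: "t \<ge> 0"
  shows "q (P (G1 t f) - G2 t (P f)) \<le> 0"
proof -
  have fV: "f \<in> V" "v0 \<in> V" using f gen_V by auto
  define w where "w \<tau> = G2 (t - \<tau>) (P (G1 \<tau> f))" for \<tau>
  define g where "g \<tau> = q (w \<tau> - w 0)" for \<tau>
  have V1: "\<tau> \<ge> 0 \<Longrightarrow> x \<in> V \<Longrightarrow> G1 \<tau> x \<in> V" and V2: "\<tau> \<ge> 0 \<Longrightarrow> x \<in> V \<Longrightarrow> G2 \<tau> x \<in> V"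
    and VP: "x \<in> V \<Longrightarrow> P x \<in> V" for \<tau> x using sgV[OF G1] sgV[OF G2] bounded_opV[OF P] by auto
  have wV: "w \<tau> \<in> V" if "0 \<le> \<tau>" "\<tau> \<le> t" for \<tau> unfolding w_def using that fV by (intro V2 VP V1) auto
  obtain C2 where C2: "C2 \<ge> 1" "\<And>s x. 0 \<le> s \<Longrightarrow> s \<le> t \<Longrightarrow> x \<in> V \<Longrightarrow> N (G2 s x) \<le> C2 * N x"
    using sg_locally_bounded[OF G2] by blast
  obtain CP where CP: "CP \<ge> 0" "\<And>x. x \<in> V \<Longrightarrow> N (P x) \<le> CP * N x" using bounded_op_bound[OF P] by blast
  have cont: "continuous_on {0..t} g"
    unfolding continuous_on_iff
  proof (intro ballI allI impI)
    fix \<tau> e :: real assume \<tau>: "\<tau> \<in> {0..t}" and e: "e > 0"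
    define y where "y = P (G1 \<tau> f)"
    have yV: "y \<in> V" using \<tau> by (auto simp: y_def intro!: V1 VP fV)
    have "C2 * CP \<ge> 0" using C2(1) CP(1) by simp
    then have e': "e / (2 * (C2 * CP + 1)) > 0" using e by simp
    obtain d1 where d1: "d1 > 0" "\<And>a b. 0 \<le> a \<Longrightarrow> a \<le> t \<Longrightarrow> 0 \<le> b \<Longrightarrow> b \<le> t \<Longrightarrow> \<bar>a - b\<bar> < d1 \<Longrightarrow>
        N (G1 a f - G1 b f) < e / (2 * (C2 * CP + 1))"
      using sg_uniformly_continuous[OF G1 fV(1) e'] by blast
    obtain d2 where d2: "d2 > 0" "\<And>a b. 0 \<le> a \<Longrightarrow> a \<le> t \<Longrightarrow> 0 \<le> b \<Longrightarrow> b \<le> t \<Longrightarrow> \<bar>a - b\<bar> < d2 \<Longrightarrow>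
        N (G2 a y - G2 b y) < e / 2"
      using sg_uniformly_continuous[OF G2 yV half_gt_zero[OF e]] by blast
    have "dist (g \<sigma>) (g \<tau>) < e" if \<sigma>: "\<sigma> \<in> {0..t}" and d: "dist \<sigma> \<tau> < min d1 d2" for \<sigma>
    proof -
      have op: "bounded_op (G2 (t - \<sigma>))" using sg_op[OF G2] \<sigma> by auto
      have V: "P (G1 \<sigma> f) \<in> V" "G2 (t - \<sigma>) y \<in> V" using \<sigma> yV by (auto intro!: V1 V2 VP fV)
      have "\<bar>g \<sigma> - g \<tau>\<bar> \<le> N ((w \<sigma> - w 0) - (w \<tau> - w 0))" unfolding g_def
        using wV[of \<sigma>] wV[of \<tau>] wV[of 0] t \<sigma> \<tau> by (intro sublin_diff(2)[OF q]) auto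
      also have "\<dots> = N (w \<sigma> - w \<tau>)" by simp
      also have "\<dots> \<le> N (w \<sigma> - G2 (t - \<sigma>) y) + N (G2 (t - \<sigma>) y - w \<tau>)"
        using wV[of \<sigma>] wV[of \<tau>] \<sigma> \<tau> V by (intro N_triangle) auto
      also have "N (w \<sigma> - G2 (t - \<sigma>) y) \<le> C2 * N (P (G1 \<sigma> f) - y)"
        unfolding w_def using \<sigma> by (intro bounded_op_Lipschitz[OF op V(1) yV] C2) auto
      also have "N (P (G1 \<sigma> f) - y) \<le> CP * N (G1 \<sigma> f - G1 \<tau> f)"
        unfolding y_def using \<sigma> \<tau> by (intro bounded_op_Lipschitz[OF P] V1 fV CP) auto
      also have "N (G1 \<sigma> f - G1 \<tau> f) \<le> e / (2 * (C2 * CP + 1))"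
        using d1(2)[of \<sigma> \<tau>] \<sigma> \<tau> d by (auto simp: dist_real_def)
      also have "C2 * (CP * (e / (2 * (C2 * CP + 1)))) \<le> e/2"
      proof -
        have "C2 * CP / (C2 * CP + 1) \<le> 1" using \<open>C2 * CP \<ge> 0\<close> by simp
        then have "C2 * CP / (C2 * CP + 1) * (e/2) \<le> 1 * (e/2)" using e by (intro mult_right_mono) auto
        then show ?thesis by (simp add: mult.commute mult.left_commute)
      qed
      also have "N (G2 (t - \<sigma>) y - w \<tau>) < e/2"
        unfolding w_def y_def[symmetric] using d2(2)[of "t - \<sigma>" "t - \<tau>"] \<sigma> \<tau> d by (auto simp: dist_real_def)
      finally show ?thesis using C2(1) CP(1) by (simp add: dist_real_def mult_left_mono)
    qed
    then show "\<exists>d>0. \<forall>x'\<in>{0..t}. dist x' \<tau> < d \<longrightarrow> dist (g x') (g \<tau>) < e"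
      using d1(1) d2(1) by (intro exI[of _ "min d1 d2"]) auto
  qed
  have "g t \<le> g 0"
  proof (rule right_derivative_nonpos[OF t cont])
    fix \<tau> e :: real assume \<tau>: "0 \<le> \<tau>" "\<tau> < t" and e: "e > 0"
    define u where "u = G1 \<tau> f"
    define v where "v = G1 \<tau> v0"
    have uv: "(u, v) \<in> gen G1" unfolding u_def v_def by (rule gen_orbit[OF G1 f \<tau>(1)])
    obtain v' where v': "(P u, v') \<in> gen G2" "\<And>s. s \<ge> 0 \<Longrightarrow> q (G2 s (P v - v')) \<le> 0"
      using H[OF \<tau>(1)] by (auto simp: u_def v_def)
    have V: "u \<in> V" "v \<in> V" "v' \<in> V" "P u \<in> V" "P v \<in> V" using uv v' gen_V VP by blast+
    \<comment> \<open>The remainder of \<open>G1\<close> passes through P and then through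
      \<open>G2\<close>, that of \<open>G2\<close> only through the latter; together they cost
      \<open>C2 * (CP + 1) * e1 * h\<close>, which is \<open>e * h\<close>.\<close>
    define e1 where "e1 = e / (C2 * (CP + 1))"
    have e1: "e1 > 0" using e C2(1) CP(1) by (simp add: e1_def)
    obtain d1 where d1: "d1 > 0" "\<And>h. 0 < h \<Longrightarrow> h < d1 \<Longrightarrow> N (G1 h u - u - h *\<^sub>R v) \<le> e1 * h"
      using gen_eps[OF G1 uv e1] by blast
    obtain d2 where d2: "d2 > 0" "\<And>h. 0 < h \<Longrightarrow> h < d2 \<Longrightarrow> N (G2 h (P u) - P u - h *\<^sub>R v') \<le> e1 * h"
      using gen_eps[OF G2 v'(1) e1] by blast
    have "g (\<tau> + h) \<le> g \<tau> + e * h" if h: "0 < h" "h < min d1 d2" "\<tau> + h \<le> t" for h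
    proof -
      \<comment> \<open>Both w (\<tau> + h) and w \<tau> are \<open>G2 s\<close> of a vector:
        \<open>a\<close> spends the time h in \<open>G1\<close>, \<open>b\<close> spends it in
        \<open>G2\<close>. Their difference is \<open>h *\<^sub>R z\<close> up to o(h), and q is
        nonpositive on \<open>G2 s z\<close> by assumption.\<close>
      define s where "s = t - (\<tau> + h)"
      have s: "0 \<le> s" "s \<le> t" using h \<tau> by (auto simp: s_def)
      note op = sg_op[OF G2 s(1)]
      define a where "a = P (G1 h u)"
      define b where "b = G2 h (P u)"
      define z where "z = P v - v'"
      have hV: "G1 h u \<in> V" "a \<in> V" "b \<in> V" "z \<in> V" "G2 s a \<in> V" "G2 s b \<in> V" "G2 s z \<in> V"
        using V h s by (auto simp: a_def b_def z_def intro!: V1 V2 VP)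
      have "G1 (\<tau> + h) f \<doteq> G1 h u" unfolding u_def
        using sg_plus[OF G1, of h \<tau> f] h \<tau> fV by (simp add: add.commute)
      then have w1: "w (\<tau> + h) \<doteq> G2 s a" unfolding w_def a_def s_def[symmetric]
        by (intro bounded_op_cong[OF op] bounded_op_cong[OF P])
      have "t - \<tau> = s + h" by (simp add: s_def)
      then have w2: "w \<tau> \<doteq> G2 s b" unfolding w_def b_def u_def[symmetric]
        using sg_plus[OF G2 s(1), of h "P u"] h V by simp
      have 1: "w (\<tau> + h) - w \<tau> \<doteq> G2 s a - G2 s b" by (rule eqv_diff[OF w1 w2])
      have D: "N (a - b - h *\<^sub>R z) \<le> (CP + 1) * (e1 * h)"
      proof -
        have "a - P u - h *\<^sub>R P v \<doteq> P (G1 h u - u - h *\<^sub>R v)"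
          unfolding a_def using eqv_sym[OF bounded_op_comb3[OF P]] hV V by auto
        then have "N (a - P u - h *\<^sub>R P v) = N (P (G1 h u - u - h *\<^sub>R v))" by (rule eqv_N)
        also have "\<dots> \<le> CP * N (G1 h u - u - h *\<^sub>R v)" using hV V by (intro CP) auto
        also have "\<dots> \<le> CP * (e1 * h)" using CP(1) d1(2)[of h] h by (intro mult_left_mono) auto
        finally have A: "N (a - P u - h *\<^sub>R P v) \<le> CP * (e1 * h)" .
        have B: "N (b - P u - h *\<^sub>R v') \<le> e1 * h" unfolding b_def using d2(2)[of h] h by auto
        have eq: "a - b - h *\<^sub>R z = (a - P u - h *\<^sub>R P v) - (b - P u - h *\<^sub>R v')"
          by (simp add: z_def algebra_simps)
        have "N ((a - P u - h *\<^sub>R P v) - (b - P u - h *\<^sub>R v')) \<le> N (a - P u - h *\<^sub>R P v) + N (b - P u - h *\<^sub>R v')"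
          by (rule N_diff) (use hV V in auto)
        moreover have "(CP + 1) * (e1 * h) = CP * (e1 * h) + e1 * h" by (simp add: algebra_simps)
        ultimately show ?thesis using A B unfolding eq by linarith
      qed
      have "q (w (\<tau> + h) - w \<tau>) = q (G2 s a - G2 s b)" by (rule sublin_eqv[OF q 1])
      also have "\<dots> \<le> q (h *\<^sub>R G2 s z) + N (G2 s a - G2 s b - h *\<^sub>R G2 s z)"
        using hV by (intro sublin_diff(1)[OF q]) auto
      also have "q (h *\<^sub>R G2 s z) \<le> h * q (G2 s z)" using sublinD(2)[OF q] hV h by auto
      also have "h * q (G2 s z) \<le> 0" using v'(2)[OF s(1)] h by (simp add: z_def mult_nonneg_nonpos)
      also have "N (G2 s a - G2 s b - h *\<^sub>R G2 s z) = N (G2 s (a - b - h *\<^sub>R z))"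
        using eqv_N[OF bounded_op_comb3[OF op hV(2,3,4)]] by simp
      also have "\<dots> \<le> C2 * N (a - b - h *\<^sub>R z)" using hV s by (intro C2) auto
      also have "\<dots> \<le> C2 * ((CP + 1) * (e1 * h))" using D C2(1) by (intro mult_left_mono) auto
      also have "\<dots> = e * h" using C2(1) CP(1) by (simp add: e1_def)
      finally have q1: "q (w (\<tau> + h) - w \<tau>) \<le> e * h" by simp
      have "w (\<tau> + h) - w 0 = (w \<tau> - w 0) + (w (\<tau> + h) - w \<tau>)" by simp
      then have "g (\<tau> + h) \<le> g \<tau> + q (w (\<tau> + h) - w \<tau>)"
        unfolding g_def using sublinD(1)[OF q, of "w \<tau> - w 0" "w (\<tau> + h) - w \<tau>"] wV[of \<tau>] wV[of "\<tau> + h"] wV[of 0] \<tau> h t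
        by (metis V_closed(3) add_nonneg_nonneg less_eq_real_def order_refl)
      then show ?thesis using q1 by simp
    qed
    then show "\<exists>d>0. \<forall>h. 0 < h \<longrightarrow> h < d \<longrightarrow> \<tau> + h \<le> t \<longrightarrow> g (\<tau> + h) \<le> g \<tau> + e * h"
      using d1(1) d2(1) by (intro exI[of _ "min d1 d2"]) auto
  qed
  also have "g 0 = 0"
    using sublinD(2)[OF q V_closed(1), of 0] sublinD(1)[OF q V_closed(1) V_closed(1)] by (simp add: g_def)
  finally have "q (w t - w 0) \<le> 0" by (simp add: g_def)
  moreover have "w t - w 0 \<doteq> P (G1 t f) - G2 t (P f)"
    unfolding w_def diff_self diff_zero
    by (intro eqv_diff sg_zero[OF G2] bounded_op_cong[OF sg_op[OF G2 t]] bounded_op_cong[OF P] sg_zero[OF G1] VP V1 fV t)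
  ultimately show ?thesis using sublin_eqv[OF q] by simp
qed

end

section \<open>Density and closedness of generators\<close>

text \<open>On each cell the mean value theorem writes the increment of F as the cell length times g
  at an inner point, which differs from g at the left end by at most the oscillation e. The bound
  depends on g only through e.\<close>

lemma left_Riemann_sum:
  fixes F g :: "real \<Rightarrow> real" and n :: nat
  assumes n: "n > 0" and h: "h > 0"
    and D: "\<And>s. 0 \<le> s \<Longrightarrow> s \<le> h \<Longrightarrow> (F has_real_derivative g s) (at s)"
    and osc: "\<And>s t. 0 \<le> s \<Longrightarrow> s \<le> h \<Longrightarrow> 0 \<le> t \<Longrightarrow> t \<le> h \<Longrightarrow> \<bar>s - t\<bar> \<le> h / n \<Longrightarrow> \<bar>g s - g t\<bar> \<le> e"
  shows "\<bar>h / n * (\<Sum>k<n. g (k * (h / n))) - (F h - F 0)\<bar> \<le> h * e"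
proof -
  define d where "d = h / n"
  have d: "d > 0" using n h by (simp add: d_def)
  have nd: "real n * d = h" using n by (simp add: d_def)
  have each: "\<bar>d * g (k * d) - (F (Suc k * d) - F (k * d))\<bar> \<le> d * e" if "k < n" for k
  proof -
    have up: "real (Suc k) * d \<le> h" using that d nd by (metis Suc_leI mult_right_mono less_imp_le of_nat_le_iff)
    have lt: "real k * d < real (Suc k) * d" using d by simp
    have "\<exists>z. real k * d < z \<and> z < real (Suc k) * d \<and>
        F (real (Suc k) * d) - F (real k * d) = (real (Suc k) * d - real k * d) * g z"
    proof (rule MVT2[OF lt])
      fix x assume x: "real k * d \<le> x" "x \<le> real (Suc k) * d"
      have "0 \<le> real k * d" using d by simp
      then show "(F has_real_derivative g x) (at x)" using x up by (intro D) linarith+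
    qed
    then obtain z where z: "real k * d < z" "z < real (Suc k) * d"
      "F (real (Suc k) * d) - F (real k * d) = (real (Suc k) * d - real k * d) * g z" by blast
    have dd: "real (Suc k) * d - real k * d = d" by (simp add: algebra_simps)
    have k0: "0 \<le> real k * d" using d by simp
    have "\<bar>g (real k * d) - g z\<bar> \<le> e"
      unfolding d_def[symmetric] by (rule osc, unfold d_def[symmetric]) (use z(1,2) k0 up dd lt in linarith)+
    then have "d * \<bar>g (real k * d) - g z\<bar> \<le> d * e" using d by simp
    moreover have "d * g (k * d) - (F (Suc k * d) - F (k * d)) = d * (g (real k * d) - g z)"
      unfolding z(3) dd by (simp add: algebra_simps)
    ultimately show ?thesis using d by (simp add: abs_mult)
  qed
  have tele: "(\<Sum>k<n. F (Suc k * d) - F (k * d)) = F h - F 0"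
    using sum_lessThan_telescope[of "\<lambda>k. F (real k * d)" n] nd by simp
  have "\<bar>d * (\<Sum>k<n. g (k * d)) - (F h - F 0)\<bar> = \<bar>\<Sum>k<n. d * g (k * d) - (F (Suc k * d) - F (k * d))\<bar>"
    unfolding tele[symmetric] by (simp add: sum_subtractf sum_distrib_left)
  also have "\<dots> \<le> (\<Sum>k<n. d * e)" 
    by (rule order_trans[OF sum_abs sum_mono]) (rule each, simp)
  also have "\<dots> = h * e" using nd by simp
  finally show ?thesis by (simp add: d_def)
qed

lemma (in seminormed) unit_functional_eqv:
  assumes "unit_functional \<phi>" "x \<doteq> y" shows "\<phi> x = \<phi> y"
  using unit_functionalD(3,5)[OF assms(1), of x y] unit_functionalD(5)[OF assms(1), of "x - y" 0] assms(2)
  by (auto simp: eqv_def)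

section \<open>Integrals of orbits and density of the domain\<close>

context seminormed_complete
begin

lemma orbit_antiderivative:
  assumes G: "semigroup G" and \<phi>: "unit_functional \<phi>" and f: "f \<in> V"
  obtains F where "\<And>s. 0 \<le> s \<Longrightarrow> s \<le> T \<Longrightarrow> (F has_real_derivative \<phi> (G s f)) (at s)"
proof -
  \<comment> \<open>The orbit is continued to negative times by its value at 0, so that 0 becomes an
    interior point and the antiderivative is differentiable there from both sides.\<close>
  define g where "g s = \<phi> (G (max 0 s) f)" for s
  have "continuous_on {-1..T+1} g"
    unfolding continuous_on_iff
  proof (intro ballI allI impI)
    fix s e :: real assume s: "s \<in> {-1..T+1}" and e: "e > 0"
    obtain d where d: "d > 0" "\<And>a b. 0 \<le> a \<Longrightarrow> a \<le> \<bar>T\<bar>+1 \<Longrightarrow> 0 \<le> b \<Longrightarrow> b \<le> \<bar>T\<bar>+1 \<Longrightarrow> \<bar>a - b\<bar> < d \<Longrightarrow> N (G a f - G b f) < e"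
      using sg_uniformly_continuous[OF G f e] by blast
    have "dist (g s') (g s) < e" if "s' \<in> {-1..T+1}" "dist s' s < d" for s'
    proof -
      have V: "G (max 0 s') f \<in> V" "G (max 0 s) f \<in> V" using sgV[OF G _ f] by auto
      have "\<bar>g s' - g s\<bar> \<le> N (G (max 0 s') f - G (max 0 s) f)"
        unfolding g_def using unit_functionalD(3)[OF \<phi> V] unit_functionalD(5)[OF \<phi> V_closed(3)[OF V] V(1)] by simp
      also have "\<dots> < e" using that s by (intro d(2)) (auto simp: dist_real_def max_def)
      finally show ?thesis by (simp add: dist_real_def)
    qed
    then show "\<exists>d>0. \<forall>x'\<in>{-1..T+1}. dist x' s < d \<longrightarrow> dist (g x') (g s) < e" using d(1) by blast
  qed
  note * = integral_has_real_derivative[OF this]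
  show thesis
  proof (rule that[of "\<lambda>x. integral {-1..x} g"])
    fix s :: real assume s: "0 \<le> s" "s \<le> T"
    have "s \<in> interior {-1..T+1}" using s by (auto simp: interior_atLeastAtMost_real)
    then have "at s within {-1..T+1} = at s" by (rule at_within_interior)
    then show "((\<lambda>x. integral {-1..x} g) has_real_derivative \<phi> (G s f)) (at s)"
      using *[of s] s by (simp add: g_def max_absorb2)
  qed
qed

text \<open>J is the integral of the orbit over [0, h], characterised weakly by antiderivatives of
  its scalar images. It is a limit of Riemann sums; a sublinear condition satisfied along the orbit
  passes to the sums and then to J, which is how positivity is kept.\<close>

lemma orbit_integral:
  assumes G: "semigroup G" and f: "f \<in> V" and h: "h > 0"
  obtains J where "J \<in> V"
    "\<And>\<phi> F. unit_functional \<phi> \<Longrightarrow> (\<And>s. 0 \<le> s \<Longrightarrow> s \<le> h \<Longrightarrow> (F has_real_derivative \<phi> (G s f)) (at s)) \<Longrightarrow>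
       \<phi> J = F h - F 0"
    "\<And>q. sublin q \<Longrightarrow> (\<And>s. 0 \<le> s \<Longrightarrow> s \<le> h \<Longrightarrow> q (G s f) \<le> 0) \<Longrightarrow> q J \<le> 0"
proof -
  define S where "S n = (h / real (Suc n)) *\<^sub>R (\<Sum>k<Suc n. G (real k * (h / real (Suc n))) f)" for n
  have kb: "0 \<le> real k * (h / real (Suc n))" for k n using h by simp
  have kh: "real k * (h / real (Suc n)) \<le> h" if "k < Suc n" for k n
  proof -
    have "real k * (h / real (Suc n)) \<le> real (Suc n) * (h / real (Suc n))"
      using that h by (intro mult_right_mono) simp_all
    also have "\<dots> = h" by simp
    finally show ?thesis .
  qed
  have GV: "G (real k * (h / real (Suc n))) f \<in> V" for k n using sgV[OF G kb f] .
  have SV: "S n \<in> V" for n unfolding S_def by (intro V_closed V_sum GV)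
  have \<phi>S: "\<phi> (S n) = h / real (Suc n) * (\<Sum>k<Suc n. \<phi> (G (real k * (h / real (Suc n))) f))"
    if "unit_functional \<phi>" for \<phi> n
  proof -
    let ?X = "\<Sum>k<Suc n. G (real k * (h / real (Suc n))) f"
    have "?X \<in> V" by (intro V_sum GV)
    then have "\<phi> (S n) = h / real (Suc n) * \<phi> ?X" unfolding S_def by (intro unit_functionalD(4)[OF that])
    also have "\<phi> ?X = (\<Sum>k<Suc n. \<phi> (G (real k * (h / real (Suc n))) f))"
      by (rule unit_functional_sum[OF that _ GV]) simp
    finally show ?thesis .
  qed
  \<comment> \<open>The index M depends only on the modulus of continuity of the orbit, hence is the
    same for all unit functionals; taking a norming functional of \<open>S m - S n\<close> then
    shows that the sums are Cauchy in norm.\<close>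
  have approx: "\<exists>M. \<forall>n\<ge>M. \<forall>\<phi> F. unit_functional \<phi> \<longrightarrow>
     (\<forall>s. 0 \<le> s \<longrightarrow> s \<le> h \<longrightarrow> (F has_real_derivative \<phi> (G s f)) (at s)) \<longrightarrow> \<bar>\<phi> (S n) - (F h - F 0)\<bar> \<le> e"
    if e: "e > 0" for e
  proof -
    have "e / h > 0" using e h by simp
    then obtain d where d: "d > 0" "\<And>a b. 0 \<le> a \<Longrightarrow> a \<le> h \<Longrightarrow> 0 \<le> b \<Longrightarrow> b \<le> h \<Longrightarrow> \<bar>a - b\<bar> < d \<Longrightarrow> N (G a f - G b f) < e / h"
      using sg_uniformly_continuous[OF G f, of "e / h" h] by blast
    obtain M where M: "real M > h / d" using reals_Archimedean2 by blast
    have "\<bar>\<phi> (S n) - (F h - F 0)\<bar> \<le> e"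
      if n: "n \<ge> M" and \<phi>: "unit_functional \<phi>"
        and F: "\<And>s. 0 \<le> s \<Longrightarrow> s \<le> h \<Longrightarrow> (F has_real_derivative \<phi> (G s f)) (at s)" for n \<phi> F
    proof -
      have "h / d < real (Suc n)" using M n by linarith
      then have hd: "h / real (Suc n) < d" using d h by (simp add: field_simps)
      have "\<bar>h / real (Suc n) * (\<Sum>k<Suc n. \<phi> (G (real k * (h / real (Suc n))) f)) - (F h - F 0)\<bar> \<le> h * (e / h)"
      proof (rule left_Riemann_sum[OF _ h F])
        fix s t :: real assume st: "0 \<le> s" "s \<le> h" "0 \<le> t" "t \<le> h" "\<bar>s - t\<bar> \<le> h / real (Suc n)"
        have V: "G s f \<in> V" "G t f \<in> V" using sgV[OF G _ f] st by auto
        have "\<bar>\<phi> (G s f) - \<phi> (G t f)\<bar> \<le> N (G s f - G t f)"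
          using unit_functionalD(3)[OF \<phi> V] unit_functionalD(5)[OF \<phi> V_closed(3)[OF V] V(1)] by simp
        also have "\<dots> < e / h" using st hd by (intro d(2)) auto
        finally show "\<bar>\<phi> (G s f) - \<phi> (G t f)\<bar> \<le> e / h" by simp
      qed auto
      then show ?thesis unfolding \<phi>S[OF \<phi>] using h by simp
    qed
    then show ?thesis by blast
  qed
  obtain J where J: "J \<in> V" "(\<lambda>n. N (S n - J)) \<longlonglongrightarrow> 0"
  proof (rule Cauchy_limit[of S, OF SV])
    fix e :: real assume e: "e > 0"
    then have e3: "e / 3 > 0" by simp
    from approx[OF e3] obtain M where M: "\<forall>n\<ge>M. \<forall>\<phi> F. unit_functional \<phi> \<longrightarrow>
      (\<forall>s. 0 \<le> s \<longrightarrow> s \<le> h \<longrightarrow> (F has_real_derivative \<phi> (G s f)) (at s)) \<longrightarrow> \<bar>\<phi> (S n) - (F h - F 0)\<bar> \<le> e/3"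
      by blast
    have "N (S m - S n) < e" if "m \<ge> M" "n \<ge> M" for m n
    proof -
      obtain \<phi> where \<phi>: "unit_functional \<phi>" "\<phi> (S m - S n) = N (S m - S n)"
        using norming_functional[of "S m - S n"] SV by blast
      obtain F where F: "\<And>s. 0 \<le> s \<Longrightarrow> s \<le> h \<Longrightarrow> (F has_real_derivative \<phi> (G s f)) (at s)"
        using orbit_antiderivative[OF G \<phi>(1) f] by blast
      show ?thesis using M[rule_format, OF that(1) \<phi>(1) F] M[rule_format, OF that(2) \<phi>(1) F] \<phi>(2) unit_functionalD(3)[OF \<phi>(1) SV SV, of m n] e
        by linarith
    qed
    then show "\<exists>M. \<forall>m\<ge>M. \<forall>n\<ge>M. N (S m - S n) < e" by blast
  qed
  show thesis
  proof (rule that[OF J(1)])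
    fix \<phi> F assume \<phi>: "unit_functional \<phi>"
      and F: "\<And>s. 0 \<le> s \<Longrightarrow> s \<le> h \<Longrightarrow> (F has_real_derivative \<phi> (G s f)) (at s)"
    have "\<bar>\<phi> J - (F h - F 0)\<bar> \<le> e" if e: "e > 0" for e
    proof -
      obtain M1 where M1: "\<And>n. n \<ge> M1 \<Longrightarrow> \<bar>\<phi> (S n) - (F h - F 0)\<bar> \<le> e/2"
        using approx[of "e/2"] \<phi> F e by (metis half_gt_zero)
      obtain M2 where M2: "\<And>n. n \<ge> M2 \<Longrightarrow> \<bar>N (S n - J)\<bar> < e/2"
        using LIMSEQ_D[OF J(2), of "e/2"] e by auto
      define n where "n = max M1 M2"
      have "\<bar>\<phi> (S n) - \<phi> J\<bar> \<le> N (S n - J)"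
        using unit_functionalD(3)[OF \<phi> SV J(1)] unit_functionalD(5)[OF \<phi> V_closed(3)[OF SV J(1)] J(1)] by simp
      then show ?thesis using M1[of n] M2[of n] unfolding n_def by linarith
    qed
    then have "\<bar>\<phi> J - (F h - F 0)\<bar> \<le> 0" by (rule field_le_epsilon) simp
    then show "\<phi> J = F h - F 0" by simp
  next
    fix q assume q: "sublin q" and neg: "\<And>s. 0 \<le> s \<Longrightarrow> s \<le> h \<Longrightarrow> q (G s f) \<le> 0"
    have sum: "q (\<Sum>k\<in>A. x k) \<le> 0" if "finite A" "\<And>k. k \<in> A \<Longrightarrow> x k \<in> V \<and> q (x k) \<le> 0" for A and x :: "nat \<Rightarrow> 'v"
      using that
    proof (induction A rule: finite_induct)
      case empty then show ?case using sublinD(3)[OF q, of 0] by simp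
    next
      case (insert a A)
      then show ?case using sublinD(1)[OF q, of "x a" "sum x A"] V_sum[of A x] by fastforce
    qed
    have qS: "q (S n) \<le> 0" for n
    proof -
      have "q (S n) \<le> (h / real (Suc n)) * q (\<Sum>k<Suc n. G (real k * (h / real (Suc n))) f)"
        unfolding S_def using h by (intro sublinD(2)[OF q] V_sum GV) auto
      also have "\<dots> \<le> 0" 
      proof (intro mult_nonneg_nonpos sum conjI GV)
        fix k assume "k \<in> {..<Suc n}"
        then show "q (G (real k * (h / real (Suc n))) f) \<le> 0" by (intro neg kb kh) simp
      qed (use h in auto)
      finally show ?thesis .
    qed
    have "(\<lambda>n. N (S n - J)) \<longlonglongrightarrow> 0" by (rule J(2))
    moreover have "q J \<le> N (S n - J)" for n
      using sublin_diff(1)[OF q J(1) SV, of n] qS[of n] N_commute[OF J(1) SV, of n] by simp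
    ultimately show "q J \<le> 0" by (intro tendsto_lowerbound[where f="\<lambda>n. N (S n - J)" and F=sequentially]) auto
  qed
qed

text \<open>The approximant is the mean of the orbit over a short interval [0, h], on which the
  generator has the value (G h f - f) / h. Being a mean, it inherits the condition
  \<open>q g \<le> 0\<close> from the orbit of f.\<close>

lemma gen_dense:
  assumes G: "semigroup G" and f: "f \<in> V" and e: "e > 0"
    and q: "sublin q" "\<And>s. 0 \<le> s \<Longrightarrow> q (G s f) \<le> 0"
  obtains g y where "(g, y) \<in> gen G" "N (g - f) \<le> e" "q g \<le> 0"
proof -
  obtain d where d: "d > 0" "\<And>t. 0 \<le> t \<Longrightarrow> t < d \<Longrightarrow> N (G t f - f) < e" using sg_cont0[OF G f e] by blast
  define h where "h = d / 2"
  have h: "h > 0" "h < d" using d by (auto simp: h_def)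
  obtain J where J: "J \<in> V"
    and J\<phi>: "\<And>\<phi> F. unit_functional \<phi> \<Longrightarrow> (\<And>s. 0 \<le> s \<Longrightarrow> s \<le> h \<Longrightarrow> (F has_real_derivative \<phi> (G s f)) (at s)) \<Longrightarrow>
       \<phi> J = F h - F 0"
    and Jq: "\<And>q. sublin q \<Longrightarrow> (\<And>s. 0 \<le> s \<Longrightarrow> s \<le> h \<Longrightarrow> q (G s f) \<le> 0) \<Longrightarrow> q J \<le> 0"
    using orbit_integral[OF G f h(1)] by blast
  have GhV: "G h f \<in> V" using sgV[OF G _ f] h by simp
  have mean: "\<exists>z. a < z \<and> z < b \<and> F b - F a = (b - a) * \<phi> (G z f)"
    if "0 \<le> a" "a < b" "b \<le> T" "\<And>s. 0 \<le> s \<Longrightarrow> s \<le> T \<Longrightarrow> (F has_real_derivative \<phi> (G s f)) (at s)" for a b T F \<phi>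
    using that by (intro MVT2) auto
  have lip: "\<bar>\<phi> x - \<phi> y\<bar> \<le> N (x - y)" if "unit_functional \<phi>" "x \<in> V" "y \<in> V" for \<phi> x y
    using unit_functionalD(3)[OF that] unit_functionalD(5)[OF that(1) V_closed(3)[OF that(2,3)] that(2)] by simp
  have 1: "N (J - h *\<^sub>R f) \<le> h * e"
  proof -
    obtain \<phi> where \<phi>: "unit_functional \<phi>" "\<phi> (J - h *\<^sub>R f) = N (J - h *\<^sub>R f)"
      using norming_functional[of "J - h *\<^sub>R f"] J f by blast
    obtain F where F: "\<And>s. 0 \<le> s \<Longrightarrow> s \<le> h \<Longrightarrow> (F has_real_derivative \<phi> (G s f)) (at s)"
      using orbit_antiderivative[OF G \<phi>(1) f] by blast
    obtain z where z: "0 < z" "z < h" "F h - F 0 = (h - 0) * \<phi> (G z f)"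
      using mean[OF order_refl h(1) order_refl F] by blast
    have "N (J - h *\<^sub>R f) = h * (\<phi> (G z f) - \<phi> f)"
      using \<phi>(2) unit_functionalD(3)[OF \<phi>(1) J, of "h *\<^sub>R f"] unit_functionalD(4)[OF \<phi>(1) f f, of h] f
        J\<phi>[OF \<phi>(1) F] z(3) by (simp add: right_diff_distrib)
    also have "\<dots> \<le> h * e"
      using lip[OF \<phi>(1) sgV[OF G _ f] f, of z] d(2)[of z] z h by (intro mult_left_mono) auto
    finally show ?thesis .
  qed
  have 2: "(J, G h f - f) \<in> gen G"
  proof (rule genI[OF G J])
    show "G h f - f \<in> V" using GhV f by simp
    fix e :: real assume "e > 0"
    then obtain d' where d': "d' > 0" "\<And>a b. 0 \<le> a \<Longrightarrow> a \<le> h + 1 \<Longrightarrow> 0 \<le> b \<Longrightarrow> b \<le> h + 1 \<Longrightarrow> \<bar>a - b\<bar> < d' \<Longrightarrow> N (G a f - G b f) < e/2"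
      using sg_uniformly_continuous[OF G f, of "e/2" "h + 1"] by (metis half_gt_zero)
    have "N (G \<tau> J - J - \<tau> *\<^sub>R (G h f - f)) \<le> e * \<tau>" if \<tau>: "0 < \<tau>" "\<tau> < min 1 d'" for \<tau>
    proof -
      have opV: "G \<tau> J \<in> V" using sgV[OF G _ J] \<tau> by simp
      obtain \<phi> where \<phi>: "unit_functional \<phi>"
        "\<phi> (G \<tau> J - J - \<tau> *\<^sub>R (G h f - f)) = N (G \<tau> J - J - \<tau> *\<^sub>R (G h f - f))"
        using norming_functional[of "G \<tau> J - J - \<tau> *\<^sub>R (G h f - f)"] opV J GhV f by blast
      obtain F where F: "\<And>s. 0 \<le> s \<Longrightarrow> s \<le> h + 1 \<Longrightarrow> (F has_real_derivative \<phi> (G s f)) (at s)"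
        using orbit_antiderivative[OF G \<phi>(1) f] by blast
      have \<tau>0: "0 \<le> \<tau>" using \<tau> by simp
      note op = sg_op[OF G \<tau>0]
      obtain C where C: "C \<ge> 0" "\<And>x. x \<in> V \<Longrightarrow> N (G \<tau> x) \<le> C * N x" using bounded_op_bound[OF op] by blast
      \<comment> \<open>Testing J with \<phi> composed with \<open>G \<tau>\<close> moves
        \<open>G \<tau>\<close> under the integral; dividing by C + 1 makes the composition a unit
        functional again.\<close>
      define \<psi> where "\<psi> x = \<phi> (G \<tau> x) / (C + 1)" for x
      have \<psi>: "unit_functional \<psi>"
        unfolding unit_functional_def
      proof (intro conjI ballI allI)
        fix x y a b assume V: "x \<in> V" "y \<in> V"
        show "\<psi> (a *\<^sub>R x + b *\<^sub>R y) = a * \<psi> x + b * \<psi> y"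
          using unit_functional_eqv[OF \<phi>(1) bounded_op_lin[OF op V, of a b]]
            unit_functionalD(1)[OF \<phi>(1) bounded_opV[OF op V(1)] bounded_opV[OF op V(2)], of a b]
          by (simp add: \<psi>_def add_divide_distrib)
      next
        fix x assume V: "x \<in> V"
        have "\<bar>\<phi> (G \<tau> x)\<bar> \<le> C * N x"
          using unit_functionalD(5)[OF \<phi>(1) bounded_opV[OF op V] V] C(2)[OF V] by linarith
        also have "\<dots> \<le> (C + 1) * N x" using N_nonneg[OF V] by (simp add: algebra_simps)
        finally show "\<bar>\<psi> x\<bar> \<le> N x" using C(1) by (simp add: \<psi>_def divide_le_eq mult.commute)
      qed
      have "\<psi> J = F (\<tau> + h) / (C + 1) - F (\<tau> + 0) / (C + 1)"
      proof (rule J\<phi>[OF \<psi>])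
        fix s assume s: "0 \<le> s" "s \<le> h"
        have "((\<lambda>x. F (\<tau> + x)) has_real_derivative \<phi> (G (\<tau> + s) f)) (at s)"
          using F[of "\<tau> + s"] s \<tau> DERIV_shift[of F _ s \<tau>] by (simp add: add.commute)
        moreover have "\<phi> (G (\<tau> + s) f) = \<phi> (G \<tau> (G s f))"
          using unit_functional_eqv[OF \<phi>(1) sg_plus[OF G \<tau>0 s(1) f]] .
        ultimately show "((\<lambda>x. F (\<tau> + x) / (C + 1)) has_real_derivative \<psi> (G s f)) (at s)"
          unfolding \<psi>_def by (simp add: DERIV_cdivide)
      qed
      then have gJ: "\<phi> (G \<tau> J) = F (\<tau> + h) - F \<tau>" using C(1) by (simp add: \<psi>_def diff_divide_distrib[symmetric])
      have pJ: "\<phi> J = F h - F 0" by (rule J\<phi>[OF \<phi>(1) F]) auto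
      \<comment> \<open>The scalar image of \<open>G \<tau> J - J\<close> is the integral over
        [h, \<tau> + h] minus the one over [0, \<tau>], so the two mean values are taken near G h f
        and near f.\<close>
      obtain z1 where z1: "h < z1" "z1 < \<tau> + h" "F (\<tau> + h) - F h = (\<tau> + h - h) * \<phi> (G z1 f)"
        using mean[of h "\<tau> + h" "h + 1" F \<phi>] F h \<tau> by auto
      obtain z2 where z2: "0 < z2" "z2 < \<tau>" "F \<tau> - F 0 = (\<tau> - 0) * \<phi> (G z2 f)"
        using mean[of 0 "\<tau>" "h + 1" F \<phi>] F h \<tau> by auto
      have zV: "G z1 f \<in> V" "G z2 f \<in> V" using sgV[OF G _ f] z1 z2 h by auto
      have "\<phi> (G \<tau> J - J - \<tau> *\<^sub>R (G h f - f)) = \<phi> (G \<tau> J) - \<phi> J - \<tau> * (\<phi> (G h f) - \<phi> f)"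
        using unit_functionalD(3)[OF \<phi>(1)] unit_functionalD(4)[OF \<phi>(1)] opV J GhV f by (metis V_closed(3,5))
      also have "\<dots> = \<tau> * ((\<phi> (G z1 f) - \<phi> (G h f)) - (\<phi> (G z2 f) - \<phi> f))"
        using gJ pJ z1(3) z2(3) by (simp add: algebra_simps)
      also have "\<dots> \<le> \<tau> * e"
      proof (intro mult_left_mono)
        have "N (G z1 f - G h f) < e/2" using z1 h \<tau> by (intro d'(2)) auto
        moreover have "N (G z2 f - G 0 f) < e/2" using z2 h \<tau> by (intro d'(2)) auto
        moreover have "N (G z2 f - f) = N (G z2 f - G 0 f)"
          using eqv_N[OF eqv_diff[OF eqv_refl[OF zV(2)] sg_zero[OF G f]]] by simp
        ultimately show "\<phi> (G z1 f) - \<phi> (G h f) - (\<phi> (G z2 f) - \<phi> f) \<le> e"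
          using lip[OF \<phi>(1) zV(1) GhV] lip[OF \<phi>(1) zV(2) f] by linarith
      qed (use \<tau> in auto)
      finally show ?thesis using \<phi>(2) by (simp add: mult.commute)
    qed
    then show "\<exists>d>0. \<forall>\<tau>. 0 < \<tau> \<longrightarrow> \<tau> < d \<longrightarrow> N (G \<tau> J - J - \<tau> *\<^sub>R (G h f - f)) \<le> e * \<tau>"
      using d'(1) by (intro exI[of _ "min 1 d'"]) auto
  qed
  define g where "g = (1/h) *\<^sub>R J"
  have gf: "N (g - f) \<le> e"
  proof -
    have "g - f = (1/h) *\<^sub>R (J - h *\<^sub>R f)" using h by (simp add: g_def scaleR_diff_right)
    then have "N (g - f) = (1/h) * N (J - h *\<^sub>R f)" using N_scale[of "J - h *\<^sub>R f" "1/h"] J f h by simp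
    then have "h * N (g - f) \<le> h * e" using 1 h by simp
    then show ?thesis using h by simp
  qed
  have gq: "q g \<le> 0"
  proof -
    have "q g \<le> (1/h) * q J" unfolding g_def using h by (intro sublinD(2)[OF q(1) J]) auto
    also have "\<dots> \<le> 0" using h Jq[OF q(1)] q(2) by (intro mult_nonneg_nonpos) auto
    finally show ?thesis .
  qed
  have "(g, (1/h) *\<^sub>R (G h f - f)) \<in> gen G"
  proof (rule genI[OF G])
    show "g \<in> V" "(1/h) *\<^sub>R (G h f - f) \<in> V" using J GhV f by (auto simp: g_def)
    fix e :: real assume "e > 0"
    then obtain d' where d': "d' > 0" "\<And>\<tau>. 0 < \<tau> \<Longrightarrow> \<tau> < d' \<Longrightarrow> N (G \<tau> J - J - \<tau> *\<^sub>R (G h f - f)) \<le> (e * h) * \<tau>"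
      using gen_eps[OF G 2, of "e * h"] h by (metis mult_pos_pos)
    have "N (G \<tau> g - g - \<tau> *\<^sub>R ((1/h) *\<^sub>R (G h f - f))) \<le> e * \<tau>" if \<tau>: "0 < \<tau>" "\<tau> < d'" for \<tau>
    proof -
      have GJ: "G \<tau> J \<in> V" using sgV[OF G _ J] \<tau> by simp
      have "G \<tau> g - g - \<tau> *\<^sub>R ((1/h) *\<^sub>R (G h f - f)) \<doteq> (1/h) *\<^sub>R G \<tau> J - g - \<tau> *\<^sub>R ((1/h) *\<^sub>R (G h f - f))"
        unfolding g_def using J GhV f \<tau> by (intro eqv_diff bounded_op_scale[OF sg_op[OF G]] eqv_refl) auto
      also have "(1/h) *\<^sub>R G \<tau> J - g - \<tau> *\<^sub>R ((1/h) *\<^sub>R (G h f - f)) = (1/h) *\<^sub>R (G \<tau> J - J - \<tau> *\<^sub>R (G h f - f))"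
        by (simp add: g_def algebra_simps)
      finally have "N (G \<tau> g - g - \<tau> *\<^sub>R ((1/h) *\<^sub>R (G h f - f))) = (1/h) * N (G \<tau> J - J - \<tau> *\<^sub>R (G h f - f))"
        using eqv_N N_scale[of "G \<tau> J - J - \<tau> *\<^sub>R (G h f - f)" "1/h"] GJ J GhV f h by simp
      also have "\<dots> \<le> (1/h) * ((e * h) * \<tau>)" using d'(2)[OF \<tau>] h by (intro mult_left_mono) auto
      also have "\<dots> = e * \<tau>" using h by simp
      finally show ?thesis .
    qed
    then show "\<exists>d>0. \<forall>\<tau>. 0 < \<tau> \<longrightarrow> \<tau> < d \<longrightarrow> N (G \<tau> g - g - \<tau> *\<^sub>R ((1/h) *\<^sub>R (G h f - f))) \<le> e * \<tau>"
      using d'(1) by blast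
  qed
  then show thesis using gf gq by (rule that)
qed

text \<open>All the maps involved are Lipschitz, so the comparison extends from the domain of the
  generator to V. The functional p singles out a cone invariant under \<open>G1\<close>; since f is
  approximated within this cone, \<open>H\<close> is required only for elements of the domain that
  belong to it.\<close>

lemma semigroup_comparison_dense:
  assumes G1: "semigroup G1" and G2: "semigroup G2" and P: "bounded_op P" and q: "sublin q"
    and p: "sublin p" "\<And>x t. x \<in> V \<Longrightarrow> p x \<le> 0 \<Longrightarrow> t \<ge> 0 \<Longrightarrow> p (G1 t x) \<le> 0"
    and H: "\<And>u v. (u, v) \<in> gen G1 \<Longrightarrow> p u \<le> 0 \<Longrightarrow>
      \<exists>v'. (P u, v') \<in> gen G2 \<and> (\<forall>s\<ge>0. q (G2 s (P v - v')) \<le> 0)"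
    and f: "f \<in> V" "p f \<le> 0" and t: "t \<ge> 0"
  shows "q (P (G1 t f) - G2 t (P f)) \<le> 0"
proof -
  note op1 = bounded_op_comp[OF P sg_op[OF G1 t]] and op2 = bounded_op_comp[OF sg_op[OF G2 t] P]
  obtain A where A: "A \<ge> 0" "\<And>x. x \<in> V \<Longrightarrow> N (P (G1 t x)) \<le> A * N x" using bounded_op_bound[OF op1] by blast
  obtain B where B: "B \<ge> 0" "\<And>x. x \<in> V \<Longrightarrow> N (G2 t (P x)) \<le> B * N x" using bounded_op_bound[OF op2] by blast
  have "q (P (G1 t f) - G2 t (P f)) \<le> 0 + e" if e: "e > 0" for e
  proof -
    have e': "e / (A + B + 1) > 0" using e A(1) B(1) by simp
    obtain g y where g: "(g, y) \<in> gen G1" "N (g - f) \<le> e / (A + B + 1)" "p g \<le> 0"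
      using gen_dense[OF G1 f(1) e' p(1)] p(2)[OF f] by blast
    have gV: "g \<in> V" using g gen_V by auto
    have "q (P (G1 t g) - G2 t (P g)) \<le> 0"
    proof (rule semigroup_comparison[OF G1 G2 P q g(1) _ t])
      fix \<tau> :: real assume "\<tau> \<ge> 0"
      then show "\<exists>v'. (P (G1 \<tau> g), v') \<in> gen G2 \<and> (\<forall>s\<ge>0. q (G2 s (P (G1 \<tau> y) - v')) \<le> 0)"
        using H[OF gen_orbit[OF G1 g(1)]] p(2)[OF gV g(3)] by blast
    qed
    moreover have V: "P (G1 t f) \<in> V" "P (G1 t g) \<in> V" "G2 t (P f) \<in> V" "G2 t (P g) \<in> V"
      using bounded_opV[OF op1] bounded_opV[OF op2] f gV by auto
    ultimately have "q (P (G1 t f) - G2 t (P f)) \<le> N ((P (G1 t f) - G2 t (P f)) - (P (G1 t g) - G2 t (P g)))"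
      using sublin_diff(1)[OF q, of "P (G1 t f) - G2 t (P f)" "P (G1 t g) - G2 t (P g)"] by auto
    also have "(P (G1 t f) - G2 t (P f)) - (P (G1 t g) - G2 t (P g)) = (P (G1 t f) - P (G1 t g)) - (G2 t (P f) - G2 t (P g))"
      by simp
    also have "N \<dots> \<le> N (P (G1 t f) - P (G1 t g)) + N (G2 t (P f) - G2 t (P g))" using V by (intro N_diff) auto
    also have "\<dots> \<le> A * N (f - g) + B * N (f - g)"
      by (intro add_mono bounded_op_Lipschitz[OF op1 f(1) gV A(2)] bounded_op_Lipschitz[OF op2 f(1) gV B(2)])
    also have "\<dots> \<le> (A + B + 1) * N (g - f)"
      using N_commute[OF f(1) gV] N_nonneg[of "g - f"] f gV by (simp add: algebra_simps)
    also have "\<dots> \<le> (A + B + 1) * (e / (A + B + 1))" using g(2) A(1) B(1) by (intro mult_left_mono) auto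
    also have "\<dots> = e" using A(1) B(1) by simp
    finally show ?thesis by simp
  qed
  then show ?thesis by (rule field_le_epsilon)
qed

section \<open>Closedness of the generator and its graph norm\<close>

lemma gen_lin:
  assumes G: "semigroup G" and g: "(x, y) \<in> gen G" "(x', y') \<in> gen G"
  shows "(a *\<^sub>R x + b *\<^sub>R x', a *\<^sub>R y + b *\<^sub>R y') \<in> gen G"
proof (rule genI[OF G])
  have V: "x \<in> V" "y \<in> V" "x' \<in> V" "y' \<in> V" using g gen_V by auto
  then show "a *\<^sub>R x + b *\<^sub>R x' \<in> V" "a *\<^sub>R y + b *\<^sub>R y' \<in> V" by auto
  fix e :: real assume e: "e > 0"
  define e1 where "e1 = e / (\<bar>a\<bar> + \<bar>b\<bar> + 1)"
  have e1: "e1 > 0" using e by (simp add: e1_def add_nonneg_pos)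
  obtain d where d: "d > 0" "\<And>h. 0 < h \<Longrightarrow> h < d \<Longrightarrow> N (G h x - x - h *\<^sub>R y) \<le> e1 * h"
    using gen_eps[OF G g(1) e1] by blast
  obtain d' where d': "d' > 0" "\<And>h. 0 < h \<Longrightarrow> h < d' \<Longrightarrow> N (G h x' - x' - h *\<^sub>R y') \<le> e1 * h"
    using gen_eps[OF G g(2) e1] by blast
  have "N (G h (a *\<^sub>R x + b *\<^sub>R x') - (a *\<^sub>R x + b *\<^sub>R x') - h *\<^sub>R (a *\<^sub>R y + b *\<^sub>R y')) \<le> e * h"
    if h: "0 < h" "h < min d d'" for h
  proof -
    have GV: "G h x \<in> V" "G h x' \<in> V" using sgV[OF G] V h by auto
    let ?X = "G h x - x - h *\<^sub>R y" and ?Y = "G h x' - x' - h *\<^sub>R y'"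
    have "G h (a *\<^sub>R x + b *\<^sub>R x') - (a *\<^sub>R x + b *\<^sub>R x') - h *\<^sub>R (a *\<^sub>R y + b *\<^sub>R y')
      \<doteq> (a *\<^sub>R G h x + b *\<^sub>R G h x') - (a *\<^sub>R x + b *\<^sub>R x') - h *\<^sub>R (a *\<^sub>R y + b *\<^sub>R y')"
      using V h by (intro eqv_diff bounded_op_lin[OF sg_op[OF G]] eqv_refl) auto
    also have "(a *\<^sub>R G h x + b *\<^sub>R G h x') - (a *\<^sub>R x + b *\<^sub>R x') - h *\<^sub>R (a *\<^sub>R y + b *\<^sub>R y') = a *\<^sub>R ?X + b *\<^sub>R ?Y"
      by (simp add: algebra_simps)
    finally have "N (G h (a *\<^sub>R x + b *\<^sub>R x') - (a *\<^sub>R x + b *\<^sub>R x') - h *\<^sub>R (a *\<^sub>R y + b *\<^sub>R y')) = N (a *\<^sub>R ?X + b *\<^sub>R ?Y)"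
      by (rule eqv_N)
    also have "\<dots> \<le> N (a *\<^sub>R ?X) + N (b *\<^sub>R ?Y)" using V GV by (intro N_add V_closed) auto
    also have "\<dots> = \<bar>a\<bar> * N ?X + \<bar>b\<bar> * N ?Y"
      using N_scale[of ?X a] N_scale[of ?Y b] V GV by auto
    also have "\<dots> \<le> \<bar>a\<bar> * (e1 * h) + \<bar>b\<bar> * (e1 * h)"
      using d(2)[of h] d'(2)[of h] h by (intro add_mono mult_left_mono) auto
    also have "\<dots> \<le> (\<bar>a\<bar> + \<bar>b\<bar> + 1) * (e1 * h)" using e1 h by (simp add: algebra_simps)
    also have "\<dots> = e * h"
    proof -
      have "\<bar>a\<bar> + \<bar>b\<bar> + 1 \<noteq> 0" by linarith
      then show ?thesis unfolding e1_def by simp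
    qed
    finally show ?thesis .
  qed
  then show "\<exists>d>0. \<forall>h. 0 < h \<longrightarrow> h < d \<longrightarrow>
      N (G h (a *\<^sub>R x + b *\<^sub>R x') - (a *\<^sub>R x + b *\<^sub>R x') - h *\<^sub>R (a *\<^sub>R y + b *\<^sub>R y')) \<le> e * h"
    using d(1) d'(1) by (intro exI[of _ "min d d'"]) auto
qed

text \<open>Formally the increment is the integral of \<open>G s v - w\<close> over [0, h]. The mean
  value inequality, applied to the norm minus \<open>s * e\<close>, gives the bound without an
  integral.\<close>

lemma gen_increment_bound:
  assumes G: "semigroup G" and g: "(u, v) \<in> gen G" and w: "w \<in> V" and h: "h > 0"
    and e: "\<And>s. 0 \<le> s \<Longrightarrow> s \<le> h \<Longrightarrow> N (G s v - w) \<le> e"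
  shows "N (G h u - u - h *\<^sub>R w) \<le> h * e"
proof -
  have V: "u \<in> V" "v \<in> V" using g gen_V by auto
  have GV: "\<And>s. s \<ge> 0 \<Longrightarrow> G s u \<in> V" "\<And>s. s \<ge> 0 \<Longrightarrow> G s v \<in> V" using sgV[OF G] V by auto
  define m where "m s = N (G s u - u - s *\<^sub>R w) - s * e" for s
  have "m h \<le> m 0"
  proof (rule right_derivative_nonpos)
    show "0 \<le> h" using h by simp
    show "continuous_on {0..h} m"
      unfolding m_def
    proof (intro continuous_intros)
      show "continuous_on {0..h} (\<lambda>s. N (G s u - u - s *\<^sub>R w))"
        unfolding continuous_on_iff
      proof (intro ballI allI impI)
        fix s e :: real assume s: "s \<in> {0..h}" and e: "e > 0"
        obtain d where d: "d > 0" "\<And>a b. 0 \<le> a \<Longrightarrow> a \<le> h \<Longrightarrow> 0 \<le> b \<Longrightarrow> b \<le> h \<Longrightarrow> \<bar>a - b\<bar> < d \<Longrightarrow> N (G a u - G b u) < e/2"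
          using sg_uniformly_continuous[OF G V(1) half_gt_zero[OF e]] by blast
        define d' where "d' = min d (e / (2 * (N w + 1)))"
        have d': "d' > 0" using d(1) e N_nonneg[OF w] by (auto simp: d'_def)
        have "dist (N (G s' u - u - s' *\<^sub>R w)) (N (G s u - u - s *\<^sub>R w)) < e"
          if s': "s' \<in> {0..h}" "dist s' s < d'" for s'
        proof -
          have "\<bar>N (G s' u - u - s' *\<^sub>R w) - N (G s u - u - s *\<^sub>R w)\<bar>
              \<le> N ((G s' u - u - s' *\<^sub>R w) - (G s u - u - s *\<^sub>R w))"
            using GV s s' V w by (intro N_abs_diff V_closed) auto
          also have "(G s' u - u - s' *\<^sub>R w) - (G s u - u - s *\<^sub>R w) = (G s' u - G s u) - (s' - s) *\<^sub>R w"
            by (simp add: algebra_simps)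
          also have "N \<dots> \<le> N (G s' u - G s u) + N ((s' - s) *\<^sub>R w)"
            using GV s s' V w by (intro N_diff V_closed) auto
          also have "N ((s' - s) *\<^sub>R w) = \<bar>s' - s\<bar> * N w" by (rule N_scale[OF w])
          also have "\<dots> \<le> (e / (2 * (N w + 1))) * (N w + 1)"
            using s'(2) N_nonneg[OF w] e by (intro mult_mono) (auto simp: d'_def dist_real_def)
          also have "\<dots> = e/2" using N_nonneg[OF w] by (simp add: field_simps)
          also have "N (G s' u - G s u) < e/2" using d(2)[of s' s] s s' by (auto simp: d'_def dist_real_def)
          finally show ?thesis by (simp add: dist_real_def)
        qed
        then show "\<exists>d>0. \<forall>x'\<in>{0..h}. dist x' s < d \<longrightarrow> dist (N (G x' u - u - x' *\<^sub>R w)) (N (G s u - u - s *\<^sub>R w)) < e"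
          using d' by blast
      qed
    qed
    fix \<tau> e1 :: real assume \<tau>: "0 \<le> \<tau>" "\<tau> < h" and e1: "e1 > 0"
    obtain d where d: "d > 0" "\<And>k. 0 < k \<Longrightarrow> k < d \<Longrightarrow> N (G k (G \<tau> u) - G \<tau> u - k *\<^sub>R G \<tau> v) \<le> e1 * k"
      using gen_eps[OF G gen_orbit[OF G g \<tau>(1)] e1] by blast
    have "m (\<tau> + k) \<le> m \<tau> + e1 * k" if k: "0 < k" "k < d" "\<tau> + k \<le> h" for k
    proof -
      have kV: "G (\<tau> + k) u \<in> V" "G \<tau> u \<in> V" "G \<tau> v \<in> V" "G k (G \<tau> u) \<in> V"
        using GV sgV[OF G, of k "G \<tau> u"] \<tau> k by auto
      have "G (\<tau> + k) u - u - (\<tau> + k) *\<^sub>R w =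
          (G \<tau> u - u - \<tau> *\<^sub>R w) + ((G (\<tau> + k) u - G \<tau> u - k *\<^sub>R G \<tau> v) + k *\<^sub>R (G \<tau> v - w))"
        by (simp add: algebra_simps)
      then have "N (G (\<tau> + k) u - u - (\<tau> + k) *\<^sub>R w) \<le> N (G \<tau> u - u - \<tau> *\<^sub>R w) +
          N ((G (\<tau> + k) u - G \<tau> u - k *\<^sub>R G \<tau> v) + k *\<^sub>R (G \<tau> v - w))"
        using N_add kV V w by (metis V_closed(2,3,5))
      also have "N ((G (\<tau> + k) u - G \<tau> u - k *\<^sub>R G \<tau> v) + k *\<^sub>R (G \<tau> v - w)) \<le>
          N (G (\<tau> + k) u - G \<tau> u - k *\<^sub>R G \<tau> v) + N (k *\<^sub>R (G \<tau> v - w))"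
        using kV V w by (intro N_add V_closed)
      also have "N (G (\<tau> + k) u - G \<tau> u - k *\<^sub>R G \<tau> v) = N (G k (G \<tau> u) - G \<tau> u - k *\<^sub>R G \<tau> v)"
      proof (rule eqv_N, intro eqv_diff eqv_refl)
        show "G (\<tau> + k) u \<doteq> G k (G \<tau> u)" using sg_plus[OF G, of k \<tau> u] V \<tau> k by (simp add: add.commute)
      qed (use kV in auto)
      also have "\<dots> \<le> e1 * k" using d(2) k by auto
      also have "N (k *\<^sub>R (G \<tau> v - w)) = k * N (G \<tau> v - w)" using N_scale[of "G \<tau> v - w" k] kV w k by auto
      also have "\<dots> \<le> k * e" using e[of \<tau>] \<tau> k by (intro mult_left_mono) auto
      finally show ?thesis unfolding m_def by (simp add: algebra_simps)
    qed
    then show "\<exists>d>0. \<forall>k. 0 < k \<longrightarrow> k < d \<longrightarrow> \<tau> + k \<le> h \<longrightarrow> m (\<tau> + k) \<le> m \<tau> + e1 * k"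
      using d(1) by blast
  qed
  moreover have "m 0 = 0" using eqvD(3)[OF sg_zero[OF G V(1)]] by (simp add: m_def)
  ultimately show ?thesis by (simp add: m_def)
qed

text \<open>The increment bound for the approximating pairs involves only the errors N (u - x n) and
  N (v - y n), with a constant independent of n, so the limit can be taken for each fixed h.\<close>

lemma gen_closed:
  assumes G: "semigroup G" and V: "u \<in> V" "v \<in> V"
    and seq: "\<And>n. (x n, y n) \<in> gen G" "(\<lambda>n::nat. N (u - x n)) \<longlonglongrightarrow> 0" "(\<lambda>n. N (v - y n)) \<longlonglongrightarrow> 0"
  shows "(u, v) \<in> gen G"
proof (rule genI[OF G V])
  fix e :: real assume e: "e > 0"
  obtain d where d: "d > 0" "\<And>t. 0 \<le> t \<Longrightarrow> t < d \<Longrightarrow> N (G t v - v) < e" using sg_cont0[OF G V(2) e] by blast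
  have xyV: "x n \<in> V" "y n \<in> V" for n by (rule gen_V[OF seq(1)])+
  have "N (G h u - u - h *\<^sub>R v) \<le> e * h" if h: "0 < h" "h < d" for h
  proof -
    obtain C where C: "C \<ge> 1" "\<And>t x. 0 \<le> t \<Longrightarrow> t \<le> h \<Longrightarrow> x \<in> V \<Longrightarrow> N (G t x) \<le> C * N x"
      using sg_locally_bounded[OF G, of h] by blast
    have h0: "0 \<le> h" using h by simp
    note op = sg_op[OF G h0]
    have GV: "G h u \<in> V" "\<And>n. G h (x n) \<in> V" using sgV[OF G h0] V xyV by auto
    have n: "N (G h u - u - h *\<^sub>R v) \<le> h * (C * N (v - y n) + e) + (C * N (u - x n) + N (u - x n))" for n
    proof -
      have "N (G h (x n) - x n - h *\<^sub>R v) \<le> h * (C * N (v - y n) + e)"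
      proof (rule gen_increment_bound[OF G seq(1) V(2) h(1)])
        fix s assume s: "0 \<le> s" "s \<le> h"
        have "N (G s (y n) - v) \<le> N (G s (y n) - G s v) + N (G s v - v)"
          using sgV[OF G s(1)] V xyV by (intro N_triangle) auto
        also have "N (G s (y n) - G s v) \<le> C * N (y n - v)"
          using C(2)[OF s] by (intro bounded_op_Lipschitz[OF sg_op[OF G s(1)] xyV(2) V(2)])
        also have "N (G s v - v) \<le> e" using d(2)[of s] s h by simp
        finally show "N (G s (y n) - v) \<le> C * N (v - y n) + e" using N_commute[OF V(2) xyV(2)] by simp
      qed
      moreover have "N (G h u - u - h *\<^sub>R v) \<le> N (G h (x n) - x n - h *\<^sub>R v) + N ((G h u - G h (x n)) - (u - x n))"
        using N_add[of "G h (x n) - x n - h *\<^sub>R v" "(G h u - G h (x n)) - (u - x n)"] GV(1) GV(2)[of n] V xyV[of n]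
        by (auto simp: algebra_simps)
      moreover have "N ((G h u - G h (x n)) - (u - x n)) \<le> N (G h u - G h (x n)) + N (u - x n)"
        using GV V xyV by (intro N_diff V_closed)
      moreover have "N (G h u - G h (x n)) \<le> C * N (u - x n)"
        using C(2)[OF h0 order_refl] by (intro bounded_op_Lipschitz[OF op V(1) xyV(1)])
      ultimately show ?thesis by linarith
    qed
    have "(\<lambda>n. h * (C * N (v - y n) + e) + (C * N (u - x n) + N (u - x n))) \<longlonglongrightarrow> h * (C * 0 + e) + (C * 0 + 0)"
      by (intro tendsto_intros seq)
    then show ?thesis using tendsto_lowerbound[where F=sequentially] n by (fastforce simp: mult.commute)
  qed
  then show "\<exists>d>0. \<forall>h. 0 < h \<longrightarrow> h < d \<longrightarrow> N (G h u - u - h *\<^sub>R v) \<le> e * h" using d(1) by blast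
qed

lemma gen_subspace: "semigroup G \<Longrightarrow> subspace (gen G)"
proof (rule subspaceI)
  assume G: "semigroup G"
  have "(0, 0) \<in> gen G"
  proof (rule genI[OF G])
    fix e :: real assume "e > 0"
    have "N (G h 0) = 0" if "h > 0" for h
      using eqv_N[OF bounded_op_scale[OF sg_op[OF G], of h 0 0]] that by simp
    then show "\<exists>d>0. \<forall>h. 0 < h \<longrightarrow> h < d \<longrightarrow> N (G h 0 - 0 - h *\<^sub>R 0) \<le> e * h"
      using \<open>e > 0\<close> by (intro exI[of _ 1]) auto
  qed auto
  then show "0 \<in> gen G" by (simp add: zero_prod_def)
  fix p q assume "p \<in> gen G" "q \<in> gen G"
  then show "p + q \<in> gen G" using gen_lin[OF G, of "fst p" "snd p" "fst q" "snd q" 1 1]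
    by (cases p, cases q) simp
  then show "c *\<^sub>R p \<in> gen G" for c
    using gen_lin[OF G, of "fst p" "snd p" "fst p" "snd p" c 0] \<open>p \<in> gen G\<close> by (cases p) simp
qed

lemma gen_graph_norm_complete:
  assumes G: "semigroup G"
  shows "seminormed_complete (gen G) (\<lambda>p. N (fst p) + N (snd p))"
proof
  show "subspace (gen G)" by (rule gen_subspace[OF G])
next
  fix p q assume pq: "p \<in> gen G" "q \<in> gen G"
  have V: "fst p \<in> V" "snd p \<in> V" "fst q \<in> V" "snd q \<in> V" using pq gen_V by (cases p; cases q; auto)+
  show "N (fst (p + q)) + N (snd (p + q)) \<le> N (fst p) + N (snd p) + (N (fst q) + N (snd q))"
    using N_add[OF V(1,3)] N_add[OF V(2,4)] by simp
next
  fix p and c :: real assume p: "p \<in> gen G"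
  have V: "fst p \<in> V" "snd p \<in> V" using p gen_V by (cases p; auto)+
  show "N (fst (c *\<^sub>R p)) + N (snd (c *\<^sub>R p)) = \<bar>c\<bar> * (N (fst p) + N (snd p))"
    using N_scale[OF V(1)] N_scale[OF V(2)] by (simp add: algebra_simps)
next
  fix x :: "nat \<Rightarrow> 'v \<times> 'v"
  assume x: "\<And>n. x n \<in> gen G" and sum: "summable (\<lambda>n. N (fst (x n)) + N (snd (x n)))"
  have xV: "fst (x n) \<in> V" "snd (x n) \<in> V" for n using x[of n] gen_V by (cases "x n"; auto)+
  have "summable (\<lambda>n. N (fst (x n)))" "summable (\<lambda>n. N (snd (x n)))"
    by (rule summable_comparison_test'[OF sum, of 0]; use xV N_nonneg in simp)+
  then obtain u v where uv: "u \<in> V" "v \<in> V" "(\<lambda>n. N (u - (\<Sum>k<n. fst (x k)))) \<longlonglongrightarrow> 0"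
    "(\<lambda>n. N (v - (\<Sum>k<n. snd (x k)))) \<longlonglongrightarrow> 0"
    using complete xV by metis
  have S: "(\<Sum>k<n. fst (x k), \<Sum>k<n. snd (x k)) = (\<Sum>k<n. x k)" for n
    by (simp add: prod_eq_iff fst_sum snd_sum)
  have "((\<Sum>k<n. fst (x k)), (\<Sum>k<n. snd (x k))) \<in> gen G" for n
    unfolding S by (rule subspace_sum[OF gen_subspace[OF G]]) (rule x)
  then have "(u, v) \<in> gen G" by (rule gen_closed[OF G uv(1,2) _ uv(3,4)])
  moreover have "(\<lambda>n. N (fst ((u, v) - (\<Sum>k<n. x k))) + N (snd ((u, v) - (\<Sum>k<n. x k)))) \<longlonglongrightarrow> 0"
    using tendsto_add[OF uv(3,4)] by (simp add: S[symmetric])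
  ultimately show "\<exists>s\<in>gen G. (\<lambda>n. N (fst (s - (\<Sum>k<n. x k))) + N (snd (s - (\<Sum>k<n. x k)))) \<longlonglongrightarrow> 0" by blast
qed

text \<open>Uniform boundedness on the domain with the graph norm, which is complete because the
  generator is closed. Pointwise boundedness is asked on the domain alone, as it holds for
  truncations of an unbounded operator.\<close>

lemma gen_uniform_boundedness:
  assumes G: "semigroup G"
    and p_add: "\<And>i x y. i \<in> I \<Longrightarrow> x \<in> V \<Longrightarrow> y \<in> V \<Longrightarrow> p i (x + y) \<le> p i x + p i y"
    and p_scale: "\<And>i c x. i \<in> I \<Longrightarrow> x \<in> V \<Longrightarrow> p i (c *\<^sub>R x) = \<bar>c\<bar> * p i x"
    and p_bdd: "\<And>i. i \<in> I \<Longrightarrow> \<exists>C\<ge>0. \<forall>x\<in>V. p i x \<le> C * N x"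
    and pw: "\<And>u v. (u, v) \<in> gen G \<Longrightarrow> \<exists>B. \<forall>i\<in>I. p i u \<le> B"
  shows "\<exists>B\<ge>0. \<forall>i\<in>I. \<forall>(u, v)\<in>gen G. p i u \<le> B * (N u + N v)"
proof -
  interpret graph: seminormed_complete "gen G" "\<lambda>p. N (fst p) + N (snd p)"
    by (rule gen_graph_norm_complete[OF G])
  have "\<exists>B\<ge>0. \<forall>i\<in>I. \<forall>x\<in>gen G. p i (fst x) \<le> B * (N (fst x) + N (snd x))"
  proof (rule graph.uniform_boundedness)
    fix i x y assume "i \<in> I" "x \<in> gen G" "y \<in> gen G"
    then show "p i (fst (x + y)) \<le> p i (fst x) + p i (fst y)"
      using p_add gen_V by (cases x, cases y) auto
  next
    fix i c x assume "i \<in> I" "x \<in> gen G"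
    then show "p i (fst (c *\<^sub>R x)) = \<bar>c\<bar> * p i (fst x)" using p_scale gen_V by (cases x) auto
  next
    fix i assume "i \<in> I"
    then obtain C where C: "C \<ge> 0" "\<And>x. x \<in> V \<Longrightarrow> p i x \<le> C * N x" using p_bdd by blast
    have "p i (fst x) \<le> C * (N (fst x) + N (snd x))" if "x \<in> gen G" for x
    proof -
      have V: "fst x \<in> V" "snd x \<in> V" using that gen_V by (cases x; auto)+
      have "C * N (fst x) \<le> C * (N (fst x) + N (snd x))" using C(1) N_nonneg[OF V(2)] by (intro mult_left_mono) auto
      then show ?thesis using C(2)[OF V(1)] by linarith
    qed
    then show "\<exists>C. \<forall>x\<in>gen G. p i (fst x) \<le> C * (N (fst x) + N (snd x))" by blast
  next
    fix x assume "x \<in> gen G"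
    then show "\<exists>B. \<forall>i\<in>I. p i (fst x) \<le> B" using pw by (cases x) auto
  qed
  then obtain B where "B \<ge> 0" "\<And>i x. i \<in> I \<Longrightarrow> x \<in> gen G \<Longrightarrow> p i (fst x) \<le> B * (N (fst x) + N (snd x))" by blast
  then show ?thesis by (intro exI[of _ B]) auto
qed

section \<open>Analytic semigroups and Cauchy's estimate\<close>

definition has_complex_derivative :: "complex set \<Rightarrow> (complex \<Rightarrow> 'v) \<Rightarrow> (complex \<Rightarrow> 'v) \<Rightarrow> complex \<Rightarrow> 'v \<Rightarrow> 'v \<Rightarrow> bool" where
  "has_complex_derivative D R J z a b \<longleftrightarrow> (\<forall>e>0. \<exists>d>0. \<forall>h. h \<noteq> 0 \<longrightarrow> cmod h < d \<longrightarrow> z + h \<in> D \<longrightarrow>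
    N (Re (1/h) *\<^sub>R (R (z + h) - R z) - Im (1/h) *\<^sub>R (J (z + h) - J z) - a) \<le> e \<and>
    N (Re (1/h) *\<^sub>R (J (z + h) - J z) + Im (1/h) *\<^sub>R (R (z + h) - R z) - b) \<le> e)"

text \<open>\<open>R z\<close> and \<open>J z\<close> are the real and the imaginary part of the holomorphic extension of
  \<open>G\<close>, restricted to real vectors.\<close>

lemma analytic_generator_bound:
  fixes D :: "complex set"
  assumes G: "semigroup G"
    and \<kappa>: "\<kappa> > 0" "\<And>t. t > 0 \<Longrightarrow> ball (complex_of_real t) (\<kappa> * t) \<subseteq> D"
    and op: "\<And>z. z \<in> D \<Longrightarrow> bounded_op (R z)" "\<And>z. z \<in> D \<Longrightarrow> bounded_op (J z)"
    and lim: "\<And>x e. x \<in> V \<Longrightarrow> e > 0 \<Longrightarrow> \<exists>d>0. \<forall>z\<in>D. cmod z < d \<longrightarrow> N (R z x - x) < e \<and> N (J z x) < e"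
    and diff: "\<And>z x. z \<in> D \<Longrightarrow> x \<in> V \<Longrightarrow>
      \<exists>a\<in>V. \<exists>b\<in>V. has_complex_derivative D (\<lambda>z. R z x) (\<lambda>z. J z x) z a b"
    and real: "\<And>t x. t > 0 \<Longrightarrow> x \<in> V \<Longrightarrow> R (complex_of_real t) x \<doteq> G t x"
  shows "\<exists>C\<ge>0. \<exists>d>0. \<forall>t x. 0 < t \<longrightarrow> t < d \<longrightarrow> x \<in> V \<longrightarrow> (\<exists>y. (G t x, y) \<in> gen G \<and> N y \<le> C / t * N x)"
proof -
  have RV: "z \<in> D \<Longrightarrow> x \<in> V \<Longrightarrow> R z x \<in> V" and JV: "z \<in> D \<Longrightarrow> x \<in> V \<Longrightarrow> J z x \<in> V" for z x
    using op bounded_opV by auto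
  \<comment> \<open>As for real times, a sequence z n tending to 0 along which the operators grow
    would contradict uniform boundedness, because \<open>lim\<close> keeps the images of each vector
    bounded.\<close>
  have "\<exists>d>0. \<exists>B\<ge>0. \<forall>z\<in>D. cmod z < d \<longrightarrow> (\<forall>x\<in>V. N (R z x) + N (J z x) \<le> B * N x)"
  proof (rule ccontr)
    assume H: "\<not> ?thesis"
    have "\<exists>z x. z \<in> D \<and> cmod z < 1 / real (Suc n) \<and> x \<in> V \<and> N (R z x) + N (J z x) > real n * N x" for n
    proof (rule ccontr)
      assume "\<not> ?thesis"
      then have "\<forall>z\<in>D. cmod z < 1 / real (Suc n) \<longrightarrow> (\<forall>x\<in>V. N (R z x) + N (J z x) \<le> real n * N x)"
        by (auto simp: not_less)
      moreover have "1 / real (Suc n) > 0" "real n \<ge> 0" by simp_all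
      ultimately show False using H by blast
    qed
    then obtain z x where zx: "\<And>n. z n \<in> D" "\<And>n. cmod (z n) < 1 / real (Suc n)" "\<And>n. x n \<in> V"
      "\<And>n. N (R (z n) (x n)) + N (J (z n) (x n)) > real n * N (x n)" by metis
    have "\<exists>B\<ge>0. \<forall>i\<in>UNIV. \<forall>x\<in>V. N (R (z i) x) + N (J (z i) x) \<le> B * N x"
    proof (rule uniform_boundedness)
      fix i x y assume V: "x \<in> V" "y \<in> V"
      note o = op[OF zx(1)[of i]]
      have v: "R (z i) x \<in> V" "R (z i) y \<in> V" "J (z i) x \<in> V" "J (z i) y \<in> V" using RV JV zx V by auto
      show "N (R (z i) (x + y)) + N (J (z i) (x + y)) \<le> N (R (z i) x) + N (J (z i) x) + (N (R (z i) y) + N (J (z i) y))"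
        using eqv_N[OF bounded_op_add[OF o(1) V]] eqv_N[OF bounded_op_add[OF o(2) V]] N_add[OF v(1,2)] N_add[OF v(3,4)]
        by simp
      show "N (R (z i) (c *\<^sub>R x)) + N (J (z i) (c *\<^sub>R x)) = \<bar>c\<bar> * (N (R (z i) x) + N (J (z i) x))" for c
        using eqv_N[OF bounded_op_scale[OF o(1) V(1), of c]] eqv_N[OF bounded_op_scale[OF o(2) V(1), of c]]
          N_scale[OF v(1)] N_scale[OF v(3)] by (simp add: algebra_simps)
    next
      fix i
      obtain C where C: "\<And>x. x \<in> V \<Longrightarrow> N (R (z i) x) \<le> C * N x" using bounded_op_bound[OF op(1)[OF zx(1)]] by blast
      obtain C' where C': "\<And>x. x \<in> V \<Longrightarrow> N (J (z i) x) \<le> C' * N x" using bounded_op_bound[OF op(2)[OF zx(1)]] by blast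
      show "\<exists>C. \<forall>x\<in>V. N (R (z i) x) + N (J (z i) x) \<le> C * N x"
        using C C' by (intro exI[of _ "C + C'"]) (auto simp: algebra_simps intro: add_mono)
    next
      fix x assume V: "x \<in> V"
      obtain d where d: "d > 0" "\<And>z. z \<in> D \<Longrightarrow> cmod z < d \<Longrightarrow> N (R z x - x) < 1 \<and> N (J z x) < 1"
        using lim[OF V, of 1] by auto
      obtain M where M: "real M > 1 / d" using reals_Archimedean2 by blast
      have fin: "N (R (z i) x) + N (J (z i) x) \<le> N x + 2" if "i \<ge> M" for i
      proof -
        have "1 / d < real (Suc i)" using M that by linarith
        then have "1 / real (Suc i) < d" using d(1) by (simp add: field_simps)
        then have "cmod (z i) < d" using zx(2)[of i] by linarith
        then have "N (R (z i) x - x) < 1" "N (J (z i) x) < 1" using d(2) zx(1) by auto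
        moreover have "N (R (z i) x) \<le> N (R (z i) x - x) + N x"
          using N_add[of "R (z i) x - x" x] RV[OF zx(1) V] V by simp
        ultimately show ?thesis by linarith
      qed
      define B where "B = (\<Sum>i<M. \<bar>N (R (z i) x) + N (J (z i) x)\<bar>) + \<bar>N x + 2\<bar>"
      have "N (R (z i) x) + N (J (z i) x) \<le> B" for i
      proof (cases "i < M")
        case True
        then have "\<bar>N (R (z i) x) + N (J (z i) x)\<bar> \<le> (\<Sum>i<M. \<bar>N (R (z i) x) + N (J (z i) x)\<bar>)"
          by (intro member_le_sum) auto
        then show ?thesis unfolding B_def by linarith
      next
        case False
        moreover have "0 \<le> (\<Sum>i<M. \<bar>N (R (z i) x) + N (J (z i) x)\<bar>)" by (intro sum_nonneg) auto
        ultimately show ?thesis using fin[of i] unfolding B_def by linarith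
      qed
      then show "\<exists>B. \<forall>i\<in>UNIV. N (R (z i) x) + N (J (z i) x) \<le> B" by blast
    qed
    then obtain B where B: "\<And>i x. x \<in> V \<Longrightarrow> N (R (z i) x) + N (J (z i) x) \<le> B * N x" by blast
    obtain n where n: "real n > B" using reals_Archimedean2 by blast
    have "B * N (x n) \<le> real n * N (x n)" using n N_nonneg[OF zx(3)] by (intro mult_right_mono) auto
    then show False using B[OF zx(3), of n n] zx(4)[of n] by simp
  qed
  then obtain d B where d: "d > 0" and B: "B \<ge> 0" "\<And>z x. z \<in> D \<Longrightarrow> cmod z < d \<Longrightarrow> x \<in> V \<Longrightarrow> N (R z x) + N (J z x) \<le> B * N x"
    by blast
  \<comment> \<open>For t < d1 every point of the disc about t with radius \<kappa> t has modulus
    below (1 + \<kappa>) t < d, where the bound B is valid.\<close>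
  define d1 where "d1 = d / (1 + \<kappa>)"
  have d1: "d1 > 0" using d \<kappa>(1) by (simp add: d1_def)
  have "\<exists>y. (G t x, y) \<in> gen G \<and> N y \<le> (2 * B / \<kappa>) / t * N x" if t: "0 < t" "t < d1" and x: "x \<in> V" for t x
  proof -
    let ?t = "complex_of_real t"
    have bD: "ball ?t (\<kappa> * t) \<subseteq> D" using \<kappa>(2)[OF t(1)] .
    have \<kappa>t: "\<kappa> * t > 0" using \<kappa> t by simp
    have tD: "?t \<in> D" using bD \<kappa>t by auto
    obtain A A' where A: "\<And>z. z \<in> D \<Longrightarrow> A z \<in> V \<and> A' z \<in> V"
      "\<And>z. z \<in> D \<Longrightarrow> has_complex_derivative D (\<lambda>z. R z x) (\<lambda>z. J z x) z (A z) (A' z)"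
      using diff[OF _ x] by metis
    define y where "y = A ?t"
    have yV: "y \<in> V" using A(1)[OF tD] by (simp add: y_def)
    \<comment> \<open>y is the real part of the derivative at t. With a functional norming y, the
      estimate of N y becomes Cauchy's inequality for the scalar holomorphic function
      \<psi>.\<close>
    obtain \<phi> where \<phi>: "unit_functional \<phi>" "\<phi> y = N y" using norming_functional[OF yV] by blast
    define \<psi> where "\<psi> z = Complex (\<phi> (R z x)) (\<phi> (J z x))" for z
    have der: "(\<psi> has_field_derivative Complex (\<phi> (A z)) (\<phi> (A' z))) (at z)" if z: "z \<in> ball ?t (\<kappa> * t)" for z
      unfolding DERIV_def
    proof (rule LIM_I)
      fix e :: real assume e: "e > 0"
      have zD: "z \<in> D" using z bD by auto
      obtain d where d: "d > 0" "\<And>h. h \<noteq> 0 \<Longrightarrow> cmod h < d \<Longrightarrow> z + h \<in> D \<Longrightarrow>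
        N (Re (1/h) *\<^sub>R (R (z + h) x - R z x) - Im (1/h) *\<^sub>R (J (z + h) x - J z x) - A z) \<le> e/3 \<and>
        N (Re (1/h) *\<^sub>R (J (z + h) x - J z x) + Im (1/h) *\<^sub>R (R (z + h) x - R z x) - A' z) \<le> e/3"
        using A(2)[OF zD, unfolded has_complex_derivative_def, rule_format, of "e/3"] e by auto
      obtain r where r: "r > 0" "ball z r \<subseteq> ball ?t (\<kappa> * t)" using z open_contains_ball[THEN iffD1, OF open_ball, of ?t "\<kappa> * t"] by blast
      have "norm ((\<psi> (z + h) - \<psi> z) / h - Complex (\<phi> (A z)) (\<phi> (A' z))) < e" if h: "h \<noteq> 0" "norm (h - 0) < min d r" for h
      proof -
        have "z + h \<in> ball z r" using h by (simp add: dist_norm)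
        then have zh: "z + h \<in> D" using r bD by auto
        note v = RV[OF zD x] RV[OF zh x] JV[OF zD x] JV[OF zh x]
        let ?X = "Re (1/h) *\<^sub>R (R (z + h) x - R z x) - Im (1/h) *\<^sub>R (J (z + h) x - J z x) - A z"
        let ?Y = "Re (1/h) *\<^sub>R (J (z + h) x - J z x) + Im (1/h) *\<^sub>R (R (z + h) x - R z x) - A' z"
        have XY: "?X \<in> V" "?Y \<in> V" using v A(1)[OF zD] by auto
        have \<phi>X: "\<phi> ?X = Re (1/h) * (\<phi> (R (z + h) x) - \<phi> (R z x)) - Im (1/h) * (\<phi> (J (z + h) x) - \<phi> (J z x)) - \<phi> (A z)"
        proof -
          have a: "Re (1/h) *\<^sub>R (R (z + h) x - R z x) \<in> V" "Im (1/h) *\<^sub>R (J (z + h) x - J z x) \<in> V" "A z \<in> V"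
            using v A(1)[OF zD] by auto
          show ?thesis
            unfolding unit_functionalD(3)[OF \<phi>(1) V_closed(3)[OF a(1,2)] a(3)] unit_functionalD(3)[OF \<phi>(1) a(1,2)]
              unit_functionalD(4)[OF \<phi>(1) V_closed(3)[OF v(2,1)] v(1)] unit_functionalD(4)[OF \<phi>(1) V_closed(3)[OF v(4,3)] v(1)]
              unit_functionalD(3)[OF \<phi>(1) v(2,1)] unit_functionalD(3)[OF \<phi>(1) v(4,3)] by simp
        qed
        have \<phi>Y: "\<phi> ?Y = Re (1/h) * (\<phi> (J (z + h) x) - \<phi> (J z x)) + Im (1/h) * (\<phi> (R (z + h) x) - \<phi> (R z x)) - \<phi> (A' z)"
        proof -
          have a: "Re (1/h) *\<^sub>R (J (z + h) x - J z x) \<in> V" "Im (1/h) *\<^sub>R (R (z + h) x - R z x) \<in> V" "A' z \<in> V"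
            using v A(1)[OF zD] by auto
          show ?thesis
            unfolding unit_functionalD(3)[OF \<phi>(1) V_closed(2)[OF a(1,2)] a(3)] unit_functionalD(2)[OF \<phi>(1) a(1,2)]
              unit_functionalD(4)[OF \<phi>(1) V_closed(3)[OF v(2,1)] v(1)] unit_functionalD(4)[OF \<phi>(1) V_closed(3)[OF v(4,3)] v(1)]
              unit_functionalD(3)[OF \<phi>(1) v(2,1)] unit_functionalD(3)[OF \<phi>(1) v(4,3)] by simp
        qed
        have cx: "(Complex p1 p2 - Complex q1 q2) * c - Complex a b =
            Complex (Re c * (p1 - q1) - Im c * (p2 - q2) - a) (Re c * (p2 - q2) + Im c * (p1 - q1) - b)"
          for c p1 p2 q1 q2 a b by (simp add: complex_eq_iff algebra_simps)
        have "(\<psi> (z + h) - \<psi> z) / h = (\<psi> (z + h) - \<psi> z) * (1/h)" by simp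
        also have "\<dots> - Complex (\<phi> (A z)) (\<phi> (A' z)) = Complex (\<phi> ?X) (\<phi> ?Y)"
          unfolding \<phi>X \<phi>Y \<psi>_def by (rule cx)
        finally have "norm ((\<psi> (z + h) - \<psi> z) / h - Complex (\<phi> (A z)) (\<phi> (A' z))) \<le> \<bar>\<phi> ?X\<bar> + \<bar>\<phi> ?Y\<bar>"
          using cmod_le[of "Complex (\<phi> ?X) (\<phi> ?Y)"] by simp
        also have "\<dots> \<le> e/3 + e/3"
          using unit_functionalD(5)[OF \<phi>(1) XY(1,1)] unit_functionalD(5)[OF \<phi>(1) XY(2,2)] d(2)[OF h(1) _ zh] h
          by (intro add_mono) auto
        finally show ?thesis using e by simp
      qed
      then show "\<exists>s>0. \<forall>h. h \<noteq> 0 \<and> norm (h - 0) < s \<longrightarrow> norm ((\<psi> (z + h) - \<psi> z) / h - Complex (\<phi> (A z)) (\<phi> (A' z))) < e"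
        using d(1) r(1) by (intro exI[of _ "min d r"]) auto
    qed
    \<comment> \<open>Half the radius keeps the closed disc inside the domain of holomorphy; it is
      the source of the constant 2 * B / \<kappa>.\<close>
    define \<rho> where "\<rho> = \<kappa> * t / 2"
    have \<rho>: "\<rho> > 0" "\<rho> < \<kappa> * t" using \<kappa>t by (auto simp: \<rho>_def)
    have hol: "\<psi> holomorphic_on ball ?t (\<kappa> * t)"
      unfolding holomorphic_on_open[OF open_ball] using der by blast
    have "norm ((deriv ^^ 1) \<psi> ?t) \<le> fact 1 * (B * N x) / \<rho> ^ 1"
    proof (rule Cauchy_inequality)
      show "\<psi> holomorphic_on ball ?t \<rho>" by (rule holomorphic_on_subset[OF hol]) (use \<rho> in auto)
      show "continuous_on (cball ?t \<rho>) \<psi>"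
        by (rule continuous_on_subset[OF holomorphic_on_imp_continuous_on[OF hol]]) (use \<rho> in auto)
      fix z assume z: "norm (?t - z) = \<rho>"
      then have "z \<in> ball ?t (\<kappa> * t)" using \<rho> by (simp add: dist_norm)
      then have zD: "z \<in> D" using bD by auto
      have "cmod z \<le> t + \<rho>" using norm_triangle_ineq4[of ?t "?t - z"] z t by simp
      also have "\<dots> < t * (1 + \<kappa>)" using \<rho> by (simp add: algebra_simps)
      also have "\<dots> < d" using t(2) \<kappa>(1) by (simp add: d1_def field_simps)
      finally have zd: "cmod z < d" .
      have "norm (\<psi> z) \<le> \<bar>\<phi> (R z x)\<bar> + \<bar>\<phi> (J z x)\<bar>" using cmod_le[of "\<psi> z"] by (simp add: \<psi>_def)
      also have "\<dots> \<le> N (R z x) + N (J z x)"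
        using unit_functionalD(5)[OF \<phi>(1)] RV[OF zD x] JV[OF zD x] by (intro add_mono) auto
      also have "\<dots> \<le> B * N x" by (rule B(2)[OF zD zd x])
      finally show "norm (\<psi> z) \<le> B * N x" .
    qed (rule \<rho>)
    moreover have "deriv \<psi> ?t = Complex (\<phi> (A ?t)) (\<phi> (A' ?t))"
      by (rule DERIV_imp_deriv[OF der]) (use \<kappa>t in simp)
    moreover have "N y \<le> cmod (Complex (\<phi> (A ?t)) (\<phi> (A' ?t)))"
      using abs_Re_le_cmod[of "Complex (\<phi> (A ?t)) (\<phi> (A' ?t))"] \<phi>(2) unfolding y_def[symmetric] by simp
    ultimately have "N y \<le> B * N x / \<rho>" by simp
    also have "\<dots> = (2 * B / \<kappa>) / t * N x" unfolding \<rho>_def by simp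
    finally have Ny: "N y \<le> (2 * B / \<kappa>) / t * N x" .
    have t0: "0 \<le> t" using t by simp
    have "(G t x, y) \<in> gen G"
    proof (rule genI[OF G])
      show "G t x \<in> V" "y \<in> V" using sgV[OF G t0 x] yV by auto
      fix e :: real assume e: "e > 0"
      obtain d where d: "d > 0" "\<And>h. h \<noteq> 0 \<Longrightarrow> cmod h < d \<Longrightarrow> ?t + h \<in> D \<Longrightarrow>
        N (Re (1/h) *\<^sub>R (R (?t + h) x - R ?t x) - Im (1/h) *\<^sub>R (J (?t + h) x - J ?t x) - y) \<le> e"
        using A(2)[OF tD, unfolded has_complex_derivative_def, rule_format, OF e] unfolding y_def by blast
      have "N (G h (G t x) - G t x - h *\<^sub>R y) \<le> e * h" if h: "0 < h" "h < d" for h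
      proof -
        \<comment> \<open>For a real increment the imaginary part of 1/h vanishes, so the complex
          derivative reduces to the right difference quotient that defines the generator.\<close>
        let ?h = "complex_of_real h"
        have thD: "?t + ?h \<in> D" using \<kappa>(2)[of "t + h"] \<kappa>(1) t h
          by (metis add_pos_pos centre_in_ball mult_pos_pos of_real_add subsetD)
        note v = RV[OF tD x] RV[OF thD x]
        have "Im (1 / ?h) = 0" "Re (1 / ?h) = 1 / h" using h by (auto simp: Re_divide Im_divide power2_eq_square)
        then have b: "N ((1/h) *\<^sub>R (R (?t + ?h) x - R ?t x) - y) \<le> e" using d(2)[of ?h] h thD by simp
        have eq: "(1/h) *\<^sub>R (R (?t + ?h) x - R ?t x) - y = (1/h) *\<^sub>R (R (?t + ?h) x - R ?t x - h *\<^sub>R y)"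
          using h by (simp add: scaleR_diff_right)
        have XV: "R (?t + ?h) x - R ?t x - h *\<^sub>R y \<in> V" using v yV by auto
        have "N (R (?t + ?h) x - R ?t x - h *\<^sub>R y) \<le> e * h"
          using b h unfolding eq N_scale[OF XV] by (simp add: field_simps)
        moreover have "G h (G t x) - G t x - h *\<^sub>R y \<doteq> R (?t + ?h) x - R ?t x - h *\<^sub>R y"
        proof (intro eqv_diff eqv_refl)
          have "G h (G t x) \<doteq> G (h + t) x" using eqv_sym[OF sg_plus[OF G _ t0 x]] h by simp
          also have "G (h + t) x \<doteq> R (?t + ?h) x" using eqv_sym[OF real[of "h + t" x]] h t x by (simp add: add.commute)
          finally show "G h (G t x) \<doteq> R (?t + ?h) x" .
          show "G t x \<doteq> R ?t x" using eqv_sym[OF real[OF t(1) x]] .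
        qed (use yV in auto)
        ultimately show ?thesis using eqv_N by simp
      qed
      then show "\<exists>d>0. \<forall>h. 0 < h \<longrightarrow> h < d \<longrightarrow> N (G h (G t x) - G t x - h *\<^sub>R y) \<le> e * h" using d(1) by blast
    qed
    then show ?thesis using Ny by blast
  qed
  moreover have "2 * B / \<kappa> \<ge> 0" using B \<kappa> by simp
  ultimately show ?thesis using d1 by blast
qed

end

section \<open>Sections of Lebesgue measurable functions\<close>

lemma complete_measure_lebesgue_on:
  assumes S: "S \<in> sets lebesgue" shows "complete_measure (lebesgue_on S)"
proof
  fix A B assume "B \<subseteq> A" "A \<in> null_sets (lebesgue_on S)"
  then have "B \<subseteq> A" "A \<subseteq> S" "A \<in> null_sets lebesgue" using S by (auto simp: null_sets_restrict_space)
  then have "B \<in> null_sets lebesgue" "S \<inter> B = B" using completion.complete2 by blast+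
  then show "B \<in> sets (lebesgue_on S)" unfolding sets_restrict_space by (metis imageI null_setsD2)
qed

text \<open>Statements proved for a Borel version of a function return to the function itself in
  this way.\<close>

lemma (in complete_measure) measurable_cong_AE:
  assumes g: "g \<in> measurable M N" and ae: "AE x in M. f x = g x" and f: "f \<in> space M \<rightarrow> space N"
  shows "f \<in> measurable M N"
proof (rule measurableI)
  show "f x \<in> space N" if "x \<in> space M" for x using f that by auto
  fix A assume A: "A \<in> sets N"
  show "f -` A \<inter> space M \<in> sets M"
    by (rule in_sets_AE[of "g -` A \<inter> space M"]) (use ae g A in \<open>auto elim: eventually_mono\<close>)
qed

text \<open>The exceptional set of P need not be measurable. It is enclosed in a Borel null set,
  whose complement satisfies the measurability that the exchange of the two quantifiers
  requires.\<close>

lemma lborel_AE_pair: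
  fixes P :: "'a::euclidean_space \<times> 'b::euclidean_space \<Rightarrow> bool"
  assumes "AE p in lborel. P p"
  shows "AE x in lborel. AE y in lborel. P (x, y)" "AE y in lborel. AE x in lborel. P (x, y)"
proof -
  obtain N where N: "N \<in> null_sets lborel" "{p. \<not> P p} \<subseteq> N"
    using assms unfolding eventually_ae_filter by auto
  have ae: "AE p in lborel \<Otimes>\<^sub>M lborel. p \<notin> N"
    unfolding lborel_prod by (rule AE_not_in[OF N(1)])
  have 1: "AE x in lborel. AE y in lborel. (x, y) \<notin> N"
    using lborel_pair.AE_pair[OF ae] .
  have "{p \<in> space (lborel \<Otimes>\<^sub>M lborel). (fst p, snd p) \<notin> N} = - N"
    by (auto simp: space_pair_measure)
  also have "\<dots> \<in> sets (lborel \<Otimes>\<^sub>M lborel)" using N(1) unfolding lborel_prod by (auto simp: null_sets_def)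
  finally have 2: "AE y in lborel. AE x in lborel. (x, y) \<notin> N"
    using lborel_pair.AE_commute[of "\<lambda>x y. (x, y) \<notin> N"] 1 by simp
  have sub: "P p" if "p \<notin> N" for p using N(2) that by blast
  show "AE x in lborel. AE y in lborel. P (x, y)"
  proof (rule eventually_mono[OF 1])
    fix x assume "AE y in lborel. (x, y) \<notin> N"
    then show "AE y in lborel. P (x, y)" by (rule eventually_mono) (rule sub)
  qed
  show "AE y in lborel. AE x in lborel. P (x, y)"
  proof (rule eventually_mono[OF 2])
    fix y assume "AE x in lborel. (x, y) \<notin> N"
    then show "AE x in lborel. P (x, y)" by (rule eventually_mono) (rule sub)
  qed
qed

lemma AE_lebesgue_on_iff:
  "S \<in> sets lebesgue \<Longrightarrow> (AE x in lebesgue_on S. P x) \<longleftrightarrow> (AE x in lborel. x \<in> S \<longrightarrow> P x)"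
  by (subst AE_restrict_space_iff) (auto simp: AE_completion_iff)

lemma AE_lebesgue_on_Times:
  fixes A :: "'a::euclidean_space set" and B :: "'b::euclidean_space set"
  assumes A: "A \<in> sets borel" and B: "B \<in> sets borel" and P: "AE p in lebesgue_on (A \<times> B). P p"
  shows "AE x in lebesgue_on A. AE y in lebesgue_on B. P (x, y)"
    "AE y in lebesgue_on B. AE x in lebesgue_on A. P (x, y)"
proof -
  have "A \<times> B \<in> sets lebesgue" using borel_Times[OF A B] by simp
  then have ae: "AE p in lborel. p \<in> A \<times> B \<longrightarrow> P p" using P by (simp add: AE_lebesgue_on_iff)
  show "AE x in lebesgue_on A. AE y in lebesgue_on B. P (x, y)"
    using lborel_AE_pair(1)[OF ae] A B by (auto simp: AE_lebesgue_on_iff elim!: eventually_mono)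
  show "AE y in lebesgue_on B. AE x in lebesgue_on A. P (x, y)"
    using lborel_AE_pair(2)[OF ae] A B by (auto simp: AE_lebesgue_on_iff elim!: eventually_mono)
qed

text \<open>The completed sigma-algebras contain more than Borel sets, so continuity alone is
  insufficient; what counts in addition is that the preimage of a null set, a cylinder over it, is
  again null.\<close>

lemma measurable_projections_lebesgue:
  fixes A :: "'a::euclidean_space set" and B :: "'b::euclidean_space set"
  shows "fst \<in> lebesgue_on (A \<times> B) \<rightarrow>\<^sub>M lebesgue_on A" "snd \<in> lebesgue_on (A \<times> B) \<rightarrow>\<^sub>M lebesgue_on B"
proof -
  have f: "fst \<in> (lebesgue :: ('a \<times> 'b) measure) \<rightarrow>\<^sub>M lebesgue"
  proof (rule completion.measurable_completion2)
    show m: "fst \<in> (lebesgue :: ('a \<times> 'b) measure) \<rightarrow>\<^sub>M lborel"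
      by (intro measurable_completion) (simp, intro borel_measurable_continuous_onI continuous_on_fst continuous_on_id)
    show "null_sets lborel \<subseteq> null_sets (distr (lebesgue :: ('a \<times> 'b) measure) lborel fst)"
    proof
      fix N :: "'a set" assume N: "N \<in> null_sets lborel"
      have "emeasure (lborel :: ('a \<times> 'b) measure) (N \<times> UNIV) = 0"
        unfolding lborel_prod[symmetric] using N
        by (subst lborel.emeasure_pair_measure_Times) (auto simp: null_sets_def)
      then have "N \<times> UNIV \<in> null_sets (lborel :: ('a \<times> 'b) measure)"
        using N borel_Times[of N UNIV] by (auto simp: null_sets_def)
      moreover have "fst -` N \<inter> space (lebesgue :: ('a \<times> 'b) measure) = N \<times> UNIV" by auto
      ultimately show "N \<in> null_sets (distr (lebesgue :: ('a \<times> 'b) measure) lborel fst)"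
        using N m by (auto simp: null_sets_def emeasure_distr)
    qed
  qed
  have s: "snd \<in> (lebesgue :: ('a \<times> 'b) measure) \<rightarrow>\<^sub>M lebesgue"
  proof (rule completion.measurable_completion2)
    show m: "snd \<in> (lebesgue :: ('a \<times> 'b) measure) \<rightarrow>\<^sub>M lborel"
      by (intro measurable_completion) (simp, intro borel_measurable_continuous_onI continuous_on_snd continuous_on_id)
    show "null_sets lborel \<subseteq> null_sets (distr (lebesgue :: ('a \<times> 'b) measure) lborel snd)"
    proof
      fix N :: "'b set" assume N: "N \<in> null_sets lborel"
      have "emeasure (lborel :: ('a \<times> 'b) measure) (UNIV \<times> N) = 0"
        unfolding lborel_prod[symmetric] using N
        by (subst lborel.emeasure_pair_measure_Times) (auto simp: null_sets_def)
      then have "UNIV \<times> N \<in> null_sets (lborel :: ('a \<times> 'b) measure)"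
        using N borel_Times[of UNIV N] by (auto simp: null_sets_def)
      moreover have "snd -` N \<inter> space (lebesgue :: ('a \<times> 'b) measure) = UNIV \<times> N" by auto
      ultimately show "N \<in> null_sets (distr (lebesgue :: ('a \<times> 'b) measure) lborel snd)"
        using N m by (auto simp: null_sets_def emeasure_distr)
    qed
  qed
  show "fst \<in> lebesgue_on (A \<times> B) \<rightarrow>\<^sub>M lebesgue_on A"
    by (rule measurable_restrict_space2) (auto intro: measurable_restrict_space1 f simp: space_restrict_space)
  show "snd \<in> lebesgue_on (A \<times> B) \<rightarrow>\<^sub>M lebesgue_on B"
    by (rule measurable_restrict_space2) (auto intro: measurable_restrict_space1 s simp: space_restrict_space)
qed

text \<open>Tonelli for the completion: the Lebesgue sigma-algebra of the plane is larger than the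
  product one, so f is replaced by a Borel function \<open>h\<close> equal to it almost everywhere.
  The sections of f and h agree almost everywhere on almost every line, and completeness on the
  lines makes those of f measurable.\<close>

lemma measurable_sections_lebesgue:
  fixes A :: "'a::euclidean_space set" and B :: "'b::euclidean_space set" and f :: "'a \<times> 'b \<Rightarrow> ennreal"
  assumes A: "A \<in> sets borel" and B: "B \<in> sets borel" and f: "f \<in> borel_measurable (lebesgue_on (A \<times> B))"
  shows "AE x in lebesgue_on A. (\<lambda>y. f (x, y)) \<in> borel_measurable (lebesgue_on B)"
    "AE y in lebesgue_on B. (\<lambda>x. f (x, y)) \<in> borel_measurable (lebesgue_on A)"
    "(\<lambda>x. \<integral>\<^sup>+y. f (x, y) \<partial>lebesgue_on B) \<in> borel_measurable (lebesgue_on A)"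
    "(\<lambda>y. \<integral>\<^sup>+x. f (x, y) \<partial>lebesgue_on A) \<in> borel_measurable (lebesgue_on B)"
    "(\<integral>\<^sup>+x. (\<integral>\<^sup>+y. f (x, y) \<partial>lebesgue_on B) \<partial>lebesgue_on A) =
     (\<integral>\<^sup>+y. (\<integral>\<^sup>+x. f (x, y) \<partial>lebesgue_on A) \<partial>lebesgue_on B)"
proof -
  have AB: "A \<times> B \<in> sets borel" using borel_Times[OF A B] .
  define g where "g p = f p * indicator (A \<times> B) p" for p
  have "g \<in> borel_measurable lebesgue"
    unfolding g_def using f AB by (subst (asm) borel_measurable_restrict_space_iff_ennreal) auto
  then obtain h where h: "h \<in> borel_measurable lborel" "AE p in lborel. g p = h p"
    using completion_ex_borel_measurable by blast
  have hm: "h \<in> borel_measurable (lborel \<Otimes>\<^sub>M lborel)" using h(1) by (simp add: lborel_prod)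
  have hm': "h \<in> borel_measurable (borel \<Otimes>\<^sub>M borel)" using h(1) by (simp add: borel_prod)
  have sec1: "(\<lambda>y. h (x, y)) \<in> borel_measurable borel" for x
    using measurable_compose[OF measurable_Pair1' hm'] by simp
  have sec2: "(\<lambda>x. h (x, y)) \<in> borel_measurable borel" for y
    using measurable_compose[OF measurable_Pair2' hm'] by simp
  have ae1: "AE x in lebesgue_on A. AE y in lebesgue_on B. f (x, y) = h (x, y)"
    using lborel_AE_pair(1)[OF h(2)] A B
    by (auto simp: AE_lebesgue_on_iff g_def elim!: eventually_mono)
  have ae2: "AE y in lebesgue_on B. AE x in lebesgue_on A. f (x, y) = h (x, y)"
    using lborel_AE_pair(2)[OF h(2)] A B
    by (auto simp: AE_lebesgue_on_iff g_def elim!: eventually_mono)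
  interpret cA: complete_measure "lebesgue_on A" using A by (intro complete_measure_lebesgue_on) simp
  interpret cB: complete_measure "lebesgue_on B" using B by (intro complete_measure_lebesgue_on) simp
  have borel_leb: "k \<in> borel_measurable borel \<Longrightarrow> k \<in> borel_measurable (lebesgue_on S)" for k :: "'c::euclidean_space \<Rightarrow> ennreal" and S
    by (intro measurable_restrict_space1 measurable_completion) simp
  show "AE x in lebesgue_on A. (\<lambda>y. f (x, y)) \<in> borel_measurable (lebesgue_on B)"
    using ae1 by (rule eventually_mono) (rule cB.measurable_cong_AE[OF borel_leb[OF sec1]], auto)
  show "AE y in lebesgue_on B. (\<lambda>x. f (x, y)) \<in> borel_measurable (lebesgue_on A)"
    using ae2 by (rule eventually_mono) (rule cA.measurable_cong_AE[OF borel_leb[OF sec2]], auto)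
  let ?k = "\<lambda>x y. h (x, y) * indicator B y" and ?l = "\<lambda>y x. h (x, y) * indicator A x"
  have i1: "(\<integral>\<^sup>+y. h (x, y) \<partial>lebesgue_on B) = (\<integral>\<^sup>+y. h (x, y) * indicator B y \<partial>lborel)" for x
    using B by (subst nn_integral_restrict_space) (auto simp: nn_integral_completion)
  have i2: "(\<integral>\<^sup>+x. h (x, y) \<partial>lebesgue_on A) = (\<integral>\<^sup>+x. h (x, y) * indicator A x \<partial>lborel)" for y
    using A by (subst nn_integral_restrict_space) (auto simp: nn_integral_completion)
  have mB: "(\<lambda>p. h p * indicator B (snd p)) \<in> borel_measurable (lborel \<Otimes>\<^sub>M lborel)"
    using hm B by measurable
  have mA: "(\<lambda>p. h p * indicator A (fst p)) \<in> borel_measurable (lborel \<Otimes>\<^sub>M lborel)"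
    using hm A by measurable
  have mAB: "(\<lambda>p. h p * indicator A (fst p) * indicator B (snd p)) \<in> borel_measurable (lborel \<Otimes>\<^sub>M lborel)"
    using hm A B by measurable
  have I1: "(\<lambda>x. \<integral>\<^sup>+y. h (x, y) * indicator B y \<partial>lborel) \<in> borel_measurable borel"
    using lborel.borel_measurable_nn_integral_fst[OF mB] by simp
  have swap: "(\<lambda>p. (snd p, fst p)) \<in> (lborel :: 'b measure) \<Otimes>\<^sub>M (lborel :: 'a measure) \<rightarrow>\<^sub>M lborel \<Otimes>\<^sub>M lborel" by measurable
  have I2: "(\<lambda>y. \<integral>\<^sup>+x. h (x, y) * indicator A x \<partial>lborel) \<in> borel_measurable borel"
    using lborel.borel_measurable_nn_integral_fst[OF measurable_compose[OF swap mA]] by simp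
  have e1: "AE x in lebesgue_on A. (\<integral>\<^sup>+y. f (x, y) \<partial>lebesgue_on B) = (\<integral>\<^sup>+y. h (x, y) * indicator B y \<partial>lborel)"
    using ae1 by (rule eventually_mono) (simp add: i1[symmetric] nn_integral_cong_AE)
  have e2: "AE y in lebesgue_on B. (\<integral>\<^sup>+x. f (x, y) \<partial>lebesgue_on A) = (\<integral>\<^sup>+x. h (x, y) * indicator A x \<partial>lborel)"
    using ae2 by (rule eventually_mono) (simp add: i2[symmetric] nn_integral_cong_AE)
  show "(\<lambda>x. \<integral>\<^sup>+y. f (x, y) \<partial>lebesgue_on B) \<in> borel_measurable (lebesgue_on A)"
    by (rule cA.measurable_cong_AE[OF borel_leb[OF I1] e1]) auto
  show "(\<lambda>y. \<integral>\<^sup>+x. f (x, y) \<partial>lebesgue_on A) \<in> borel_measurable (lebesgue_on B)"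
    by (rule cB.measurable_cong_AE[OF borel_leb[OF I2] e2]) auto
  have "(\<integral>\<^sup>+x. (\<integral>\<^sup>+y. f (x, y) \<partial>lebesgue_on B) \<partial>lebesgue_on A) =
      (\<integral>\<^sup>+x. (\<integral>\<^sup>+y. h (x, y) * indicator B y \<partial>lborel) \<partial>lebesgue_on A)"
    using e1 by (rule nn_integral_cong_AE)
  also have "\<dots> = (\<integral>\<^sup>+x. (\<integral>\<^sup>+y. h (x, y) * indicator B y \<partial>lborel) * indicator A x \<partial>lborel)"
    using A by (subst nn_integral_restrict_space) (auto simp: nn_integral_completion)
  also have "\<dots> = (\<integral>\<^sup>+x. (\<integral>\<^sup>+y. h (x, y) * indicator A x * indicator B y \<partial>lborel) \<partial>lborel)"
    by (intro nn_integral_cong) (auto simp: indicator_def)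
  also have "\<dots> = (\<integral>\<^sup>+y. (\<integral>\<^sup>+x. h (x, y) * indicator A x * indicator B y \<partial>lborel) \<partial>lborel)"
    using lborel_pair.Fubini[of "\<lambda>p. h p * indicator A (fst p) * indicator B (snd p)"] mAB by simp
  also have "\<dots> = (\<integral>\<^sup>+y. (\<integral>\<^sup>+x. h (x, y) * indicator A x \<partial>lborel) * indicator B y \<partial>lborel)"
    by (intro nn_integral_cong) (auto simp: indicator_def)
  also have "\<dots> = (\<integral>\<^sup>+y. (\<integral>\<^sup>+x. h (x, y) * indicator A x \<partial>lborel) \<partial>lebesgue_on B)"
    using B by (subst nn_integral_restrict_space) (auto simp: nn_integral_completion)
  also have "\<dots> = (\<integral>\<^sup>+y. (\<integral>\<^sup>+x. f (x, y) \<partial>lebesgue_on A) \<partial>lebesgue_on B)"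
    using e2 by (intro nn_integral_cong_AE) (auto elim: eventually_mono)
  finally show "(\<integral>\<^sup>+x. (\<integral>\<^sup>+y. f (x, y) \<partial>lebesgue_on B) \<partial>lebesgue_on A) =
     (\<integral>\<^sup>+y. (\<integral>\<^sup>+x. f (x, y) \<partial>lebesgue_on A) \<partial>lebesgue_on B)" .
qed

lemma real_measurable_sections_lebesgue:
  fixes A :: "'a::euclidean_space set" and B :: "'b::euclidean_space set" and f :: "'a \<times> 'b \<Rightarrow> real"
  assumes A: "A \<in> sets borel" and B: "B \<in> sets borel" and f: "f \<in> borel_measurable (lebesgue_on (A \<times> B))"
  shows "AE x in lebesgue_on A. (\<lambda>y. f (x, y)) \<in> borel_measurable (lebesgue_on B)"
    "AE y in lebesgue_on B. (\<lambda>x. f (x, y)) \<in> borel_measurable (lebesgue_on A)"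
proof -
  have m: "(\<lambda>p. ennreal (f p)) \<in> borel_measurable (lebesgue_on (A \<times> B))"
    "(\<lambda>p. ennreal (- f p)) \<in> borel_measurable (lebesgue_on (A \<times> B))" using f by auto
  have real: "k \<in> borel_measurable M" if "(\<lambda>y. ennreal (k y)) \<in> borel_measurable M" "(\<lambda>y. ennreal (- k y)) \<in> borel_measurable M"
    for k :: "'c \<Rightarrow> real" and M
  proof -
    have "k = (\<lambda>y. enn2real (ennreal (k y)) - enn2real (ennreal (- k y)))"
    proof
      fix y show "k y = enn2real (ennreal (k y)) - enn2real (ennreal (- k y))"
        by (cases "0 \<le> k y") (simp_all add: ennreal_neg)
    qed
    moreover have "\<dots> \<in> borel_measurable M" using that by measurable
    ultimately show ?thesis by simp
  qed
  show "AE x in lebesgue_on A. (\<lambda>y. f (x, y)) \<in> borel_measurable (lebesgue_on B)"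
    using measurable_sections_lebesgue(1)[OF A B m(1)] measurable_sections_lebesgue(1)[OF A B m(2)]
    by eventually_elim (rule real)
  show "AE y in lebesgue_on B. (\<lambda>x. f (x, y)) \<in> borel_measurable (lebesgue_on A)"
    using measurable_sections_lebesgue(2)[OF A B m(1)] measurable_sections_lebesgue(2)[OF A B m(2)]
    by eventually_elim (rule real)
qed

lemma (in complete_measure) measurable_ennreal_AE_limit:
  fixes f :: "nat \<Rightarrow> 'a \<Rightarrow> ennreal"
  assumes "\<And>n. f n \<in> borel_measurable M" "AE x in M. (\<lambda>n. f n x) \<longlonglongrightarrow> g x"
  shows "g \<in> borel_measurable M"
proof (rule measurable_cong_AE)
  show "(\<lambda>x. limsup (\<lambda>n. f n x)) \<in> borel_measurable M" using assms(1) by measurable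
  show "AE x in M. g x = limsup (\<lambda>n. f n x)"
    using assms(2) by eventually_elim (simp add: lim_imp_Limsup)
qed auto

section \<open>The spaces \<open>X_x\<close> and \<open>X_r\<close>\<close>

text \<open>All functions on a set form the ambient vector space, in which the spaces of elements
  are subspaces.\<close>

instantiation "fun" :: (type, real_vector) real_vector
begin

definition scaleR_fun :: "real \<Rightarrow> ('a \<Rightarrow> 'b) \<Rightarrow> 'a \<Rightarrow> 'b" where
  "scaleR_fun c f = (\<lambda>x. c *\<^sub>R f x)"

instance
  by standard (auto simp: scaleR_fun_def fun_eq_iff scaleR_add_left scaleR_add_right)

end

lemma scaleR_fun_apply [simp]: "(c *\<^sub>R f) x = c *\<^sub>R f x"
  by (simp add: scaleR_fun_def)

lemma sum_fun_apply: "(\<Sum>i\<in>I. f i) x = (\<Sum>i\<in>I. f i x)" for f :: "'i \<Rightarrow> 'a \<Rightarrow> 'b::comm_monoid_add"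
  by (induction I rule: infinite_finite_induct) auto

lemma ennreal_suminf_tail:
  fixes a :: "nat \<Rightarrow> real"
  assumes "(\<Sum>n. ennreal \<bar>a n\<bar>) < \<infinity>"
  shows "summable (\<lambda>n. \<bar>a n\<bar>)"
    "ennreal \<bar>suminf a - (\<Sum>k<n. a k)\<bar> \<le> (\<Sum>k. ennreal \<bar>a (k + n)\<bar>)"
proof -
  show s: "summable (\<lambda>n. \<bar>a n\<bar>)"
    using assms by (intro summable_suminf_not_top) auto
  then have s': "summable (\<lambda>k. \<bar>a (k + n)\<bar>)" by (rule summable_ignore_initial_segment)
  have "suminf a - (\<Sum>k<n. a k) = (\<Sum>k. a (k + n))"
    using suminf_minus_initial_segment[of a n] s summable_rabs_cancel by fastforce
  also have "\<bar>\<dots>\<bar> \<le> (\<Sum>k. \<bar>a (k + n)\<bar>)" by (rule summable_rabs[OF s'])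
  finally have "ennreal \<bar>suminf a - (\<Sum>k<n. a k)\<bar> \<le> ennreal (\<Sum>k. \<bar>a (k + n)\<bar>)" by (rule ennreal_leI)
  also have "\<dots> = (\<Sum>k. ennreal \<bar>a (k + n)\<bar>)" by (rule suminf_ennreal2[OF _ s', symmetric]) simp
  finally show "ennreal \<bar>suminf a - (\<Sum>k<n. a k)\<bar> \<le> (\<Sum>k. ennreal \<bar>a (k + n)\<bar>)" .
qed

text \<open>What an \<open>fspace\<close> has to satisfy for its elements and its norm to form a
  seminormed space.\<close>

definition fs_lin :: "'p fspace \<Rightarrow> bool" where
  "fs_lin X \<longleftrightarrow> (\<lambda>_. 0) \<in> elems X \<and>
     (\<forall>f\<in>elems X. \<forall>g\<in>elems X. \<forall>c d. (\<lambda>p. c * f p + d * g p) \<in> elems X) \<and>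
     (\<forall>f\<in>elems X. nrm X f < \<infinity>) \<and>
     (\<forall>f\<in>elems X. \<forall>g\<in>elems X. nrm X (\<lambda>p. f p + g p) \<le> nrm X f + nrm X g) \<and>
     (\<forall>f\<in>elems X. \<forall>c. nrm X (\<lambda>p. c * f p) = ennreal \<bar>c\<bar> * nrm X f)"

text \<open>An infinite norm becomes 0 here, so the real value is informative on elements
  only.\<close>

definition rnrm :: "'p fspace \<Rightarrow> ('p \<Rightarrow> real) \<Rightarrow> real" where
  "rnrm X f = enn2real (nrm X f)"

lemma fs_lin_nrm: "fs_lin X \<Longrightarrow> f \<in> elems X \<Longrightarrow> nrm X f = ennreal (rnrm X f)"
  by (auto simp: fs_lin_def rnrm_def ennreal_enn2real_if top.not_eq_extremum)

lemma fs_lin_seminormed: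
  assumes X: "fs_lin X" shows "seminormed (elems X) (rnrm X)"
proof
  have c: "(\<lambda>p. c * f p + d * g p) \<in> elems X" if "f \<in> elems X" "g \<in> elems X" for f g c d
    using X that by (auto simp: fs_lin_def)
  show "subspace (elems X)"
  proof (rule subspaceI)
    show "0 \<in> elems X" using X by (simp add: fs_lin_def zero_fun_def)
    show "f + g \<in> elems X" if "f \<in> elems X" "g \<in> elems X" for f g
      using c[OF that, of 1 1] by (simp add: plus_fun_def)
    show "k *\<^sub>R f \<in> elems X" if "f \<in> elems X" for f k
      using c[OF that that, of k 0] by (simp add: scaleR_fun_def)
  qed
  fix f assume f: "f \<in> elems X"
  show "rnrm X (k *\<^sub>R f) = \<bar>k\<bar> * rnrm X f" for k
    using X f by (auto simp: fs_lin_def rnrm_def scaleR_fun_def enn2real_mult)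
  fix g assume g: "g \<in> elems X"
  have "nrm X (f + g) \<le> nrm X f + nrm X g" using X f g by (auto simp: fs_lin_def plus_fun_def)
  moreover have "nrm X f < top" "nrm X g < top" using X f g by (auto simp: fs_lin_def)
  ultimately have "enn2real (nrm X (f + g)) \<le> enn2real (nrm X f + nrm X g)"
    by (intro enn2real_mono) auto
  also have "\<dots> = enn2real (nrm X f) + enn2real (nrm X g)"
    using \<open>nrm X f < top\<close> \<open>nrm X g < top\<close> by (rule enn2real_plus)
  finally show "rnrm X (f + g) \<le> rnrm X f + rnrm X g" by (simp add: rnrm_def)
qed

section \<open>The space of functions of x\<close>

locale space_setting =
  fixes i :: nat and \<Omega> :: "(real^'n) set"
  assumes i01: "i \<in> {0, 1}" and dom: "(open \<Omega> \<and> bounded \<Omega>) \<or> \<Omega> = UNIV"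
begin

abbreviation "E \<equiv> X_x i \<Omega>"

lemma open_\<Omega>: "open \<Omega>" using dom by auto
lemma borel_\<Omega>: "\<Omega> \<in> sets borel" using open_\<Omega> by simp
lemma leb_\<Omega>: "\<Omega> \<in> sets lebesgue" using borel_\<Omega> by simp

lemma E_L1: "i = 1 \<Longrightarrow> E = L1_space \<Omega>" and E_C0: "i \<noteq> 1 \<Longrightarrow> E = C0_space \<Omega>"
  by (auto simp: X_x_def)

lemma X_x_1: "X_x (Suc 0) \<Omega> = L1_space \<Omega>" by (simp add: X_x_def)

lemma C0_cont: "f \<in> elems (C0_space \<Omega>) \<Longrightarrow> continuous_on (closure \<Omega>) f"
  by (simp add: C0_space_def)

lemma E_measurable: "f \<in> elems E \<Longrightarrow> f \<in> borel_measurable (lebesgue_on \<Omega>)"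
proof (cases "i = 1")
  case False
  assume "f \<in> elems E"
  then have "continuous_on \<Omega> f" using E_C0[OF False] C0_cont continuous_on_subset closure_subset by metis
  then show ?thesis using leb_\<Omega> by (rule continuous_imp_measurable_on_sets_lebesgue)
qed (auto simp: X_x_1 L1_space_def)

lemma C0_bounded:
  assumes f: "f \<in> elems (C0_space \<Omega>)"
  obtains C where "C \<ge> 0" "\<And>x. x \<in> closure \<Omega> \<Longrightarrow> \<bar>f x\<bar> \<le> C"
proof -
  have c: "continuous_on (closure \<Omega>) f" using f by (rule C0_cont)
  have "\<exists>C. \<forall>x\<in>closure \<Omega>. \<bar>f x\<bar> \<le> C"
    using dom
  proof
    assume "open \<Omega> \<and> bounded \<Omega>"
    then have "compact (f ` closure \<Omega>)" by (intro compact_continuous_image c) (auto simp: compact_closure)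
    then have "bounded (f ` closure \<Omega>)" by (rule compact_imp_bounded)
    then show ?thesis by (auto simp: bounded_iff)
  next
    assume U: "\<Omega> = UNIV"
    then have "(f \<longlongrightarrow> 0) at_infinity" using f by (simp add: C0_space_def)
    then have "\<forall>\<^sub>F x in at_infinity. dist (f x) 0 < 1" by (rule tendstoD) simp
    then obtain b where b: "\<And>x. norm x \<ge> b \<Longrightarrow> \<bar>f x\<bar> < 1" by (auto simp: eventually_at_infinity)
    have "compact (f ` cball 0 b)"
      by (intro compact_continuous_image continuous_on_subset[OF c]) (auto simp: U)
    then have "bounded (f ` cball 0 b)" by (rule compact_imp_bounded)
    then obtain C where "\<forall>y\<in>f ` cball 0 b. norm y \<le> C" unfolding bounded_iff by blast
    then have C: "\<And>x. norm x \<le> b \<Longrightarrow> \<bar>f x\<bar> \<le> C" by simp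
    have "\<bar>f x\<bar> \<le> max C 1" for x using b[of x] C[of x] by (cases "norm x \<le> b") auto
    then show ?thesis by blast
  qed
  then obtain C where C: "\<And>x. x \<in> closure \<Omega> \<Longrightarrow> \<bar>f x\<bar> \<le> C" by blast
  have "\<bar>f x\<bar> \<le> \<bar>C\<bar>" if "x \<in> closure \<Omega>" for x using C[OF that] by simp
  then show thesis using that[of "\<bar>C\<bar>"] by simp
qed

text \<open>The set where the continuous h exceeds c is open in \<Omega> and null, hence empty, and
  continuity extends the bound to the closure. Almost everywhere statements thereby yield statements
  on the supremum norm, and the cases i = 0 and i = 1 can be treated alike.\<close>

lemma AE_le_closure:
  assumes h: "continuous_on (closure \<Omega>) h" and ae: "AE x in lebesgue_on \<Omega>. h x \<le> (c::real)" and x: "x \<in> closure \<Omega>"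
  shows "h x \<le> c"
proof -
  have cO: "continuous_on \<Omega> h" using h continuous_on_subset closure_subset by blast
  define S where "S = {x \<in> \<Omega>. h x > c}"
  have "S = \<Omega> \<inter> h -` {c<..}" by (auto simp: S_def)
  then have "open S" using continuous_open_preimage[OF cO open_\<Omega>, of "{c<..}"] by simp
  moreover have "S \<in> null_sets lebesgue"
  proof -
    have "AE x in lebesgue. x \<in> \<Omega> \<longrightarrow> h x \<le> c"
      using ae leb_\<Omega> by (subst (asm) AE_restrict_space_iff) auto
    then have "{x \<in> space lebesgue. \<not> (x \<in> \<Omega> \<longrightarrow> h x \<le> c)} \<in> null_sets lebesgue"
      by (simp add: completion.AE_iff_null_sets)
    moreover have "{x \<in> space lebesgue. \<not> (x \<in> \<Omega> \<longrightarrow> h x \<le> c)} = S" by (auto simp: S_def)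
    ultimately show ?thesis by simp
  qed
  then have "negligible S" by (simp add: negligible_iff_null_sets)
  ultimately have "S = {}" using open_not_negligible by blast
  then have "\<And>x. x \<in> \<Omega> \<Longrightarrow> h x \<le> c" by (auto simp: S_def not_less[symmetric])
  then show ?thesis by (rule continuous_le_on_closure[OF h x])
qed

lemma E_nrm_mono:
  assumes f: "f \<in> elems E" and g: "g \<in> elems E" and ae: "AE x in lebesgue_on \<Omega>. \<bar>f x\<bar> \<le> \<bar>g x\<bar>"
  shows "nrm E f \<le> nrm E g"
proof (cases "i = 1")
  case True
  then show ?thesis using ae by (auto simp: X_x_1 L1_space_def intro!: nn_integral_mono_AE elim: eventually_mono)
next
  case False
  have "continuous_on (closure \<Omega>) f" "continuous_on (closure \<Omega>) g" using f g C0_cont E_C0[OF False] by auto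
  then have c: "continuous_on (closure \<Omega>) (\<lambda>x. \<bar>f x\<bar> - \<bar>g x\<bar>)" by (intro continuous_intros)
  have "\<bar>f x\<bar> - \<bar>g x\<bar> \<le> 0" if "x \<in> closure \<Omega>" for x
    by (rule AE_le_closure[OF c _ that]) (use ae in \<open>auto elim: eventually_mono\<close>)
  then show ?thesis
    by (auto simp: E_C0[OF False] C0_space_def intro!: SUP_mono' ennreal_leI SUP_mono)
qed

lemma E_cone_iff: "f \<in> elems E \<Longrightarrow> f \<in> cone E \<longleftrightarrow> (AE x in lebesgue_on \<Omega>. 0 \<le> f x)"
proof (cases "i = 1")
  case False
  assume f: "f \<in> elems E"
  have "continuous_on (closure \<Omega>) (\<lambda>x. - f x)" using f C0_cont E_C0[OF False] by (intro continuous_intros) auto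
  note * = AE_le_closure[OF this, of 0]
  show ?thesis
  proof
    assume "f \<in> cone E"
    then show "AE x in lebesgue_on \<Omega>. 0 \<le> f x"
      using closure_subset[of \<Omega>] by (intro AE_I2) (auto simp: E_C0[OF False] C0_space_def)
  next
    assume "AE x in lebesgue_on \<Omega>. 0 \<le> f x"
    then show "f \<in> cone E" using * by (auto simp: E_C0[OF False] C0_space_def)
  qed
qed (simp add: X_x_1 L1_space_def)

lemma E_abs: "f \<in> elems E \<Longrightarrow> (\<lambda>x. \<bar>f x\<bar>) \<in> elems E"
  by (cases "i = 1") (auto simp: X_x_1 L1_space_def E_C0 C0_space_def intro!: continuous_intros tendsto_rabs_zero)

lemma E_fs_lin: "fs_lin E"
proof (cases "i = 1")
  case True
  show ?thesis
    unfolding fs_lin_def E_L1[OF True]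
  proof (intro conjI ballI allI)
    show "(\<lambda>_. 0) \<in> elems (L1_space \<Omega>)" by (simp add: L1_space_def)
    fix f :: "real^'n \<Rightarrow> real" assume f: "f \<in> elems (L1_space \<Omega>)"
    then show "nrm (L1_space \<Omega>) f < \<infinity>" by (simp add: L1_space_def integrable_iff_bounded)
    have fm: "f \<in> borel_measurable (lebesgue_on \<Omega>)" using f by (simp add: L1_space_def)
    show "nrm (L1_space \<Omega>) (\<lambda>x. c * f x) = ennreal \<bar>c\<bar> * nrm (L1_space \<Omega>) f" for c
      unfolding L1_space_def fspace.simps
      using fm by (subst nn_integral_cmult[symmetric]) (auto simp: abs_mult ennreal_mult)
    fix g :: "real^'n \<Rightarrow> real" assume g: "g \<in> elems (L1_space \<Omega>)"
    show "(\<lambda>x. c * f x + d * g x) \<in> elems (L1_space \<Omega>)" for c d using f g by (simp add: L1_space_def)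
    have gm: "g \<in> borel_measurable (lebesgue_on \<Omega>)" using g by (simp add: L1_space_def)
    have "(\<integral>\<^sup>+x. ennreal \<bar>f x + g x\<bar> \<partial>lebesgue_on \<Omega>) \<le> (\<integral>\<^sup>+x. ennreal \<bar>f x\<bar> + ennreal \<bar>g x\<bar> \<partial>lebesgue_on \<Omega>)"
      by (intro nn_integral_mono) (simp add: ennreal_plus[symmetric] abs_triangle_ineq del: ennreal_plus)
    also have "\<dots> = (\<integral>\<^sup>+x. ennreal \<bar>f x\<bar> \<partial>lebesgue_on \<Omega>) + (\<integral>\<^sup>+x. ennreal \<bar>g x\<bar> \<partial>lebesgue_on \<Omega>)"
      using fm gm by (intro nn_integral_add) auto
    finally show "nrm (L1_space \<Omega>) (\<lambda>x. f x + g x) \<le> nrm (L1_space \<Omega>) f + nrm (L1_space \<Omega>) g"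
      by (simp add: L1_space_def)
  qed
next
  case False
  have lin: "(\<lambda>x. c * f x + d * g x) \<in> elems (C0_space \<Omega>)"
    if "f \<in> elems (C0_space \<Omega>)" "g \<in> elems (C0_space \<Omega>)" for f g c d
    using that by (auto simp: C0_space_def intro!: continuous_intros tendsto_add_zero tendsto_mult_right_zero)
  have fin: "nrm (C0_space \<Omega>) f < \<infinity>" if f: "f \<in> elems (C0_space \<Omega>)" for f
  proof -
    obtain C where C: "C \<ge> 0" "\<And>x. x \<in> closure \<Omega> \<Longrightarrow> \<bar>f x\<bar> \<le> C" using C0_bounded[OF f] by blast
    have "nrm (C0_space \<Omega>) f \<le> ennreal C"
      using C by (auto simp: C0_space_def intro!: SUP_least ennreal_leI)
    then show ?thesis using le_less_trans by fastforce
  qed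
  have add: "nrm (C0_space \<Omega>) (\<lambda>x. f x + g x) \<le> nrm (C0_space \<Omega>) f + nrm (C0_space \<Omega>) g" for f g
    unfolding C0_space_def fspace.simps
  proof (rule SUP_least)
    fix x assume x: "x \<in> closure \<Omega>"
    have "ennreal \<bar>f x + g x\<bar> \<le> ennreal \<bar>f x\<bar> + ennreal \<bar>g x\<bar>"
      by (simp add: ennreal_plus[symmetric] abs_triangle_ineq del: ennreal_plus)
    also have "\<dots> \<le> (SUP x\<in>closure \<Omega>. ennreal \<bar>f x\<bar>) + (SUP x\<in>closure \<Omega>. ennreal \<bar>g x\<bar>)"
      using x by (intro add_mono SUP_upper)
    finally show "ennreal \<bar>f x + g x\<bar> \<le> (SUP x\<in>closure \<Omega>. ennreal \<bar>f x\<bar>) + (SUP x\<in>closure \<Omega>. ennreal \<bar>g x\<bar>)" .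
  qed
  have sc: "nrm (C0_space \<Omega>) (\<lambda>x. c * f x) = ennreal \<bar>c\<bar> * nrm (C0_space \<Omega>) f" for c f
    unfolding C0_space_def fspace.simps by (simp add: abs_mult ennreal_mult SUP_mult_left_ennreal)
  have "(\<lambda>_. 0) \<in> elems (C0_space \<Omega>)" by (simp add: C0_space_def)
  then show ?thesis unfolding fs_lin_def E_C0[OF False] by (intro conjI ballI allI lin fin add sc)
qed

sublocale E: seminormed "elems E" "rnrm E"
  by (rule fs_lin_seminormed[OF E_fs_lin])

lemma E_nrm: "f \<in> elems E \<Longrightarrow> nrm E f = ennreal (rnrm E f)"
  by (rule fs_lin_nrm[OF E_fs_lin])

text \<open>In both spaces the sum is the pointwise series. For integrable functions it converges
  off a null set by Tonelli; for continuous functions it converges uniformly by the Weierstrass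
  test, which keeps continuity and the limit 0 at infinity.\<close>

lemma E_suminf:
  assumes u: "\<And>n. u n \<in> elems E" and fin: "(\<Sum>n. nrm E (u n)) < \<infinity>"
  shows "(\<lambda>x. \<Sum>n. u n x) \<in> elems E"
    "nrm E (\<lambda>x. (\<Sum>n. u n x) - (\<Sum>k<m. u k x)) \<le> (\<Sum>k. nrm E (u (k + m)))"
proof -
  note um = E_measurable[OF u]
  have "(\<lambda>x. \<Sum>n. u n x) \<in> elems E \<and>
    nrm E (\<lambda>x. (\<Sum>n. u n x) - (\<Sum>k<m. u k x)) \<le> (\<Sum>k. nrm E (u (k + m)))"
  proof (cases "i = 1")
    case True
    have "(\<integral>\<^sup>+x. (\<Sum>n. ennreal \<bar>u n x\<bar>) \<partial>lebesgue_on \<Omega>) = (\<Sum>n. nrm E (u n))"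
      using um by (subst nn_integral_suminf) (auto simp: E_L1[OF True] L1_space_def)
    then have fi: "(\<integral>\<^sup>+x. (\<Sum>n. ennreal \<bar>u n x\<bar>) \<partial>lebesgue_on \<Omega>) < \<infinity>" using fin by simp
    have ae: "AE x in lebesgue_on \<Omega>. (\<Sum>n. ennreal \<bar>u n x\<bar>) < \<infinity>"
      using nn_integral_PInf_AE[of "\<lambda>x. \<Sum>n. ennreal \<bar>u n x\<bar>"] fi um by (auto simp: less_top)
    have sm: "(\<lambda>x. \<Sum>n. u n x) \<in> borel_measurable (lebesgue_on \<Omega>)" using um by (intro borel_measurable_suminf)
    have "(\<integral>\<^sup>+x. ennreal \<bar>\<Sum>n. u n x\<bar> \<partial>lebesgue_on \<Omega>) \<le> (\<integral>\<^sup>+x. (\<Sum>n. ennreal \<bar>u n x\<bar>) \<partial>lebesgue_on \<Omega>)"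
    proof (rule nn_integral_mono_AE)
      show "AE x in lebesgue_on \<Omega>. ennreal \<bar>\<Sum>n. u n x\<bar> \<le> (\<Sum>n. ennreal \<bar>u n x\<bar>)"
        using ae by eventually_elim (use ennreal_suminf_tail(2)[where n=0] in force)
    qed
    then have "integrable (lebesgue_on \<Omega>) (\<lambda>x. \<Sum>n. u n x)"
      using sm fi by (intro integrableI_bounded) (auto intro: le_less_trans)
    moreover have "nrm E (\<lambda>x. (\<Sum>n. u n x) - (\<Sum>k<m. u k x)) \<le> (\<integral>\<^sup>+x. (\<Sum>k. ennreal \<bar>u (k + m) x\<bar>) \<partial>lebesgue_on \<Omega>)"
      unfolding E_L1[OF True] L1_space_def fspace.simps
    proof (rule nn_integral_mono_AE)
      show "AE x in lebesgue_on \<Omega>. ennreal \<bar>(\<Sum>n. u n x) - (\<Sum>k<m. u k x)\<bar> \<le> (\<Sum>k. ennreal \<bar>u (k + m) x\<bar>)"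
        using ae by eventually_elim (rule ennreal_suminf_tail(2))
    qed
    moreover have "(\<integral>\<^sup>+x. (\<Sum>k. ennreal \<bar>u (k + m) x\<bar>) \<partial>lebesgue_on \<Omega>) = (\<Sum>k. nrm E (u (k + m)))"
      using um by (subst nn_integral_suminf) (auto simp: E_L1[OF True] L1_space_def)
    ultimately show ?thesis by (simp add: E_L1[OF True] L1_space_def)
  next
    case False
    note E = E_C0[OF False]
    define Mn where "Mn n = rnrm E (u n)" for n
    have nM: "nrm E (u n) = ennreal (Mn n)" for n unfolding Mn_def by (rule E_nrm[OF u])
    have M0: "Mn n \<ge> 0" for n by (simp add: Mn_def rnrm_def)
    have sM: "summable Mn" using fin unfolding nM using M0 by (intro summable_suminf_not_top) auto
    have le: "\<bar>u n x\<bar> \<le> Mn n" if "x \<in> closure \<Omega>" for n x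
    proof -
      have "ennreal \<bar>u n x\<bar> \<le> nrm E (u n)" unfolding E C0_space_def fspace.simps using that by (rule SUP_upper)
      then show ?thesis unfolding nM using M0 by simp
    qed
    have fx: "(\<Sum>n. ennreal \<bar>u n x\<bar>) < \<infinity>" if "x \<in> closure \<Omega>" for x
    proof -
      have "(\<Sum>n. ennreal \<bar>u n x\<bar>) \<le> (\<Sum>n. nrm E (u n))"
        unfolding nM using le[OF that] by (intro suminf_le ennreal_leI) auto
      then show ?thesis using fin by (rule le_less_trans)
    qed
    have tl: "ennreal \<bar>(\<Sum>n. u n x) - (\<Sum>k<m. u k x)\<bar> \<le> (\<Sum>k. nrm E (u (k + m)))" if "x \<in> closure \<Omega>" for x m
    proof -
      have "ennreal \<bar>(\<Sum>n. u n x) - (\<Sum>k<m. u k x)\<bar> \<le> (\<Sum>k. ennreal \<bar>u (k + m) x\<bar>)"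
        by (rule ennreal_suminf_tail(2)[OF fx[OF that]])
      also have "\<dots> \<le> (\<Sum>k. nrm E (u (k + m)))"
        unfolding nM using le[OF that] by (intro suminf_le ennreal_leI) auto
      finally show ?thesis .
    qed
    have ul: "uniform_limit (closure \<Omega>) (\<lambda>n x. \<Sum>k<n. u k x) (\<lambda>x. \<Sum>n. u n x) sequentially"
      by (rule Weierstrass_m_test[OF _ sM]) (use le in auto)
    have cs: "continuous_on (closure \<Omega>) (\<lambda>x. \<Sum>k<n. u k x)" for n
      using u C0_cont E by (intro continuous_on_sum) auto
    have "continuous_on (closure \<Omega>) (\<lambda>x. \<Sum>n. u n x)"
      by (rule uniform_limit_theorem[OF _ ul]) (use cs in auto)
    moreover have "((\<lambda>x. \<Sum>n. u n x) \<longlongrightarrow> 0) at_infinity" if U: "\<Omega> = UNIV"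
    proof (rule tendstoI)
      fix e :: real assume e: "e > 0"
      obtain n where n: "\<And>x. \<bar>(\<Sum>k<n. u k x) - (\<Sum>n. u n x)\<bar> < e/2"
        using uniform_limitD[OF ul, of "e/2"] e U by (auto simp: eventually_sequentially dist_real_def)
      have "((\<lambda>x. \<Sum>k<n. u k x) \<longlongrightarrow> (\<Sum>k<n. 0)) at_infinity"
        using u U E by (intro tendsto_sum) (auto simp: C0_space_def)
      then have "((\<lambda>x. \<Sum>k<n. u k x) \<longlongrightarrow> 0) at_infinity" by simp
      from tendstoD[OF this half_gt_zero[OF e]]
      show "\<forall>\<^sub>F x in at_infinity. dist (\<Sum>n. u n x) 0 < e"
      proof eventually_elim
        case (elim x)
        then show ?case using n[of x] unfolding dist_real_def by linarith
      qed
    qed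
    moreover have "nrm E (\<lambda>x. (\<Sum>n. u n x) - (\<Sum>k<m. u k x)) \<le> (\<Sum>k. nrm E (u (k + m)))"
      using tl unfolding E C0_space_def fspace.simps by (intro SUP_least) auto
    ultimately show ?thesis unfolding E by (simp add: C0_space_def)
  qed
  then show "(\<lambda>x. \<Sum>n. u n x) \<in> elems E"
    "nrm E (\<lambda>x. (\<Sum>n. u n x) - (\<Sum>k<m. u k x)) \<le> (\<Sum>k. nrm E (u (k + m)))" by auto
qed

text \<open>In L_1 this is monotonicity and Tonelli. For the supremum norm the right-hand side
  bounds |v x| for almost every x first, and continuity of v extends the bound to the
  closure.\<close>

lemma Minkowski_integral_inequality:
  fixes w :: "(real^'n) \<times> real \<Rightarrow> real" and k :: "real \<Rightarrow> real"
  assumes v: "v \<in> elems E"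
    and w: "w \<in> borel_measurable (lebesgue_on (\<Omega> \<times> {0..}))" and k: "k \<in> borel_measurable (lebesgue_on {0..})"
    and le: "AE x in lebesgue_on \<Omega>. ennreal \<bar>v x\<bar> \<le> (\<integral>\<^sup>+s. ennreal (k s) * ennreal \<bar>w (x, s)\<bar> \<partial>lebesgue_on {0..})"
  shows "nrm E v \<le> (\<integral>\<^sup>+s. ennreal (k s) * nrm E (\<lambda>x. w (x, s)) \<partial>lebesgue_on {0..})"
proof (cases "i = 1")
  case True
  have km: "(\<lambda>p. k (snd p)) \<in> borel_measurable (lebesgue_on (\<Omega> \<times> {0..}))"
    by (rule measurable_compose[OF measurable_projections_lebesgue(2) k])
  have m: "(\<lambda>p. ennreal (k (snd p)) * ennreal \<bar>w p\<bar>) \<in> borel_measurable (lebesgue_on (\<Omega> \<times> {0..}))"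
    using km w by measurable
  have at: "{0..} \<in> sets (borel :: real measure)" by simp
  have "nrm E v = (\<integral>\<^sup>+x. ennreal \<bar>v x\<bar> \<partial>lebesgue_on \<Omega>)" by (simp add: E_L1[OF True] L1_space_def)
  also have "\<dots> \<le> (\<integral>\<^sup>+x. (\<integral>\<^sup>+s. ennreal (k s) * ennreal \<bar>w (x, s)\<bar> \<partial>lebesgue_on {0..}) \<partial>lebesgue_on \<Omega>)"
    using le by (rule nn_integral_mono_AE)
  also have "\<dots> = (\<integral>\<^sup>+s. (\<integral>\<^sup>+x. ennreal (k s) * ennreal \<bar>w (x, s)\<bar> \<partial>lebesgue_on \<Omega>) \<partial>lebesgue_on {0..})"
    using measurable_sections_lebesgue(5)[OF borel_\<Omega> at m] by simp
  also have "\<dots> = (\<integral>\<^sup>+s. ennreal (k s) * nrm E (\<lambda>x. w (x, s)) \<partial>lebesgue_on {0..})"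
  proof (rule nn_integral_cong_AE)
    show "AE s in lebesgue_on {0..}. (\<integral>\<^sup>+x. ennreal (k s) * ennreal \<bar>w (x, s)\<bar> \<partial>lebesgue_on \<Omega>) =
        ennreal (k s) * nrm E (\<lambda>x. w (x, s))"
      using real_measurable_sections_lebesgue(2)[OF borel_\<Omega> at w]
    proof eventually_elim
      case (elim s)
      then have "(\<integral>\<^sup>+x. ennreal (k s) * ennreal \<bar>w (x, s)\<bar> \<partial>lebesgue_on \<Omega>) =
          ennreal (k s) * (\<integral>\<^sup>+x. ennreal \<bar>w (x, s)\<bar> \<partial>lebesgue_on \<Omega>)"
        by (intro nn_integral_cmult) auto
      then show ?case by (simp add: E_L1[OF True] L1_space_def)
    qed
  qed
  finally show ?thesis .
next
  case False
  note E = E_C0[OF False]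
  let ?I = "\<integral>\<^sup>+s. ennreal (k s) * nrm E (\<lambda>x. w (x, s)) \<partial>lebesgue_on {0..}"
  have ae: "AE x in lebesgue_on \<Omega>. ennreal \<bar>v x\<bar> \<le> ?I"
    using le AE_space
  proof eventually_elim
    case (elim x)
    then have x: "x \<in> closure \<Omega>" using closure_subset by auto
    have "(\<integral>\<^sup>+s. ennreal (k s) * ennreal \<bar>w (x, s)\<bar> \<partial>lebesgue_on {0..}) \<le> ?I"
      unfolding E C0_space_def fspace.simps using x by (intro nn_integral_mono mult_left_mono SUP_upper) auto
    with elim show ?case by (rule_tac order_trans)
  qed
  show ?thesis
  proof (cases "?I = \<infinity>")
    case fin: False
    then obtain c where c: "?I = ennreal c" "c \<ge> 0" by (cases ?I) auto
    have "\<bar>v x\<bar> \<le> c" if "x \<in> closure \<Omega>" for x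
    proof (rule AE_le_closure[OF _ _ that, of "\<lambda>x. \<bar>v x\<bar>"])
      show "continuous_on (closure \<Omega>) (\<lambda>x. \<bar>v x\<bar>)" using v C0_cont unfolding E by (intro continuous_intros) auto
      show "AE x in lebesgue_on \<Omega>. \<bar>v x\<bar> \<le> c" using ae unfolding c(1) using c(2) by (auto elim: eventually_mono)
    qed
    then show ?thesis unfolding c(1) unfolding E C0_space_def fspace.simps by (intro SUP_least ennreal_leI)
  qed simp
qed

end

section \<open>The half line of masses and its weighted measures\<close>

abbreviation Lm :: "real measure" where "Lm \<equiv> lebesgue_on {0..}"

lemma half_line_lebesgue: "{0..} \<in> sets (lebesgue :: real measure)" by simp

interpretation Lm: complete_measure Lm
  by (rule complete_measure_lebesgue_on[OF half_line_lebesgue])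

lemma borel_measurable_Lm: "f \<in> borel_measurable borel \<Longrightarrow> f \<in> borel_measurable Lm"
  by (intro measurable_restrict_space1 measurable_completion) simp

lemma dm_weight_measurable [measurable]: "(\<lambda>m. ennreal (1 + m powr r)) \<in> borel_measurable Lm"
  by (rule borel_measurable_Lm) measurable

lemma AE_dm_iff: "(AE m in dm r. P m) \<longleftrightarrow> (AE m in Lm. P m)"
proof -
  have "0 < ennreal (1 + m powr r)" for m :: real using powr_ge_zero[of m r] by (simp add: add_pos_nonneg)
  then show ?thesis unfolding dm_def by (subst AE_density[OF dm_weight_measurable]) (simp only: simp_thms)
qed

lemma sets_dm [measurable_cong, simp]: "sets (dm r) = sets Lm" and space_dm [simp]: "space (dm r) = {0..}"
  by (auto simp: dm_def)

lemma nn_integral_dm: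
  "f \<in> borel_measurable Lm \<Longrightarrow> (\<integral>\<^sup>+m. f m \<partial>dm r) = (\<integral>\<^sup>+m. ennreal (1 + m powr r) * f m \<partial>Lm)"
  unfolding dm_def by (rule nn_integral_density[OF dm_weight_measurable])

lemma strongly_measurable_dm: "strongly_measurable (dm r) X u \<longleftrightarrow> strongly_measurable Lm X u"
  unfolding strongly_measurable_def AE_dm_iff by (simp add: simple_function_def)

lemma ennreal_suminf_tail_tendsto:
  fixes a :: "nat \<Rightarrow> ennreal"
  assumes "(\<Sum>n. a n) < \<infinity>"
  shows "(\<lambda>n. \<Sum>k. a (k + n)) \<longlonglongrightarrow> 0"
proof -
  have "a n \<noteq> top" for n
    using assms ennreal_suminf_lessD[of a top n] by auto
  then have a: "a n = ennreal (enn2real (a n))" for n by (simp add: less_top)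
  define b where "b n = enn2real (a n)" for n
  have b0: "b n \<ge> 0" for n by (simp add: b_def)
  have ab: "a = (\<lambda>n. ennreal (b n))" using a by (auto simp: b_def)
  have s: "summable b" using assms unfolding ab using b0 by (intro summable_suminf_not_top) auto
  have "(\<lambda>n. ennreal (suminf b - (\<Sum>k<n. b k))) \<longlonglongrightarrow> ennreal (suminf b - suminf b)"
    by (intro tendsto_ennrealI tendsto_diff tendsto_const summable_LIMSEQ s)
  moreover have "ennreal (suminf b - (\<Sum>k<n. b k)) = (\<Sum>k. a (k + n))" for n
    unfolding ab suminf_minus_initial_segment[OF s, symmetric]
    by (rule suminf_ennreal2[symmetric]) (use b0 s in \<open>auto intro: summable_ignore_initial_segment\<close>)
  ultimately show ?thesis by simp
qed

lemma AE_summable_of_nn_integral: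
  fixes g :: "nat \<Rightarrow> 'a \<Rightarrow> ennreal"
  assumes "\<And>n. g n \<in> borel_measurable M" "(\<Sum>n. \<integral>\<^sup>+x. g n x \<partial>M) < \<infinity>"
  shows "AE x in M. (\<Sum>n. g n x) < \<infinity>"
proof -
  have "(\<integral>\<^sup>+x. (\<Sum>n. g n x) \<partial>M) < \<infinity>" using assms by (subst nn_integral_suminf) auto
  then have "AE x in M. (\<Sum>n. g n x) \<noteq> \<infinity>"
    using assms(1) by (intro nn_integral_PInf_AE) auto
  then show ?thesis by (simp add: less_top)
qed

section \<open>Strong measurability and the spaces X_r\<close>

context space_setting
begin

lemma E_nrm_fun:
  "f \<in> elems E \<Longrightarrow> g \<in> elems E \<Longrightarrow> nrm E (\<lambda>x. f x - g x) = ennreal (rnrm E (f - g))"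
  using E_nrm[of "f - g"] E.V_closed(3)[of f g] by (simp add: fun_diff_def)

lemma rnrm_nonneg [simp]: "0 \<le> rnrm X f" by (simp add: rnrm_def)

abbreviation SM :: "(real \<Rightarrow> real^'n \<Rightarrow> real) \<Rightarrow> bool" where "SM \<equiv> strongly_measurable Lm E"

lemma SM_iff:
  "SM u \<longleftrightarrow> (AE m in Lm. u m \<in> elems E) \<and>
    (\<exists>s. (\<forall>n. simple_function Lm (s n)) \<and> (\<forall>n. \<forall>m\<in>{0..}. s n m \<in> elems E) \<and>
       (AE m in Lm. (\<lambda>n. rnrm E (s n m - u m)) \<longlonglongrightarrow> 0))"
proof -
  have "(AE m in Lm. (\<lambda>n. nrm E (\<lambda>x. s n m x - u m x)) \<longlonglongrightarrow> 0) \<longleftrightarrow> (AE m in Lm. (\<lambda>n. rnrm E (s n m - u m)) \<longlonglongrightarrow> 0)"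
    if u: "AE m in Lm. u m \<in> elems E" and s: "\<And>n m. m \<in> {0..} \<Longrightarrow> s n m \<in> elems E" for s :: "nat \<Rightarrow> real \<Rightarrow> real^'n \<Rightarrow> real"
  proof -
    have "AE m in Lm. (\<lambda>n. nrm E (\<lambda>x. s n m x - u m x)) \<longlonglongrightarrow> 0 \<longleftrightarrow> (\<lambda>n. rnrm E (s n m - u m)) \<longlonglongrightarrow> 0"
      using u AE_space
    proof eventually_elim
      case (elim m)
      have "nrm E (\<lambda>x. s n m x - u m x) = ennreal (rnrm E (s n m - u m))" for n
        using elim s by (intro E_nrm_fun) auto
      then show ?case by (simp add: ennreal_0[symmetric] tendsto_ennreal_iff del: ennreal_0)
    qed
    then show ?thesis by (rule eventually_subst)
  qed
  note * = this
  show ?thesis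
    unfolding strongly_measurable_def space_restrict_space
    by (intro conj_cong refl ex_cong1, simp, rule *) auto
qed

lemma SM_rnrm_measurable:
  assumes "SM u" shows "(\<lambda>m. nrm E (u m)) \<in> borel_measurable Lm" "(\<lambda>m. rnrm E (u m)) \<in> borel_measurable Lm"
proof -
  from assms obtain s where u: "AE m in Lm. u m \<in> elems E"
    and s: "\<And>n. simple_function Lm (s n)" "\<And>n m. m \<in> {0..} \<Longrightarrow> s n m \<in> elems E"
       "AE m in Lm. (\<lambda>n. rnrm E (s n m - u m)) \<longlonglongrightarrow> 0" unfolding SM_iff by blast
  show 1: "(\<lambda>m. nrm E (u m)) \<in> borel_measurable Lm"
  proof (rule Lm.measurable_ennreal_AE_limit)
    show "(\<lambda>m. nrm E (s n m)) \<in> borel_measurable Lm" for n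
      by (rule borel_measurable_simple_function) (rule simple_function_compose1[OF s(1)])
    show "AE m in Lm. (\<lambda>n. nrm E (s n m)) \<longlonglongrightarrow> nrm E (u m)"
      using u s(3) AE_space
    proof eventually_elim
      case (elim m)
      have sm: "s n m \<in> elems E" for n using elim s by auto
      have "(\<lambda>n. rnrm E (s n m) - rnrm E (u m)) \<longlonglongrightarrow> 0"
        by (rule Lim_null_comparison[OF _ elim(2)]) (use E.N_abs_diff[OF sm elim(1)] in auto)
      then have "(\<lambda>n. rnrm E (s n m)) \<longlonglongrightarrow> rnrm E (u m)" by (simp add: LIM_zero_iff)
      then show ?case unfolding E_nrm[OF sm] E_nrm[OF elim(1)] by (rule tendsto_ennrealI)
    qed
  qed
  show "(\<lambda>m. rnrm E (u m)) \<in> borel_measurable Lm" unfolding rnrm_def using 1 by measurable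
qed

text \<open>Cutting off at twice the norm of u leaves the limit unchanged and provides a majorant
  for dominated convergence. The last property replaces null values by 0, so that every nonzero
  value of a simple function has positive norm.\<close>

lemma SM_truncated:
  assumes "SM u"
  obtains s where "\<And>n. simple_function Lm (s n)" "\<And>n m. m \<in> {0..} \<Longrightarrow> s n m \<in> elems E"
    "AE m in Lm. (\<lambda>n. rnrm E (s n m - u m)) \<longlonglongrightarrow> 0"
    "\<And>n m. rnrm E (s n m) \<le> 2 * rnrm E (u m)" "\<And>n m. rnrm E (s n m) = 0 \<Longrightarrow> s n m = 0"
proof -
  from assms obtain s where u: "AE m in Lm. u m \<in> elems E"
    and s: "\<And>n. simple_function Lm (s n)" "\<And>n m. m \<in> {0..} \<Longrightarrow> s n m \<in> elems E"
       "AE m in Lm. (\<lambda>n. rnrm E (s n m - u m)) \<longlonglongrightarrow> 0" unfolding SM_iff by blast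
  note um [measurable] = SM_rnrm_measurable(2)[OF assms]
  have sm [measurable]: "(\<lambda>m. rnrm E (s n m)) \<in> borel_measurable Lm" for n
    by (rule borel_measurable_simple_function) (rule simple_function_compose1[OF s(1)])
  have z: "rnrm E 0 = 0" by (rule E.N_zero)
  define S where "S n m = (if 0 < rnrm E (s n m) \<and> rnrm E (s n m) \<le> 2 * rnrm E (u m) then s n m else 0)" for n m
  show thesis
  proof (rule that[of S])
    show "simple_function Lm (S n)" for n
      unfolding S_def
    proof (rule simple_function_If)
      show "simple_function Lm (s n)" by (rule s)
      show "simple_function Lm (\<lambda>_. 0 :: real^'n \<Rightarrow> real)" by (rule simple_function_const)
      show "{m \<in> space Lm. 0 < rnrm E (s n m) \<and> rnrm E (s n m) \<le> 2 * rnrm E (u m)} \<in> sets Lm" by measurable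
    qed
    show "S n m \<in> elems E" if "m \<in> {0..}" for n m unfolding S_def using s(2)[OF that] E.V_closed(1) by simp
    show "rnrm E (S n m) \<le> 2 * rnrm E (u m)" for n m by (simp add: S_def z)
    show "S n m = 0" if "rnrm E (S n m) = 0" for n m using that by (auto simp: S_def split: if_splits)
    show "AE m in Lm. (\<lambda>n. rnrm E (S n m - u m)) \<longlonglongrightarrow> 0"
      using u s(3) AE_space
    proof eventually_elim
      case (elim m)
      have sE: "s n m \<in> elems E" for n using elim s by auto
      show ?case
      proof (cases "rnrm E (u m) = 0")
        case True
        then have "S n m = 0" for n by (auto simp: S_def)
        then show ?thesis using True E.N_minus[OF elim(1)] by simp
      next
        case False
        then have pos: "rnrm E (u m) > 0" by (metis less_eq_real_def rnrm_nonneg)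
        have "\<forall>\<^sub>F n in sequentially. rnrm E (s n m - u m) < rnrm E (u m)"
          using order_tendstoD(2)[OF elim(2) pos] .
        then have "\<forall>\<^sub>F n in sequentially. rnrm E (s n m - u m) = rnrm E (S n m - u m)"
        proof eventually_elim
          case (elim n)
          have "\<bar>rnrm E (s n m) - rnrm E (u m)\<bar> < rnrm E (u m)"
            using E.N_abs_diff[OF sE \<open>u m \<in> elems E\<close>, of n] elim by linarith
          then have "S n m = s n m" unfolding S_def by auto
          then show ?case by simp
        qed
        then show ?thesis using elim(2) by (rule Lim_transform_eventually[rotated])
      qed
    qed
  qed
qed

lemma SM_lin:
  assumes "SM u" "SM v" shows "SM (\<lambda>m. c *\<^sub>R u m + d *\<^sub>R v m)"
proof -
  from assms(1) obtain s where u: "AE m in Lm. u m \<in> elems E"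
    and s: "\<And>n. simple_function Lm (s n)" "\<And>n m. m \<in> {0..} \<Longrightarrow> s n m \<in> elems E"
       "AE m in Lm. (\<lambda>n. rnrm E (s n m - u m)) \<longlonglongrightarrow> 0" unfolding SM_iff by blast
  from assms(2) obtain t where v: "AE m in Lm. v m \<in> elems E"
    and t: "\<And>n. simple_function Lm (t n)" "\<And>n m. m \<in> {0..} \<Longrightarrow> t n m \<in> elems E"
       "AE m in Lm. (\<lambda>n. rnrm E (t n m - v m)) \<longlonglongrightarrow> 0" unfolding SM_iff by blast
  show ?thesis
    unfolding SM_iff
  proof (intro conjI exI[of _ "\<lambda>n m. c *\<^sub>R s n m + d *\<^sub>R t n m"] allI ballI)
    show "AE m in Lm. c *\<^sub>R u m + d *\<^sub>R v m \<in> elems E" using u v by eventually_elim (intro E.V_closed)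
    show "simple_function Lm (\<lambda>m. c *\<^sub>R s n m + d *\<^sub>R t n m)" for n
      by (rule simple_function_compose2[OF s(1) t(1)])
    show "c *\<^sub>R s n m + d *\<^sub>R t n m \<in> elems E" if "m \<in> {0..}" for n m using s(2)[OF that] t(2)[OF that] by (intro E.V_closed)
    show "AE m in Lm. (\<lambda>n. rnrm E (c *\<^sub>R s n m + d *\<^sub>R t n m - (c *\<^sub>R u m + d *\<^sub>R v m))) \<longlonglongrightarrow> 0"
      using u v s(3) t(3) AE_space
    proof eventually_elim
      case (elim m)
      have V: "s n m - u m \<in> elems E" "t n m - v m \<in> elems E" for n using elim s t by (auto intro!: E.V_closed(3))
      have b: "rnrm E (c *\<^sub>R s n m + d *\<^sub>R t n m - (c *\<^sub>R u m + d *\<^sub>R v m)) \<le> \<bar>c\<bar> * rnrm E (s n m - u m) + \<bar>d\<bar> * rnrm E (t n m - v m)" for n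
      proof -
        have "c *\<^sub>R s n m + d *\<^sub>R t n m - (c *\<^sub>R u m + d *\<^sub>R v m) = c *\<^sub>R (s n m - u m) + d *\<^sub>R (t n m - v m)"
          by (simp add: algebra_simps)
        then show ?thesis using E.N_add[of "c *\<^sub>R (s n m - u m)" "d *\<^sub>R (t n m - v m)"] V[of n] E.N_scale[OF V(1)] E.N_scale[OF V(2)]
          by (metis E.V_closed(5))
      qed
      have "(\<lambda>n. \<bar>c\<bar> * rnrm E (s n m - u m) + \<bar>d\<bar> * rnrm E (t n m - v m)) \<longlonglongrightarrow> \<bar>c\<bar> * 0 + \<bar>d\<bar> * 0"
        by (intro tendsto_intros elim)
      then have "(\<lambda>n. \<bar>c\<bar> * rnrm E (s n m - u m) + \<bar>d\<bar> * rnrm E (t n m - v m)) \<longlonglongrightarrow> 0" by simp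
      then show ?case by (rule Lim_null_comparison[rotated]) (use b in auto)
    qed
  qed
qed

lemma SM_abs:
  assumes "SM u" shows "SM (\<lambda>m x. \<bar>u m x\<bar>)"
proof -
  from assms(1) obtain s where u: "AE m in Lm. u m \<in> elems E"
    and s: "\<And>n. simple_function Lm (s n)" "\<And>n m. m \<in> {0..} \<Longrightarrow> s n m \<in> elems E"
       "AE m in Lm. (\<lambda>n. rnrm E (s n m - u m)) \<longlonglongrightarrow> 0" unfolding SM_iff by blast
  show ?thesis
    unfolding SM_iff
  proof (intro conjI exI[of _ "\<lambda>n m x. \<bar>s n m x\<bar>"] allI ballI)
    show "AE m in Lm. (\<lambda>x. \<bar>u m x\<bar>) \<in> elems E" using u by eventually_elim (rule E_abs)
    show "simple_function Lm (\<lambda>m x. \<bar>s n m x\<bar>)" for n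
      using simple_function_compose1[OF s(1), of "\<lambda>f x. \<bar>f x\<bar>"] .
    show "(\<lambda>x. \<bar>s n m x\<bar>) \<in> elems E" if "m \<in> {0..}" for n m using s(2)[OF that] by (rule E_abs)
    show "AE m in Lm. (\<lambda>n. rnrm E ((\<lambda>x. \<bar>s n m x\<bar>) - (\<lambda>x. \<bar>u m x\<bar>))) \<longlonglongrightarrow> 0"
      using u s(3) AE_space
    proof eventually_elim
      case (elim m)
      have V: "s n m \<in> elems E" for n using elim s by auto
      have "rnrm E ((\<lambda>x. \<bar>s n m x\<bar>) - (\<lambda>x. \<bar>u m x\<bar>)) \<le> rnrm E (s n m - u m)" for n
      proof -
        have e: "(\<lambda>x. \<bar>s n m x\<bar>) - (\<lambda>x. \<bar>u m x\<bar>) \<in> elems E" "s n m - u m \<in> elems E"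
          using E_abs[OF V] E_abs[OF elim(1)] V elim(1) by (auto intro: E.V_closed(3))
        have "nrm E ((\<lambda>x. \<bar>s n m x\<bar>) - (\<lambda>x. \<bar>u m x\<bar>)) \<le> nrm E (s n m - u m)"
          by (rule E_nrm_mono[OF e]) (auto simp: abs_triangle_ineq3)
        then show ?thesis unfolding E_nrm[OF e(1)] E_nrm[OF e(2)] by simp
      qed
      then show ?case by (intro Lim_null_comparison[OF _ elim(2)]) auto
    qed
  qed
qed

lemma SM_mult:
  assumes "SM u" and \<alpha>: "\<alpha> \<in> borel_measurable Lm" shows "SM (\<lambda>m. \<alpha> m *\<^sub>R u m)"
proof -
  from assms(1) obtain s where u: "AE m in Lm. u m \<in> elems E"
    and s: "\<And>n. simple_function Lm (s n)" "\<And>n m. m \<in> {0..} \<Longrightarrow> s n m \<in> elems E"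
       "AE m in Lm. (\<lambda>n. rnrm E (s n m - u m)) \<longlonglongrightarrow> 0" unfolding SM_iff by blast
  obtain F where F: "\<And>k. simple_function Lm (F k)" "\<And>x. x \<in> space Lm \<Longrightarrow> (\<lambda>k. F k x) \<longlonglongrightarrow> \<alpha> x"
    using borel_measurable_implies_sequence_metric[OF \<alpha>, of 0] by blast
  show ?thesis
    unfolding SM_iff
  proof (intro conjI exI[of _ "\<lambda>n m. F n m *\<^sub>R s n m"] allI ballI)
    show "AE m in Lm. \<alpha> m *\<^sub>R u m \<in> elems E" using u by eventually_elim (intro E.V_closed)
    show "simple_function Lm (\<lambda>m. F n m *\<^sub>R s n m)" for n
      by (rule simple_function_compose2[OF F(1) s(1)])
    show "F n m *\<^sub>R s n m \<in> elems E" if "m \<in> {0..}" for n m using s(2)[OF that] by (intro E.V_closed)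
    show "AE m in Lm. (\<lambda>n. rnrm E (F n m *\<^sub>R s n m - \<alpha> m *\<^sub>R u m)) \<longlonglongrightarrow> 0"
      using u s(3) AE_space
    proof eventually_elim
      case (elim m)
      have V: "s n m - u m \<in> elems E" for n using elim s by (auto intro!: E.V_closed(3))
      have b: "rnrm E (F n m *\<^sub>R s n m - \<alpha> m *\<^sub>R u m) \<le> \<bar>F n m\<bar> * rnrm E (s n m - u m) + \<bar>F n m - \<alpha> m\<bar> * rnrm E (u m)" for n
      proof -
        have eq: "F n m *\<^sub>R s n m - \<alpha> m *\<^sub>R u m = F n m *\<^sub>R (s n m - u m) + (F n m - \<alpha> m) *\<^sub>R u m"
          by (simp add: algebra_simps)
        show ?thesis unfolding eq
          using E.N_add[OF E.V_closed(5)[OF V[of n]] E.V_closed(5)[OF elim(1)], of "F n m" "F n m - \<alpha> m"]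
            E.N_scale[OF V[of n], of "F n m"] E.N_scale[OF elim(1), of "F n m - \<alpha> m"] by simp
      qed
      have Fm: "(\<lambda>n. F n m) \<longlonglongrightarrow> \<alpha> m" using F(2) elim by auto
      have "(\<lambda>n. \<bar>F n m\<bar> * rnrm E (s n m - u m) + \<bar>F n m - \<alpha> m\<bar> * rnrm E (u m)) \<longlonglongrightarrow> \<bar>\<alpha> m\<bar> * 0 + \<bar>\<alpha> m - \<alpha> m\<bar> * rnrm E (u m)"
        by (intro tendsto_intros Fm elim)
      then have "(\<lambda>n. \<bar>F n m\<bar> * rnrm E (s n m - u m) + \<bar>F n m - \<alpha> m\<bar> * rnrm E (u m)) \<longlonglongrightarrow> 0" by simp
      then show ?case by (rule Lim_null_comparison[rotated]) (use b in auto)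
    qed
  qed
qed

abbreviation slice :: "((real^'n) \<times> real \<Rightarrow> real) \<Rightarrow> real \<Rightarrow> real^'n \<Rightarrow> real" where
  "slice u \<equiv> \<lambda>m x. u (x, m)"

abbreviation "XR r \<equiv> X_r i \<Omega> r"

lemma XR_elems_iff: "u \<in> elems (XR r) \<longleftrightarrow> SM (slice u) \<and>
    u \<in> borel_measurable (lebesgue_on (\<Omega> \<times> {0..})) \<and> nrm (XR r) u < \<infinity>"
  by (simp add: X_r_def strongly_measurable_dm)

lemma XR_nrm_eq: "nrm (XR r) u = (\<integral>\<^sup>+m. nrm E (slice u m) \<partial>dm r)"
  by (simp add: X_r_def)

lemma XR_slice_elems: "u \<in> elems (XR r) \<Longrightarrow> AE m in Lm. slice u m \<in> elems E"
  by (simp add: XR_elems_iff strongly_measurable_def)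

lemma XR_slice_measurable: "u \<in> elems (XR r) \<Longrightarrow> (\<lambda>m. nrm E (slice u m)) \<in> borel_measurable Lm"
  using SM_rnrm_measurable(1) by (auto simp: XR_elems_iff)

lemma XR_joint: "u \<in> elems (XR r) \<Longrightarrow> u \<in> borel_measurable (lebesgue_on (\<Omega> \<times> {0..}))"
  by (simp add: XR_elems_iff)

lemma nrm_mono_slices:
  assumes "AE m in Lm. nrm E (slice u m) \<le> nrm E (slice v m)"
  shows "nrm (XR r) u \<le> nrm (XR r) v"
  unfolding XR_nrm_eq using assms by (intro nn_integral_mono_AE) (simp add: AE_dm_iff)

lemma XR_fs_lin: "fs_lin (XR r)"
  unfolding fs_lin_def
proof (intro conjI ballI allI)
  have [simp]: "nrm E (\<lambda>_. 0) = 0" using E_nrm[OF E.V_closed(1)] E.N_zero by (simp add: zero_fun_def)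
  have "SM (\<lambda>_. 0)" unfolding SM_iff
    by (intro conjI exI[of _ "\<lambda>_ _. 0"]) (auto simp: E.V_closed(1))
  then show "(\<lambda>_. 0) \<in> elems (XR r)" by (simp add: XR_elems_iff XR_nrm_eq zero_fun_def)
  fix f assume f: "f \<in> elems (XR r)"
  show "nrm (XR r) f < \<infinity>" using f by (simp add: XR_elems_iff)
  note fm = XR_slice_measurable[OF f] and fE = XR_slice_elems[OF f]
  show sc: "nrm (XR r) (\<lambda>p. c * f p) = ennreal \<bar>c\<bar> * nrm (XR r) f" for c
  proof -
    have "(\<integral>\<^sup>+m. nrm E (\<lambda>x. c * f (x, m)) \<partial>dm r) = (\<integral>\<^sup>+m. ennreal \<bar>c\<bar> * nrm E (slice f m) \<partial>dm r)"
      by (rule nn_integral_cong_AE, unfold AE_dm_iff) (use fE E_fs_lin in \<open>auto simp: fs_lin_def elim!: eventually_mono\<close>)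
    also have "\<dots> = ennreal \<bar>c\<bar> * (\<integral>\<^sup>+m. nrm E (slice f m) \<partial>dm r)"
      by (rule nn_integral_cmult) (use fm in measurable)
    finally show ?thesis by (simp add: XR_nrm_eq)
  qed
  fix g assume g: "g \<in> elems (XR r)"
  note gm = XR_slice_measurable[OF g] and gE = XR_slice_elems[OF g]
  show add: "nrm (XR r) (\<lambda>p. f p + g p) \<le> nrm (XR r) f + nrm (XR r) g"
  proof -
    have "(\<integral>\<^sup>+m. nrm E (\<lambda>x. f (x, m) + g (x, m)) \<partial>dm r) \<le> (\<integral>\<^sup>+m. nrm E (slice f m) + nrm E (slice g m) \<partial>dm r)"
    proof (rule nn_integral_mono_AE, unfold AE_dm_iff)
      show "AE m in Lm. nrm E (\<lambda>x. f (x, m) + g (x, m)) \<le> nrm E (slice f m) + nrm E (slice g m)"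
        using fE gE by eventually_elim (use E_fs_lin in \<open>auto simp: fs_lin_def\<close>)
    qed
    also have "\<dots> = (\<integral>\<^sup>+m. nrm E (slice f m) \<partial>dm r) + (\<integral>\<^sup>+m. nrm E (slice g m) \<partial>dm r)"
      by (rule nn_integral_add) (use fm gm in measurable)
    finally show ?thesis by (simp add: XR_nrm_eq)
  qed
  show "(\<lambda>p. c * f p + d * g p) \<in> elems (XR r)" for c d
    unfolding XR_elems_iff
  proof (intro conjI)
    show "SM (slice (\<lambda>p. c * f p + d * g p))"
      using SM_lin[of "slice f" "slice g" c d] f g by (simp add: XR_elems_iff scaleR_fun_def plus_fun_def)
    show "(\<lambda>p. c * f p + d * g p) \<in> borel_measurable (lebesgue_on (\<Omega> \<times> {0..}))"
      using f g by (auto simp: XR_elems_iff)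
    have "nrm (XR r) (\<lambda>p. c * f p + d * g p) \<le>
       (\<integral>\<^sup>+m. ennreal \<bar>c\<bar> * nrm E (slice f m) + ennreal \<bar>d\<bar> * nrm E (slice g m) \<partial>dm r)"
      unfolding XR_nrm_eq
    proof (rule nn_integral_mono_AE, unfold AE_dm_iff)
      show "AE m in Lm. nrm E (\<lambda>x. c * f (x, m) + d * g (x, m)) \<le> ennreal \<bar>c\<bar> * nrm E (slice f m) + ennreal \<bar>d\<bar> * nrm E (slice g m)"
        using fE gE
      proof eventually_elim
        case (elim m)
        have *: "(\<lambda>x. c * f (x, m)) \<in> elems E" "(\<lambda>x. d * g (x, m)) \<in> elems E"
          using E.V_closed(5)[OF elim(1), of c] E.V_closed(5)[OF elim(2), of d] by (simp_all add: scaleR_fun_def)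
        have "nrm E (\<lambda>x. c * f (x, m) + d * g (x, m)) \<le> nrm E (\<lambda>x. c * f (x, m)) + nrm E (\<lambda>x. d * g (x, m))"
          using E_fs_lin * by (auto simp: fs_lin_def)
        also have "\<dots> = ennreal \<bar>c\<bar> * nrm E (slice f m) + ennreal \<bar>d\<bar> * nrm E (slice g m)"
          using E_fs_lin elim by (auto simp: fs_lin_def)
        finally show ?case .
      qed
    qed
    also have "\<dots> = ennreal \<bar>c\<bar> * nrm (XR r) f + ennreal \<bar>d\<bar> * nrm (XR r) g"
    proof -
      have fm': "(\<lambda>m. nrm E (slice f m)) \<in> borel_measurable (dm r)" and gm': "(\<lambda>m. nrm E (slice g m)) \<in> borel_measurable (dm r)"
        using fm gm by measurable
      show ?thesis unfolding XR_nrm_eq nn_integral_cmult[OF fm', symmetric] nn_integral_cmult[OF gm', symmetric]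
        using fm' gm' by (intro nn_integral_add) auto
    qed
    also have "\<dots> < \<infinity>" using f g by (auto simp: XR_elems_iff ennreal_mult_less_top)
    finally show "nrm (XR r) (\<lambda>p. c * f p + d * g p) < \<infinity>" .
  qed
qed

lemma XR_abs: "u \<in> elems (XR r) \<Longrightarrow> (\<lambda>p. \<bar>u p\<bar>) \<in> elems (XR r) \<and> nrm (XR r) (\<lambda>p. \<bar>u p\<bar>) = nrm (XR r) u"
proof -
  assume u: "u \<in> elems (XR r)"
  have "AE m in Lm. nrm E (\<lambda>x. \<bar>u (x, m)\<bar>) = nrm E (slice u m)"
    using XR_slice_elems[OF u] by eventually_elim (intro antisym E_nrm_mono E_abs, auto)
  then have "nrm (XR r) (\<lambda>p. \<bar>u p\<bar>) = nrm (XR r) u"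
    unfolding XR_nrm_eq by (intro nn_integral_cong_AE) (simp add: AE_dm_iff)
  then show ?thesis using u SM_abs by (auto simp: XR_elems_iff)
qed

sublocale XR: seminormed "elems (X_r i \<Omega> r)" "rnrm (X_r i \<Omega> r)" for r
  by (rule fs_lin_seminormed[OF XR_fs_lin])

lemma XR_nrm: "f \<in> elems (XR r) \<Longrightarrow> nrm (XR r) f = ennreal (rnrm (XR r) f)"
  by (rule fs_lin_nrm[OF XR_fs_lin])

lemma SM_simple_approx:
  assumes u: "SM u" and fin: "(\<integral>\<^sup>+m. nrm E (u m) \<partial>dm r) < \<infinity>" and e: "e > 0"
  obtains s where "simple_function Lm s" "\<And>m. m \<in> {0..} \<Longrightarrow> s m \<in> elems E"
    "(\<integral>\<^sup>+m. nrm E (s m - u m) \<partial>dm r) < ennreal e"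
proof -
  obtain s where s: "\<And>n. simple_function Lm (s n)" "\<And>n m. m \<in> {0..} \<Longrightarrow> s n m \<in> elems E"
    "AE m in Lm. (\<lambda>n. rnrm E (s n m - u m)) \<longlonglongrightarrow> 0"
    "\<And>n m. rnrm E (s n m) \<le> 2 * rnrm E (u m)" "\<And>n m. rnrm E (s n m) = 0 \<Longrightarrow> s n m = 0"
    using SM_truncated[OF u] by blast
  have uE: "AE m in Lm. u m \<in> elems E" using u by (simp add: strongly_measurable_def)
  have sSM: "SM (s n)" for n
    unfolding SM_iff
  proof (intro conjI exI[of _ "\<lambda>_. s n"])
    show "AE m in Lm. s n m \<in> elems E" using AE_space by eventually_elim (use s(2) in auto)
    have "rnrm E (s n m - s n m) = 0" for m using E.N_zero by simp
    then show "AE m in Lm. (\<lambda>na. rnrm E (s n m - s n m)) \<longlonglongrightarrow> 0" by simp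
  qed (use s in auto)
  have dSM: "SM (\<lambda>m. s n m - u m)" for n using SM_lin[OF sSM[of n] u, of 1 "-1"] by simp
  note um = SM_rnrm_measurable(1)[OF u] and dmm = SM_rnrm_measurable(1)[OF dSM]
  have "(\<lambda>n. \<integral>\<^sup>+m. nrm E (s n m - u m) \<partial>dm r) \<longlonglongrightarrow> (\<integral>\<^sup>+m. 0 \<partial>dm r)"
  proof (rule nn_integral_dominated_convergence[where w="\<lambda>m. 3 * nrm E (u m)"])
    show "(\<lambda>m. nrm E (s n m - u m)) \<in> borel_measurable (dm r)" for n using dmm by measurable
    show "(\<lambda>m. 3 * nrm E (u m)) \<in> borel_measurable (dm r)" using um by measurable
    show "(\<integral>\<^sup>+m. 3 * nrm E (u m) \<partial>dm r) < \<infinity>"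
    proof -
      have "(\<integral>\<^sup>+m. 3 * nrm E (u m) \<partial>dm r) = 3 * (\<integral>\<^sup>+m. nrm E (u m) \<partial>dm r)"
        by (rule nn_integral_cmult) (use um in measurable)
      then show ?thesis using fin by (simp add: ennreal_mult_less_top)
    qed
    show "AE m in dm r. nrm E (s n m - u m) \<le> 3 * nrm E (u m)" for n
      unfolding AE_dm_iff using uE AE_space
    proof eventually_elim
      case (elim m)
      have sE: "s n m \<in> elems E" using s(2) elim by auto
      have "rnrm E (s n m - u m) \<le> 3 * rnrm E (u m)"
        using E.N_diff[OF sE elim(1)] s(4)[of n m] by simp
      then show ?case unfolding E_nrm[OF elim(1)] E_nrm[OF E.V_closed(3)[OF sE elim(1)]]
        by (simp add: ennreal_mult'[symmetric] del: ennreal_mult' flip: ennreal_numeral)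
    qed
    show "AE m in dm r. (\<lambda>n. nrm E (s n m - u m)) \<longlonglongrightarrow> 0"
      unfolding AE_dm_iff using uE AE_space s(3)
    proof eventually_elim
      case (elim m)
      have sE: "s n m - u m \<in> elems E" for n using s(2) elim by (auto intro!: E.V_closed(3))
      show ?case unfolding E_nrm[OF sE] using tendsto_ennrealI[OF elim(3)] by simp
    qed
  qed simp
  then have "(\<lambda>n. \<integral>\<^sup>+m. nrm E (s n m - u m) \<partial>dm r) \<longlonglongrightarrow> 0" by simp
  then have "\<forall>\<^sub>F n in sequentially. (\<integral>\<^sup>+m. nrm E (s n m - u m) \<partial>dm r) < ennreal e"
    by (rule order_tendstoD) (use e in simp)
  then obtain n where "(\<integral>\<^sup>+m. nrm E (s n m - u m) \<partial>dm r) < ennreal e" by (auto simp: eventually_sequentially)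
  then show thesis using that s(1,2) by blast
qed

text \<open>The limit is the pointwise series, which stays jointly measurable. Its strong
  measurability needs simple functions: \<open>\<sigma> n\<close> approximates the n-th partial sum
  within 2^-n in the norm, and summability of these errors forces convergence for almost every
  m.\<close>

lemma XR_complete:
  assumes u: "\<And>n. u n \<in> elems (XR r)" and sum: "summable (\<lambda>n. rnrm (XR r) (u n))"
  shows "\<exists>s\<in>elems (XR r). (\<lambda>n. rnrm (XR r) (s - (\<Sum>k<n. u k))) \<longlonglongrightarrow> 0"
proof -
  define s where "s p = (\<Sum>n. u n p)" for p
  have slice_sum: "slice (\<Sum>k<n. u k) m = (\<Sum>k<n. slice (u k) m)" for n m by (auto simp: fun_eq_iff sum_fun_apply)
  have fin: "(\<Sum>n. nrm (XR r) (u n)) < \<infinity>"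
    unfolding XR_nrm[OF u] suminf_ennreal2[OF rnrm_nonneg sum] by simp
  have mu: "(\<lambda>m. nrm E (slice (u n) m)) \<in> borel_measurable (dm r)" for n
    using XR_slice_measurable[OF u] by measurable
  have ae1: "AE m in Lm. (\<Sum>n. nrm E (slice (u n) m)) < \<infinity>"
    unfolding AE_dm_iff[symmetric, of _ r] using mu fin by (intro AE_summable_of_nn_integral) (auto simp: XR_nrm_eq)
  have ae2: "AE m in Lm. \<forall>n. slice (u n) m \<in> elems E" using XR_slice_elems[OF u] by (simp add: AE_all_countable)
  have ae: "AE m in Lm. slice s m \<in> elems E \<and> (\<forall>n. nrm E (slice s m - (\<Sum>k<n. slice (u k) m)) \<le> (\<Sum>k. nrm E (slice (u (k + n)) m)))"
    using ae1 ae2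
  proof eventually_elim
    case (elim m)
    then have "\<And>n. slice (u n) m \<in> elems E" by auto
    note * = E_suminf[OF this elim(1)]
    have "slice s m - (\<Sum>k<n. slice (u k) m) = (\<lambda>x. (\<Sum>j. u j (x, m)) - (\<Sum>k<n. u k (x, m)))" for n
      by (auto simp: fun_eq_iff sum_fun_apply s_def)
    then show ?case using *(1) *(2) by (simp add: s_def)
  qed
  define U where "U n = (\<Sum>k<n. u k)" for n
  have UX: "U n \<in> elems (XR r)" for n unfolding U_def using u by (intro XR.V_sum)
  have "\<exists>\<sigma>. simple_function Lm \<sigma> \<and> (\<forall>m\<in>{0..}. \<sigma> m \<in> elems E) \<and>
      (\<integral>\<^sup>+m. nrm E (\<sigma> m - slice (U n) m) \<partial>dm r) < ennreal ((1/2)^n)" for n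
  proof -
    have p: "(1/2::real)^n > 0" by simp
    have a: "SM (slice (U n))" "(\<integral>\<^sup>+m. nrm E (slice (U n) m) \<partial>dm r) < \<infinity>" using UX[of n] by (auto simp: XR_elems_iff XR_nrm_eq)
    show ?thesis
    proof (rule SM_simple_approx[OF a p])
      fix \<sigma> assume "simple_function Lm \<sigma>" "\<And>m. m \<in> {0..} \<Longrightarrow> \<sigma> m \<in> elems E"
        "(\<integral>\<^sup>+m. nrm E (\<sigma> m - slice (U n) m) \<partial>dm r) < ennreal ((1/2)^n)"
      then show ?thesis by (intro exI[of _ \<sigma>] conjI ballI)
    qed
  qed
  note ex = this
  define \<sigma> where "\<sigma> n = (SOME \<sigma>. simple_function Lm \<sigma> \<and> (\<forall>m\<in>{0..}. \<sigma> m \<in> elems E) \<and>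
      (\<integral>\<^sup>+m. nrm E (\<sigma> m - slice (U n) m) \<partial>dm r) < ennreal ((1/2)^n))" for n
  have "simple_function Lm (\<sigma> n) \<and> (\<forall>m\<in>{0..}. \<sigma> n m \<in> elems E) \<and>
      (\<integral>\<^sup>+m. nrm E (\<sigma> n m - slice (U n) m) \<partial>dm r) < ennreal ((1/2)^n)" for n
    unfolding \<sigma>_def by (rule someI_ex[OF ex])
  then have \<sigma>: "\<And>n. simple_function Lm (\<sigma> n)" "\<And>n m. m \<in> {0..} \<Longrightarrow> \<sigma> n m \<in> elems E"
    "\<And>n. (\<integral>\<^sup>+m. nrm E (\<sigma> n m - slice (U n) m) \<partial>dm r) < ennreal ((1/2)^n)" by auto
  have \<sigma>SM: "SM (\<sigma> n)" for n
    unfolding SM_iff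
  proof (intro conjI exI[of _ "\<lambda>_. \<sigma> n"])
    show "AE m in Lm. \<sigma> n m \<in> elems E" using AE_space by eventually_elim (use \<sigma>(2) in auto)
    have "rnrm E (\<sigma> n m - \<sigma> n m) = 0" for m using E.N_zero by simp
    then show "AE m in Lm. (\<lambda>na. rnrm E (\<sigma> n m - \<sigma> n m)) \<longlonglongrightarrow> 0" by simp
  qed (use \<sigma> in auto)
  have dSM: "SM (\<lambda>m. \<sigma> n m - slice (U n) m)" for n
    using SM_lin[OF \<sigma>SM[of n], of "slice (U n)" 1 "-1"] UX[of n] by (simp add: XR_elems_iff)
  have dmeas: "(\<lambda>m. nrm E (\<sigma> n m - slice (U n) m)) \<in> borel_measurable (dm r)" for n
    using SM_rnrm_measurable(1)[OF dSM] by measurable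
  have "(\<Sum>n. \<integral>\<^sup>+m. nrm E (\<sigma> n m - slice (U n) m) \<partial>dm r) \<le> (\<Sum>n. ennreal ((1/2)^n))"
    using \<sigma>(3) by (intro suminf_le) (auto intro: less_imp_le)
  also have "\<dots> < \<infinity>" by (subst suminf_ennreal2) (auto intro: summable_geometric)
  finally have ae3: "AE m in Lm. (\<Sum>n. nrm E (\<sigma> n m - slice (U n) m)) < \<infinity>"
    unfolding AE_dm_iff[symmetric, of _ r] using dmeas by (intro AE_summable_of_nn_integral) auto
  have "SM (slice s)"
    unfolding SM_iff
  proof (intro conjI exI[of _ \<sigma>] allI ballI)
    show "AE m in Lm. slice s m \<in> elems E" using ae by eventually_elim simp
    show "AE m in Lm. (\<lambda>n. rnrm E (\<sigma> n m - slice s m)) \<longlonglongrightarrow> 0"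
      using ae ae1 ae2 ae3 AE_space
    proof eventually_elim
      case (elim m)
      have sE: "\<sigma> n m \<in> elems E" for n using elim \<sigma>(2) by auto
      have UE: "slice (U n) m \<in> elems E" for n unfolding U_def slice_sum using elim by (intro E.V_sum) auto
      have lim1: "(\<lambda>n. rnrm E (\<sigma> n m - slice (U n) m)) \<longlonglongrightarrow> 0"
      proof -
        have "summable (\<lambda>n. rnrm E (\<sigma> n m - slice (U n) m))"
          using elim(4) unfolding E_nrm[OF E.V_closed(3)[OF sE UE]] by (intro summable_suminf_not_top) auto
        then show ?thesis by (rule summable_LIMSEQ_zero)
      qed
      have lim2: "(\<lambda>n. rnrm E (slice s m - slice (U n) m)) \<longlonglongrightarrow> 0"
      proof -
        have "(\<lambda>n. nrm E (slice s m - slice (U n) m)) \<longlonglongrightarrow> 0"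
        proof (rule tendsto_sandwich[OF _ _ tendsto_const ennreal_suminf_tail_tendsto[OF elim(2)]])
          show "\<forall>\<^sub>F n in sequentially. nrm E (slice s m - slice (U n) m) \<le> (\<Sum>k. nrm E (slice (u (k + n)) m))"
            using elim(1) unfolding U_def slice_sum by auto
        qed auto
        moreover have "nrm E (slice s m - slice (U n) m) = ennreal (rnrm E (slice s m - slice (U n) m))" for n
          by (rule E_nrm[OF E.V_closed(3)]) (use elim UE in auto)
        ultimately show ?thesis by (simp add: ennreal_0[symmetric] tendsto_ennreal_iff del: ennreal_0)
      qed
      have b: "rnrm E (\<sigma> n m - slice s m) \<le> rnrm E (\<sigma> n m - slice (U n) m) + rnrm E (slice s m - slice (U n) m)" for n
        using E.N_triangle[OF sE UE, of "slice s m" n n] E.N_commute[OF UE, of "slice s m" n] elim(1) by simp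
      have "(\<lambda>n. rnrm E (\<sigma> n m - slice (U n) m) + rnrm E (slice s m - slice (U n) m)) \<longlonglongrightarrow> 0"
        using tendsto_add[OF lim1 lim2] by simp
      then show ?case by (rule Lim_null_comparison[rotated]) (use b in auto)
    qed
  qed (use \<sigma> in auto)
  have tail: "nrm (XR r) (s - (\<Sum>k<n. u k)) \<le> (\<Sum>k. nrm (XR r) (u (k + n)))" for n
  proof -
    have "nrm (XR r) (s - (\<Sum>k<n. u k)) \<le> (\<integral>\<^sup>+m. (\<Sum>k. nrm E (slice (u (k + n)) m)) \<partial>dm r)"
      unfolding XR_nrm_eq
    proof (rule nn_integral_mono_AE, unfold AE_dm_iff)
      have "slice (s - (\<Sum>k<n. u k)) m = slice s m - (\<Sum>k<n. slice (u k) m)" for m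
        by (auto simp: fun_eq_iff sum_fun_apply)
      note sl = this
      show "AE m in Lm. nrm E (slice (s - (\<Sum>k<n. u k)) m) \<le> (\<Sum>k. nrm E (slice (u (k + n)) m))"
        using ae
      proof (rule eventually_mono)
        fix m assume "slice s m \<in> elems E \<and> (\<forall>n. nrm E (slice s m - (\<Sum>k<n. slice (u k) m)) \<le> (\<Sum>k. nrm E (slice (u (k + n)) m)))"
        then show "nrm E (slice (s - (\<Sum>k<n. u k)) m) \<le> (\<Sum>k. nrm E (slice (u (k + n)) m))"
          unfolding sl by blast
      qed
    qed
    also have "\<dots> = (\<Sum>k. nrm (XR r) (u (k + n)))"
      unfolding XR_nrm_eq using mu by (intro nn_integral_suminf)
    finally show ?thesis .
  qed
  have sX: "s \<in> elems (XR r)"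
    unfolding XR_elems_iff
  proof (intro conjI)
    show "SM (slice s)" by fact
    show "s \<in> borel_measurable (lebesgue_on (\<Omega> \<times> {0..}))"
      unfolding s_def using XR_joint[OF u] by (intro borel_measurable_suminf)
    have "s - (\<Sum>k<0. u k) = s" by simp
    then show "nrm (XR r) s < \<infinity>" using tail[of 0] fin by (simp add: le_less_trans)
  qed
  have "(\<lambda>n. nrm (XR r) (s - U n)) \<longlonglongrightarrow> 0"
    by (rule tendsto_sandwich[OF _ _ tendsto_const ennreal_suminf_tail_tendsto[OF fin]])
      (use tail in \<open>auto simp: U_def\<close>)
  then have "(\<lambda>n. rnrm (XR r) (s - U n)) \<longlonglongrightarrow> 0"
    unfolding XR_nrm[OF XR.V_closed(3)[OF sX UX]] by (simp add: ennreal_0[symmetric] tendsto_ennreal_iff del: ennreal_0)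
  then show ?thesis using sX by (auto simp: U_def)
qed

sublocale XR: seminormed_complete "elems (X_r i \<Omega> r)" "rnrm (X_r i \<Omega> r)" for r
  by unfold_locales (rule XR_complete)

end

section \<open>Products and intertwining of semigroups\<close>

context seminormed
begin

lemma gen_cong_left:
  assumes G: "semigroup G" "(x, y) \<in> gen G" "x \<doteq> x'"
  shows "(x', y) \<in> gen G"
proof (rule genI[OF G(1)])
  show V: "x' \<in> V" "y \<in> V" using assms gen_V by (auto simp: eqv_def)
  fix e :: real assume "e > 0"
  then obtain d where d: "d > 0" "\<And>h. 0 < h \<Longrightarrow> h < d \<Longrightarrow> N (G h x - x - h *\<^sub>R y) \<le> e * h"
    using gen_eps[OF G(1,2) \<open>e > 0\<close>] by blast
  have "N (G h x' - x' - h *\<^sub>R y) \<le> e * h" if "0 < h" "h < d" for h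
  proof -
    have "G h x - x - h *\<^sub>R y \<doteq> G h x' - x' - h *\<^sub>R y"
      using that V by (intro eqv_diff bounded_op_cong[OF sg_op[OF G(1)]] G(3) eqv_refl) auto
    then show ?thesis using d(2)[OF that] eqv_N by metis
  qed
  then show "\<exists>d>0. \<forall>h. 0 < h \<longrightarrow> h < d \<longrightarrow> N (G h x' - x' - h *\<^sub>R y) \<le> e * h" using d(1) by blast
qed

end

context seminormed_complete
begin

text \<open>The comparison lemma with q equal to the norm, p equal to 0 and \<open>v' = P v\<close>:
  the commutator vanishes.\<close>

lemma semigroup_intertwining:
  assumes G1: "semigroup G1" and G2: "semigroup G2" and P: "bounded_op P"
    and H: "\<And>u v. (u, v) \<in> gen G1 \<Longrightarrow> (P u, P v) \<in> gen G2"
    and f: "f \<in> V" and t: "t \<ge> 0"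
  shows "P (G1 t f) \<doteq> G2 t (P f)"
proof -
  have "sublin (\<lambda>_. 0)" by (auto simp: sublin_def N_nonneg)
  note z = this
  have "N (P (G1 t f) - G2 t (P f)) \<le> 0"
  proof (rule semigroup_comparison_dense[OF G1 G2 P sublin_N z _ _ f _ t])
    fix u v assume uv: "(u, v) \<in> gen G1"
    have "N (G2 s (P v - P v)) \<le> 0" if "s \<ge> 0" for s
      using eqv_N[OF bounded_op_scale[OF sg_op[OF G2 that], of 0 0]] by simp
    then show "\<exists>v'. (P u, v') \<in> gen G2 \<and> (\<forall>s\<ge>0. N (G2 s (P v - v')) \<le> 0)" using H[OF uv] by blast
  qed auto
  moreover have "P (G1 t f) \<in> V" "G2 t (P f) \<in> V"
    using sgV[OF G1 t] sgV[OF G2 t] bounded_opV[OF P] f by auto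
  ultimately show ?thesis using N_nonneg[of "P (G1 t f) - G2 t (P f)"] by (auto simp: eqv_def)
qed

lemma semigroup_unique:
  assumes "semigroup G1" "semigroup G2" "gen G1 \<subseteq> gen G2" "f \<in> V" "t \<ge> 0"
  shows "G1 t f \<doteq> G2 t f"
  using semigroup_intertwining[OF assms(1,2) bounded_op_id, of f t] assms by auto

text \<open>On the common domain the generator of the product contains the sum of the generators.
  This one inclusion is enough, because a semigroup is determined by any semigroup generator
  contained in its own. Contractivity of \<open>G0\<close> controls it uniformly in time.\<close>

lemma semigroup_product:
  assumes G0: "semigroup G0" and G1: "semigroup G1"
    and contr: "\<And>t x. t \<ge> 0 \<Longrightarrow> x \<in> V \<Longrightarrow> N (G0 t x) \<le> N x"
    and comm: "\<And>s t x. s \<ge> 0 \<Longrightarrow> t \<ge> 0 \<Longrightarrow> x \<in> V \<Longrightarrow> G0 s (G1 t x) \<doteq> G1 t (G0 s x)"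
  shows "semigroup (\<lambda>t x. G0 t (G1 t x))"
    "(u, v0) \<in> gen G0 \<Longrightarrow> (u, v1) \<in> gen G1 \<Longrightarrow> (u, v0 + v1) \<in> gen (\<lambda>t x. G0 t (G1 t x))"
proof -
  have V0: "t \<ge> 0 \<Longrightarrow> x \<in> V \<Longrightarrow> G0 t x \<in> V" and V1: "t \<ge> 0 \<Longrightarrow> x \<in> V \<Longrightarrow> G1 t x \<in> V" for t x
    using sgV[OF G0] sgV[OF G1] by auto
  have lip: "N (G0 t x - G0 t y) \<le> N (x - y)" if "t \<ge> 0" "x \<in> V" "y \<in> V" for t x y
    using bounded_op_Lipschitz[OF sg_op[OF G0 that(1)] that(2,3), of 1] contr[OF that(1)] by simp
  show H: "semigroup (\<lambda>t x. G0 t (G1 t x))"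
    unfolding semigroup_def
  proof (intro conjI allI impI ballI)
    fix t :: real assume t: "t \<ge> 0"
    show "bounded_op (\<lambda>x. G0 t (G1 t x))" by (rule bounded_op_comp[OF sg_op[OF G0 t] sg_op[OF G1 t]])
  next
    fix x assume x: "x \<in> V"
    have "G0 0 (G1 0 x) \<doteq> x" using eqv_trans[OF sg_zero[OF G0 V1[OF _ x]] sg_zero[OF G1 x]] by simp
    then show "N (G0 0 (G1 0 x) - x) = 0" by (simp add: eqv_def)
  next
    fix s t :: real and x assume s: "0 \<le> s" and t: "0 \<le> t" and x: "x \<in> V"
    have st: "s + t \<ge> 0" using s t by simp
    have "G0 (s + t) (G1 (s + t) x) \<doteq> G0 s (G0 t (G1 (s + t) x))" by (rule sg_plus[OF G0 s t V1[OF st x]])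
    also have "\<dots> \<doteq> G0 s (G0 t (G1 s (G1 t x)))"
      by (intro bounded_op_cong[OF sg_op[OF G0 s]] bounded_op_cong[OF sg_op[OF G0 t]] sg_plus[OF G1 s t x])
    also have "\<dots> \<doteq> G0 s (G1 s (G0 t (G1 t x)))"
      by (intro bounded_op_cong[OF sg_op[OF G0 s]] comm s t V1 x)
    finally show "N (G0 (s + t) (G1 (s + t) x) - G0 s (G1 s (G0 t (G1 t x)))) = 0" by (rule eqvD)
  next
    fix x assume x: "x \<in> V"
    show "((\<lambda>t. N (G0 t (G1 t x) - x)) \<longlongrightarrow> 0) (at_right 0)"
    proof (rule Lim_null_comparison)
      have "N (G0 t (G1 t x) - x) \<le> N (G1 t x - x) + N (G0 t x - x)" if "t > 0" for t
        using N_triangle[of "G0 t (G1 t x)" "G0 t x" x] lip[of t "G1 t x" x] V0 V1 x that by fastforce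
      moreover have "0 \<le> N (G0 t (G1 t x) - x)" if "t > 0" for t using V0 V1 x that by (intro N_nonneg) auto
      ultimately show "\<forall>\<^sub>F t in at_right 0. norm (N (G0 t (G1 t x) - x)) \<le> N (G1 t x - x) + N (G0 t x - x)"
        by (auto simp: eventually_at_right_field intro!: exI[of _ 1])
      have "((\<lambda>t. N (G1 t x - x)) \<longlongrightarrow> 0) (at_right 0)" "((\<lambda>t. N (G0 t x - x)) \<longlongrightarrow> 0) (at_right 0)"
        using G0 G1 x by (auto simp: semigroup_def)
      then show "((\<lambda>t. N (G1 t x - x) + N (G0 t x - x)) \<longlongrightarrow> 0) (at_right 0)"
        using tendsto_add by fastforce
    qed
  qed
  show "(u, v0 + v1) \<in> gen (\<lambda>t x. G0 t (G1 t x))" if u0: "(u, v0) \<in> gen G0" and u1: "(u, v1) \<in> gen G1"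
  proof (rule genI[OF H])
    show uV: "u \<in> V" "v0 + v1 \<in> V" using u0 u1 gen_V by auto
    have vV: "v0 \<in> V" "v1 \<in> V" using u0 u1 gen_V by auto
    fix e :: real assume e: "e > 0"
    then have e3: "e / 3 > 0" by simp
    obtain d0 where d0: "d0 > 0" "\<And>h. 0 < h \<Longrightarrow> h < d0 \<Longrightarrow> N (G0 h u - u - h *\<^sub>R v0) \<le> e/3 * h"
      using gen_eps[OF G0 u0 e3] by blast
    obtain d1 where d1: "d1 > 0" "\<And>h. 0 < h \<Longrightarrow> h < d1 \<Longrightarrow> N (G1 h u - u - h *\<^sub>R v1) \<le> e/3 * h"
      using gen_eps[OF G1 u1 e3] by blast
    obtain d2 where d2: "d2 > 0" "\<And>h. 0 \<le> h \<Longrightarrow> h < d2 \<Longrightarrow> N (G0 h v1 - v1) < e/3"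
      using sg_cont0[OF G0 vV(2) e3] by blast
    have "N (G0 h (G1 h u) - u - h *\<^sub>R (v0 + v1)) \<le> e * h" if h: "0 < h" "h < min d0 (min d1 d2)" for h
    proof -
      have h0: "h \<ge> 0" using h by simp
      have W: "G1 h u \<in> V" "G0 h u \<in> V" "G0 h (G1 h u) \<in> V" "G0 h v1 \<in> V" "G0 h (u + h *\<^sub>R v1) \<in> V"
        using V0 V1 uV vV h0 by auto
      \<comment> \<open>The four terms are the error of \<open>G1\<close> at u, the defect of
        linearity of \<open>G0\<close> on representatives, which is null, the error of
        \<open>G0\<close> at u, and the strong continuity of \<open>G0\<close> at v1.\<close>
      have "G0 h (G1 h u) - u - h *\<^sub>R (v0 + v1) =
          (G0 h (G1 h u) - G0 h (u + h *\<^sub>R v1)) + ((G0 h (u + h *\<^sub>R v1) - (G0 h u + h *\<^sub>R G0 h v1)) +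
          ((G0 h u - u - h *\<^sub>R v0) + h *\<^sub>R (G0 h v1 - v1)))"
        by (simp add: algebra_simps)
      then have "N (G0 h (G1 h u) - u - h *\<^sub>R (v0 + v1)) \<le>
          N (G0 h (G1 h u) - G0 h (u + h *\<^sub>R v1)) + N ((G0 h (u + h *\<^sub>R v1) - (G0 h u + h *\<^sub>R G0 h v1)) +
          ((G0 h u - u - h *\<^sub>R v0) + h *\<^sub>R (G0 h v1 - v1)))"
        using W uV vV by (metis N_add V_closed(2,3,5))
      also have "\<dots> \<le> N (G0 h (G1 h u) - G0 h (u + h *\<^sub>R v1)) + (N (G0 h (u + h *\<^sub>R v1) - (G0 h u + h *\<^sub>R G0 h v1)) +
          N ((G0 h u - u - h *\<^sub>R v0) + h *\<^sub>R (G0 h v1 - v1)))"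
        using W uV vV by (intro add_left_mono N_add V_closed)
      also have "\<dots> \<le> N (G0 h (G1 h u) - G0 h (u + h *\<^sub>R v1)) + (N (G0 h (u + h *\<^sub>R v1) - (G0 h u + h *\<^sub>R G0 h v1)) +
          (N (G0 h u - u - h *\<^sub>R v0) + N (h *\<^sub>R (G0 h v1 - v1))))"
        using W uV vV by (intro add_left_mono N_add V_closed)
      also have "N (G0 h (u + h *\<^sub>R v1) - (G0 h u + h *\<^sub>R G0 h v1)) = 0"
        using bounded_op_lin[OF sg_op[OF G0 h0] uV(1) vV(2), of 1 h] by (simp add: eqv_def)
      also have "N (h *\<^sub>R (G0 h v1 - v1)) = h * N (G0 h v1 - v1)" using N_scale[of "G0 h v1 - v1" h] W vV h0 by auto
      also have "N (G0 h (G1 h u) - G0 h (u + h *\<^sub>R v1)) \<le> N (G1 h u - (u + h *\<^sub>R v1))"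
        using W uV vV h0 by (intro lip) auto
      also have "N (G1 h u - (u + h *\<^sub>R v1)) \<le> e/3 * h" using d1(2)[of h] h by (simp add: diff_diff_eq)
      also have "N (G0 h u - u - h *\<^sub>R v0) \<le> e/3 * h" using d0(2)[of h] h by simp
      also have "h * N (G0 h v1 - v1) \<le> h * (e/3)" using d2(2)[of h] h by (intro mult_left_mono) auto
      finally show ?thesis by (simp add: algebra_simps)
    qed
    then show "\<exists>d>0. \<forall>h. 0 < h \<longrightarrow> h < d \<longrightarrow> N (G0 h (G1 h u) - u - h *\<^sub>R (v0 + v1)) \<le> e * h"
      using d0(1) d1(1) d2(1) by (intro exI[of _ "min d0 (min d1 d2)"]) auto
  qed
qed

text \<open>For t >= d the vector is propagated from the time d/2, where the bound near 0 applies.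
  This loses the factor 1/t, which is restored by t <= exp t at the price of \<omega> + 1 in place
  of \<omega>.\<close>

lemma generator_bound_all_times:
  assumes G: "semigroup G"
    and w: "w \<le> \<omega>" "\<omega> \<ge> 0" and C: "C \<ge> 0" "\<And>t x. t \<ge> 0 \<Longrightarrow> x \<in> V \<Longrightarrow> N (G t x) \<le> C * exp (w * t) * N x"
    and d: "C' \<ge> 0" "d > 0" "\<And>t x. 0 < t \<Longrightarrow> t < d \<Longrightarrow> x \<in> V \<Longrightarrow> \<exists>y. (G t x, y) \<in> gen G \<and> N y \<le> C' / t * N x"
  shows "\<exists>K\<ge>0. \<forall>t x. 0 < t \<longrightarrow> x \<in> V \<longrightarrow> (\<exists>y. (G t x, y) \<in> gen G \<and> N y \<le> K / t * exp ((\<omega> + 1) * t) * N x)"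
proof -
  \<comment> \<open>C' covers t < d; the second term covers t >= d, where the bound C' / \<tau> at
    \<tau> = d/2 equals 2 * C' / d and propagation contributes C.\<close>
  define K where "K = C' + 2 * C * C' / d"
  have K: "K \<ge> 0" "C' \<le> K" "2 * C * C' / d \<le> K" using C(1) d(1,2) by (auto simp: K_def)
  have "\<exists>y. (G t x, y) \<in> gen G \<and> N y \<le> K / t * exp ((\<omega> + 1) * t) * N x" if t: "0 < t" and x: "x \<in> V" for t x
  proof (cases "t < d")
    case True
    obtain y where y: "(G t x, y) \<in> gen G" "N y \<le> C' / t * N x" using d(3)[OF t True x] by blast
    have "C' / t * 1 \<le> K / t * exp ((\<omega> + 1) * t)"
      using K t w by (intro mult_mono divide_right_mono) auto
    then have "C' / t * N x \<le> K / t * exp ((\<omega> + 1) * t) * N x" using N_nonneg[OF x] by (intro mult_right_mono) auto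
    then show ?thesis using y by (intro exI[of _ y]) auto
  next
    case False
    define \<tau> where "\<tau> = d / 2"
    have \<tau>: "0 < \<tau>" "\<tau> < d" "0 \<le> t - \<tau>" using d(2) False by (auto simp: \<tau>_def)
    have \<tau>0: "0 \<le> \<tau>" using \<tau> by simp
    obtain y where y: "(G \<tau> x, y) \<in> gen G" "N y \<le> C' / \<tau> * N x" using d(3)[OF \<tau>(1,2) x] by blast
    have yV: "y \<in> V" using y gen_V by auto
    have "G (t - \<tau>) (G \<tau> x) \<doteq> G t x" using eqv_sym[OF sg_plus[OF G \<tau>(3) \<tau>0 x]] by simp
    then have g: "(G t x, G (t - \<tau>) y) \<in> gen G" by (rule gen_cong_left[OF G gen_orbit[OF G y(1) \<tau>(3)]])
    \<comment> \<open>w may be negative, so it is replaced by the nonnegative \<omega> before the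
      time t - \<tau> is enlarged to t.\<close>
    have ex: "exp (w * (t - \<tau>)) \<le> exp (\<omega> * t)"
    proof -
      have "w * (t - \<tau>) \<le> \<omega> * (t - \<tau>)" using w(1) \<tau>(3) by (rule mult_right_mono)
      also have "\<dots> \<le> \<omega> * t" using w(2) \<tau>0 by (intro mult_left_mono) auto
      finally show ?thesis by simp
    qed
    have "N (G (t - \<tau>) y) \<le> C * exp (w * (t - \<tau>)) * N y" by (rule C(2)[OF \<tau>(3) yV])
    also have "\<dots> \<le> C * exp (\<omega> * t) * (C' / \<tau> * N x)"
      using ex y(2) C(1) N_nonneg[OF yV] by (intro mult_mono mult_nonneg_nonneg) auto
    also have "\<dots> = (2 * C * C' / d) * (exp (\<omega> * t) * N x)" by (simp add: \<tau>_def)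
    also have "\<dots> \<le> K * (exp (\<omega> * t) * N x)" using K(3) N_nonneg[OF x] by (intro mult_right_mono) auto
    also have "\<dots> \<le> K * (exp ((\<omega> + 1) * t) / t * N x)"
    proof -
      have "t \<le> exp t" using exp_ge_add_one_self[of t] by linarith
      then have "exp (\<omega> * t) * t \<le> exp (\<omega> * t) * exp t" by (intro mult_left_mono) auto
      also have "\<dots> = exp ((\<omega> + 1) * t)" by (simp add: exp_add[symmetric] algebra_simps)
      finally have "exp (\<omega> * t) \<le> exp ((\<omega> + 1) * t) / t" using t by (simp add: pos_le_divide_eq)
      then show ?thesis using K(1) N_nonneg[OF x] by (intro mult_left_mono mult_right_mono) auto
    qed
    finally have "N (G (t - \<tau>) y) \<le> K / t * exp ((\<omega> + 1) * t) * N x" by simp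
    then show ?thesis using g by blast
  qed
  then show ?thesis using K(1) by blast
qed

end

section \<open>From the given notions to the seminormed setting\<close>

lemma fs_eq_iff:
  assumes X: "fs_lin X" and fg: "f \<in> elems X" "g \<in> elems X"
  shows "fs_eq X f g \<longleftrightarrow> seminormed.eqv (elems X) (rnrm X) f g"
proof -
  interpret seminormed "elems X" "rnrm X" by (rule fs_lin_seminormed[OF X])
  have "nrm X (f - g) = ennreal (rnrm X (f - g))" using fs_lin_nrm[OF X V_closed(3)[OF fg]] .
  then show ?thesis using fg N_nonneg[OF V_closed(3)[OF fg]]
    by (auto simp: fs_eq_def eqv_def fun_diff_def)
qed

lemma bounded_operator_imp:
  assumes X: "fs_lin X" and S: "bounded_operator X S"
  shows "seminormed.bounded_op (elems X) (rnrm X) S"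
proof -
  interpret seminormed "elems X" "rnrm X" by (rule fs_lin_seminormed[OF X])
  have SV: "\<And>f. f \<in> elems X \<Longrightarrow> S f \<in> elems X" using S by (auto simp: bounded_operator_def)
  obtain C where C: "\<And>f. f \<in> elems X \<Longrightarrow> nrm X (S f) \<le> ennreal C * nrm X f" using S by (auto simp: bounded_operator_def)
  show ?thesis
    unfolding bounded_op_def
  proof (intro conjI ballI allI exI)
    fix f assume f: "f \<in> elems X"
    show "S f \<in> elems X" using SV[OF f] .
    \<comment> \<open>A negative C means the bound 0, as \<open>ennreal C\<close> is then 0; this
      explains the constant \<open>max C 0\<close>.\<close>
    have "ennreal (rnrm X (S f)) \<le> ennreal (max C 0 * rnrm X f)"
      using C[OF f] fs_lin_nrm[OF X f] fs_lin_nrm[OF X SV[OF f]] N_nonneg[OF f]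
      by (cases "C \<ge> 0") (auto simp: ennreal_mult' max_def ennreal_neg)
    then show "rnrm X (S f) \<le> max C 0 * rnrm X f" using N_nonneg[OF f] by (simp add: ennreal_le_iff)
    fix g c d assume g: "g \<in> elems X"
    have "fs_eq X (S (\<lambda>p. c * f p + d * g p)) (\<lambda>p. c * S f p + d * S g p)"
      using S f g by (auto simp: bounded_operator_def linear_expr_on_def)
    then have "fs_eq X (S (c *\<^sub>R f + d *\<^sub>R g)) (c *\<^sub>R S f + d *\<^sub>R S g)" by (simp add: plus_fun_def scaleR_fun_def)
    moreover have "S (c *\<^sub>R f + d *\<^sub>R g) \<in> elems X" "c *\<^sub>R S f + d *\<^sub>R S g \<in> elems X"
      using SV f g by (auto intro!: SV)
    ultimately show "rnrm X (S (c *\<^sub>R f + d *\<^sub>R g) - (c *\<^sub>R S f + d *\<^sub>R S g)) = 0"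
      using fs_eq_iff[OF X] by (simp add: eqv_def)
  qed
qed

lemma C0_semigroup_imp:
  assumes X: "fs_lin X" and G: "C0_semigroup X G"
  shows "seminormed.semigroup (elems X) (rnrm X) G"
proof -
  interpret seminormed "elems X" "rnrm X" by (rule fs_lin_seminormed[OF X])
  have op: "bounded_op (G t)" if "t \<ge> 0" for t using G that by (intro bounded_operator_imp[OF X]) (auto simp: C0_semigroup_def)
  have GV: "G t f \<in> elems X" if "t \<ge> 0" "f \<in> elems X" for t f using bounded_opV[OF op] that by auto
  show ?thesis
    unfolding semigroup_def
  proof (intro conjI allI impI ballI op)
    fix f assume f: "f \<in> elems X"
    show "rnrm X (G 0 f - f) = 0"
      using G f fs_eq_iff[OF X GV[OF _ f] f, of 0] by (auto simp: C0_semigroup_def eqv_def)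
    show "rnrm X (G (s + t) f - G s (G t f)) = 0" if "s \<ge> 0" "t \<ge> 0" for s t
      using G f that fs_eq_iff[OF X GV[OF _ f] GV[OF _ GV[OF _ f]], of "s + t" s t] by (auto simp: C0_semigroup_def eqv_def)
    have "((\<lambda>t. nrm X (\<lambda>p. G t f p - f p)) \<longlongrightarrow> 0) (at_right 0)" using G f by (auto simp: C0_semigroup_def)
    then have "((\<lambda>t. enn2real (nrm X (G t f - f))) \<longlongrightarrow> enn2real 0) (at_right 0)"
      by (intro tendsto_enn2real) (auto simp: fun_diff_def)
    then show "((\<lambda>t. rnrm X (G t f - f)) \<longlongrightarrow> 0) (at_right 0)" by (simp add: rnrm_def)
  qed
qed

lemma generator_eq:
  assumes X: "fs_lin X" and G: "C0_semigroup X G"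
  shows "generator X G = seminormed.gen (elems X) (rnrm X) G"
proof -
  interpret seminormed "elems X" "rnrm X" by (rule fs_lin_seminormed[OF X])
  note sg = C0_semigroup_imp[OF X G]
  have "((\<lambda>h. nrm X (\<lambda>p. (G h f p - f p) / h - g p)) \<longlongrightarrow> 0) (at_right 0) \<longleftrightarrow>
      ((\<lambda>h. rnrm X ((1 / h) *\<^sub>R (G h f - f) - g)) \<longlongrightarrow> 0) (at_right 0)"
    if fg: "f \<in> elems X" "g \<in> elems X" for f g
  proof -
    have "nrm X (\<lambda>p. (G h f p - f p) / h - g p) = ennreal (rnrm X ((1 / h) *\<^sub>R (G h f - f) - g))" if "h > 0" for h
    proof -
      have "(1 / h) *\<^sub>R (G h f - f) - g \<in> elems X" using sgV[OF sg _ fg(1), of h] fg that by auto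
      moreover have "(\<lambda>p. (G h f p - f p) / h - g p) = (1 / h) *\<^sub>R (G h f - f) - g" by (auto simp: fun_eq_iff)
      ultimately show ?thesis using fs_lin_nrm[OF X] by simp
    qed
    then have "((\<lambda>h. nrm X (\<lambda>p. (G h f p - f p) / h - g p)) \<longlongrightarrow> 0) (at_right 0) \<longleftrightarrow>
        ((\<lambda>h. ennreal (rnrm X ((1 / h) *\<^sub>R (G h f - f) - g))) \<longlongrightarrow> 0) (at_right 0)"
      by (intro tendsto_cong) (auto simp: eventually_at_right_field intro!: exI[of _ 1])
    also have "\<dots> \<longleftrightarrow> ((\<lambda>h. rnrm X ((1 / h) *\<^sub>R (G h f - f) - g)) \<longlongrightarrow> 0) (at_right 0)"
      unfolding ennreal_0[symmetric] by (rule tendsto_ennreal_iff) (auto simp: rnrm_def)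
    finally show ?thesis .
  qed
  then show ?thesis unfolding generator_def gen_def by auto
qed

section \<open>Functionals and operators under the integral over masses\<close>

context space_setting
begin

sublocale E: seminormed_complete "elems (X_x i \<Omega>)" "rnrm (X_x i \<Omega>)"
proof
  fix u :: "nat \<Rightarrow> real^'n \<Rightarrow> real"
  assume u: "\<And>n. u n \<in> elems E" and sum: "summable (\<lambda>n. rnrm E (u n))"
  have fin: "(\<Sum>n. nrm E (u n)) < \<infinity>" unfolding E_nrm[OF u] suminf_ennreal2[OF rnrm_nonneg sum] by simp
  define s where "s x = (\<Sum>n. u n x)" for x
  have sE: "s \<in> elems E" unfolding s_def by (rule E_suminf(1)[OF u fin])
  have "(\<lambda>n. nrm E (s - (\<Sum>k<n. u k))) \<longlonglongrightarrow> 0"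
  proof (rule tendsto_sandwich[OF _ _ tendsto_const ennreal_suminf_tail_tendsto[OF fin]])
    have "s - (\<Sum>k<n. u k) = (\<lambda>x. (\<Sum>j. u j x) - (\<Sum>k<n. u k x))" for n
      by (auto simp: fun_eq_iff sum_fun_apply s_def)
    then show "\<forall>\<^sub>F n in sequentially. nrm E (s - (\<Sum>k<n. u k)) \<le> (\<Sum>k. nrm E (u (k + n)))"
      using E_suminf(2)[OF u fin] by simp
  qed auto
  moreover have "nrm E (s - (\<Sum>k<n. u k)) = ennreal (rnrm E (s - (\<Sum>k<n. u k)))" for n
    using u sE by (intro E_nrm E.V_closed(3) E.V_sum)
  ultimately have "(\<lambda>n. rnrm E (s - (\<Sum>k<n. u k))) \<longlonglongrightarrow> 0"
    by (simp add: ennreal_0[symmetric] tendsto_ennreal_iff del: ennreal_0)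
  then show "\<exists>s\<in>elems E. (\<lambda>n. rnrm E (s - (\<Sum>k<n. u k))) \<longlonglongrightarrow> 0" using sE by blast
qed

text \<open>\<phi> is Lipschitz, so the images of the simple approximants converge almost
  everywhere.\<close>

lemma functional_measurable:
  assumes w: "SM w" and \<phi>: "E.unit_functional \<phi>"
  shows "(\<lambda>s. \<phi> (w s)) \<in> borel_measurable Lm"
proof -
  obtain s where s: "\<And>n. simple_function Lm (s n)" "\<And>n m. m \<in> {0..} \<Longrightarrow> s n m \<in> elems E"
    "AE m in Lm. (\<lambda>n. rnrm E (s n m - w m)) \<longlonglongrightarrow> 0" using w unfolding SM_iff by blast
  have wE: "AE m in Lm. w m \<in> elems E" using w by (simp add: strongly_measurable_def)
  show ?thesis
  proof (rule Lm.measurable_cong_AE)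
  show "(\<lambda>m. lim (\<lambda>n. \<phi> (s n m))) \<in> borel_measurable Lm"
    by (intro borel_measurable_lim_metric borel_measurable_simple_function simple_function_compose1[OF s(1)])
  show "AE m in Lm. \<phi> (w m) = lim (\<lambda>n. \<phi> (s n m))"
    using s(3) wE AE_space
  proof eventually_elim
    case (elim m)
    have sE: "s n m \<in> elems E" for n using elim s(2) by auto
    have "\<bar>\<phi> (s n m) - \<phi> (w m)\<bar> \<le> rnrm E (s n m - w m)" for n
      using E.unit_functionalD(3)[OF \<phi> sE elim(2)] E.unit_functionalD(5)[OF \<phi> E.V_closed(3)[OF sE elim(2)] sE] by simp
    then have "(\<lambda>n. \<phi> (s n m) - \<phi> (w m)) \<longlonglongrightarrow> 0"
      by (intro Lim_null_comparison[OF _ elim(1)]) auto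
    then have "(\<lambda>n. \<phi> (s n m)) \<longlonglongrightarrow> \<phi> (w m)" by (simp add: LIM_zero_iff)
    then show ?case by (simp add: limI)
  qed
qed auto
qed

text \<open>A bounded functional commutes with the integral over \<open>s\<close>, although the latter is
  taken pointwise in \<open>x\<close> only.\<close>

lemma functional_integral:
  fixes u :: "(real^'n) \<times> real \<Rightarrow> real" and k :: "real \<Rightarrow> real"
  assumes u: "SM (slice u)" "u \<in> borel_measurable (lebesgue_on (\<Omega> \<times> {0..}))"
    and k: "k \<in> borel_measurable Lm" and fin: "(\<integral>\<^sup>+s. ennreal \<bar>k s\<bar> * nrm E (slice u s) \<partial>Lm) < \<infinity>"
    and v: "v \<in> elems E" "AE x in lebesgue_on \<Omega>. integrable Lm (\<lambda>s. k s * u (x, s)) \<and> v x = (\<integral>s. k s * u (x, s) \<partial>Lm)"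
    and \<phi>: "E.unit_functional \<phi>"
  shows "\<phi> v = (\<integral>s. k s * \<phi> (slice u s) \<partial>Lm)"
proof -
  obtain s where s: "\<And>n. simple_function Lm (s n)" "\<And>n m. m \<in> {0..} \<Longrightarrow> s n m \<in> elems E"
    "AE m in Lm. (\<lambda>n. rnrm E (s n m - slice u m)) \<longlonglongrightarrow> 0"
    "\<And>n m. rnrm E (s n m) \<le> 2 * rnrm E (slice u m)" "\<And>n m. rnrm E (s n m) = 0 \<Longrightarrow> s n m = 0"
    using SM_truncated[OF u(1)] by blast
  have uE: "AE m in Lm. slice u m \<in> elems E" using u(1) by (simp add: strongly_measurable_def)
  note um = SM_rnrm_measurable[OF u(1)]
  have kint: "integrable Lm (\<lambda>m. k m * rnrm E (slice u m))"
  proof (rule integrableI_bounded)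
    show "(\<lambda>m. k m * rnrm E (slice u m)) \<in> borel_measurable Lm" using k um(2) by measurable
    have "(\<integral>\<^sup>+m. ennreal (norm (k m * rnrm E (slice u m))) \<partial>Lm) = (\<integral>\<^sup>+m. ennreal \<bar>k m\<bar> * nrm E (slice u m) \<partial>Lm)"
      by (rule nn_integral_cong_AE) (use uE in \<open>auto simp: abs_mult ennreal_mult E_nrm elim!: eventually_mono\<close>)
    then show "(\<integral>\<^sup>+m. ennreal (norm (k m * rnrm E (slice u m))) \<partial>Lm) < \<infinity>" using fin by simp
  qed
  \<comment> \<open>The value 0 is left out, because nothing is known about the integrability of k
    on its level set.\<close>
  define Y where "Y n = s n ` {0..} - {0}" for n
  define A where "A n y = {m \<in> space Lm. s n m = y}" for n y
  define c where "c n y = (\<integral>m. indicator (A n y) m *\<^sub>R k m \<partial>Lm)" for n y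
  define vn where "vn n = (\<Sum>y\<in>Y n. c n y *\<^sub>R y)" for n
  have Yfin: "finite (Y n)" for n using simple_functionD(1)[OF s(1)] by (auto simp: Y_def)
  have Asets: "A n y \<in> sets Lm" for n y
    using simple_functionD(2)[OF s(1), of n "{y}"] by (auto simp: A_def vimage_def Int_def conj_commute)
  have YE: "y \<in> elems E" if "y \<in> Y n" for y n using that s(2) by (auto simp: Y_def)
  \<comment> \<open>On the level set of y the norm of the slice of u is at least half that of y,
    which is positive, so k is dominated there by a multiple of the integrable function
    \<open>k m * rnrm E (slice u m)\<close>.\<close>
  have cint: "integrable Lm (\<lambda>m. indicator (A n y) m *\<^sub>R k m)" if y: "y \<in> Y n" for n y
  proof -
    have ypos: "rnrm E y > 0"
    proof -
      obtain m where "s n m = y" "y \<noteq> 0" using y by (auto simp: Y_def)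
      then have "rnrm E y \<noteq> 0" using s(5)[of n m] by auto
      then show ?thesis using rnrm_nonneg[of E y] by linarith
    qed
    show ?thesis
    proof (rule Bochner_Integration.integrable_bound[OF integrable_mult_left[OF kint, of "2 / rnrm E y"]])
      show "(\<lambda>m. indicator (A n y) m *\<^sub>R k m) \<in> borel_measurable Lm" using k Asets by measurable
      show "AE m in Lm. norm (indicator (A n y) m *\<^sub>R k m) \<le> norm (k m * rnrm E (slice u m) * (2 / rnrm E y))"
      proof (rule AE_I2)
        fix m
        have "\<bar>k m\<bar> * 1 \<le> \<bar>k m\<bar> * (rnrm E (slice u m) * (2 / rnrm E y))" if "m \<in> A n y"
        proof (intro mult_left_mono)
          have "rnrm E y \<le> 2 * rnrm E (slice u m)" using s(4)[of n m] that by (simp add: A_def)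
          then show "1 \<le> rnrm E (slice u m) * (2 / rnrm E y)" using ypos by (simp add: field_simps)
        qed simp
        then show "norm (indicator (A n y) m *\<^sub>R k m) \<le> norm (k m * rnrm E (slice u m) * (2 / rnrm E y))"
          using ypos by (auto simp: indicator_def abs_mult mult.assoc)
      qed
    qed
  qed
  have rep: "(\<Sum>y\<in>Y n. indicator (A n y) m * F y) = F (s n m)" if "m \<in> {0..}" "F 0 = (0::real)" for n m F
  proof (cases "s n m = 0")
    case True
    then have "indicator (A n y) m = (0::real)" if "y \<in> Y n" for y using that by (auto simp: A_def Y_def)
    then show ?thesis using True that by simp
  next
    case False
    then have sY: "s n m \<in> Y n" using that by (auto simp: Y_def)
    have "(\<Sum>y\<in>Y n. indicator (A n y) m * F y) = (\<Sum>y\<in>Y n. if y = s n m then F y else 0)"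
      using that by (intro sum.cong) (auto simp: A_def indicator_def)
    also have "\<dots> = F (s n m)" using sY Yfin by simp
    finally show ?thesis .
  qed
  \<comment> \<open>The formula holds for every real function F with F 0 = 0. Used with F equal to
    \<phi> and to the evaluation at a point x, it identifies the scalar integral and the pointwise
    integral of the simple functions through the same finite sum \<open>vn n\<close>.\<close>
  have Fint: "integrable Lm (\<lambda>m. k m * F (s n m))" "(\<integral>m. k m * F (s n m) \<partial>Lm) = (\<Sum>y\<in>Y n. c n y * F y)"
    if F: "F 0 = (0::real)" for F n
  proof -
    have eq: "k m * F (s n m) = (\<Sum>y\<in>Y n. (indicator (A n y) m *\<^sub>R k m) * F y)" if "m \<in> space Lm" for m
      using rep[of m F n] that F by (simp add: sum_distrib_left mult.commute mult.left_commute flip: rep)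
    have i: "integrable Lm (\<lambda>m. \<Sum>y\<in>Y n. (indicator (A n y) m *\<^sub>R k m) * F y)"
      by (intro Bochner_Integration.integrable_sum integrable_mult_left cint)
    then show "integrable Lm (\<lambda>m. k m * F (s n m))" using Bochner_Integration.integrable_cong[OF refl eq, of Lm] by simp
    have "(\<integral>m. k m * F (s n m) \<partial>Lm) = (\<integral>m. (\<Sum>y\<in>Y n. (indicator (A n y) m *\<^sub>R k m) * F y) \<partial>Lm)"
      by (rule Bochner_Integration.integral_cong[OF refl eq])
    also have "\<dots> = (\<Sum>y\<in>Y n. \<integral>m. (indicator (A n y) m *\<^sub>R k m) * F y \<partial>Lm)"
      by (rule Bochner_Integration.integral_sum) (intro integrable_mult_left cint)
    also have "\<dots> = (\<Sum>y\<in>Y n. c n y * F y)"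
      unfolding c_def by (intro sum.cong refl Bochner_Integration.integral_mult_left) (rule cint)
    finally show "(\<integral>m. k m * F (s n m) \<partial>Lm) = (\<Sum>y\<in>Y n. c n y * F y)" .
  qed
  have vnE: "vn n \<in> elems E" for n unfolding vn_def using YE by (intro E.V_sum E.V_closed(5))
  have \<phi>0: "\<phi> 0 = 0" using E.unit_functionalD(6)[OF \<phi> v(1) v(1)] .
  have \<phi>vn: "\<phi> (vn n) = (\<integral>m. k m * \<phi> (s n m) \<partial>Lm)" for n
  proof -
    have "\<phi> (vn n) = (\<Sum>y\<in>Y n. \<phi> (c n y *\<^sub>R y))" unfolding vn_def
      using YE by (intro E.unit_functional_sum[OF \<phi> Yfin] E.V_closed(5))
    also have "\<dots> = (\<Sum>y\<in>Y n. c n y * \<phi> y)" using YE by (intro sum.cong refl E.unit_functionalD(4)[OF \<phi>]) auto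
    also have "\<dots> = (\<integral>m. k m * \<phi> (s n m) \<partial>Lm)" using Fint(2)[of \<phi> n] \<phi>0 by simp
    finally show ?thesis .
  qed
  have vnx: "vn n x = (\<integral>m. k m * s n m x \<partial>Lm)" "integrable Lm (\<lambda>m. k m * s n m x)" for n x
    using Fint[of "\<lambda>f. f x" n] by (auto simp: vn_def sum_fun_apply)
  have sjoint: "(\<lambda>p. s n (snd p) (fst p)) \<in> borel_measurable (lebesgue_on (\<Omega> \<times> {0..}))" for n
  proof -
    have yx: "(\<lambda>p. y (fst p)) \<in> borel_measurable (lebesgue_on (\<Omega> \<times> ({0..} :: real set)))" if "y \<in> Y n" for y
      by (rule measurable_compose[OF measurable_projections_lebesgue(1) E_measurable[OF YE[OF that]]])
    have iA: "(\<lambda>p. indicator (A n y) (snd p) :: real) \<in> borel_measurable (lebesgue_on (\<Omega> \<times> {0..}))" for y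
      by (rule measurable_compose[OF measurable_projections_lebesgue(2)]) (use Asets in measurable)
    have "(\<lambda>p. \<Sum>y\<in>Y n. indicator (A n y) (snd p) * y (fst p)) \<in> borel_measurable (lebesgue_on (\<Omega> \<times> {0..}))"
      using yx iA by (intro borel_measurable_sum borel_measurable_times)
    moreover have "s n (snd p) (fst p) = (\<Sum>y\<in>Y n. indicator (A n y) (snd p) * y (fst p))"
      if "p \<in> space (lebesgue_on (\<Omega> \<times> {0..}))" for p
      using rep[of "snd p" "\<lambda>f. f (fst p)" n] that by auto
    ultimately show ?thesis using measurable_cong[of "lebesgue_on (\<Omega> \<times> {0..})" "\<lambda>p. s n (snd p) (fst p)"] by simp
  qed
  have sSM: "SM (s n)" for n
    unfolding SM_iff
  proof (intro conjI exI[of _ "\<lambda>_. s n"])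
    show "AE m in Lm. s n m \<in> elems E" using AE_space by eventually_elim (use s(2) in auto)
    have "rnrm E (s n m - s n m) = 0" for m using E.N_zero by simp
    then show "AE m in Lm. (\<lambda>na. rnrm E (s n m - s n m)) \<longlonglongrightarrow> 0" by simp
  qed (use s in auto)
  have dSM: "SM (\<lambda>m. slice u m - s n m)" for n using SM_lin[OF u(1) sSM[of n], of 1 "-1"] by simp
  define e where "e n = (\<integral>m. \<bar>k m\<bar> * rnrm E (slice u m - s n m) \<partial>Lm)" for n
  have b3: "AE m in Lm. rnrm E (slice u m - s n m) \<le> 3 * rnrm E (slice u m)" for n
    using uE AE_space
  proof eventually_elim
    case (elim m)
    then show ?case using E.N_diff[of "slice u m" "s n m"] s(4)[of n m] s(2)[of m n] by simp
  qed
  have dmeas: "(\<lambda>m. \<bar>k m\<bar> * rnrm E (slice u m - s n m)) \<in> borel_measurable Lm" for n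
    using k SM_rnrm_measurable(2)[OF dSM] by measurable
  have kabs: "integrable Lm (\<lambda>m. \<bar>k m\<bar> * (3 * rnrm E (slice u m)))"
    using integrable_mult_left[OF integrable_abs[OF kint], of 3] by (simp add: abs_mult mult_ac)
  have eint: "integrable Lm (\<lambda>m. \<bar>k m\<bar> * rnrm E (slice u m - s n m))" for n
  proof (rule Bochner_Integration.integrable_bound[OF kabs dmeas])
    show "AE m in Lm. norm (\<bar>k m\<bar> * rnrm E (slice u m - s n m)) \<le> norm (\<bar>k m\<bar> * (3 * rnrm E (slice u m)))"
      using b3[of n] by eventually_elim (auto simp: abs_mult intro!: mult_left_mono)
  qed
  have elim0: "e \<longlonglongrightarrow> 0"
  proof -
    have "e \<longlonglongrightarrow> (\<integral>m. 0 \<partial>Lm)" unfolding e_def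
    proof (rule integral_dominated_convergence[OF _ dmeas kabs])
      show "AE m in Lm. (\<lambda>n. \<bar>k m\<bar> * rnrm E (slice u m - s n m)) \<longlonglongrightarrow> 0"
        using s(3) uE AE_space
      proof eventually_elim
        case (elim m)
        have "rnrm E (slice u m - s n m) = rnrm E (s n m - slice u m)" for n
          using elim s(2)[of m n] by (intro E.N_commute) auto
        then show ?case using tendsto_mult_right_zero[OF elim(1)] by simp
      qed
      show "AE m in Lm. norm (\<bar>k m\<bar> * rnrm E (slice u m - s n m)) \<le> \<bar>k m\<bar> * (3 * rnrm E (slice u m))" for n
        using b3[of n] by eventually_elim (auto simp: abs_mult intro!: mult_left_mono)
    qed auto
    then show ?thesis by simp
  qed
  have eN: "(\<integral>\<^sup>+m. ennreal \<bar>k m\<bar> * nrm E (slice u m - s n m) \<partial>Lm) = ennreal (e n)" for n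
  proof -
    have "(\<integral>\<^sup>+m. ennreal \<bar>k m\<bar> * nrm E (slice u m - s n m) \<partial>Lm) = (\<integral>\<^sup>+m. ennreal (\<bar>k m\<bar> * rnrm E (slice u m - s n m)) \<partial>Lm)"
    proof (rule nn_integral_cong_AE)
      show "AE m in Lm. ennreal \<bar>k m\<bar> * nrm E (slice u m - s n m) = ennreal (\<bar>k m\<bar> * rnrm E (slice u m - s n m))"
        using uE AE_space
      proof eventually_elim
        case (elim m)
        then have "slice u m - s n m \<in> elems E" using s(2)[of m n] by (intro E.V_closed(3)) auto
        then show ?case by (simp add: E_nrm ennreal_mult)
      qed
    qed
    also have "\<dots> = ennreal (e n)" unfolding e_def using eint by (intro nn_integral_eq_integral) auto
    finally show ?thesis .
  qed
  \<comment> \<open>v and vn n are both integrals pointwise in x, and Minkowski's inequality turns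
    this pointwise information into the convergence of vn n to v in the norm of
    \<open>E\<close>.\<close>
  have nv: "rnrm E (v - vn n) \<le> e n" for n
  proof -
    have dE: "v - vn n \<in> elems E" using v(1) vnE by (intro E.V_closed(3))
    have "nrm E (v - vn n) \<le> (\<integral>\<^sup>+m. ennreal \<bar>k m\<bar> * nrm E (\<lambda>x. u (x, m) - s n m x) \<partial>Lm)"
    proof (rule Minkowski_integral_inequality[OF dE, where w="\<lambda>p. u p - s n (snd p) (fst p)", simplified fst_conv snd_conv])
      show "(\<lambda>p. u p - s n (snd p) (fst p)) \<in> borel_measurable (lebesgue_on (\<Omega> \<times> {0..}))" using u(2) sjoint by measurable
      show "(\<lambda>m. \<bar>k m\<bar>) \<in> borel_measurable Lm" using k by measurable
      show "AE x in lebesgue_on \<Omega>. ennreal \<bar>(v - vn n) x\<bar> \<le> (\<integral>\<^sup>+m. ennreal \<bar>k m\<bar> * ennreal \<bar>u (x, m) - s n m x\<bar> \<partial>Lm)"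
        using v(2)
      proof eventually_elim
        case (elim x)
        then have i: "integrable Lm (\<lambda>m. k m * u (x, m) - k m * s n m x)" using vnx(2) by auto
        have "(v - vn n) x = (\<integral>m. k m * u (x, m) - k m * s n m x \<partial>Lm)"
          using elim vnx[of n x] by simp
        also have "ennreal \<bar>\<dots>\<bar> \<le> (\<integral>\<^sup>+m. ennreal (norm (k m * u (x, m) - k m * s n m x)) \<partial>Lm)"
          using integral_norm_bound_ennreal[OF i] by simp
        also have "\<dots> = (\<integral>\<^sup>+m. ennreal \<bar>k m\<bar> * ennreal \<bar>u (x, m) - s n m x\<bar> \<partial>Lm)"
          by (intro nn_integral_cong) (simp add: ennreal_mult[symmetric] abs_mult[symmetric] right_diff_distrib)
        finally show ?case .
      qed
    qed
    also have "\<dots> = ennreal (e n)" using eN[of n] by (simp add: fun_diff_def)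
    finally show ?thesis unfolding E_nrm[OF dE] by (subst (asm) ennreal_le_iff) (auto simp: e_def intro!: integral_nonneg_AE)
  qed
  have \<phi>bound: "\<bar>\<phi> f - \<phi> g\<bar> \<le> rnrm E (f - g)" if "f \<in> elems E" "g \<in> elems E" for f g
    using E.unit_functionalD(3)[OF \<phi> that] E.unit_functionalD(5)[OF \<phi> E.V_closed(3)[OF that] that(1)] by simp
  have \<phi>u: "(\<lambda>m. \<phi> (slice u m)) \<in> borel_measurable Lm" by (rule functional_measurable[OF u(1) \<phi>])
  have k\<phi>int: "integrable Lm (\<lambda>m. k m * \<phi> (slice u m))"
  proof (rule Bochner_Integration.integrable_bound[OF kint])
    show "(\<lambda>m. k m * \<phi> (slice u m)) \<in> borel_measurable Lm" using k \<phi>u by measurable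
    show "AE m in Lm. norm (k m * \<phi> (slice u m)) \<le> norm (k m * rnrm E (slice u m))"
      using uE by eventually_elim (use E.unit_functionalD(5)[OF \<phi>] in \<open>auto simp: abs_mult intro!: mult_left_mono\<close>)
  qed
  have "\<bar>\<phi> v - (\<integral>m. k m * \<phi> (slice u m) \<partial>Lm)\<bar> \<le> 2 * e n" for n
  proof -
    have ki: "integrable Lm (\<lambda>m. k m * \<phi> (s n m))" using Fint(1)[of \<phi> n] \<phi>0 by simp
    have "\<bar>(\<integral>m. k m * \<phi> (slice u m) \<partial>Lm) - (\<integral>m. k m * \<phi> (s n m) \<partial>Lm)\<bar> = \<bar>\<integral>m. k m * \<phi> (slice u m) - k m * \<phi> (s n m) \<partial>Lm\<bar>"
      using k\<phi>int ki by simp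
    also have "\<dots> \<le> (\<integral>m. \<bar>k m * \<phi> (slice u m) - k m * \<phi> (s n m)\<bar> \<partial>Lm)" by (rule integral_abs_bound)
    also have "\<dots> \<le> e n" unfolding e_def
    proof (rule integral_mono_AE)
      show "AE m in Lm. \<bar>k m * \<phi> (slice u m) - k m * \<phi> (s n m)\<bar> \<le> \<bar>k m\<bar> * rnrm E (slice u m - s n m)"
        using uE AE_space
      proof eventually_elim
        case (elim m)
        then have "\<bar>\<phi> (slice u m) - \<phi> (s n m)\<bar> \<le> rnrm E (slice u m - s n m)" using s(2)[of m n] by (intro \<phi>bound) auto
        then show ?case by (simp add: right_diff_distrib[symmetric] abs_mult mult_left_mono)
      qed
    qed (use k\<phi>int ki eint in auto)
    finally have "\<bar>(\<integral>m. k m * \<phi> (slice u m) \<partial>Lm) - \<phi> (vn n)\<bar> \<le> e n" by (simp add: \<phi>vn)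
    moreover have "\<bar>\<phi> v - \<phi> (vn n)\<bar> \<le> e n" using \<phi>bound[OF v(1) vnE] nv[of n] by (rule order_trans)
    ultimately show ?thesis by linarith
  qed
  moreover have "(\<lambda>n. 2 * e n) \<longlonglongrightarrow> 0" using tendsto_mult_right_zero[OF elim0] by simp
  ultimately have "\<bar>\<phi> v - (\<integral>m. k m * \<phi> (slice u m) \<partial>Lm)\<bar> \<le> 0"
    by (intro tendsto_lowerbound[where f="\<lambda>n. 2 * e n" and F=sequentially]) auto
  then show ?thesis by simp
qed

text \<open>A functional norming the difference is applied to both sides; composed with P and
  divided by C + 1 it is a unit functional too, so \<open>functional_integral\<close> applies twice.
  The function u' is a jointly measurable representative of P acting on the slices of u, since P
  slice by slice may pick representatives that fit together badly.\<close>

lemma operator_integral: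
  fixes u u' :: "(real^'n) \<times> real \<Rightarrow> real" and k :: "real \<Rightarrow> real"
  assumes P: "E.bounded_op P"
    and u: "SM (slice u)" "u \<in> borel_measurable (lebesgue_on (\<Omega> \<times> {0..}))"
    and u': "SM (slice u')" "u' \<in> borel_measurable (lebesgue_on (\<Omega> \<times> {0..}))"
    and Pu: "AE s in Lm. E.eqv (slice u' s) (P (slice u s))"
    and k: "k \<in> borel_measurable Lm"
    and fin: "(\<integral>\<^sup>+s. ennreal \<bar>k s\<bar> * nrm E (slice u s) \<partial>Lm) < \<infinity>" "(\<integral>\<^sup>+s. ennreal \<bar>k s\<bar> * nrm E (slice u' s) \<partial>Lm) < \<infinity>"
    and v: "v \<in> elems E" "AE x in lebesgue_on \<Omega>. integrable Lm (\<lambda>s. k s * u (x, s)) \<and> v x = (\<integral>s. k s * u (x, s) \<partial>Lm)"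
    and v': "v' \<in> elems E" "AE x in lebesgue_on \<Omega>. integrable Lm (\<lambda>s. k s * u' (x, s)) \<and> v' x = (\<integral>s. k s * u' (x, s) \<partial>Lm)"
  shows "E.eqv (P v) v'"
proof -
  have PvE: "P v \<in> elems E" using E.bounded_opV[OF P v(1)] .
  have dE: "P v - v' \<in> elems E" using PvE v'(1) by (intro E.V_closed(3))
  obtain \<phi> where \<phi>: "E.unit_functional \<phi>" "\<phi> (P v - v') = rnrm E (P v - v')"
    using E.norming_functional[OF dE] by blast
  obtain C where C: "C \<ge> 0" "\<And>x. x \<in> elems E \<Longrightarrow> rnrm E (P x) \<le> C * rnrm E x" using E.bounded_op_bound[OF P] by blast
  define \<psi> where "\<psi> x = \<phi> (P x) / (C + 1)" for x
  have \<psi>: "E.unit_functional \<psi>"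
    unfolding E.unit_functional_def
  proof (intro conjI ballI allI)
    fix x y a b assume V: "x \<in> elems E" "y \<in> elems E"
    show "\<psi> (a *\<^sub>R x + b *\<^sub>R y) = a * \<psi> x + b * \<psi> y"
      using E.unit_functional_eqv[OF \<phi>(1) E.bounded_op_lin[OF P V, of a b]]
        E.unit_functionalD(1)[OF \<phi>(1) E.bounded_opV[OF P V(1)] E.bounded_opV[OF P V(2)], of a b]
      by (simp add: \<psi>_def add_divide_distrib)
  next
    fix x assume V: "x \<in> elems E"
    have "\<bar>\<phi> (P x)\<bar> \<le> C * rnrm E x"
      using E.unit_functionalD(5)[OF \<phi>(1) E.bounded_opV[OF P V] V] C(2)[OF V] by linarith
    also have "\<dots> \<le> (C + 1) * rnrm E x" by (simp add: algebra_simps)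
    finally show "\<bar>\<psi> x\<bar> \<le> rnrm E x" using C(1) by (simp add: \<psi>_def divide_le_eq mult.commute)
  qed
  have "\<phi> (P v) = (C + 1) * \<psi> v" using C(1) by (simp add: \<psi>_def)
  also have "\<psi> v = (\<integral>s. k s * \<psi> (slice u s) \<partial>Lm)" by (rule functional_integral[OF u k fin(1) v \<psi>])
  also have "(C + 1) * \<dots> = (\<integral>s. k s * \<phi> (P (slice u s)) \<partial>Lm)"
  proof -
    have "(C + 1) * (\<integral>s. k s * \<psi> (slice u s) \<partial>Lm) = (\<integral>s. (C + 1) * (k s * \<psi> (slice u s)) \<partial>Lm)" by simp
    also have "\<dots> = (\<integral>s. k s * \<phi> (P (slice u s)) \<partial>Lm)"
      by (intro Bochner_Integration.integral_cong refl) (use C(1) in \<open>simp add: \<psi>_def\<close>)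
    finally show ?thesis .
  qed
  also have "\<dots> = (\<integral>s. k s * \<phi> (slice u' s) \<partial>Lm)"
  proof -
    have ae: "AE s in Lm. \<phi> (P (slice u s)) = \<phi> (slice u' s)"
      using Pu \<phi>(1) by (auto elim!: eventually_mono dest: E.unit_functional_eqv)
    have m: "(\<lambda>s. k s * \<phi> (slice u' s)) \<in> borel_measurable Lm"
      using k functional_measurable[OF u'(1) \<phi>(1)] by measurable
    have "(\<lambda>s. k s * \<phi> (P (slice u s))) = (\<lambda>s. (C + 1) * (k s * \<psi> (slice u s)))" using C(1) by (auto simp: \<psi>_def)
    also have "\<dots> \<in> borel_measurable Lm" using functional_measurable[OF u(1) \<psi>] k by measurable
    finally show ?thesis
      using m ae by (intro integral_cong_AE) (auto elim: eventually_mono)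
  qed
  also have "\<dots> = \<phi> v'" by (rule functional_integral[OF u' k fin(2) v' \<phi>(1), symmetric])
  finally have "\<phi> (P v - v') = 0" using E.unit_functionalD(3)[OF \<phi>(1) PvE v'(1)] by simp
  then show ?thesis using \<phi>(2) PvE v'(1) by (simp add: E.eqv_def)
qed

end

text \<open>The middle variable comes out first, as the operators quantify the mass m before x. The
  innermost quantifier is encoded as the vanishing of the measurable function \<open>g\<close>,
  which allows the exchange of the other two.\<close>

lemma lborel_AE_triple:
  fixes P :: "'a::euclidean_space \<times> 'b::euclidean_space \<times> 'c::euclidean_space \<Rightarrow> bool"
  assumes "AE p in lborel. P p"
  shows "AE y in lborel. AE x in lborel. AE z in lborel. P (x, y, z)"
proof -
  obtain N where N: "N \<in> null_sets lborel" "{p. \<not> P p} \<subseteq> N"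
    using assms unfolding eventually_ae_filter by auto
  have ae: "AE p in lborel. p \<notin> N" by (rule AE_not_in[OF N(1)])
  have 1: "AE x in lborel. AE y in lborel. AE z in lborel. (x, y, z) \<notin> N"
    using lborel_AE_pair(1)[OF ae] by (rule eventually_mono) (rule lborel_AE_pair(1))
  define g where "g p = (\<integral>\<^sup>+z. indicator N (fst p, snd p, z) \<partial>lborel)" for p
  have Nm: "N \<in> sets borel" using N(1) by auto
  have m: "(\<lambda>q :: ('a \<times> 'b) \<times> 'c. (fst (fst q), snd (fst q), snd q)) \<in> borel_measurable (lborel \<Otimes>\<^sub>M lborel)"
    unfolding lborel_prod
    by (simp, intro borel_measurable_continuous_onI continuous_intros)
  have "(\<lambda>q :: ('a \<times> 'b) \<times> 'c. indicator N (fst (fst q), snd (fst q), snd q) :: ennreal) \<in> borel_measurable (lborel \<Otimes>\<^sub>M lborel)"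
    by (rule measurable_compose[OF m]) (use Nm in measurable)
  from lborel.borel_measurable_nn_integral_fst[OF this]
  moreover have "g = (\<lambda>p. \<integral>\<^sup>+z. indicator N (fst (fst (p, z)), snd (fst (p, z)), snd (p, z)) \<partial>lborel)"
    by (simp add: g_def fun_eq_iff)
  ultimately have gm: "g \<in> borel_measurable lborel" unfolding lborel_prod by simp
  have sec: "(\<lambda>z. indicator N (x, y, z) :: ennreal) \<in> borel_measurable lborel" for x y
  proof -
    have "(\<lambda>z. (x, y, z)) \<in> borel_measurable borel" by (intro borel_measurable_continuous_onI continuous_intros)
    from measurable_compose[OF this, of "indicator N :: _ \<Rightarrow> ennreal"] show ?thesis using Nm by simp
  qed
  have g0: "g (x, y) = 0 \<longleftrightarrow> (AE z in lborel. (x, y, z) \<notin> N)" for x y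
    unfolding g_def using nn_integral_0_iff_AE[OF sec, of x y] by (simp add: indicator_eq_0_iff)
  have "{p \<in> space (lborel \<Otimes>\<^sub>M lborel). g (fst p, snd p) = 0} \<in> sets (lborel \<Otimes>\<^sub>M lborel)"
    unfolding lborel_prod using measurable_sets[OF gm, of "{0}"] by (simp add: vimage_def)
  from lborel_pair.AE_commute[OF this] 1
  have "AE y in lborel. AE x in lborel. g (x, y) = 0" by (simp add: g0)
  then have 2: "AE y in lborel. AE x in lborel. AE z in lborel. (x, y, z) \<notin> N" by (simp add: g0)
  have sub: "P p" if "p \<notin> N" for p using N(2) that by blast
  show ?thesis
    using 2
  proof (rule eventually_mono)
    fix y assume "AE x in lborel. AE z in lborel. (x, y, z) \<notin> N"
    then show "AE x in lborel. AE z in lborel. P (x, y, z)"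
    proof (rule eventually_mono)
      fix x assume "AE z in lborel. (x, y, z) \<notin> N"
      then show "AE z in lborel. P (x, y, z)" by (rule eventually_mono) (rule sub)
    qed
  qed
qed

lemma AE_Lm_ex:
  assumes "AE m in Lm. Q m" obtains m where "m \<ge> 0" "Q m"
proof -
  have "\<exists>m\<ge>0. Q m"
  proof (rule ccontr)
  assume no: "\<not> ?thesis"
  have "AE m in Lm. False" using assms AE_space by eventually_elim (use no in auto)
  then have "{m \<in> space Lm. True} \<in> null_sets Lm" by (simp add: Lm.AE_iff_null_sets)
  then have "{0..} \<in> null_sets (lebesgue :: real measure)" by (simp add: null_sets_restrict_space atLeast_def)
  then have "negligible {0::real..}" by (simp add: negligible_iff_null_sets)
  moreover have "{0::real<..<1} \<subseteq> {0..}" by auto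
  ultimately have "negligible {0::real<..<1}" using negligible_subset by blast
  moreover have "open {0::real<..<1}" "{0::real<..<1} \<noteq> {}" by auto
  ultimately show False using open_not_negligible by blast
  qed
  then show thesis using that by blast
qed

text \<open>Gain kernels vanish below the diagonal, so the domain of integration can be made
  independent of m.\<close>

lemma gain_integral_half_line:
  assumes "m \<ge> (0::real)" "\<And>s. 0 \<le> s \<Longrightarrow> s < m \<Longrightarrow> h s = (0::real)"
  shows "set_integrable lebesgue {m..} h \<longleftrightarrow> integrable Lm h" "(LINT s:{m..}|lebesgue. h s) = (\<integral>s. h s \<partial>Lm)"
proof -
  have eq: "(\<lambda>s. indicator {m..} s *\<^sub>R h s) = (\<lambda>s. indicator {0..} s *\<^sub>R h s)"
    using assms by (auto simp: fun_eq_iff indicator_def)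
  show "set_integrable lebesgue {m..} h \<longleftrightarrow> integrable Lm h"
    unfolding set_integrable_def eq by (subst integrable_restrict_space) (auto simp: set_integrable_def)
  show "(LINT s:{m..}|lebesgue. h s) = (\<integral>s. h s \<partial>Lm)"
    unfolding set_lebesgue_integral_def eq by (subst integral_restrict_space) auto
qed

section \<open>Equality and order almost everywhere in X_r\<close>

context space_setting
begin

lemma E_null_iff: "f \<in> elems E \<Longrightarrow> rnrm E f = 0 \<longleftrightarrow> (AE x in lebesgue_on \<Omega>. f x = 0)"
proof
  assume f: "f \<in> elems E" and z: "rnrm E f = 0"
  then have n0: "nrm E f = 0" by (simp add: E_nrm)
  show "AE x in lebesgue_on \<Omega>. f x = 0"
  proof (cases "i = 1")
    case True
    have "(\<lambda>x. ennreal \<bar>f x\<bar>) \<in> borel_measurable (lebesgue_on \<Omega>)" using E_measurable[OF f] by measurable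
    from nn_integral_0_iff_AE[OF this] show ?thesis using n0 by (simp add: E_L1[OF True] L1_space_def)
  next
    case False
    have "f x = 0" if x: "x \<in> closure \<Omega>" for x
    proof -
      have "ennreal \<bar>f x\<bar> \<le> nrm E f" unfolding E_C0[OF False] C0_space_def fspace.simps using x by (rule SUP_upper)
      then show ?thesis using n0 by simp
    qed
    then show ?thesis using closure_subset by (intro AE_I2) auto
  qed
next
  assume f: "f \<in> elems E" and z: "AE x in lebesgue_on \<Omega>. f x = 0"
  have "nrm E f \<le> nrm E 0" by (rule E_nrm_mono[OF f E.V_closed(1)]) (use z in auto)
  then show "rnrm E f = 0" using E_nrm[OF f] E_nrm[OF E.V_closed(1)] E.N_zero by simp
qed

lemma E_eqv_iff: "f \<in> elems E \<Longrightarrow> g \<in> elems E \<Longrightarrow> E.eqv f g \<longleftrightarrow> (AE x in lebesgue_on \<Omega>. f x = g x)"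
  using E_null_iff[of "f - g"] E.V_closed(3)[of f g] by (simp add: E.eqv_def)

abbreviation eqX :: "real \<Rightarrow> _ \<Rightarrow> _ \<Rightarrow> bool" where
  "eqX r \<equiv> seminormed.eqv (elems (XR r)) (rnrm (XR r))"
abbreviation genX :: "real \<Rightarrow> _ \<Rightarrow> _" where
  "genX r \<equiv> seminormed.gen (elems (XR r)) (rnrm (XR r))"
abbreviation sgX :: "real \<Rightarrow> _ \<Rightarrow> bool" where
  "sgX r \<equiv> seminormed.semigroup (elems (XR r)) (rnrm (XR r))"

lemma X_null_iff:
  assumes f: "f \<in> elems (XR r)"
  shows "rnrm (XR r) f = 0 \<longleftrightarrow> (AE m in Lm. rnrm E (slice f m) = 0)"
    "rnrm (XR r) f = 0 \<longleftrightarrow> (AE m in Lm. AE x in lebesgue_on \<Omega>. f (x, m) = 0)"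
proof -
  have "(\<lambda>m. nrm E (slice f m)) \<in> borel_measurable (dm r)" using XR_slice_measurable[OF f] by measurable
  from nn_integral_0_iff_AE[OF this] have "nrm (XR r) f = 0 \<longleftrightarrow> (AE m in Lm. nrm E (slice f m) = 0)"
    by (simp add: XR_nrm_eq AE_dm_iff)
  moreover have "(AE m in Lm. nrm E (slice f m) = 0) \<longleftrightarrow> (AE m in Lm. rnrm E (slice f m) = 0)"
    by (rule eventually_subst) (use XR_slice_elems[OF f] in \<open>auto simp: E_nrm elim!: eventually_mono\<close>)
  ultimately show 1: "rnrm (XR r) f = 0 \<longleftrightarrow> (AE m in Lm. rnrm E (slice f m) = 0)" by (simp add: XR_nrm[OF f])
  have "(AE m in Lm. rnrm E (slice f m) = 0) \<longleftrightarrow> (AE m in Lm. AE x in lebesgue_on \<Omega>. f (x, m) = 0)"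
    by (rule eventually_subst) (use XR_slice_elems[OF f] in \<open>auto simp: E_null_iff elim!: eventually_mono\<close>)
  then show "rnrm (XR r) f = 0 \<longleftrightarrow> (AE m in Lm. AE x in lebesgue_on \<Omega>. f (x, m) = 0)" using 1 by simp
qed

lemma X_eqv_iff:
  assumes "f \<in> elems (XR r)" "g \<in> elems (XR r)"
  shows "eqX r f g \<longleftrightarrow> (AE m in Lm. E.eqv (slice f m) (slice g m))"
    "eqX r f g \<longleftrightarrow> (AE m in Lm. AE x in lebesgue_on \<Omega>. f (x, m) = g (x, m))"
proof -
  have d: "f - g \<in> elems (XR r)" using assms by (rule XR.V_closed(3))
  have "eqX r f g \<longleftrightarrow> rnrm (XR r) (f - g) = 0" using assms by (simp add: XR.eqv_def)
  also have "\<dots> \<longleftrightarrow> (AE m in Lm. AE x in lebesgue_on \<Omega>. f (x, m) = g (x, m))" unfolding X_null_iff(2)[OF d] by simp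
  finally show 1: "eqX r f g \<longleftrightarrow> (AE m in Lm. AE x in lebesgue_on \<Omega>. f (x, m) = g (x, m))" .
  have "(AE m in Lm. E.eqv (slice f m) (slice g m)) \<longleftrightarrow> (AE m in Lm. AE x in lebesgue_on \<Omega>. f (x, m) = g (x, m))"
    by (rule eventually_subst, use XR_slice_elems[OF assms(1)] XR_slice_elems[OF assms(2)] in eventually_elim)
      (simp add: E_eqv_iff)
  then show "eqX r f g \<longleftrightarrow> (AE m in Lm. E.eqv (slice f m) (slice g m))" using 1 by simp
qed

lemma mult_elems:
  assumes \<alpha>: "\<alpha> \<in> borel_measurable Lm" and u: "u \<in> elems (XR r)"
    and fin: "(\<integral>\<^sup>+m. ennreal \<bar>\<alpha> m\<bar> * nrm E (slice u m) \<partial>dm r) < \<infinity>"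
  shows "(\<lambda>p. \<alpha> (snd p) * u p) \<in> elems (XR r)"
    "nrm (XR r) (\<lambda>p. \<alpha> (snd p) * u p) = (\<integral>\<^sup>+m. ennreal \<bar>\<alpha> m\<bar> * nrm E (slice u m) \<partial>dm r)"
proof -
  have ae: "AE m in Lm. nrm E (\<lambda>x. \<alpha> m * u (x, m)) = ennreal \<bar>\<alpha> m\<bar> * nrm E (slice u m)"
    using XR_slice_elems[OF u] by eventually_elim (use E_fs_lin in \<open>auto simp: fs_lin_def\<close>)
  show n: "nrm (XR r) (\<lambda>p. \<alpha> (snd p) * u p) = (\<integral>\<^sup>+m. ennreal \<bar>\<alpha> m\<bar> * nrm E (slice u m) \<partial>dm r)"
    unfolding XR_nrm_eq using ae by (intro nn_integral_cong_AE) (simp add: AE_dm_iff)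
  have "SM (slice (\<lambda>p. \<alpha> (snd p) * u p))"
    using SM_mult[of "slice u" \<alpha>] u \<alpha> by (simp add: XR_elems_iff scaleR_fun_def)
  moreover have "(\<lambda>p. \<alpha> (snd p)) \<in> borel_measurable (lebesgue_on (\<Omega> \<times> {0..}))"
    by (rule measurable_compose[OF measurable_projections_lebesgue(2) \<alpha>])
  ultimately show "(\<lambda>p. \<alpha> (snd p) * u p) \<in> elems (XR r)"
    unfolding XR_elems_iff n using u fin by (auto simp: XR_elems_iff)
qed

lemma X_rnrm_mono:
  assumes u: "u \<in> elems (XR r)" "v \<in> elems (XR r)" and ae: "AE m in Lm. AE x in lebesgue_on \<Omega>. \<bar>u (x, m)\<bar> \<le> \<bar>v (x, m)\<bar>"
  shows "rnrm (XR r) u \<le> rnrm (XR r) v"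
proof -
  have "AE m in Lm. nrm E (slice u m) \<le> nrm E (slice v m)"
    using XR_slice_elems[OF u(1)] XR_slice_elems[OF u(2)] ae by eventually_elim (rule E_nrm_mono)
  then have "nrm (XR r) u \<le> nrm (XR r) v" by (rule nrm_mono_slices)
  then show ?thesis unfolding XR_nrm[OF u(1)] XR_nrm[OF u(2)] by (simp add: ennreal_le_iff)
qed

lemma X_cone_iff: "u \<in> elems (XR r) \<Longrightarrow> u \<in> cone (XR r) \<longleftrightarrow> (AE m in Lm. AE x in lebesgue_on \<Omega>. 0 \<le> u (x, m))"
proof -
  assume u: "u \<in> elems (XR r)"
  have "u \<in> cone (XR r) \<longleftrightarrow> (AE m in Lm. slice u m \<in> cone E)" by (simp add: X_r_def AE_dm_iff)
  also have "\<dots> \<longleftrightarrow> (AE m in Lm. AE x in lebesgue_on \<Omega>. 0 \<le> u (x, m))"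
    by (rule eventually_subst) (use XR_slice_elems[OF u] in \<open>auto simp: E_cone_iff elim!: eventually_mono\<close>)
  finally show ?thesis .
qed

definition pos_part :: "((real^'n) \<times> real \<Rightarrow> real) \<Rightarrow> (real^'n) \<times> real \<Rightarrow> real" where
  "pos_part u = (\<lambda>p. max 0 (u p))"

lemma pos_part_elems: "u \<in> elems (XR r) \<Longrightarrow> pos_part u \<in> elems (XR r)"
proof -
  assume u: "u \<in> elems (XR r)"
  have "pos_part u = (1/2) *\<^sub>R ((\<lambda>p. \<bar>u p\<bar>) + u)" by (auto simp: pos_part_def fun_eq_iff max_def)
  then show ?thesis using XR_abs[OF u] u by auto
qed

text \<open>This functional vanishes exactly when u <= 0 almost everywhere, so the comparison lemma
  with it yields order relations.\<close>

lemma pos_part_sublin: "seminormed.sublin (elems (XR r)) (rnrm (XR r)) (\<lambda>u. rnrm (XR r) (pos_part u))"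
  unfolding XR.sublin_def
proof (intro conjI ballI allI impI)
  fix x assume x: "x \<in> elems (XR r)"
  show "rnrm (XR r) (pos_part x) \<le> rnrm (XR r) x"
    by (rule X_rnrm_mono[OF pos_part_elems[OF x] x]) (auto simp: pos_part_def)
  fix c :: real assume c: "c \<ge> 0"
  have "pos_part (c *\<^sub>R x) = c *\<^sub>R pos_part x" using c by (auto simp: pos_part_def fun_eq_iff max_def mult_le_0_iff zero_le_mult_iff)
  then show "rnrm (XR r) (pos_part (c *\<^sub>R x)) \<le> c * rnrm (XR r) (pos_part x)"
    using XR.N_scale[OF pos_part_elems[OF x], of c] c by simp
next
  fix x y assume xy: "x \<in> elems (XR r)" "y \<in> elems (XR r)"
  have "rnrm (XR r) (pos_part (x + y)) \<le> rnrm (XR r) (pos_part x + pos_part y)"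
    using xy by (intro X_rnrm_mono XR.V_closed(2) pos_part_elems) (auto simp: pos_part_def)
  also have "\<dots> \<le> rnrm (XR r) (pos_part x) + rnrm (XR r) (pos_part y)" using xy by (intro XR.N_add pos_part_elems)
  finally show "rnrm (XR r) (pos_part (x + y)) \<le> rnrm (XR r) (pos_part x) + rnrm (XR r) (pos_part y)" .
qed

text \<open>This functional vanishes exactly on the cone; invariance of the cone under a positive
  semigroup takes the form required of p in the comparison lemma.\<close>

lemma neg_part_sublin: "seminormed.sublin (elems (XR r)) (rnrm (XR r)) (\<lambda>u. rnrm (XR r) (pos_part (- u)))"
  unfolding XR.sublin_def
proof (intro conjI ballI allI impI)
  note q = pos_part_sublin[of r]
  fix x assume x: "x \<in> elems (XR r)"
  note x' = XR.V_closed(4)[OF x]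
  show "rnrm (XR r) (pos_part (- x)) \<le> rnrm (XR r) x" using XR.sublinD(3)[OF q x'] XR.N_minus[OF x] by simp
  show "rnrm (XR r) (pos_part (- (c *\<^sub>R x))) \<le> c * rnrm (XR r) (pos_part (- x))" if "c \<ge> 0" for c
    using XR.sublinD(2)[OF q x' that] by simp
  fix y assume y: "y \<in> elems (XR r)"
  show "rnrm (XR r) (pos_part (- (x + y))) \<le> rnrm (XR r) (pos_part (- x)) + rnrm (XR r) (pos_part (- y))"
    using XR.sublinD(1)[OF q x' XR.V_closed(4)[OF y]] by (simp add: algebra_simps)
qed

lemma pos_part_null_iff:
  "u \<in> elems (XR r) \<Longrightarrow> rnrm (XR r) (pos_part u) \<le> 0 \<longleftrightarrow> (AE m in Lm. AE x in lebesgue_on \<Omega>. u (x, m) \<le> 0)"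
proof -
  assume u: "u \<in> elems (XR r)"
  have "rnrm (XR r) (pos_part u) \<le> 0 \<longleftrightarrow> rnrm (XR r) (pos_part u) = 0" using rnrm_nonneg[of "XR r" "pos_part u"] by linarith
  also have "\<dots> \<longleftrightarrow> (AE m in Lm. AE x in lebesgue_on \<Omega>. u (x, m) \<le> 0)"
  proof -
    have "(max 0 z = 0) = (z \<le> 0)" for z :: real by auto
    then show ?thesis unfolding X_null_iff(2)[OF pos_part_elems[OF u]] by (simp only: pos_part_def)
  qed
  finally show ?thesis .
qed

lemma neg_part_null_iff:
  "u \<in> elems (XR r) \<Longrightarrow> rnrm (XR r) (pos_part (- u)) \<le> 0 \<longleftrightarrow> u \<in> cone (XR r)"
  using pos_part_null_iff[OF XR.V_closed(4), of u r] by (simp add: X_cone_iff)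

text \<open>Exchanging the two quantifiers rests on joint measurability: the iterated integral of
  the negative part is 0 in one order, hence in the other.\<close>

lemma AE_swap_nonneg:
  assumes u: "u \<in> borel_measurable (lebesgue_on (\<Omega> \<times> ({0..} :: real set)))"
    and ae: "AE m in Lm. AE x in lebesgue_on \<Omega>. 0 \<le> (u (x, m) :: real)"
  shows "AE x in lebesgue_on \<Omega>. AE m in Lm. 0 \<le> u (x, m)"
proof -
  define f where "f p = ennreal (- u p)" for p
  have f: "f \<in> borel_measurable (lebesgue_on (\<Omega> \<times> {0..}))" unfolding f_def using u by measurable
  note F = measurable_sections_lebesgue[OF borel_\<Omega> _ f, simplified]
  have "(\<integral>\<^sup>+m. (\<integral>\<^sup>+x. f (x, m) \<partial>lebesgue_on \<Omega>) \<partial>Lm) = (\<integral>\<^sup>+m. 0 \<partial>Lm)"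
  proof (rule nn_integral_cong_AE)
    show "AE m in Lm. (\<integral>\<^sup>+x. f (x, m) \<partial>lebesgue_on \<Omega>) = 0"
      using ae
    proof (rule eventually_mono)
      fix m assume "AE x in lebesgue_on \<Omega>. 0 \<le> u (x, m)"
      then have "(\<integral>\<^sup>+x. f (x, m) \<partial>lebesgue_on \<Omega>) = (\<integral>\<^sup>+x. 0 \<partial>lebesgue_on \<Omega>)"
        by (intro nn_integral_cong_AE) (auto simp: f_def ennreal_neg elim!: eventually_mono)
      then show "(\<integral>\<^sup>+x. f (x, m) \<partial>lebesgue_on \<Omega>) = 0" by simp
    qed
  qed
  then have "(\<integral>\<^sup>+x. (\<integral>\<^sup>+m. f (x, m) \<partial>Lm) \<partial>lebesgue_on \<Omega>) = 0" using F(5) by simp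
  then have "AE x in lebesgue_on \<Omega>. (\<integral>\<^sup>+m. f (x, m) \<partial>Lm) = 0" using nn_integral_0_iff_AE[OF F(3)] by simp
  then show ?thesis using F(1)
  proof eventually_elim
    case (elim x)
    then have "AE m in Lm. f (x, m) = 0" using nn_integral_0_iff_AE[OF elim(2)] by simp
    then show ?case by (auto simp: f_def ennreal_eq_0_iff elim!: eventually_mono)
  qed
qed

end

section \<open>The operators of the transport--fragmentation problem\<close>

lemma (in space_setting) X_sum_eqv:
  assumes "w \<in> elems (XR r)" "fs_eq (XR r) w (\<lambda>p. v p + v' p)" "v \<in> elems (XR r)" "v' \<in> elems (XR r)"
  shows "eqX r w (v + v')"
proof -
  have "(\<lambda>p. v p + v' p) = v + v'" by (simp add: plus_fun_def)
  then show ?thesis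
    using fs_eq_iff[OF XR_fs_lin assms(1) XR.V_closed(2)[OF assms(3,4)]] assms(2) by simp
qed

text \<open>One value r is fixed. For empty \<Omega> the bounds of a by \<alpha>1 and \<alpha>2
  would be void, so \<Omega> is nonempty here; the empty case is settled in the theorem.\<close>

locale transport_fragmentation = space_setting i \<Omega> for i and \<Omega> :: "(real^'n) set" +
  fixes a :: "real^'n \<Rightarrow> real \<Rightarrow> real" and \<alpha>1 \<alpha>2 :: "real \<Rightarrow> real" and M :: real
    and b :: "real^'n \<Rightarrow> real \<Rightarrow> real \<Rightarrow> real" and \<beta> :: "real \<Rightarrow> real \<Rightarrow> real"
    and T0 :: "real \<Rightarrow> (real^'n \<Rightarrow> real) \<Rightarrow> real^'n \<Rightarrow> real"
    and D0 :: "real \<Rightarrow> (real^'n \<Rightarrow> real) set"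
    and GTm :: "real \<Rightarrow> real \<Rightarrow> (real^'n \<Rightarrow> real) \<Rightarrow> real^'n \<Rightarrow> real"
    and GF GKmaj GK :: "real \<Rightarrow> real \<Rightarrow> ((real^'n) \<times> real \<Rightarrow> real) \<Rightarrow> (real^'n) \<times> real \<Rightarrow> real"
    and \<beta>0 l r0 r1 r :: real
  assumes nonempty: "\<Omega> \<noteq> {}"
    and rate: "rate_assumption i \<Omega> a \<alpha>1 \<alpha>2 M"
    and ker_b: "kernel_b \<Omega> b" and ker_\<beta>: "kernel_beta \<beta>"
    and transport: "transport_assumption i \<Omega> T0 D0 GTm" and A1: "assumption_A1 i \<Omega> T0 D0 GTm"
    and l0: "l \<ge> 0"
    and \<beta>_bound: "\<forall>s\<ge>0. (\<integral>\<^sup>+m\<in>{0..s}. ennreal (\<beta> m s) \<partial>lebesgue) \<le> ennreal (\<beta>0 * (1 + s powr l))"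
    and b_le_\<beta>: "AE (x, m, s) in lebesgue_on (\<Omega> \<times> {0..} \<times> {0..}). m \<le> s \<longrightarrow> b x m s \<le> \<beta> m s"
    and T0_const: "\<forall>m\<ge>0. \<forall>m'\<ge>0. T0 m = T0 m' \<and> D0 m = D0 m'"
    and thr: "threshold i \<Omega> T0 D0 a b \<alpha>1 \<alpha>2 \<beta> GF GKmaj GK l r0 r1"
    and r: "r \<ge> r1"
begin

abbreviation "X \<equiv> XR r"

lemma r_bounds: "r > l" "r \<ge> 0" using thr r l0 by (auto simp: threshold_def)

lemma \<alpha>_measurable [measurable]: "\<alpha>1 \<in> borel_measurable Lm" "\<alpha>2 \<in> borel_measurable Lm"
  using rate by (auto simp: rate_assumption_def Linf_loc_def)

lemma half_line_borel: "{0..} \<in> sets (borel :: real measure)" by simp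

lemma rate_ae: "AE m in Lm. AE x in lebesgue_on \<Omega>. 0 \<le> a x m \<and> \<alpha>1 m \<le> a x m \<and> a x m \<le> \<alpha>2 m"
  "AE x in lebesgue_on \<Omega>. AE m in Lm. 0 \<le> a x m \<and> \<alpha>1 m \<le> a x m \<and> a x m \<le> \<alpha>2 m"
proof -
  have "AE p in lebesgue_on (\<Omega> \<times> {0..}). 0 \<le> a (fst p) (snd p) \<and> \<alpha>1 (snd p) \<le> a (fst p) (snd p) \<and> a (fst p) (snd p) \<le> \<alpha>2 (snd p)"
    using rate by (auto simp: rate_assumption_def case_prod_unfold)
  from AE_lebesgue_on_Times[OF borel_\<Omega> half_line_borel this]
  show "AE m in Lm. AE x in lebesgue_on \<Omega>. 0 \<le> a x m \<and> \<alpha>1 m \<le> a x m \<and> a x m \<le> \<alpha>2 m"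
    "AE x in lebesgue_on \<Omega>. AE m in Lm. 0 \<le> a x m \<and> \<alpha>1 m \<le> a x m \<and> a x m \<le> \<alpha>2 m" by simp_all
qed

text \<open>An inequality free of x that holds for almost every x in a nonempty open set holds
  outright. This gives the sign of \<alpha>2, and \<alpha>2 <= M \<alpha>1 with M > 0 gives that of
  \<alpha>1.\<close>

lemma \<alpha>_ae: "AE m in Lm. 0 \<le> \<alpha>1 m \<and> 0 \<le> \<alpha>2 m \<and> \<alpha>2 m \<le> M * \<alpha>1 m"
proof -
  have M: "M > 0" "AE m in Lm. \<alpha>2 m \<le> M * \<alpha>1 m" using rate by (auto simp: rate_assumption_def)
  show ?thesis using rate_ae(1) M(2)
  proof eventually_elim
    case (elim m)
    obtain x where x: "x \<in> \<Omega>" using nonempty by auto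
    have "- \<alpha>2 m \<le> 0"
      by (rule AE_le_closure[of "\<lambda>_. - \<alpha>2 m", OF _ _ closure_subset[THEN subsetD, OF x]])
        (simp, rule eventually_mono[OF elim(1)], linarith)
    moreover from this have "0 \<le> M * \<alpha>1 m" using elim(2) by linarith
    ultimately show ?case using M(1) elim(2) by (simp add: zero_le_mult_iff)
  qed
qed

lemma threshold_facts:
  "Domain (maj_F_op i \<Omega> r \<alpha>1 \<alpha>2 \<beta>) = Domain (maj_A_op i \<Omega> r \<alpha>1)"
  "generates X (maj_F_op i \<Omega> r \<alpha>1 \<alpha>2 \<beta>) (GF r)" "analytic_semigroup X (GF r)"
  "Domain (maj_K_op i \<Omega> r T0 D0 \<alpha>1 \<alpha>2 \<beta>) = Domain (maj_T_op i \<Omega> r T0 D0 \<alpha>1)"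
  "generates X (maj_K_op i \<Omega> r T0 D0 \<alpha>1 \<alpha>2 \<beta>) (GKmaj r)" "positive_semigroup X (GKmaj r)"
  "generates X (K_op i \<Omega> r T0 D0 a b) (GK r)" "positive_semigroup X (GK r)"
  using thr r unfolding threshold_def by blast+

lemma generates_imp: "generates X A G \<Longrightarrow> sgX r G" "generates X A G \<Longrightarrow> genX r G = A"
  using C0_semigroup_imp[OF XR_fs_lin] generator_eq[OF XR_fs_lin] by (auto simp: generates_def)

lemmas sgF = generates_imp(1)[OF threshold_facts(2)] and genF = generates_imp(2)[OF threshold_facts(2)]
lemmas sgKm = generates_imp(1)[OF threshold_facts(5)] and genKm = generates_imp(2)[OF threshold_facts(5)]
lemmas sgK = generates_imp(1)[OF threshold_facts(7)] and genK = generates_imp(2)[OF threshold_facts(7)]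

definition G0 where
  "G0 = (SOME G. substochastic_semigroup X G \<and> generates X (T0_op i \<Omega> r T0 D0) G \<and>
     (\<forall>t\<ge>0. \<forall>u\<in>elems X. AE m in Lm. fs_eq E (\<lambda>x. G t u (x, m)) (GTm m t (\<lambda>x. u (x, m)))))"

lemma G0: "substochastic_semigroup X G0" "generates X (T0_op i \<Omega> r T0 D0) G0"
  "t \<ge> 0 \<Longrightarrow> u \<in> elems X \<Longrightarrow> AE m in Lm. fs_eq E (slice (G0 t u) m) (GTm m t (slice u m))"
proof -
  have "\<exists>G. substochastic_semigroup X G \<and> generates X (T0_op i \<Omega> r T0 D0) G \<and>
     (\<forall>t\<ge>0. \<forall>u\<in>elems X. AE m in Lm. fs_eq E (\<lambda>x. G t u (x, m)) (GTm m t (\<lambda>x. u (x, m))))"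
    using A1 r_bounds(2) unfolding assumption_A1_def by blast
  from someI_ex[OF this] have *: "substochastic_semigroup X G0 \<and> generates X (T0_op i \<Omega> r T0 D0) G0 \<and>
     (\<forall>t\<ge>0. \<forall>u\<in>elems X. AE m in Lm. fs_eq E (\<lambda>x. G0 t u (x, m)) (GTm m t (\<lambda>x. u (x, m))))"
    unfolding G0_def .
  show "substochastic_semigroup X G0" "generates X (T0_op i \<Omega> r T0 D0) G0" using * by auto
  show "t \<ge> 0 \<Longrightarrow> u \<in> elems X \<Longrightarrow> AE m in Lm. fs_eq E (slice (G0 t u) m) (GTm m t (slice u m))" using * by auto
qed

lemmas sg0 = generates_imp(1)[OF G0(2)] and gen0 = generates_imp(2)[OF G0(2)]

lemma G0_contr: "t \<ge> 0 \<Longrightarrow> u \<in> elems X \<Longrightarrow> rnrm X (G0 t u) \<le> rnrm X u"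
proof -
  assume t: "t \<ge> 0" and u: "u \<in> elems X"
  have "nrm X (G0 t u) \<le> nrm X u" using G0(1) t u by (auto simp: substochastic_semigroup_def)
  then show ?thesis using XR_nrm[OF u] XR_nrm[OF XR.sgV[OF sg0 t u]] by (simp add: ennreal_le_iff)
qed

text \<open>By uniqueness of the semigroup generated by an operator, \<open>GTm m\<close> is independent of \<open>m\<close>
  as well.\<close>

lemma transport_semigroup_constant:
  obtains P where "\<And>t. t \<ge> 0 \<Longrightarrow> E.bounded_op (P t)" "\<And>t f. t \<ge> 0 \<Longrightarrow> f \<in> elems E \<Longrightarrow> rnrm E (P t f) \<le> rnrm E f"
    "AE m in Lm. \<forall>t\<ge>0. \<forall>f\<in>elems E. E.eqv (GTm m t f) (P t f)"
proof -
  define Q where "Q m \<longleftrightarrow> D0 m \<subseteq> elems E \<and> linear_expr_on E (D0 m) (T0 m) \<and>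
     Domain (restriction_to E (D0 m) (T0 m)) = D0 m \<and>
     generates E (restriction_to E (D0 m) (T0 m)) (GTm m) \<and> substochastic_semigroup E (GTm m)" for m
  have Q: "AE m in Lm. Q m" using transport by (simp add: transport_assumption_def Q_def)
  obtain m0 where m0: "m0 \<ge> 0" "Q m0" using AE_Lm_ex[OF Q] by blast
  have sg: "E.semigroup (GTm m)" and ge: "E.gen (GTm m) = restriction_to E (D0 m) (T0 m)"
    and co: "\<And>t f. t \<ge> 0 \<Longrightarrow> f \<in> elems E \<Longrightarrow> nrm E (GTm m t f) \<le> nrm E f" if "Q m" for m
    using that C0_semigroup_imp[OF E_fs_lin] generator_eq[OF E_fs_lin]
    by (auto simp: Q_def generates_def substochastic_semigroup_def)
  show thesis
  proof (rule that[of "GTm m0"])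
    show "E.bounded_op (GTm m0 t)" if "t \<ge> 0" for t using E.sg_op[OF sg[OF m0(2)] that] .
    show "rnrm E (GTm m0 t f) \<le> rnrm E f" if "t \<ge> 0" "f \<in> elems E" for t f
      using co[OF m0(2) that] E_nrm[OF that(2)] E_nrm[OF E.sgV[OF sg[OF m0(2)] that]] by (simp add: ennreal_le_iff)
    show "AE m in Lm. \<forall>t\<ge>0. \<forall>f\<in>elems E. E.eqv (GTm m t f) (GTm m0 t f)"
      using Q AE_space
    proof eventually_elim
      case (elim m)
      have "m \<ge> 0" using elim(2) by simp
      then have "T0 m = T0 m0" "D0 m = D0 m0" using T0_const m0(1) by blast+
      then have "E.gen (GTm m) = E.gen (GTm m0)" using ge[OF elim(1)] ge[OF m0(2)] by simp
      then show ?case using E.semigroup_unique[OF sg[OF elim(1)] sg[OF m0(2)]] by simp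
    qed
  qed
qed

definition slice_semigroup where
  "slice_semigroup = (SOME P. (\<forall>t\<ge>0. E.bounded_op (P t)) \<and> (\<forall>t\<ge>0. \<forall>f\<in>elems E. rnrm E (P t f) \<le> rnrm E f) \<and>
     (AE m in Lm. \<forall>t\<ge>0. \<forall>f\<in>elems E. E.eqv (GTm m t f) (P t f)))"

lemma slice_semigroup: "t \<ge> 0 \<Longrightarrow> E.bounded_op (slice_semigroup t)" "t \<ge> 0 \<Longrightarrow> f \<in> elems E \<Longrightarrow> rnrm E (slice_semigroup t f) \<le> rnrm E f"
  "AE m in Lm. \<forall>t\<ge>0. \<forall>f\<in>elems E. E.eqv (GTm m t f) (slice_semigroup t f)"
proof -
  have "\<exists>P. (\<forall>t\<ge>0. E.bounded_op (P t)) \<and> (\<forall>t\<ge>0. \<forall>f\<in>elems E. rnrm E (P t f) \<le> rnrm E f) \<and>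
     (AE m in Lm. \<forall>t\<ge>0. \<forall>f\<in>elems E. E.eqv (GTm m t f) (P t f))"
    by (rule transport_semigroup_constant) blast
  from someI_ex[OF this, folded slice_semigroup_def]
  show "t \<ge> 0 \<Longrightarrow> E.bounded_op (slice_semigroup t)" "t \<ge> 0 \<Longrightarrow> f \<in> elems E \<Longrightarrow> rnrm E (slice_semigroup t f) \<le> rnrm E f"
    "AE m in Lm. \<forall>t\<ge>0. \<forall>f\<in>elems E. E.eqv (GTm m t f) (slice_semigroup t f)" by blast+
qed

text \<open>On almost every slice the semigroup on X acts as one and the same contraction of
  \<open>E\<close>; the commutation with F depends on this operator being the same for all
  m.\<close>

lemma G0_slice:
  assumes t: "t \<ge> 0" and u: "u \<in> elems X"
  shows "AE m in Lm. E.eqv (slice (G0 t u) m) (slice_semigroup t (slice u m))"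
    "AE m in Lm. nrm E (slice (G0 t u) m) \<le> nrm E (slice u m)"
proof -
  have Gu: "G0 t u \<in> elems X" by (rule XR.sgV[OF sg0 t u])
  show 1: "AE m in Lm. E.eqv (slice (G0 t u) m) (slice_semigroup t (slice u m))"
    using G0(3)[OF t u] slice_semigroup(3) XR_slice_elems[OF u] XR_slice_elems[OF Gu]
  proof eventually_elim
    case (elim m)
    have e: "E.eqv (GTm m t (slice u m)) (slice_semigroup t (slice u m))" using elim t by blast
    then have "GTm m t (slice u m) \<in> elems E" by (rule E.eqvD)
    then have "E.eqv (slice (G0 t u) m) (GTm m t (slice u m))" using fs_eq_iff[OF E_fs_lin] elim by blast
    then show ?case using e by (rule E.eqv_trans)
  qed
  show "AE m in Lm. nrm E (slice (G0 t u) m) \<le> nrm E (slice u m)"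
    using 1 XR_slice_elems[OF u] XR_slice_elems[OF Gu]
  proof eventually_elim
    case (elim m)
    have "rnrm E (slice (G0 t u) m) \<le> rnrm E (slice u m)" using E.eqv_N[OF elim(1)] slice_semigroup(2)[OF t elim(2)] by simp
    then show ?case using E_nrm[OF elim(2)] E_nrm[OF elim(3)] by simp
  qed
qed

section \<open>The majorising operators slice by slice\<close>

lemma maj_A_iff: "(u, v) \<in> maj_A_op i \<Omega> r \<alpha>1 \<longleftrightarrow> u \<in> elems X \<and> v \<in> elems X \<and>
    (AE m in Lm. AE x in lebesgue_on \<Omega>. v (x, m) = - \<alpha>1 m * u (x, m))"
  by (simp add: maj_A_op_def absorption_op_def)

lemma maj_A_slice:
  assumes "(u, v) \<in> maj_A_op i \<Omega> r \<alpha>1"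
  shows "AE m in Lm. E.eqv (slice v m) ((- \<alpha>1 m) *\<^sub>R slice u m)" "AE m in Lm. nrm E (slice v m) = ennreal (\<alpha>1 m) * nrm E (slice u m)"
proof -
  have uv: "u \<in> elems X" "v \<in> elems X" "AE m in Lm. AE x in lebesgue_on \<Omega>. v (x, m) = - \<alpha>1 m * u (x, m)"
    using assms by (auto simp: maj_A_iff)
  show 1: "AE m in Lm. E.eqv (slice v m) ((- \<alpha>1 m) *\<^sub>R slice u m)"
    using uv(3) XR_slice_elems[OF uv(1)] XR_slice_elems[OF uv(2)]
    by eventually_elim (subst E_eqv_iff, auto intro: E.V_closed)
  show "AE m in Lm. nrm E (slice v m) = ennreal (\<alpha>1 m) * nrm E (slice u m)"
    using 1 XR_slice_elems[OF uv(1)] XR_slice_elems[OF uv(2)] \<alpha>_ae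
  proof eventually_elim
    case (elim m)
    have "rnrm E (slice v m) = \<alpha>1 m * rnrm E (slice u m)"
      using E.eqv_N[OF elim(1)] E.N_scale[OF elim(2), of "- \<alpha>1 m"] elim(4) by simp
    then show ?case using E_nrm[OF elim(2)] E_nrm[OF elim(3)] elim(4) by (simp add: ennreal_mult)
  qed
qed

lemma maj_A_I:
  assumes u: "u \<in> elems X" and fin: "(\<integral>\<^sup>+m. ennreal (\<alpha>1 m) * nrm E (slice u m) \<partial>dm r) < \<infinity>"
  shows "(u, \<lambda>p. - \<alpha>1 (snd p) * u p) \<in> maj_A_op i \<Omega> r \<alpha>1"
proof -
  have "(\<integral>\<^sup>+m. ennreal \<bar>- \<alpha>1 m\<bar> * nrm E (slice u m) \<partial>dm r) = (\<integral>\<^sup>+m. ennreal (\<alpha>1 m) * nrm E (slice u m) \<partial>dm r)"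
    by (rule nn_integral_cong_AE) (use \<alpha>_ae in \<open>auto simp: AE_dm_iff elim!: eventually_mono\<close>)
  then have "(\<lambda>p. - \<alpha>1 (snd p) * u p) \<in> elems X"
    using fin by (intro mult_elems(1)[of "\<lambda>m. - \<alpha>1 m"] u) auto
  then show ?thesis unfolding maj_A_iff using u by simp
qed

lemma maj_A_finite:
  assumes "(u, v) \<in> maj_A_op i \<Omega> r \<alpha>1"
  shows "(\<integral>\<^sup>+m. ennreal (\<alpha>1 m) * nrm E (slice u m) \<partial>dm r) = nrm X v"
  unfolding XR_nrm_eq by (rule nn_integral_cong_AE) (use maj_A_slice(2)[OF assms] in \<open>auto simp: AE_dm_iff elim!: eventually_mono\<close>)

lemma \<beta>_section: "AE m in Lm. (\<lambda>s. \<beta> m s) \<in> borel_measurable Lm"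
  "(\<lambda>p. \<beta> (fst p) (snd p)) \<in> borel_measurable (lebesgue_on ({0..} \<times> {0..}))"
proof -
  show 1: "(\<lambda>p. \<beta> (fst p) (snd p)) \<in> borel_measurable (lebesgue_on ({0..} \<times> {0..}))"
    using ker_\<beta> by (simp add: kernel_beta_def case_prod_unfold)
  show "AE m in Lm. (\<lambda>s. \<beta> m s) \<in> borel_measurable Lm"
    using real_measurable_sections_lebesgue(1)[OF half_line_borel half_line_borel 1] by simp
qed

text \<open>Integration in m first leaves the mass of \<beta>, at most \<beta>0 (1 + s^l) and hence
  at most 2 |\<beta>0| (1 + s^r) as l < r; with \<alpha>2 <= M \<alpha>1 the total is a multiple of
  the norm of \<alpha>1 u. For almost every m the gain integral then converges absolutely in norm,
  as \<open>operator_integral\<close> demands.\<close>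

lemma gain_finite:
  assumes uv: "(u, v) \<in> maj_A_op i \<Omega> r \<alpha>1"
  shows "AE m in Lm. (\<integral>\<^sup>+s. ennreal \<bar>\<alpha>2 s * \<beta> m s\<bar> * nrm E (slice u s) \<partial>Lm) < \<infinity>"
proof -
  have u: "u \<in> elems X" and v: "v \<in> elems X" using uv by (auto simp: maj_A_iff)
  note um = XR_slice_measurable[OF u]
  define f where "f p = ennreal \<bar>\<alpha>2 (snd p)\<bar> * ennreal \<bar>\<beta> (fst p) (snd p)\<bar> * nrm E (slice u (snd p))" for p :: "real \<times> real"
  have a2: "(\<lambda>p. \<alpha>2 (snd p)) \<in> borel_measurable (lebesgue_on (({0..} :: real set) \<times> {0..}))"
    by (rule measurable_compose[OF measurable_projections_lebesgue(2) \<alpha>_measurable(2)])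
  have un: "(\<lambda>p. nrm E (slice u (snd p))) \<in> borel_measurable (lebesgue_on (({0..} :: real set) \<times> {0..}))"
    by (rule measurable_compose[OF measurable_projections_lebesgue(2) um])
  have f: "f \<in> borel_measurable (lebesgue_on ({0..} \<times> {0..}))"
    unfolding f_def using a2 un \<beta>_section(2) by measurable
  note F = measurable_sections_lebesgue[OF half_line_borel half_line_borel f]
  have M: "M > 0" using rate by (simp add: rate_assumption_def)
  have "(\<integral>\<^sup>+m. (\<integral>\<^sup>+s. f (m, s) \<partial>Lm) \<partial>Lm) = (\<integral>\<^sup>+s. (\<integral>\<^sup>+m. f (m, s) \<partial>Lm) \<partial>Lm)" by (rule F(5))
  also have "\<dots> \<le> (\<integral>\<^sup>+s. ennreal (2 * M * \<bar>\<beta>0\<bar>) * (ennreal (1 + s powr r) * (ennreal (\<alpha>1 s) * nrm E (slice u s))) \<partial>Lm)"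
  proof (rule nn_integral_mono_AE)
    show "AE s in Lm. (\<integral>\<^sup>+m. f (m, s) \<partial>Lm) \<le> ennreal (2 * M * \<bar>\<beta>0\<bar>) * (ennreal (1 + s powr r) * (ennreal (\<alpha>1 s) * nrm E (slice u s)))"
      using \<alpha>_ae real_measurable_sections_lebesgue(2)[OF half_line_borel half_line_borel \<beta>_section(2)] AE_space
    proof eventually_elim
      case (elim s)
      then have s0: "s \<ge> 0" by simp
      have bm: "(\<lambda>m. \<beta> m s) \<in> borel_measurable Lm" using elim(2) by simp
      have \<beta>nn: "m \<ge> 0 \<Longrightarrow> 0 \<le> \<beta> m s" "m \<ge> 0 \<Longrightarrow> m > s \<Longrightarrow> \<beta> m s = 0" for m
        using ker_\<beta> s0 by (auto simp: kernel_beta_def)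
      have "(\<integral>\<^sup>+m. f (m, s) \<partial>Lm) = (\<integral>\<^sup>+m. (ennreal \<bar>\<alpha>2 s\<bar> * nrm E (slice u s)) * ennreal \<bar>\<beta> m s\<bar> \<partial>Lm)"
        by (simp add: f_def mult_ac)
      also have "\<dots> = (ennreal \<bar>\<alpha>2 s\<bar> * nrm E (slice u s)) * (\<integral>\<^sup>+m. ennreal \<bar>\<beta> m s\<bar> \<partial>Lm)"
        using bm by (intro nn_integral_cmult) auto
      also have "(\<integral>\<^sup>+m. ennreal \<bar>\<beta> m s\<bar> \<partial>Lm) = (\<integral>\<^sup>+m\<in>{0..s}. ennreal (\<beta> m s) \<partial>lebesgue)"
        using \<beta>nn by (subst nn_integral_restrict_space) (auto intro!: nn_integral_cong simp: indicator_def)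
      also have "\<dots> \<le> ennreal (\<beta>0 * (1 + s powr l))" using \<beta>_bound s0 by blast
      also have "\<dots> \<le> ennreal (2 * \<bar>\<beta>0\<bar> * (1 + s powr r))"
      proof (rule ennreal_leI)
        have "s powr l \<le> 1 + s powr r"
        proof (cases "s \<le> 1")
          case True
          then have "s powr l \<le> 1 powr l" using s0 l0 by (intro powr_mono2) auto
          then have "s powr l \<le> 1" by simp
          then show ?thesis using powr_ge_zero[of s r] by linarith
        next
          case False
          then have "s powr l \<le> s powr r" using r_bounds by (intro powr_mono) auto
          then show ?thesis by simp
        qed
        moreover have "x \<le> 1 + y \<Longrightarrow> 0 \<le> y \<Longrightarrow> 1 + x \<le> 2 * (1 + y)" for x y :: real by simp
        ultimately have "1 + s powr l \<le> 2 * (1 + s powr r)" using powr_ge_zero[of s r] by blast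
        then have "\<bar>\<beta>0\<bar> * (1 + s powr l) \<le> \<bar>\<beta>0\<bar> * (2 * (1 + s powr r))" by (rule mult_left_mono) simp
        moreover have "\<beta>0 * (1 + s powr l) \<le> \<bar>\<beta>0\<bar> * (1 + s powr l)"
          using powr_ge_zero[of s l] by (intro mult_right_mono) auto
        ultimately show "\<beta>0 * (1 + s powr l) \<le> 2 * \<bar>\<beta>0\<bar> * (1 + s powr r)" by (simp add: mult_ac)
      qed
      also have "ennreal \<bar>\<alpha>2 s\<bar> * nrm E (slice u s) * ennreal (2 * \<bar>\<beta>0\<bar> * (1 + s powr r)) \<le>
          ennreal (M * \<alpha>1 s) * nrm E (slice u s) * ennreal (2 * \<bar>\<beta>0\<bar> * (1 + s powr r))"
        using elim(1) by (intro mult_right_mono ennreal_leI) auto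
      also have "\<dots> = ennreal (2 * M * \<bar>\<beta>0\<bar>) * (ennreal (1 + s powr r) * (ennreal (\<alpha>1 s) * nrm E (slice u s)))"
      proof -
        define R where "R = 1 + s powr r"
        have "R \<ge> 0" using powr_ge_zero[of s r] unfolding R_def by (intro add_nonneg_nonneg) auto
        then show ?thesis unfolding R_def[symmetric] using elim(1) M by (simp add: ennreal_mult mult_ac)
      qed
      finally show ?case by (simp add: mult_left_mono)
    qed
  qed
  also have "\<dots> = ennreal (2 * M * \<bar>\<beta>0\<bar>) * (\<integral>\<^sup>+s. ennreal (\<alpha>1 s) * nrm E (slice u s) \<partial>dm r)"
  proof -
    have am: "(\<lambda>s. ennreal (\<alpha>1 s) * nrm E (slice u s)) \<in> borel_measurable Lm"
      using um \<alpha>_measurable(1) by measurable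
    show ?thesis
      unfolding nn_integral_dm[OF am]
      by (rule nn_integral_cmult[OF borel_measurable_times_ennreal[OF dm_weight_measurable am]])
  qed
  also have "\<dots> < \<infinity>"
    using v unfolding maj_A_finite[OF uv] by (auto simp: XR_elems_iff ennreal_mult_less_top)
  finally have "AE m in Lm. (\<integral>\<^sup>+s. f (m, s) \<partial>Lm) \<noteq> \<infinity>" by (intro nn_integral_PInf_AE F(3)) auto
  then show ?thesis by (auto simp: f_def abs_mult ennreal_mult less_top elim!: eventually_mono)
qed

lemma maj_B_slice:
  assumes "(u, v) \<in> maj_B_op i \<Omega> r \<alpha>1 \<alpha>2 \<beta>"
  shows "AE m in Lm. AE x in lebesgue_on \<Omega>. integrable Lm (\<lambda>s. \<alpha>2 s * \<beta> m s * u (x, s)) \<and>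
      v (x, m) = (\<integral>s. \<alpha>2 s * \<beta> m s * u (x, s) \<partial>Lm)"
proof -
  have "AE m in Lm. AE x in lebesgue_on \<Omega>. set_integrable lebesgue {m..} (\<lambda>s. \<alpha>2 s * \<beta> m s * u (x, s)) \<and>
        v (x, m) = (LINT s:{m..}|lebesgue. \<alpha>2 s * \<beta> m s * u (x, s))"
    using assms by (simp add: maj_B_op_def gain_op_def)
  then show ?thesis using AE_space
  proof eventually_elim
    case (elim m)
    have m0: "m \<ge> 0" using elim(2) by simp
    have z: "\<alpha>2 s * \<beta> m s * u (x, s) = 0" if "0 \<le> s" "s < m" for s x
      using ker_\<beta> m0 that by (simp add: kernel_beta_def)
    show ?case using elim(1) by (rule eventually_mono) (simp add: gain_integral_half_line[OF m0 z])
  qed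
qed

text \<open>On each slice the loss is multiplication by a number, and the gain is an integral over s
  with a kernel free of x. The slice operator of G_0 does not depend on the mass, so it can be moved
  under that integral.\<close>

lemma G0_commutes_F:
  assumes t: "t \<ge> 0" and uw: "(u, w) \<in> maj_F_op i \<Omega> r \<alpha>1 \<alpha>2 \<beta>"
  shows "(G0 t u, G0 t w) \<in> maj_F_op i \<Omega> r \<alpha>1 \<alpha>2 \<beta>"
proof -
  obtain v v' where v: "(u, v) \<in> maj_A_op i \<Omega> r \<alpha>1" "(u, v') \<in> maj_B_op i \<Omega> r \<alpha>1 \<alpha>2 \<beta>" and w: "w \<in> elems X" "fs_eq X w (\<lambda>p. v p + v' p)"
    using uw by (auto simp: maj_F_op_def op_sum_def)
  have el: "u \<in> elems X" "v \<in> elems X" "v' \<in> elems X" using v by (auto simp: maj_A_iff maj_B_op_def gain_op_def)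
  have wv: "eqX r w (v + v')" by (rule X_sum_eqv[OF w]) (use el in auto)
  define u1 where "u1 = G0 t u"
  have u1: "u1 \<in> elems X" unfolding u1_def by (rule XR.sgV[OF sg0 t el(1)])
  note u1s = G0_slice[OF t el(1), folded u1_def]
  have fin1: "(\<integral>\<^sup>+m. ennreal (\<alpha>1 m) * nrm E (slice u1 m) \<partial>dm r) < \<infinity>"
  proof -
    have "(\<integral>\<^sup>+m. ennreal (\<alpha>1 m) * nrm E (slice u1 m) \<partial>dm r) \<le> (\<integral>\<^sup>+m. ennreal (\<alpha>1 m) * nrm E (slice u m) \<partial>dm r)"
      by (rule nn_integral_mono_AE) (use u1s(2) in \<open>auto simp: AE_dm_iff elim!: eventually_mono intro: mult_left_mono\<close>)
    also have "\<dots> = nrm X v" by (rule maj_A_finite[OF v(1)])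
    also have "\<dots> < \<infinity>" using el by (simp add: XR_elems_iff)
    finally show ?thesis .
  qed
  \<comment> \<open>G_0 contracts each slice, so u1 stays in the domain of the loss operator. By the
    threshold property this is also the domain of F, and the gain integral of u1 therefore exists in
    X.\<close>
  have "u1 \<in> Domain (maj_F_op i \<Omega> r \<alpha>1 \<alpha>2 \<beta>)" unfolding threshold_facts(1) using maj_A_I[OF u1 fin1] by blast
  then obtain w1 where w1: "(u1, w1) \<in> maj_F_op i \<Omega> r \<alpha>1 \<alpha>2 \<beta>" by blast
  then obtain v2 v2' where v2: "(u1, v2) \<in> maj_A_op i \<Omega> r \<alpha>1" "(u1, v2') \<in> maj_B_op i \<Omega> r \<alpha>1 \<alpha>2 \<beta>"
    and w1': "w1 \<in> elems X" "fs_eq X w1 (\<lambda>p. v2 p + v2' p)"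
    by (auto simp: maj_F_op_def op_sum_def)
  have el2: "v2 \<in> elems X" "v2' \<in> elems X" using v2 by (auto simp: maj_A_iff maj_B_op_def gain_op_def)
  have w1v: "eqX r w1 (v2 + v2')" by (rule X_sum_eqv[OF w1' el2])
  have Gel: "G0 t v \<in> elems X" "G0 t v' \<in> elems X" using XR.sgV[OF sg0 t] el by auto
  have A: "eqX r (G0 t v) v2"
    unfolding X_eqv_iff(1)[OF Gel(1) el2(1)]
    using G0_slice(1)[OF t el(2)] u1s(1) maj_A_slice(1)[OF v(1)] maj_A_slice(1)[OF v2(1)] XR_slice_elems[OF el(1)]
  proof eventually_elim
    case (elim m)
    note P = slice_semigroup(1)[OF t]
    have "E.eqv (slice (G0 t v) m) (slice_semigroup t ((- \<alpha>1 m) *\<^sub>R slice u m))"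
      using E.eqv_trans[OF elim(1) E.bounded_op_cong[OF P elim(3)]] .
    also have "E.eqv \<dots> ((- \<alpha>1 m) *\<^sub>R slice_semigroup t (slice u m))" by (rule E.bounded_op_scale[OF P elim(5)])
    also have "E.eqv \<dots> ((- \<alpha>1 m) *\<^sub>R slice u1 m)" by (rule E.eqv_scale[OF E.eqv_sym[OF elim(2)]])
    also have "E.eqv \<dots> (slice v2 m)" by (rule E.eqv_sym[OF elim(4)])
    finally show ?case .
  qed
  have B: "eqX r (G0 t v') v2'"
    unfolding X_eqv_iff(1)[OF Gel(2) el2(2)]
    using G0_slice(1)[OF t el(3)] \<beta>_section(1) gain_finite[OF v(1)] gain_finite[OF v2(1)]
      maj_B_slice[OF v(2)] maj_B_slice[OF v2(2)] XR_slice_elems[OF el(3)] XR_slice_elems[OF el2(2)]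
  proof eventually_elim
    case (elim m)
    have k: "(\<lambda>s. \<alpha>2 s * \<beta> m s) \<in> borel_measurable Lm" using elim(2) by measurable
    have "E.eqv (slice_semigroup t (slice v' m)) (slice v2' m)"
      by (rule operator_integral[OF slice_semigroup(1)[OF t] _ _ _ _ u1s(1) k elim(3,4) elim(7,5) elim(8,6)])
        (use el(1) u1 in \<open>auto simp: XR_elems_iff\<close>)
    then show ?case using E.eqv_trans[OF elim(1)] by blast
  qed
  have "eqX r w1 (G0 t w)"
  proof -
    have "eqX r w1 (v2 + v2')" by (rule w1v)
    also have "eqX r \<dots> (G0 t v + G0 t v')" by (intro XR.eqv_add XR.eqv_sym[OF A] XR.eqv_sym[OF B])
    also have "eqX r \<dots> (G0 t (v + v'))" by (rule XR.eqv_sym[OF XR.bounded_op_add[OF XR.sg_op[OF sg0 t] el(2,3)]])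
    also have "eqX r \<dots> (G0 t w)" by (rule XR.bounded_op_cong[OF XR.sg_op[OF sg0 t] XR.eqv_sym[OF wv]])
    finally show ?thesis .
  qed
  then show ?thesis using XR.gen_cong[OF sgF, of u1 w1 "G0 t w"] w1 unfolding genF u1_def by blast
qed

lemma G0_GF_commute:
  assumes "s \<ge> 0" "t \<ge> 0" "f \<in> elems X"
  shows "eqX r (G0 s (GF r t f)) (GF r t (G0 s f))"
  by (rule XR.semigroup_intertwining[OF sgF sgF XR.sg_op[OF sg0 assms(1)] _ assms(3,2)])
    (unfold genF, rule G0_commutes_F[OF assms(1)])

text \<open>Regrouping T0 + A + B as T0 + (A + B) shows that the generator of G_maj is contained in
  that of the product, and uniqueness of the generated semigroup does the rest.\<close>

lemma GKmaj_product:
  assumes t: "t \<ge> 0" and f: "f \<in> elems X"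
  shows "eqX r (GKmaj r t f) (G0 t (GF r t f))"
proof -
  define H where "H = (\<lambda>t x. G0 t (GF r t x))"
  have H: "sgX r H" unfolding H_def by (rule XR.semigroup_product(1)[OF sg0 sgF G0_contr G0_GF_commute])
  have sub: "genX r (GKmaj r) \<subseteq> genX r H"
  proof
    fix p assume p: "p \<in> genX r (GKmaj r)"
    obtain u w where uw: "p = (u, w)" by (cases p)
    obtain v v' where v: "(u, v) \<in> maj_T_op i \<Omega> r T0 D0 \<alpha>1" "(u, v') \<in> maj_B_op i \<Omega> r \<alpha>1 \<alpha>2 \<beta>"
      and w: "w \<in> elems X" "fs_eq X w (\<lambda>p. v p + v' p)"
      using p unfolding genKm uw by (auto simp: maj_K_op_def op_sum_def)
    obtain t0 a0 where ta: "(u, t0) \<in> T0_op i \<Omega> r T0 D0" "(u, a0) \<in> maj_A_op i \<Omega> r \<alpha>1" and vel: "v \<in> elems X" "fs_eq X v (\<lambda>p. t0 p + a0 p)"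
      using v(1) by (auto simp: maj_T_op_def op_sum_def)
    have el: "t0 \<in> elems X" "a0 \<in> elems X" "v' \<in> elems X"
      using ta v by (auto simp: maj_A_iff T0_op_def maj_B_op_def gain_op_def)
    have e1: "eqX r w (v + v')" by (rule X_sum_eqv[OF w]) (use el vel in auto)
    have e2: "eqX r v (t0 + a0)" by (rule X_sum_eqv[OF vel el(1,2)])
    have e3: "eqX r w (t0 + (a0 + v'))"
      using XR.eqv_trans[OF e1 XR.eqv_add[OF e2 XR.eqv_refl[OF el(3)]]] by (simp add: add.assoc)
    have avel: "a0 + v' \<in> elems X" using el by (intro XR.V_closed(2))
    have "fs_eq X (a0 + v') (\<lambda>p. a0 p + v' p)"
      using fs_eq_iff[OF XR_fs_lin avel avel] avel XR.eqv_refl[OF avel] by (simp add: plus_fun_def)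
    then have "(u, a0 + v') \<in> genX r (GF r)" unfolding genF maj_F_op_def op_sum_def using ta v avel by blast
    moreover have "(u, t0) \<in> genX r G0" unfolding gen0 by (rule ta)
    ultimately have "(u, t0 + (a0 + v')) \<in> genX r H"
      unfolding H_def by (intro XR.semigroup_product(2)[OF sg0 sgF G0_contr G0_GF_commute])
    then show "p \<in> genX r H" unfolding uw using XR.gen_cong[OF H _ XR.eqv_sym[OF e3]] by blast
  qed
  show ?thesis using XR.semigroup_unique[OF sgKm H sub f t] by (simp add: H_def)
qed

lemma GKmaj_slice_le:
  assumes t: "t \<ge> 0" and f: "f \<in> elems X"
  shows "AE m in Lm. nrm E (slice (GKmaj r t f) m) \<le> nrm E (slice (GF r t f) m)"
proof -
  have Fel: "GF r t f \<in> elems X" by (rule XR.sgV[OF sgF t f])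
  have "GKmaj r t f \<in> elems X" "G0 t (GF r t f) \<in> elems X" using XR.sgV[OF sgKm t f] XR.sgV[OF sg0 t Fel] by auto
  note e = X_eqv_iff(1)[OF this] and se = XR_slice_elems[OF this(1)] XR_slice_elems[OF this(2)]
  show ?thesis
    using iffD1[OF e GKmaj_product[OF t f]] G0_slice(2)[OF t Fel] se
    by eventually_elim (metis E.eqv_N E_nrm)
qed

end

section \<open>Comparison and smoothing estimates\<close>

lemma ball_in_sector:
  assumes \<theta>: "0 < \<theta>"
  obtains \<kappa> where "\<kappa> > 0" "\<And>t. t > 0 \<Longrightarrow> ball (complex_of_real t) (\<kappa> * t) \<subseteq> sector \<theta>"
proof
  \<comment> \<open>1/2 keeps Re z above t/2, and then |Im z| < \<kappa> t gives |Im z / Re z| < 2 *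
    \<kappa> <= \<theta>; the angle is smaller still, as |arctan x| <= |x|.\<close>
  define \<kappa> where "\<kappa> = min (1/2) (\<theta>/2)"
  show "\<kappa> > 0" using \<theta> by (simp add: \<kappa>_def)
  have \<kappa>: "\<kappa> \<le> 1/2" "\<kappa> \<le> \<theta>/2" by (auto simp: \<kappa>_def)
  show "ball (complex_of_real t) (\<kappa> * t) \<subseteq> sector \<theta>" if t: "t > 0" for t
  proof
    fix z assume z: "z \<in> ball (complex_of_real t) (\<kappa> * t)"
    then have d: "cmod (complex_of_real t - z) < \<kappa> * t" by (simp add: dist_norm)
    have "\<bar>t - Re z\<bar> < \<kappa> * t" "\<bar>Im z\<bar> < \<kappa> * t"
      using d abs_Re_le_cmod[of "complex_of_real t - z"] abs_Im_le_cmod[of "complex_of_real t - z"] by auto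
    moreover have "\<kappa> * t \<le> 1/2 * t" using \<kappa>(1) t by (intro mult_right_mono) auto
    ultimately have Re: "Re z > t/2" and Im: "\<bar>Im z\<bar> < \<kappa> * t" by (auto simp: abs_less_iff)
    then have pos: "Re z > 0" using t by linarith
    have "\<bar>Im z / Re z\<bar> = \<bar>Im z\<bar> / Re z" using pos by simp
    also have "\<dots> < (\<kappa> * t) / (t/2)" using Re Im t pos by (intro frac_less) auto
    also have "\<dots> \<le> \<theta>" using \<kappa>(2) t by simp
    finally have q: "\<bar>Im z / Re z\<bar> < \<theta>" .
    have "\<bar>arctan x\<bar> \<le> \<bar>x\<bar>" for x :: real
    proof -
      have "norm (arctan x - arctan 0) \<le> 1 * norm (x - 0)"
      proof (rule field_differentiable_bound[where S=UNIV and f'="\<lambda>y. inverse (1 + y\<^sup>2)"])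
        show "(arctan has_field_derivative inverse (1 + y\<^sup>2)) (at y within UNIV)" for y :: real by (simp add: DERIV_arctan)
        show "norm (inverse (1 + y\<^sup>2)) \<le> 1" for y :: real by (simp add: inverse_le_1_iff)
      qed auto
      then show ?thesis by simp
    qed
    then have "\<bar>Arg z\<bar> < \<theta>" using q arg_conv_arctan[OF pos] by (metis le_less_trans)
    then show "z \<in> sector \<theta>" using pos by (auto simp: sector_def)
  qed
qed

section \<open>Analyticity in terms of real functions\<close>

context space_setting
begin

text \<open>No membership is asked: this is applied to the modulus of a complex function, which is
  not known to be an element.\<close>

lemma E_nrm_mono_everywhere: "(\<And>x. \<bar>f x\<bar> \<le> \<bar>g x\<bar>) \<Longrightarrow> nrm E f \<le> nrm E g"
  by (cases "i = 1")
    (auto simp: X_x_1 L1_space_def E_C0 C0_space_def intro!: nn_integral_mono SUP_mono ennreal_leI)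

lemma X_nrm_mono_everywhere: "(\<And>p. \<bar>f p\<bar> \<le> \<bar>g p\<bar>) \<Longrightarrow> nrm (XR r) f \<le> nrm (XR r) g"
  unfolding XR_nrm_eq by (intro nn_integral_mono E_nrm_mono_everywhere)

lemma cnrm_bounds: "nrm (XR r) (\<lambda>p. Re (f p)) \<le> cnrm (XR r) f" "nrm (XR r) (\<lambda>p. Im (f p)) \<le> cnrm (XR r) f"
  unfolding cnrm_def by (intro X_nrm_mono_everywhere, simp add: abs_Re_le_cmod abs_Im_le_cmod)+

lemma cnrm_of_real: "cnrm (XR r) (\<lambda>p. complex_of_real (f p)) = nrm (XR r) f"
  unfolding cnrm_def by (intro antisym X_nrm_mono_everywhere) auto

lemma of_real_celems: "f \<in> elems (XR r) \<Longrightarrow> (\<lambda>p. complex_of_real (f p)) \<in> celems (XR r)"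
  using XR.V_closed(1)[of r] by (simp add: celems_def zero_fun_def)

lemma rnrm_le: "f \<in> elems (XR r) \<Longrightarrow> nrm (XR r) f \<le> ennreal c \<Longrightarrow> c \<ge> 0 \<Longrightarrow> rnrm (XR r) f \<le> c"
  by (simp add: XR_nrm)

text \<open>Analyticity is given on the complexified space. The real and imaginary parts of
  \<open>S z\<close> on real functions are bounded operators on the real space, and norms of both
  parts are dominated by the complex norm, so the real-variable estimate applies.\<close>

lemma analytic_semigroup_bound:
  assumes an: "analytic_semigroup (XR r) G"
  shows "\<exists>C\<ge>0. \<exists>d>0. \<forall>t x. 0 < t \<longrightarrow> t < d \<longrightarrow> x \<in> elems (XR r) \<longrightarrow>
    (\<exists>y. (G t x, y) \<in> genX r G \<and> rnrm (XR r) y \<le> C / t * rnrm (XR r) x)"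
proof -
  let ?X = "XR r"
  have sg: "sgX r G" using an by (intro C0_semigroup_imp[OF XR_fs_lin]) (simp add: analytic_semigroup_def)
  from an obtain \<theta> S where \<theta>: "0 < \<theta>"
    and S1: "\<forall>z\<in>sector \<theta>. cbounded_operator ?X (S z)"
    and S2: "\<forall>z\<in>sector \<theta>. \<exists>D. cbounded_operator ?X D \<and>
          (\<forall>\<epsilon>>0. \<exists>\<delta>>0. \<forall>h. h \<noteq> 0 \<longrightarrow> cmod h < \<delta> \<longrightarrow> z + h \<in> sector \<theta> \<longrightarrow> (\<forall>f\<in>celems ?X.
             cnrm ?X (\<lambda>p. (S (z + h) f p - S z f p) / h - D f p) \<le> ennreal \<epsilon> * cnrm ?X f))"
    and S3: "\<forall>\<theta>'. 0 < \<theta>' \<longrightarrow> \<theta>' < \<theta> \<longrightarrow> (\<forall>f\<in>celems ?X.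
          ((\<lambda>z. cnrm ?X (\<lambda>p. S z f p - f p)) \<longlongrightarrow> 0) (at 0 within sector \<theta>'))"
    and S4: "\<forall>t>0. \<forall>f\<in>celems ?X. cnrm ?X (\<lambda>p. S (complex_of_real t) f p -
          Complex (G t (\<lambda>p. Re (f p)) p) (G t (\<lambda>p. Im (f p)) p)) = 0"
    unfolding analytic_semigroup_def by (elim conjE exE) (rule that)
  define cf where "cf f = (\<lambda>p. complex_of_real (f p))" for f :: "(real^'n) \<times> real \<Rightarrow> real"
  have cfE: "f \<in> elems ?X \<Longrightarrow> cf f \<in> celems ?X" for f unfolding cf_def by (rule of_real_celems)
  define R where "R z f = (\<lambda>p. Re (S z (cf f) p))" for z f
  define J where "J z f = (\<lambda>p. Im (S z (cf f) p))" for z f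
  \<comment> \<open>Strong continuity at 0 is available in strictly smaller sectors only, hence half
    the angle.\<close>
  have sub: "sector (\<theta>/2) \<subseteq> sector \<theta>" using \<theta> by (auto simp: sector_def)
  obtain \<kappa> where \<kappa>: "\<kappa> > 0" "\<And>t. t > 0 \<Longrightarrow> ball (complex_of_real t) (\<kappa> * t) \<subseteq> sector (\<theta>/2)"
    using ball_in_sector[of "\<theta>/2"] \<theta> by auto
  have ops: "XR.bounded_op r (\<lambda>f p. Re (T (cf f) p)) \<and> XR.bounded_op r (\<lambda>f p. Im (T (cf f) p))"
    if T: "cbounded_operator ?X T" for T
  proof -
    have TV: "(\<lambda>p. Re (T (cf f) p)) \<in> elems ?X" "(\<lambda>p. Im (T (cf f) p)) \<in> elems ?X" if "f \<in> elems ?X" for f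
      using T cfE[OF that] by (auto simp: cbounded_operator_def celems_def)
    obtain C where "\<forall>f\<in>celems ?X. cnrm ?X (T f) \<le> ennreal C * cnrm ?X f" using T unfolding cbounded_operator_def by blast
    then have C: "\<And>f. f \<in> celems ?X \<Longrightarrow> cnrm ?X (T f) \<le> ennreal C * cnrm ?X f" by blast
    have bd: "cnrm ?X (T (cf f)) \<le> ennreal (\<bar>C\<bar> * rnrm ?X f)" if "f \<in> elems ?X" for f
    proof -
      have "cnrm ?X (T (cf f)) \<le> ennreal C * nrm ?X f" using C[OF cfE[OF that]] by (simp add: cf_def cnrm_of_real)
      also have "\<dots> \<le> ennreal \<bar>C\<bar> * ennreal (rnrm ?X f)" unfolding XR_nrm[OF that] by (intro mult_right_mono ennreal_leI) auto
      finally show ?thesis by (simp add: ennreal_mult)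
    qed
    have lin: "cnrm ?X (\<lambda>p. T (cf (c *\<^sub>R f + d *\<^sub>R g)) p - (complex_of_real c * T (cf f) p + complex_of_real d * T (cf g) p)) = 0"
      if "f \<in> elems ?X" "g \<in> elems ?X" for f g c d
    proof -
      have "cf (c *\<^sub>R f + d *\<^sub>R g) = (\<lambda>p. complex_of_real c * cf f p + complex_of_real d * cf g p)"
        by (auto simp: cf_def fun_eq_iff)
      then show ?thesis using T cfE[OF that(1)] cfE[OF that(2)] by (simp add: cbounded_operator_def)
    qed
    have "XR.bounded_op r (\<lambda>f p. Re (T (cf f) p))"
      unfolding XR.bounded_op_def
    proof (intro conjI ballI allI exI[of _ "\<bar>C\<bar>"] TV(1))
      fix f assume f: "f \<in> elems ?X"
      show "rnrm ?X (\<lambda>p. Re (T (cf f) p)) \<le> \<bar>C\<bar> * rnrm ?X f"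
        by (rule rnrm_le[OF TV(1)[OF f] order_trans[OF cnrm_bounds(1) bd[OF f]]]) simp
      fix g c d assume g: "g \<in> elems ?X"
      let ?h = "\<lambda>p. T (cf (c *\<^sub>R f + d *\<^sub>R g)) p - (complex_of_real c * T (cf f) p + complex_of_real d * T (cf g) p)"
      have "(\<lambda>p. Re (T (cf (c *\<^sub>R f + d *\<^sub>R g)) p)) - (c *\<^sub>R (\<lambda>p. Re (T (cf f) p)) + d *\<^sub>R (\<lambda>p. Re (T (cf g) p))) = (\<lambda>p. Re (?h p))"
        by (auto simp: fun_eq_iff)
      then show "rnrm ?X ((\<lambda>p. Re (T (cf (c *\<^sub>R f + d *\<^sub>R g)) p)) - (c *\<^sub>R (\<lambda>p. Re (T (cf f) p)) + d *\<^sub>R (\<lambda>p. Re (T (cf g) p)))) = 0"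
        using cnrm_bounds(1)[of r ?h] lin[OF f g, of c d] by (simp add: rnrm_def)
    qed
    moreover have "XR.bounded_op r (\<lambda>f p. Im (T (cf f) p))"
      unfolding XR.bounded_op_def
    proof (intro conjI ballI allI exI[of _ "\<bar>C\<bar>"] TV(2))
      fix f assume f: "f \<in> elems ?X"
      show "rnrm ?X (\<lambda>p. Im (T (cf f) p)) \<le> \<bar>C\<bar> * rnrm ?X f"
        by (rule rnrm_le[OF TV(2)[OF f] order_trans[OF cnrm_bounds(2) bd[OF f]]]) simp
      fix g c d assume g: "g \<in> elems ?X"
      let ?h = "\<lambda>p. T (cf (c *\<^sub>R f + d *\<^sub>R g)) p - (complex_of_real c * T (cf f) p + complex_of_real d * T (cf g) p)"
      have "(\<lambda>p. Im (T (cf (c *\<^sub>R f + d *\<^sub>R g)) p)) - (c *\<^sub>R (\<lambda>p. Im (T (cf f) p)) + d *\<^sub>R (\<lambda>p. Im (T (cf g) p))) = (\<lambda>p. Im (?h p))"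
        by (auto simp: fun_eq_iff)
      then show "rnrm ?X ((\<lambda>p. Im (T (cf (c *\<^sub>R f + d *\<^sub>R g)) p)) - (c *\<^sub>R (\<lambda>p. Im (T (cf f) p)) + d *\<^sub>R (\<lambda>p. Im (T (cf g) p)))) = 0"
        using cnrm_bounds(2)[of r ?h] lin[OF f g, of c d] by (simp add: rnrm_def)
    qed
    ultimately show ?thesis by blast
  qed
  have opR: "XR.bounded_op r (R z)" "XR.bounded_op r (J z)" if "z \<in> sector \<theta>" for z
    using ops[of "S z"] S1 that unfolding R_def J_def by auto
  have RV: "R z f \<in> elems ?X" "J z f \<in> elems ?X" if "z \<in> sector \<theta>" "f \<in> elems ?X" for z f
    using XR.bounded_opV[OF opR(1)] XR.bounded_opV[OF opR(2)] that by auto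
  show ?thesis
  proof (rule XR.analytic_generator_bound[OF sg \<kappa>])
    show "XR.bounded_op r (R z)" "XR.bounded_op r (J z)" if "z \<in> sector (\<theta>/2)" for z using opR sub that by auto
  next
    fix x e assume x: "x \<in> elems ?X" and e: "(e::real) > 0"
    have th: "0 < \<theta>/2" "\<theta>/2 < \<theta>" using \<theta> by auto
    have "((\<lambda>z. cnrm ?X (\<lambda>p. S z (cf x) p - cf x p)) \<longlongrightarrow> 0) (at 0 within sector (\<theta>/2))"
      using S3 th cfE[OF x] by blast
    then have "\<forall>\<^sub>F z in at 0 within sector (\<theta>/2). cnrm ?X (\<lambda>p. S z (cf x) p - cf x p) < ennreal e"
      by (rule order_tendstoD) (use e in simp)
    then obtain d where d: "d > 0" "\<And>z. z \<in> sector (\<theta>/2) \<Longrightarrow> z \<noteq> 0 \<Longrightarrow> dist z 0 < d \<Longrightarrow> cnrm ?X (\<lambda>p. S z (cf x) p - cf x p) < ennreal e"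
      by (auto simp: eventually_at)
    have "rnrm ?X (R z x - x) < e \<and> rnrm ?X (J z x) < e" if z: "z \<in> sector (\<theta>/2)" "cmod z < d" for z
    proof -
      have z0: "z \<noteq> 0" "dist z 0 < d" using z by (auto simp: sector_def)
      have zs: "z \<in> sector \<theta>" using z sub by auto
      let ?h = "\<lambda>p. S z (cf x) p - cf x p"
      have c: "cnrm ?X ?h < ennreal e" by (rule d(2)[OF z(1) z0])
      have "R z x - x = (\<lambda>p. Re (?h p))" "J z x = (\<lambda>p. Im (?h p))" by (auto simp: R_def J_def cf_def fun_eq_iff)
      then have "nrm ?X (R z x - x) < ennreal e" "nrm ?X (J z x) < ennreal e"
        using cnrm_bounds[of r ?h] c by (auto intro: le_less_trans)
      then show ?thesis using XR_nrm[OF XR.V_closed(3)[OF RV(1)[OF zs x] x]] XR_nrm[OF RV(2)[OF zs x]] e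
        by (simp add: ennreal_less_iff)
    qed
    then show "\<exists>d>0. \<forall>z\<in>sector (\<theta>/2). cmod z < d \<longrightarrow> rnrm ?X (R z x - x) < e \<and> rnrm ?X (J z x) < e"
      using d(1) by blast
  next
    fix z x assume "z \<in> sector (\<theta>/2)" and x: "x \<in> elems ?X"
    then have z: "z \<in> sector \<theta>" using sub by auto
    then obtain D where D: "cbounded_operator ?X D" and
      Dd: "\<And>\<epsilon>. \<epsilon> > 0 \<Longrightarrow> \<exists>\<delta>>0. \<forall>h. h \<noteq> 0 \<longrightarrow> cmod h < \<delta> \<longrightarrow> z + h \<in> sector \<theta> \<longrightarrow> (\<forall>f\<in>celems ?X.
             cnrm ?X (\<lambda>p. (S (z + h) f p - S z f p) / h - D f p) \<le> ennreal \<epsilon> * cnrm ?X f)"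
      using S2 by blast
    define A where "A f = (\<lambda>p. Re (D (cf f) p))" for f
    define B where "B f = (\<lambda>p. Im (D (cf f) p))" for f
    have AV: "A f \<in> elems ?X" "B f \<in> elems ?X" if "f \<in> elems ?X" for f
      using D cfE[OF that] by (auto simp: cbounded_operator_def celems_def A_def B_def)
    have "XR.has_complex_derivative r (sector (\<theta>/2)) (\<lambda>z. R z x) (\<lambda>z. J z x) z (A x) (B x)"
      unfolding XR.has_complex_derivative_def
    proof (intro allI impI)
      fix e :: real assume e: "e > 0"
      define \<epsilon> where "\<epsilon> = e / (rnrm ?X x + 1)"
      have \<epsilon>: "\<epsilon> > 0" using e by (simp add: \<epsilon>_def add_nonneg_pos)
      have \<epsilon>e: "\<epsilon> * rnrm ?X x \<le> e"
      proof -
        have "\<epsilon> * rnrm ?X x \<le> \<epsilon> * (rnrm ?X x + 1)" using \<epsilon> by (intro mult_left_mono) auto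
        also have "\<dots> = e" using rnrm_nonneg[of ?X x] by (simp add: \<epsilon>_def add_nonneg_eq_0_iff)
        finally show ?thesis .
      qed
      obtain \<delta> where \<delta>: "\<delta> > 0" "\<And>h. h \<noteq> 0 \<Longrightarrow> cmod h < \<delta> \<Longrightarrow> z + h \<in> sector \<theta> \<Longrightarrow>
          cnrm ?X (\<lambda>p. (S (z + h) (cf x) p - S z (cf x) p) / h - D (cf x) p) \<le> ennreal \<epsilon> * cnrm ?X (cf x)"
        using Dd[OF \<epsilon>] cfE[OF x] by blast
      have "rnrm ?X (Re (1/h) *\<^sub>R (R (z + h) x - R z x) - Im (1/h) *\<^sub>R (J (z + h) x - J z x) - A x) \<le> e \<and>
        rnrm ?X (Re (1/h) *\<^sub>R (J (z + h) x - J z x) + Im (1/h) *\<^sub>R (R (z + h) x - R z x) - B x) \<le> e"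
        if h: "h \<noteq> 0" "cmod h < \<delta>" and "z + h \<in> sector (\<theta>/2)" for h
      proof -
        have zh: "z + h \<in> sector \<theta>" using that(3) sub by auto
        let ?h = "\<lambda>p. (S (z + h) (cf x) p - S z (cf x) p) / h - D (cf x) p"
        have "cnrm ?X ?h \<le> ennreal \<epsilon> * ennreal (rnrm ?X x)"
          using \<delta>(2)[OF h zh] XR_nrm[OF x] by (simp add: cf_def cnrm_of_real)
        also have "\<dots> \<le> ennreal e" using \<epsilon>e \<epsilon> by (simp add: ennreal_mult[symmetric] ennreal_leI)
        finally have c: "cnrm ?X ?h \<le> ennreal e" .
        have split: "Re (w / h - q) = Re (1/h) * Re w - Im (1/h) * Im w - Re q"
          "Im (w / h - q) = Re (1/h) * Im w + Im (1/h) * Re w - Im q" for w q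
        proof -
          have "w / h = (1/h) * w" by simp
          then show "Re (w / h - q) = Re (1/h) * Re w - Im (1/h) * Im w - Re q"
            "Im (w / h - q) = Re (1/h) * Im w + Im (1/h) * Re w - Im q"
            by (simp_all only: minus_complex.sel times_complex.sel)
        qed
        have e1: "Re (1/h) *\<^sub>R (R (z + h) x - R z x) - Im (1/h) *\<^sub>R (J (z + h) x - J z x) - A x = (\<lambda>p. Re (?h p))"
          unfolding split by (auto simp: fun_eq_iff R_def J_def A_def)
        have e2: "Re (1/h) *\<^sub>R (J (z + h) x - J z x) + Im (1/h) *\<^sub>R (R (z + h) x - R z x) - B x = (\<lambda>p. Im (?h p))"
          unfolding split by (auto simp: fun_eq_iff R_def J_def B_def)
        note V = RV[OF z x] RV[OF zh x] AV[OF x]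
        have v1: "Re (1/h) *\<^sub>R (R (z + h) x - R z x) - Im (1/h) *\<^sub>R (J (z + h) x - J z x) - A x \<in> elems ?X"
          "Re (1/h) *\<^sub>R (J (z + h) x - J z x) + Im (1/h) *\<^sub>R (R (z + h) x - R z x) - B x \<in> elems ?X"
          using V by (intro XR.V_closed; simp)+
        show ?thesis
          using rnrm_le[OF v1(1)] rnrm_le[OF v1(2)] order_trans[OF cnrm_bounds(1) c] order_trans[OF cnrm_bounds(2) c] e
          unfolding e1 e2 by auto
      qed
      then show "\<exists>d>0. \<forall>h. h \<noteq> 0 \<longrightarrow> cmod h < d \<longrightarrow> z + h \<in> sector (\<theta>/2) \<longrightarrow>
        rnrm ?X (Re (1/h) *\<^sub>R (R (z + h) x - R z x) - Im (1/h) *\<^sub>R (J (z + h) x - J z x) - A x) \<le> e \<and>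
        rnrm ?X (Re (1/h) *\<^sub>R (J (z + h) x - J z x) + Im (1/h) *\<^sub>R (R (z + h) x - R z x) - B x) \<le> e"
        using \<delta>(1) by blast
    qed
    then show "\<exists>a\<in>elems ?X. \<exists>b\<in>elems ?X. XR.has_complex_derivative r (sector (\<theta>/2)) (\<lambda>z. R z x) (\<lambda>z. J z x) z a b"
      using AV[OF x] by blast
  next
    fix t x assume t: "(t::real) > 0" and x: "x \<in> elems ?X"
    have ts: "complex_of_real t \<in> sector \<theta>" using t \<theta> by (auto simp: sector_def)
    have t0: "t \<ge> 0" using t by simp
    let ?h = "\<lambda>p. S (complex_of_real t) (cf x) p - Complex (G t (\<lambda>p. Re (cf x p)) p) (G t (\<lambda>p. Im (cf x p)) p)"
    have "cnrm ?X ?h = 0" using S4 t cfE[OF x] by blast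
    then have "nrm ?X (\<lambda>p. Re (?h p)) = 0" using cnrm_bounds(1)[of r ?h] by simp
    moreover have "(\<lambda>p. Re (?h p)) = R (complex_of_real t) x - G t x" by (auto simp: R_def cf_def fun_eq_iff)
    ultimately have "rnrm ?X (R (complex_of_real t) x - G t x) = 0" by (simp add: rnrm_def)
    then show "eqX r (R (complex_of_real t) x) (G t x)"
      using RV(1)[OF ts x] XR.sgV[OF sg t0 x] by (intro XR.eqvI)
  qed
qed

end

text \<open>This is (t y)^\<mu> <= t y + 1 multiplied by t^(-\<mu>); the cases t y <= 1 and t y > 1
  show which summand dominates. The constant 1 in front of both summands is what makes the later
  bounds uniform in \<mu>.\<close>

lemma powr_interpolation:
  fixes y t \<mu> :: real
  assumes "y > 0" "t > 0" "0 \<le> \<mu>" "\<mu> \<le> 1"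
  shows "y powr \<mu> \<le> t powr (1 - \<mu>) * y + t powr (- \<mu>)"
proof (cases "t * y \<le> 1")
  case True
  then have "y \<le> inverse t" using assms by (simp add: field_simps)
  then have "y powr \<mu> \<le> inverse t powr \<mu>" using assms by (intro powr_mono2) auto
  also have "\<dots> = t powr (- \<mu>)" using assms by (simp add: powr_minus inverse_powr)
  finally have "y powr \<mu> \<le> t powr (- \<mu>)" .
  moreover have "0 \<le> t powr (1 - \<mu>) * y" using assms by simp
  ultimately show ?thesis by linarith
next
  case False
  then have "inverse t \<le> y" using assms by (simp add: field_simps)
  then have "inverse t powr (1 - \<mu>) \<le> y powr (1 - \<mu>)" using assms by (intro powr_mono2) auto
  then have "t powr (1 - \<mu>) * inverse t powr (1 - \<mu>) \<le> t powr (1 - \<mu>) * y powr (1 - \<mu>)" by (intro mult_left_mono) auto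
  moreover have "t powr (1 - \<mu>) * inverse t powr (1 - \<mu>) = 1" using assms by (simp add: powr_mult[symmetric])
  ultimately have "1 \<le> t powr (1 - \<mu>) * y powr (1 - \<mu>)" by simp
  then have "y powr \<mu> * 1 \<le> y powr \<mu> * (t powr (1 - \<mu>) * y powr (1 - \<mu>))" by (intro mult_left_mono) auto
  also have "\<dots> = t powr (1 - \<mu>) * y" using assms by (simp add: mult.left_commute powr_add[symmetric])
  finally have "y powr \<mu> \<le> t powr (1 - \<mu>) * y" by simp
  moreover have "0 \<le> t powr (- \<mu>)" by simp
  ultimately show ?thesis by linarith
qed

section \<open>Comparison of K with the majorising operator\<close>

context transport_fragmentation
begin

lemma b_le_\<beta>_slices: "AE m in Lm. AE x in lebesgue_on \<Omega>. AE s in Lm. m \<le> s \<longrightarrow> b x m s \<le> \<beta> m s"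
proof -
  have bor: "({0..} :: real set) \<times> ({0..} :: real set) \<in> sets borel" by (intro borel_Times) auto
  have S: "\<Omega> \<times> ({0..} :: real set) \<times> ({0..} :: real set) \<in> sets lebesgue"
    using borel_Times[OF borel_\<Omega> bor] by simp
  have "AE p in lborel. p \<in> \<Omega> \<times> {0..} \<times> {0..} \<longrightarrow> (case p of (x, m, s) \<Rightarrow> m \<le> s \<longrightarrow> b x m s \<le> \<beta> m s)"
    using b_le_\<beta> unfolding AE_lebesgue_on_iff[OF S] .
  from lborel_AE_triple[OF this] show ?thesis
    unfolding AE_lebesgue_on_iff[OF half_line_lebesgue] AE_lebesgue_on_iff[OF leb_\<Omega>]
  proof (rule eventually_mono, intro impI)
    fix m :: real assume m: "m \<in> {0..}"
      and *: "AE x in lborel. AE s in lborel. (x, m, s) \<in> \<Omega> \<times> {0..} \<times> {0..} \<longrightarrow> (case (x, m, s) of (x, m, s) \<Rightarrow> m \<le> s \<longrightarrow> b x m s \<le> \<beta> m s)"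
    from * show "AE x in lborel. x \<in> \<Omega> \<longrightarrow> (AE s in lborel. s \<in> {0..} \<longrightarrow> m \<le> s \<longrightarrow> b x m s \<le> \<beta> m s)"
    proof (rule eventually_mono, intro impI)
      fix x assume x: "x \<in> \<Omega>" and *: "AE s in lborel. (x, m, s) \<in> \<Omega> \<times> {0..} \<times> {0..} \<longrightarrow> (case (x, m, s) of (x, m, s) \<Rightarrow> m \<le> s \<longrightarrow> b x m s \<le> \<beta> m s)"
      from * show "AE s in lborel. s \<in> {0..} \<longrightarrow> m \<le> s \<longrightarrow> b x m s \<le> \<beta> m s"
        by (rule eventually_mono) (use m x in auto)
    qed
  qed
qed

text \<open>On nonnegative u both changes go upwards: the loss shrinks because \<alpha>1 <= a, and
  the gain grows because b a <= \<beta> \<alpha>2. The transport terms agree, since a generator is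
  single-valued up to null vectors.\<close>

lemma K_le_Kmaj:
  assumes uw: "(u, w) \<in> K_op i \<Omega> r T0 D0 a b" and pos: "u \<in> cone X"
  shows "\<exists>w'. (u, w') \<in> maj_K_op i \<Omega> r T0 D0 \<alpha>1 \<alpha>2 \<beta> \<and> (AE m in Lm. AE x in lebesgue_on \<Omega>. w (x, m) \<le> w' (x, m))"
proof -
  obtain v v1 where v: "(u, v) \<in> T_op i \<Omega> r T0 D0 a"
    and v1: "(u, v1) \<in> gain_op i \<Omega> r (Domain (T_op i \<Omega> r T0 D0 a)) (\<lambda>x m s. b x m s * a x s)"
    and w: "w \<in> elems X" "fs_eq X w (\<lambda>p. v p + v1 p)"
    using uw by (auto simp: K_op_def op_sum_def)
  obtain t0 a0 where t0: "(u, t0) \<in> T0_op i \<Omega> r T0 D0" and a0: "(u, a0) \<in> absorption_op i \<Omega> r a"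
    and vel: "v \<in> elems X" "fs_eq X v (\<lambda>p. t0 p + a0 p)"
    using v by (auto simp: T_op_def op_sum_def)
  have el: "u \<in> elems X" "t0 \<in> elems X" "a0 \<in> elems X" "v1 \<in> elems X"
    using t0 a0 v1 by (auto simp: T0_op_def absorption_op_def gain_op_def)
  have a0ae: "AE m in Lm. AE x in lebesgue_on \<Omega>. a0 (x, m) = - a x m * u (x, m)" using a0 by (simp add: absorption_op_def)
  have fin: "(\<integral>\<^sup>+m. ennreal (\<alpha>1 m) * nrm E (slice u m) \<partial>dm r) < \<infinity>"
  proof -
    have "(\<integral>\<^sup>+m. ennreal (\<alpha>1 m) * nrm E (slice u m) \<partial>dm r) \<le> (\<integral>\<^sup>+m. nrm E (slice a0 m) \<partial>dm r)"
    proof (rule nn_integral_mono_AE, unfold AE_dm_iff)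
      show "AE m in Lm. ennreal (\<alpha>1 m) * nrm E (slice u m) \<le> nrm E (slice a0 m)"
        using a0ae rate_ae(1) \<alpha>_ae XR_slice_elems[OF el(1)] XR_slice_elems[OF el(3)]
      proof eventually_elim
        case (elim m)
        have "nrm E (\<alpha>1 m *\<^sub>R slice u m) \<le> nrm E (slice a0 m)"
        proof (rule E_nrm_mono[OF E.V_closed(5)[OF elim(4)] elim(5)])
          show "AE x in lebesgue_on \<Omega>. \<bar>(\<alpha>1 m *\<^sub>R slice u m) x\<bar> \<le> \<bar>a0 (x, m)\<bar>"
            using elim(1,2)
          proof eventually_elim
            case (elim x)
            then show ?case using \<open>0 \<le> \<alpha>1 m \<and> _\<close> by (auto simp: abs_mult intro!: mult_right_mono)
          qed
        qed
        moreover have "nrm E (\<alpha>1 m *\<^sub>R slice u m) = ennreal (\<alpha>1 m) * nrm E (slice u m)"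
          using E_nrm[OF E.V_closed(5)[OF elim(4)]] E_nrm[OF elim(4)] E.N_scale[OF elim(4)] elim(3) by (simp add: ennreal_mult)
        ultimately show ?case by simp
      qed
    qed
    also have "\<dots> < \<infinity>" using el(3) by (simp add: XR_elems_iff XR_nrm_eq)
    finally show ?thesis .
  qed
  define a1 where "a1 = (\<lambda>p. - \<alpha>1 (snd p) * u p)"
  have a1: "(u, a1) \<in> maj_A_op i \<Omega> r \<alpha>1" unfolding a1_def by (rule maj_A_I[OF el(1) fin])
  have a1el: "a1 \<in> elems X" using a1 by (simp add: maj_A_iff)
  have "t0 + a1 \<in> elems X" using el a1el by (intro XR.V_closed(2))
  moreover have "fs_eq X (t0 + a1) (\<lambda>p. t0 p + a1 p)" unfolding fs_eq_def using XR_nrm[OF XR.V_closed(1), of r] XR.N_zero[of r] by (simp add: zero_fun_def)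
  ultimately have "(u, t0 + a1) \<in> maj_T_op i \<Omega> r T0 D0 \<alpha>1" unfolding maj_T_op_def op_sum_def using t0 a1 by blast
  \<comment> \<open>The domain equality of the threshold property supplies the gain term of u in the
    majorising problem, so that nothing but values remains to be compared.\<close>
  then have "u \<in> Domain (maj_K_op i \<Omega> r T0 D0 \<alpha>1 \<alpha>2 \<beta>)" unfolding threshold_facts(4) by blast
  then obtain w' where w': "(u, w') \<in> maj_K_op i \<Omega> r T0 D0 \<alpha>1 \<alpha>2 \<beta>" by blast
  then obtain v2 v3 where v2: "(u, v2) \<in> maj_T_op i \<Omega> r T0 D0 \<alpha>1" and v3: "(u, v3) \<in> maj_B_op i \<Omega> r \<alpha>1 \<alpha>2 \<beta>"
    and w'el: "w' \<in> elems X" "fs_eq X w' (\<lambda>p. v2 p + v3 p)" by (auto simp: maj_K_op_def op_sum_def)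
  obtain t2 a2 where t2: "(u, t2) \<in> T0_op i \<Omega> r T0 D0" and a2: "(u, a2) \<in> maj_A_op i \<Omega> r \<alpha>1"
    and v2el: "v2 \<in> elems X" "fs_eq X v2 (\<lambda>p. t2 p + a2 p)" using v2 by (auto simp: maj_T_op_def op_sum_def)
  have el2: "t2 \<in> elems X" "a2 \<in> elems X" "v3 \<in> elems X"
    using t2 a2 v3 by (auto simp: T0_op_def maj_A_iff maj_B_op_def gain_op_def)
  have tt: "eqX r t0 t2" using XR.gen_unique[OF sg0] t0 t2 unfolding gen0 by blast
  have ew: "eqX r w (v + v1)" "eqX r v (t0 + a0)" "eqX r w' (v2 + v3)" "eqX r v2 (t2 + a2)"
    by (rule X_sum_eqv[OF w vel(1) el(4)], rule X_sum_eqv[OF vel el(2,3)], rule X_sum_eqv[OF w'el v2el(1) el2(3)],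
        rule X_sum_eqv[OF v2el el2(1,2)])
  have e1: "AE m in Lm. AE x in lebesgue_on \<Omega>. w (x, m) = v (x, m) + v1 (x, m)"
    using X_eqv_iff(2)[OF w(1) XR.V_closed(2)[OF vel(1) el(4)]] ew(1) by simp
  have e2: "AE m in Lm. AE x in lebesgue_on \<Omega>. v (x, m) = t0 (x, m) + a0 (x, m)"
    using X_eqv_iff(2)[OF vel(1) XR.V_closed(2)[OF el(2,3)]] ew(2) by simp
  have e3: "AE m in Lm. AE x in lebesgue_on \<Omega>. w' (x, m) = v2 (x, m) + v3 (x, m)"
    using X_eqv_iff(2)[OF w'el(1) XR.V_closed(2)[OF v2el(1) el2(3)]] ew(3) by simp
  have e4: "AE m in Lm. AE x in lebesgue_on \<Omega>. v2 (x, m) = t2 (x, m) + a2 (x, m)"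
    using X_eqv_iff(2)[OF v2el(1) XR.V_closed(2)[OF el2(1,2)]] ew(4) by simp
  have e5: "AE m in Lm. AE x in lebesgue_on \<Omega>. t0 (x, m) = t2 (x, m)"
    using X_eqv_iff(2)[OF el(2) el2(1)] tt by simp
  have e6: "AE m in Lm. AE x in lebesgue_on \<Omega>. a2 (x, m) = - \<alpha>1 m * u (x, m)" using a2 by (simp add: maj_A_iff)
  have upos: "AE m in Lm. AE x in lebesgue_on \<Omega>. 0 \<le> u (x, m)" using pos X_cone_iff[OF el(1)] by simp
  \<comment> \<open>Inside the gain integral x and m are fixed and s varies, so positivity of u is
    needed for almost every s at almost every x.\<close>
  have upos': "AE x in lebesgue_on \<Omega>. AE s in Lm. 0 \<le> u (x, s)" by (rule AE_swap_nonneg[OF XR_joint[OF el(1)] upos])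
  have gain: "AE m in Lm. AE x in lebesgue_on \<Omega>. v1 (x, m) \<le> v3 (x, m)"
  proof -
    have g1: "AE m in Lm. AE x in lebesgue_on \<Omega>. set_integrable lebesgue {m..} (\<lambda>s. b x m s * a x s * u (x, s)) \<and>
        v1 (x, m) = (LINT s:{m..}|lebesgue. b x m s * a x s * u (x, s))" using v1 by (simp add: gain_op_def)
    show ?thesis using g1 maj_B_slice[OF v3] b_le_\<beta>_slices AE_space
    proof eventually_elim
      case (elim m)
      have m0: "m \<ge> 0" using elim(4) by simp
      show ?case using elim(1,2,3) rate_ae(2) upos' AE_space
      proof eventually_elim
        case (elim x)
        have x: "x \<in> \<Omega>" using elim(6) by simp
        have bz: "b x m s * a x s * u (x, s) = 0" if "0 \<le> s" "s < m" for s
          using ker_b x m0 that by (simp add: kernel_b_def)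
        have i1: "integrable Lm (\<lambda>s. b x m s * a x s * u (x, s))" and v1e: "v1 (x, m) = (\<integral>s. b x m s * a x s * u (x, s) \<partial>Lm)"
          using elim(1) gain_integral_half_line[OF m0 bz] by auto
        have "(\<integral>s. b x m s * a x s * u (x, s) \<partial>Lm) \<le> (\<integral>s. \<alpha>2 s * \<beta> m s * u (x, s) \<partial>Lm)"
        proof (rule integral_mono_AE[OF i1])
          show "integrable Lm (\<lambda>s. \<alpha>2 s * \<beta> m s * u (x, s))" using elim(2) by simp
          show "AE s in Lm. b x m s * a x s * u (x, s) \<le> \<alpha>2 s * \<beta> m s * u (x, s)"
            using elim(3,4,5) AE_space
          proof eventually_elim
            case (elim s)
            have s0: "s \<ge> 0" using elim(4) by simp
            have bnn: "0 \<le> b x m s" "s < m \<Longrightarrow> b x m s = 0" and \<beta>nn: "0 \<le> \<beta> m s" "s < m \<Longrightarrow> \<beta> m s = 0"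
              using ker_b ker_\<beta> x m0 s0 by (auto simp: kernel_b_def kernel_beta_def)
            show ?case
            proof (cases "m \<le> s")
              case True
              then have "b x m s * a x s \<le> \<beta> m s * \<alpha>2 s" using elim bnn \<beta>nn by (intro mult_mono) auto
              then have "b x m s * a x s \<le> \<alpha>2 s * \<beta> m s" by (simp add: mult.commute)
              then show ?thesis using elim(3) by (intro mult_right_mono) simp_all
            qed (use bnn \<beta>nn in auto)
          qed
        qed
        then show ?case using v1e elim(2) by simp
      qed
    qed
  qed
  have "AE m in Lm. AE x in lebesgue_on \<Omega>. w (x, m) \<le> w' (x, m)"
    using e1 e2 e3 e4 e5 e6 a0ae upos gain rate_ae(1)
  proof eventually_elim
    case (elim m)
    then show ?case
    proof eventually_elim
      case (elim x)
      have "\<alpha>1 m * u (x, m) \<le> a x m * u (x, m)" using elim(8,10) by (intro mult_right_mono) auto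
      then show ?case using elim by simp
    qed
  qed
  then show ?thesis using w' by blast
qed

text \<open>The comparison lemma with P the identity, q the norm of the positive part and p the norm
  of the negative part. On the cone the difference \<open>v - v'\<close> of the generators is
  nonpositive by \<open>K_le_Kmaj\<close>, and positivity of G_maj preserves this sign.\<close>

lemma GK_le_GKmaj:
  assumes t: "t \<ge> 0" and f: "f \<in> elems X" "f \<in> cone X"
  shows "AE m in Lm. AE x in lebesgue_on \<Omega>. 0 \<le> GK r t f (x, m) \<and> GK r t f (x, m) \<le> GKmaj r t f (x, m)"
proof -
  have el: "GK r t f \<in> elems X" "GKmaj r t f \<in> elems X" using XR.sgV[OF sgK t f(1)] XR.sgV[OF sgKm t f(1)] by auto
  have posK: "t \<ge> 0 \<Longrightarrow> f \<in> elems X \<Longrightarrow> f \<in> cone X \<Longrightarrow> GK r t f \<in> cone X" for t f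
    using threshold_facts(8) by (auto simp: positive_semigroup_def)
  have posKm: "t \<ge> 0 \<Longrightarrow> f \<in> elems X \<Longrightarrow> f \<in> cone X \<Longrightarrow> GKmaj r t f \<in> cone X" for t f
    using threshold_facts(6) by (auto simp: positive_semigroup_def)
  have "rnrm X (pos_part (GK r t f - GKmaj r t f)) \<le> 0"
  proof (rule XR.semigroup_comparison_dense[OF sgK sgKm XR.bounded_op_id pos_part_sublin neg_part_sublin _ _ f(1) _ t])
    show "rnrm X (pos_part (- GK r t x)) \<le> 0" if "x \<in> elems X" "rnrm X (pos_part (- x)) \<le> 0" "t \<ge> 0" for x t
      using posK[OF that(3,1)] that XR.sgV[OF sgK that(3,1)] by (simp add: neg_part_null_iff)
    show "rnrm X (pos_part (- f)) \<le> 0" using f by (simp add: neg_part_null_iff)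
    fix u v assume uv: "(u, v) \<in> genX r (GK r)" and u: "rnrm X (pos_part (- u)) \<le> 0"
    have uel: "u \<in> elems X" "v \<in> elems X" using uv XR.gen_V by blast+
    obtain v' where v': "(u, v') \<in> genX r (GKmaj r)" "AE m in Lm. AE x in lebesgue_on \<Omega>. v (x, m) \<le> v' (x, m)"
      using K_le_Kmaj[of u v] uv u neg_part_null_iff[OF uel(1)] unfolding genK genKm by blast
    have v'el: "v' \<in> elems X" using v'(1) XR.gen_V by blast
    define d where "d = v' - v"
    have del: "d \<in> elems X" unfolding d_def using v'el uel(2) by (rule XR.V_closed(3))
    have dcone: "d \<in> cone X" unfolding X_cone_iff[OF del] using v'(2) by (simp add: d_def)
    have "rnrm X (pos_part (GKmaj r s (v - v'))) \<le> 0" if s: "s \<ge> 0" for s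
    proof -
      have e: "eqX r (GKmaj r s ((-1) *\<^sub>R d)) ((-1) *\<^sub>R GKmaj r s d)"
        by (rule XR.bounded_op_scale[OF XR.sg_op[OF sgKm s] del])
      have "(-1) *\<^sub>R d = v - v'" by (simp add: d_def)
      then have "rnrm X (pos_part (GKmaj r s (v - v'))) = rnrm X (pos_part (- GKmaj r s d))"
        using XR.sublin_eqv[OF pos_part_sublin e] by simp
      also have "\<dots> \<le> 0" using posKm[OF s del dcone] XR.sgV[OF sgKm s del] by (simp add: neg_part_null_iff)
      finally show ?thesis .
    qed
    then show "\<exists>v'. (u, v') \<in> genX r (GKmaj r) \<and> (\<forall>s\<ge>0. rnrm X (pos_part (GKmaj r s (v - v'))) \<le> 0)"
      using v'(1) by blast
  qed
  then have 1: "AE m in Lm. AE x in lebesgue_on \<Omega>. (GK r t f - GKmaj r t f) (x, m) \<le> 0"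
    using pos_part_null_iff[OF XR.V_closed(3)[OF el]] by simp
  have 2: "AE m in Lm. AE x in lebesgue_on \<Omega>. 0 \<le> GK r t f (x, m)" using X_cone_iff[OF el(1)] posK[OF t f] by simp
  show ?thesis using 1 2
  proof eventually_elim
    case (elim m)
    then show ?case by eventually_elim auto
  qed
qed

lemma GK_slice_le:
  assumes t: "t \<ge> 0" and f: "f \<in> elems X" "f \<in> cone X"
  shows "AE m in Lm. nrm E (slice (GK r t f) m) \<le> nrm E (slice (GKmaj r t f) m)"
proof -
  have el: "GK r t f \<in> elems X" "GKmaj r t f \<in> elems X" using XR.sgV[OF sgK t f(1)] XR.sgV[OF sgKm t f(1)] by auto
  show ?thesis using GK_le_GKmaj[OF t f] XR_slice_elems[OF el(1)] XR_slice_elems[OF el(2)]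
  proof eventually_elim
    case (elim m)
    show ?case
      by (rule E_nrm_mono[OF elim(2,3)], rule eventually_mono[OF elim(1)]) auto
  qed
qed

text \<open>With f split into its positive and negative parts, |G_K f| is at most the sum of their
  images under G_K, which are dominated by G_maj, and these add up to G_maj |f|.\<close>

lemma GK_slice_le_abs:
  assumes t: "t \<ge> 0" and f: "f \<in> elems X"
  shows "AE m in Lm. nrm E (slice (GK r t f) m) \<le> nrm E (slice (GKmaj r t (\<lambda>p. \<bar>f p\<bar>)) m)"
proof -
  define g where "g = pos_part f"
  define h where "h = pos_part (- f)"
  have el: "g \<in> elems X" "h \<in> elems X" unfolding g_def h_def using f by (auto intro!: pos_part_elems XR.V_closed(4))
  have co: "g \<in> cone X" "h \<in> cone X" using el by (auto simp: X_cone_iff) (auto simp: g_def h_def pos_part_def)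
  have fe: "f = g - h" "(\<lambda>p. \<bar>f p\<bar>) = g + h" by (auto simp: g_def h_def pos_part_def fun_eq_iff)
  have ael: "g + h \<in> elems X" using el by (rule XR.V_closed(2))
  note Kel = XR.sgV[OF sgK t f] XR.sgV[OF sgK t el(1)] XR.sgV[OF sgK t el(2)]
  note Mel = XR.sgV[OF sgKm t ael] XR.sgV[OF sgKm t el(1)] XR.sgV[OF sgKm t el(2)]
  have e1: "AE m in Lm. AE x in lebesgue_on \<Omega>. GK r t f (x, m) = GK r t g (x, m) - GK r t h (x, m)"
    using X_eqv_iff(2)[OF Kel(1) XR.V_closed(3)[OF Kel(2,3)]] XR.bounded_op_diff[OF XR.sg_op[OF sgK t] el] fe(1) by simp
  have e2: "AE m in Lm. AE x in lebesgue_on \<Omega>. GKmaj r t (g + h) (x, m) = GKmaj r t g (x, m) + GKmaj r t h (x, m)"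
    using X_eqv_iff(2)[OF Mel(1) XR.V_closed(2)[OF Mel(2,3)]] XR.bounded_op_add[OF XR.sg_op[OF sgKm t] el] by simp
  show ?thesis unfolding fe(2)
    using e1 e2 GK_le_GKmaj[OF t el(1) co(1)] GK_le_GKmaj[OF t el(2) co(2)] XR_slice_elems[OF Kel(1)] XR_slice_elems[OF Mel(1)]
  proof eventually_elim
    case (elim m)
    show ?case
    proof (rule E_nrm_mono[OF elim(5,6)])
      show "AE x in lebesgue_on \<Omega>. \<bar>GK r t f (x, m)\<bar> \<le> \<bar>GKmaj r t (g + h) (x, m)\<bar>"
        using elim(1-4) by eventually_elim auto
    qed
  qed
qed

text \<open>The loss operator is bounded relative to F because the two have the same domain. Its
  truncations at height n are bounded operators, pointwise bounded in n on this domain by the norm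
  of the untruncated loss term; uniform boundedness in the graph norm of F makes the bound uniform
  in u, and n tends to infinity by dominated convergence.\<close>

lemma \<alpha>1_bound:
  "\<exists>B\<ge>0. \<forall>(u, v)\<in>genX r (GF r). (\<integral>\<^sup>+m. ennreal (\<alpha>1 m) * nrm E (slice u m) \<partial>dm r) \<le> ennreal (B * (rnrm X u + rnrm X v))"
proof -
  \<comment> \<open>\<alpha>1 is nonnegative only almost everywhere; the maximum with 0 gives a
    multiplier with values in [0, n] everywhere.\<close>
  define \<alpha>n where "\<alpha>n n m = min (max 0 (\<alpha>1 m)) (real n)" for n m
  have \<alpha>nm: "\<alpha>n n \<in> borel_measurable Lm" for n unfolding \<alpha>n_def using \<alpha>_measurable(1) by measurable
  have \<alpha>n0: "0 \<le> \<alpha>n n m" "\<alpha>n n m \<le> real n" for n m by (auto simp: \<alpha>n_def)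
  define T where "T n u = (\<lambda>p. \<alpha>n n (snd p) * u p)" for n and u :: "(real^'n) \<times> real \<Rightarrow> real"
  have le: "(\<integral>\<^sup>+m. ennreal \<bar>\<alpha>n n m\<bar> * nrm E (slice u m) \<partial>dm r) \<le> ennreal (real n) * nrm X u" if u: "u \<in> elems X" for n u
  proof -
    have m: "(\<lambda>m. nrm E (slice u m)) \<in> borel_measurable (dm r)" using XR_slice_measurable[OF u] by measurable
    have "(\<integral>\<^sup>+m. ennreal \<bar>\<alpha>n n m\<bar> * nrm E (slice u m) \<partial>dm r) \<le> (\<integral>\<^sup>+m. ennreal (real n) * nrm E (slice u m) \<partial>dm r)"
      using \<alpha>n0 by (intro nn_integral_mono mult_right_mono ennreal_leI) auto
    also have "\<dots> = ennreal (real n) * nrm X u" unfolding XR_nrm_eq by (rule nn_integral_cmult[OF m])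
    finally show ?thesis .
  qed
  have Tel: "T n u \<in> elems X" "nrm X (T n u) = (\<integral>\<^sup>+m. ennreal \<bar>\<alpha>n n m\<bar> * nrm E (slice u m) \<partial>dm r)" if u: "u \<in> elems X" for n u
  proof -
    have "(\<integral>\<^sup>+m. ennreal \<bar>\<alpha>n n m\<bar> * nrm E (slice u m) \<partial>dm r) < \<infinity>"
      using le[OF u, of n] XR_nrm[OF u] by (auto simp: ennreal_mult_less_top intro: le_less_trans)
    from mult_elems[OF \<alpha>nm u this]
    show "T n u \<in> elems X" "nrm X (T n u) = (\<integral>\<^sup>+m. ennreal \<bar>\<alpha>n n m\<bar> * nrm E (slice u m) \<partial>dm r)" by (auto simp: T_def)
  qed
  have FA: "\<exists>v1. (u, v1) \<in> maj_A_op i \<Omega> r \<alpha>1" if "(u, v) \<in> genX r (GF r)" for u v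
    using that unfolding genF maj_F_op_def op_sum_def by blast
  have Tle: "nrm X (T n u) \<le> nrm X v1" if uv: "(u, v1) \<in> maj_A_op i \<Omega> r \<alpha>1" for u v1 n
  proof -
    have u: "u \<in> elems X" using uv by (simp add: maj_A_iff)
    have "nrm X (T n u) \<le> (\<integral>\<^sup>+m. ennreal (\<alpha>1 m) * nrm E (slice u m) \<partial>dm r)"
      unfolding Tel(2)[OF u]
      by (rule nn_integral_mono_AE) (use \<alpha>_ae in \<open>auto simp: AE_dm_iff \<alpha>n_def elim!: eventually_mono intro!: mult_right_mono ennreal_leI\<close>)
    then show ?thesis using maj_A_finite[OF uv] by simp
  qed
  have "\<exists>B\<ge>0. \<forall>n\<in>UNIV. \<forall>(u, v)\<in>genX r (GF r). rnrm X (T n u) \<le> B * (rnrm X u + rnrm X v)"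
  proof (rule XR.gen_uniform_boundedness[OF sgF])
    fix n x y assume xy: "x \<in> elems X" "y \<in> elems X"
    have "T n (x + y) = T n x + T n y" by (auto simp: T_def fun_eq_iff distrib_left)
    then show "rnrm X (T n (x + y)) \<le> rnrm X (T n x) + rnrm X (T n y)" using XR.N_add[OF Tel(1)[OF xy(1)] Tel(1)[OF xy(2)]] by simp
  next
    fix n c x assume x: "x \<in> elems X"
    have "T n (c *\<^sub>R x) = c *\<^sub>R T n x" by (auto simp: T_def fun_eq_iff)
    then show "rnrm X (T n (c *\<^sub>R x)) = \<bar>c\<bar> * rnrm X (T n x)" using XR.N_scale[OF Tel(1)[OF x]] by simp
  next
    fix n :: nat
    have "rnrm X (T n x) \<le> real n * rnrm X x" if x: "x \<in> elems X" for x
    proof (rule rnrm_le[OF Tel(1)[OF x]])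
      show "nrm X (T n x) \<le> ennreal (real n * rnrm X x)" using le[OF x, of n] XR_nrm[OF x] Tel(2)[OF x] by (simp add: ennreal_mult)
    qed simp
    then show "\<exists>C\<ge>0. \<forall>x\<in>elems X. rnrm X (T n x) \<le> C * rnrm X x" by (intro exI[of _ "real n"]) auto
  next
    fix u v assume uv: "(u, v) \<in> genX r (GF r)"
    obtain v1 where v1: "(u, v1) \<in> maj_A_op i \<Omega> r \<alpha>1" using FA[OF uv] by blast
    have el: "u \<in> elems X" "v1 \<in> elems X" using v1 by (auto simp: maj_A_iff)
    have "rnrm X (T n u) \<le> rnrm X v1" for n
      by (rule rnrm_le[OF Tel(1)[OF el(1)]]) (use Tle[OF v1, of n] XR_nrm[OF el(2)] in auto)
    then show "\<exists>B. \<forall>n\<in>UNIV. rnrm X (T n u) \<le> B" by blast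
  qed
  then obtain B where B: "B \<ge> 0" "\<And>n u v. (u, v) \<in> genX r (GF r) \<Longrightarrow> rnrm X (T n u) \<le> B * (rnrm X u + rnrm X v)" by blast
  have "(\<integral>\<^sup>+m. ennreal (\<alpha>1 m) * nrm E (slice u m) \<partial>dm r) \<le> ennreal (B * (rnrm X u + rnrm X v))"
    if uv: "(u, v) \<in> genX r (GF r)" for u v
  proof -
    obtain v1 where v1: "(u, v1) \<in> maj_A_op i \<Omega> r \<alpha>1" using FA[OF uv] by blast
    have el: "u \<in> elems X" "v1 \<in> elems X" using v1 by (auto simp: maj_A_iff)
    have um: "(\<lambda>m. nrm E (slice u m)) \<in> borel_measurable (dm r)" using XR_slice_measurable[OF el(1)] by measurable
    have a1m: "\<alpha>1 \<in> borel_measurable (dm r)" and anm: "\<alpha>n n \<in> borel_measurable (dm r)" for n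
      using \<alpha>_measurable(1) \<alpha>nm by measurable
    have "(\<lambda>n. \<integral>\<^sup>+m. ennreal \<bar>\<alpha>n n m\<bar> * nrm E (slice u m) \<partial>dm r) \<longlonglongrightarrow> (\<integral>\<^sup>+m. ennreal (\<alpha>1 m) * nrm E (slice u m) \<partial>dm r)"
    proof (rule nn_integral_dominated_convergence[where w="\<lambda>m. ennreal (\<alpha>1 m) * nrm E (slice u m)"])
      show "(\<lambda>m. ennreal \<bar>\<alpha>n n m\<bar> * nrm E (slice u m)) \<in> borel_measurable (dm r)" for n using anm um by measurable
      show "(\<lambda>m. ennreal (\<alpha>1 m) * nrm E (slice u m)) \<in> borel_measurable (dm r)" using a1m um by measurable
      show "(\<lambda>m. ennreal (\<alpha>1 m) * nrm E (slice u m)) \<in> borel_measurable (dm r)" using a1m um by measurable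
      show "AE m in dm r. ennreal \<bar>\<alpha>n n m\<bar> * nrm E (slice u m) \<le> ennreal (\<alpha>1 m) * nrm E (slice u m)" for n
        using \<alpha>_ae by (auto simp: AE_dm_iff \<alpha>n_def elim!: eventually_mono intro!: mult_right_mono ennreal_leI)
      show "(\<integral>\<^sup>+m. ennreal (\<alpha>1 m) * nrm E (slice u m) \<partial>dm r) < \<infinity>"
        using maj_A_finite[OF v1] el(2) by (simp add: XR_elems_iff)
      show "AE m in dm r. (\<lambda>n. ennreal \<bar>\<alpha>n n m\<bar> * nrm E (slice u m)) \<longlonglongrightarrow> ennreal (\<alpha>1 m) * nrm E (slice u m)"
        unfolding AE_dm_iff using \<alpha>_ae
      proof (rule eventually_mono)
        fix m assume m: "0 \<le> \<alpha>1 m \<and> 0 \<le> \<alpha>2 m \<and> \<alpha>2 m \<le> M * \<alpha>1 m"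
        obtain k :: nat where k: "\<alpha>1 m \<le> real k" using real_arch_simple by blast
        have "\<forall>\<^sub>F n in sequentially. ennreal (\<alpha>1 m) * nrm E (slice u m) = ennreal \<bar>\<alpha>n n m\<bar> * nrm E (slice u m)"
          unfolding eventually_sequentially
        proof (intro exI allI impI)
          fix n assume "n \<ge> k"
          then have "\<alpha>1 m \<le> real n" using k by linarith
          then show "ennreal (\<alpha>1 m) * nrm E (slice u m) = ennreal \<bar>\<alpha>n n m\<bar> * nrm E (slice u m)" using m by (simp add: \<alpha>n_def)
        qed
        then show "(\<lambda>n. ennreal \<bar>\<alpha>n n m\<bar> * nrm E (slice u m)) \<longlonglongrightarrow> ennreal (\<alpha>1 m) * nrm E (slice u m)"
          by (rule Lim_transform_eventually[OF tendsto_const])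
      qed
    qed
    moreover have "(\<integral>\<^sup>+m. ennreal \<bar>\<alpha>n n m\<bar> * nrm E (slice u m) \<partial>dm r) \<le> ennreal (B * (rnrm X u + rnrm X v))" for n
      using B(2)[OF uv, of n] XR_nrm[OF Tel(1)[OF el(1), of n]] Tel(2)[OF el(1), of n] by (simp add: ennreal_leI)
    ultimately show ?thesis by (intro LIMSEQ_le_const2) auto
  qed
  then show ?thesis using B(1) by blast
qed

section \<open>Estimates in the intermediate spaces and of moments\<close>

lemma growth_bound_less:
  assumes "ereal \<omega> > growth_bound X (GF r)"
  obtains w C where "w < \<omega>" "C \<ge> 0" "\<And>t x. t \<ge> 0 \<Longrightarrow> x \<in> elems X \<Longrightarrow> rnrm X (GF r t x) \<le> C * exp (w * t) * rnrm X x"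
proof -
  from assms obtain z where "z \<in> {ereal w |w. \<exists>C. \<forall>t\<ge>0. \<forall>f\<in>elems X. nrm X (GF r t f) \<le> ennreal (C * exp (w * t)) * nrm X f}" "z < ereal \<omega>"
    unfolding growth_bound_def Inf_less_iff by blast
  then obtain w C where w: "w < \<omega>" and C': "\<forall>t\<ge>0. \<forall>f\<in>elems X. nrm X (GF r t f) \<le> ennreal (C * exp (w * t)) * nrm X f"
    by auto
  have C: "nrm X (GF r t f) \<le> ennreal (C * exp (w * t)) * nrm X f" if "t \<ge> 0" "f \<in> elems X" for t f
    using C' that by blast
  \<comment> \<open>The constant in the growth bound may be negative, hence the absolute
    value.\<close>
  have "rnrm X (GF r t x) \<le> \<bar>C\<bar> * exp (w * t) * rnrm X x" if t: "t \<ge> 0" and x: "x \<in> elems X" for t x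
  proof (rule rnrm_le[OF XR.sgV[OF sgF t x]])
    have "nrm X (GF r t x) \<le> ennreal (\<bar>C\<bar> * exp (w * t)) * nrm X x"
      using C[OF t x] by (rule order_trans) (intro mult_right_mono ennreal_leI, auto)
    then show "nrm X (GF r t x) \<le> ennreal (\<bar>C\<bar> * exp (w * t) * rnrm X x)" by (simp add: XR_nrm[OF x] ennreal_mult)
  qed simp
  then show thesis using w by (intro that[of w "\<bar>C\<bar>"]) auto
qed

text \<open>K is obtained before \<mu>: interpolation with y = \<omega> + \<alpha>1 reduces every
  \<mu> to the same bounds of G_F(t) f and of \<alpha>1 G_F(t) f.\<close>

lemma GF_interp_bound:
  assumes \<omega>: "\<omega> > 1" "ereal \<omega> > growth_bound X (GF r)"
  shows "\<exists>K\<ge>0. \<forall>\<mu>\<in>{0..1}. \<forall>t>0. \<forall>f\<in>elems X.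
    interp_norm i \<Omega> r \<alpha>1 \<omega> \<mu> (GF r t f) \<le> ennreal (K / t powr \<mu> * exp ((\<omega> + 1) * t)) * nrm X f"
proof -
  obtain w C where w: "w < \<omega>" and C: "C \<ge> 0" "\<And>t x. t \<ge> 0 \<Longrightarrow> x \<in> elems X \<Longrightarrow> rnrm X (GF r t x) \<le> C * exp (w * t) * rnrm X x"
    using growth_bound_less[OF \<omega>(2)] by blast
  obtain C' d where Cd: "C' \<ge> 0" "d > 0" "\<And>t x. 0 < t \<Longrightarrow> t < d \<Longrightarrow> x \<in> elems X \<Longrightarrow>
      \<exists>y. (GF r t x, y) \<in> genX r (GF r) \<and> rnrm X y \<le> C' / t * rnrm X x"
    using analytic_semigroup_bound[OF threshold_facts(3)] by blast
  have w\<omega>: "w \<le> \<omega>" "0 \<le> \<omega>" using w \<omega> by auto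
  obtain C2 where C2: "C2 \<ge> 0" "\<And>t x. 0 < t \<Longrightarrow> x \<in> elems X \<Longrightarrow>
      \<exists>y. (GF r t x, y) \<in> genX r (GF r) \<and> rnrm X y \<le> C2 / t * exp ((\<omega> + 1) * t) * rnrm X x"
    using XR.generator_bound_all_times[OF sgF w\<omega> C Cd] by blast
  obtain B where B: "B \<ge> 0" "\<And>u v. (u, v) \<in> genX r (GF r) \<Longrightarrow>
      (\<integral>\<^sup>+m. ennreal (\<alpha>1 m) * nrm E (slice u m) \<partial>dm r) \<le> ennreal (B * (rnrm X u + rnrm X v))"
    using \<alpha>1_bound by blast
  \<comment> \<open>After extraction of t^(-\<mu>) four terms remain for g = G_F(t) f and its image
    y: \<omega> t |g|, then B t |g| and B t |y| from the loss bound, and |g|. They contribute the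
    four summands in this order.\<close>
  define K where "K = \<omega> * C + B * C + B * C2 + C"
  have K: "K \<ge> 0" using \<omega> C B C2 by (simp add: K_def)
  have "interp_norm i \<Omega> r \<alpha>1 \<omega> \<mu> (GF r t f) \<le> ennreal (K / t powr \<mu> * exp ((\<omega> + 1) * t)) * nrm X f"
    if \<mu>: "\<mu> \<in> {0..1}" and t: "t > 0" and f: "f \<in> elems X" for \<mu> t f
  proof -
    define g where "g = GF r t f"
    have t0: "t \<ge> 0" using t by simp
    have gel: "g \<in> elems X" unfolding g_def by (rule XR.sgV[OF sgF t0 f])
    have gm: "(\<lambda>m. nrm E (slice g m)) \<in> borel_measurable (dm r)" using XR_slice_measurable[OF gel] by measurable
    have a1m: "\<alpha>1 \<in> borel_measurable (dm r)" using \<alpha>_measurable(1) by measurable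
    define e where "e = exp ((\<omega> + 1) * t)"
    have e0: "e \<ge> 0" by (simp add: e_def)
    have tt: "t \<le> exp t" using exp_ge_add_one_self[of t] by linarith
    have ew: "exp (w * t) \<le> exp (\<omega> * t)" using w t by simp
    have e\<omega>: "exp (\<omega> * t) * exp t = e" by (simp add: e_def exp_add[symmetric] algebra_simps)
    have E1: "exp (w * t) \<le> e"
    proof -
      have "exp (w * t) * 1 \<le> exp (\<omega> * t) * exp t" using ew t by (intro mult_mono) auto
      then show ?thesis using e\<omega> by simp
    qed
    \<comment> \<open>t^(1-\<mu>) equals t times t^(-\<mu>); the surplus factor t is absorbed by exp
      t in the rate \<omega> + 1.\<close>
    have E2: "t * exp (w * t) \<le> e"
    proof -
      have "exp (w * t) * t \<le> exp (\<omega> * t) * exp t" using ew tt t by (intro mult_mono) auto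
      then show ?thesis using e\<omega> by (simp add: mult.commute)
    qed
    have Ng: "rnrm X g \<le> C * exp (w * t) * rnrm X f" unfolding g_def by (rule C(2)[OF t0 f])
    obtain y where y: "(g, y) \<in> genX r (GF r)" "rnrm X y \<le> C2 / t * e * rnrm X f"
      using C2(2)[OF t f] unfolding g_def e_def by blast
    define I where "I = B * (rnrm X g + rnrm X y)"
    have I0: "I \<ge> 0" using B(1) by (simp add: I_def)
    have aI: "(\<integral>\<^sup>+m. ennreal (\<alpha>1 m) * nrm E (slice g m) \<partial>dm r) \<le> ennreal I" unfolding I_def by (rule B(2)[OF y(1)])
    have "interp_norm i \<Omega> r \<alpha>1 \<omega> \<mu> g \<le>
      (\<integral>\<^sup>+m. ennreal (t powr (1 - \<mu>)) * (ennreal \<omega> * nrm E (slice g m) + ennreal (\<alpha>1 m) * nrm E (slice g m)) + ennreal (t powr (- \<mu>)) * nrm E (slice g m) \<partial>dm r)"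
      unfolding interp_norm_def
    proof (rule nn_integral_mono_AE, unfold AE_dm_iff)
      show "AE m in Lm. nrm E (slice g m) * ennreal ((\<omega> + \<alpha>1 m) powr \<mu>) \<le>
          ennreal (t powr (1 - \<mu>)) * (ennreal \<omega> * nrm E (slice g m) + ennreal (\<alpha>1 m) * nrm E (slice g m)) + ennreal (t powr (- \<mu>)) * nrm E (slice g m)"
        using \<alpha>_ae
      proof (rule eventually_mono)
        fix m assume m: "0 \<le> \<alpha>1 m \<and> 0 \<le> \<alpha>2 m \<and> \<alpha>2 m \<le> M * \<alpha>1 m"
        have "ennreal ((\<omega> + \<alpha>1 m) powr \<mu>) \<le> ennreal (t powr (1 - \<mu>) * (\<omega> + \<alpha>1 m) + t powr (- \<mu>))"
          using m \<omega> \<mu> t by (intro ennreal_leI powr_interpolation) auto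
        also have "\<dots> = ennreal (t powr (1 - \<mu>)) * (ennreal \<omega> + ennreal (\<alpha>1 m)) + ennreal (t powr (- \<mu>))"
          using m \<omega> by (simp add: ennreal_mult)
        finally have "nrm E (slice g m) * ennreal ((\<omega> + \<alpha>1 m) powr \<mu>) \<le>
           nrm E (slice g m) * (ennreal (t powr (1 - \<mu>)) * (ennreal \<omega> + ennreal (\<alpha>1 m)) + ennreal (t powr (- \<mu>)))"
          by (rule mult_left_mono) simp
        also have "\<dots> = ennreal (t powr (1 - \<mu>)) * (ennreal \<omega> * nrm E (slice g m) + ennreal (\<alpha>1 m) * nrm E (slice g m)) + ennreal (t powr (- \<mu>)) * nrm E (slice g m)"
          by (simp add: distrib_left distrib_right mult_ac)
        finally show "nrm E (slice g m) * ennreal ((\<omega> + \<alpha>1 m) powr \<mu>) \<le>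
          ennreal (t powr (1 - \<mu>)) * (ennreal \<omega> * nrm E (slice g m) + ennreal (\<alpha>1 m) * nrm E (slice g m)) + ennreal (t powr (- \<mu>)) * nrm E (slice g m)" .
      qed
    qed
    also have "\<dots> = ennreal (t powr (1 - \<mu>)) * (ennreal \<omega> * nrm X g + (\<integral>\<^sup>+m. ennreal (\<alpha>1 m) * nrm E (slice g m) \<partial>dm r)) + ennreal (t powr (- \<mu>)) * nrm X g"
    proof -
      have m1: "(\<lambda>m. ennreal (\<alpha>1 m) * nrm E (slice g m)) \<in> borel_measurable (dm r)" using a1m gm by measurable
      have m2: "(\<lambda>m. ennreal c * nrm E (slice g m)) \<in> borel_measurable (dm r)" for c using gm by measurable
      have m3: "(\<lambda>m. ennreal \<omega> * nrm E (slice g m) + ennreal (\<alpha>1 m) * nrm E (slice g m)) \<in> borel_measurable (dm r)"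
        using m1 m2 by (intro borel_measurable_add)
      have m4: "(\<lambda>m. ennreal (t powr (1 - \<mu>)) * (ennreal \<omega> * nrm E (slice g m) + ennreal (\<alpha>1 m) * nrm E (slice g m))) \<in> borel_measurable (dm r)"
        using m3 by measurable
      show ?thesis
        unfolding XR_nrm_eq nn_integral_add[OF m4 m2] nn_integral_cmult[OF m3] nn_integral_add[OF m2 m1] nn_integral_cmult[OF gm] ..
    qed
    also have "\<dots> \<le> ennreal (t powr (1 - \<mu>)) * (ennreal \<omega> * ennreal (rnrm X g) + ennreal I) + ennreal (t powr (- \<mu>)) * ennreal (rnrm X g)"
      unfolding XR_nrm[OF gel] using aI by (intro add_mono mult_left_mono) auto
    also have "\<dots> = ennreal (t powr (1 - \<mu>) * (\<omega> * rnrm X g + I) + t powr (- \<mu>) * rnrm X g)"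
      using \<omega> I0 by (simp add: ennreal_mult)
    also have "\<dots> \<le> ennreal (K / t powr \<mu> * e * rnrm X f)"
    proof (rule ennreal_leI)
      have p: "t powr (1 - \<mu>) = t * t powr (- \<mu>)" using t by (simp add: powr_diff powr_minus divide_inverse)
      have tg: "t * rnrm X g \<le> C * e * rnrm X f"
      proof -
        have "t * rnrm X g \<le> t * (C * exp (w * t) * rnrm X f)" using Ng t by (intro mult_left_mono) auto
        also have "\<dots> = C * (t * exp (w * t)) * rnrm X f" by simp
        also have "\<dots> \<le> C * e * rnrm X f" using E2 C(1) by (intro mult_right_mono mult_left_mono) auto
        finally show ?thesis .
      qed
      have ng: "rnrm X g \<le> C * e * rnrm X f"
      proof -
        have "C * exp (w * t) * rnrm X f \<le> C * e * rnrm X f" using E1 C(1) by (intro mult_right_mono mult_left_mono) auto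
        then show ?thesis using Ng by linarith
      qed
      have ty: "t * rnrm X y \<le> C2 * e * rnrm X f"
      proof -
        have "t * rnrm X y \<le> t * (C2 / t * e * rnrm X f)" using y(2) t by (intro mult_left_mono) auto
        then show ?thesis using t by simp
      qed
      have "t powr (1 - \<mu>) * (\<omega> * rnrm X g + I) + t powr (- \<mu>) * rnrm X g =
          t powr (- \<mu>) * (\<omega> * (t * rnrm X g) + B * (t * rnrm X g) + B * (t * rnrm X y) + rnrm X g)"
        unfolding p I_def by (simp add: algebra_simps)
      also have "\<dots> \<le> t powr (- \<mu>) * (\<omega> * (C * e * rnrm X f) + B * (C * e * rnrm X f) + B * (C2 * e * rnrm X f) + C * e * rnrm X f)"
        using tg ng ty B(1) \<omega> by (intro mult_left_mono add_mono) auto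
      also have "\<dots> = K / t powr \<mu> * e * rnrm X f"
        unfolding K_def using t by (simp add: powr_minus divide_inverse algebra_simps)
      finally show "t powr (1 - \<mu>) * (\<omega> * rnrm X g + I) + t powr (- \<mu>) * rnrm X g \<le> K / t powr \<mu> * e * rnrm X f" .
    qed
    also have "\<dots> = ennreal (K / t powr \<mu> * e) * nrm X f" 
    proof -
      have "K / t powr \<mu> * e \<ge> 0" using K e0 by simp
      then show ?thesis unfolding XR_nrm[OF f] by (rule ennreal_mult) simp
    qed
    finally show ?thesis unfolding g_def e_def .
  qed
  then show ?thesis using K by blast
qed

lemma interp_norm_mono:
  assumes "AE m in Lm. nrm E (slice u m) \<le> nrm E (slice v m)"
  shows "interp_norm i \<Omega> r \<alpha>1 \<omega> \<mu> u \<le> interp_norm i \<Omega> r \<alpha>1 \<omega> \<mu> v"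
  unfolding interp_norm_def
  by (rule nn_integral_mono_AE) (use assms in \<open>auto simp: AE_dm_iff elim!: eventually_mono intro: mult_right_mono\<close>)

text \<open>The weights are compared pointwise. For large m the lower bound on \<alpha>1 makes
  (\<omega> + \<alpha>1)^\<mu> at least a multiple of m^q; for small m the moment weight is bounded,
  while \<omega> > 1 keeps the other weight at least 1.\<close>

lemma moment_le_interp:
  assumes \<omega>: "\<omega> > 1" and \<mu>: "\<mu> \<in> {0..1}" and c: "a0 > 0" "\<gamma> > 0" "m0 \<ge> 1"
    and low: "AE m in Lm. m \<ge> m0 \<longrightarrow> \<alpha>1 m \<ge> a0 * m powr \<gamma>"
  shows "\<exists>C1\<ge>0. \<forall>u\<in>elems X. nrm (XR (r + \<mu> * \<gamma>)) u \<le> ennreal C1 * interp_norm i \<Omega> r \<alpha>1 \<omega> \<mu> u"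
proof -
  define q where "q = \<mu> * \<gamma>"
  have q: "q \<ge> 0" using \<mu> c by (simp add: q_def)
  \<comment> \<open>The first two summands bound the weight 1 + m^(r+q) for m below m0; the last one
    comes from m^q <= a0^(-\<mu>) (\<omega> + \<alpha>1)^\<mu> for m above m0.\<close>
  define C1 where "C1 = 1 + m0 powr (r + q) + a0 powr (- \<mu>)"
  have C1: "C1 \<ge> 1" by (simp add: C1_def)
  have key: "AE m in Lm. 1 + m powr (r + q) \<le> C1 * ((1 + m powr r) * (\<omega> + \<alpha>1 m) powr \<mu>)"
    using low \<alpha>_ae AE_space
  proof eventually_elim
    case (elim m)
    have m0': "m \<ge> 0" and a: "\<alpha>1 m \<ge> 0" using elim by auto
    define W where "W = (\<omega> + \<alpha>1 m) powr \<mu>"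
    have W: "W \<ge> 1" unfolding W_def using \<omega> a \<mu> by (intro ge_one_powr_ge_zero) auto
    have pr: "m powr r \<ge> 0" by simp
    show ?case
    proof (cases "m \<ge> m0")
      case False
      have "m powr (r + q) \<le> m0 powr (r + q)" using False m0' r_bounds(2) q by (intro powr_mono2) auto
      then have "1 + m powr (r + q) \<le> C1 * 1" by (simp add: C1_def add_increasing2)
      also have "\<dots> \<le> C1 * ((1 + m powr r) * W)"
      proof (intro mult_left_mono)
        have "1 * 1 \<le> (1 + m powr r) * W" using W pr by (intro mult_mono) auto
        then show "1 \<le> (1 + m powr r) * W" by simp
      qed (use C1 in auto)
      finally show ?thesis by (simp add: W_def)
    next
      case True
      have "m powr \<gamma> \<le> (\<omega> + \<alpha>1 m) / a0"
      proof -
        have "a0 * m powr \<gamma> \<le> \<omega> + \<alpha>1 m" using elim True \<omega> by auto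
        then show ?thesis using c by (simp add: field_simps)
      qed
      then have "(m powr \<gamma>) powr \<mu> \<le> ((\<omega> + \<alpha>1 m) / a0) powr \<mu>" using \<mu> by (intro powr_mono2) auto
      also have "\<dots> = a0 powr (- \<mu>) * W" using c \<omega> a by (simp add: W_def powr_divide powr_minus_divide)
      finally have mq: "m powr q \<le> a0 powr (- \<mu>) * W" by (simp add: powr_powr q_def mult.commute)
      have "m powr (r + q) = m powr r * m powr q" by (simp add: powr_add)
      also have "\<dots> \<le> m powr r * (a0 powr (- \<mu>) * W)" using mq by (intro mult_left_mono) auto
      finally have "1 + m powr (r + q) \<le> W + a0 powr (- \<mu>) * (m powr r * W)" using W by (simp add: mult_ac)
      also have "\<dots> \<le> C1 * ((1 + m powr r) * W)"
      proof -
        have "1 * W \<le> C1 * W" using C1 W by (intro mult_right_mono) auto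
        moreover have "a0 powr (- \<mu>) * (m powr r * W) \<le> C1 * (m powr r * W)"
          using W pr by (intro mult_right_mono mult_nonneg_nonneg) (auto simp: C1_def)
        ultimately show ?thesis by (simp add: algebra_simps)
      qed
      finally show ?thesis by (simp add: W_def)
    qed
  qed
  have "nrm (XR (r + q)) u \<le> ennreal C1 * interp_norm i \<Omega> r \<alpha>1 \<omega> \<mu> u" if u: "u \<in> elems X" for u
  proof -
    note um = XR_slice_measurable[OF u]
    have Wm: "(\<lambda>m. ennreal ((\<omega> + \<alpha>1 m) powr \<mu>)) \<in> borel_measurable Lm"
    proof -
      have pm: "(\<lambda>y. ennreal ((\<omega> + y) powr \<mu>)) \<in> borel_measurable borel" by measurable
      show ?thesis by (rule measurable_compose[OF \<alpha>_measurable(1) pm])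
    qed
    have uWm: "(\<lambda>m. nrm E (slice u m) * ennreal ((\<omega> + \<alpha>1 m) powr \<mu>)) \<in> borel_measurable Lm"
      by (rule borel_measurable_times_ennreal[OF um Wm])
    have "nrm (XR (r + q)) u = (\<integral>\<^sup>+m. ennreal (1 + m powr (r + q)) * nrm E (slice u m) \<partial>Lm)"
      unfolding XR_nrm_eq by (rule nn_integral_dm[OF um])
    also have "\<dots> \<le> (\<integral>\<^sup>+m. ennreal C1 * (ennreal (1 + m powr r) * (nrm E (slice u m) * ennreal ((\<omega> + \<alpha>1 m) powr \<mu>))) \<partial>Lm)"
    proof (rule nn_integral_mono_AE)
      show "AE m in Lm. ennreal (1 + m powr (r + q)) * nrm E (slice u m) \<le>
          ennreal C1 * (ennreal (1 + m powr r) * (nrm E (slice u m) * ennreal ((\<omega> + \<alpha>1 m) powr \<mu>)))"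
        using key
      proof (rule eventually_mono)
        fix m assume m: "1 + m powr (r + q) \<le> C1 * ((1 + m powr r) * (\<omega> + \<alpha>1 m) powr \<mu>)"
        define R where "R = 1 + m powr r"
        have R: "R \<ge> 0" using powr_ge_zero[of m r] unfolding R_def by (intro add_nonneg_nonneg) auto
        have "ennreal (1 + m powr (r + q)) * nrm E (slice u m) \<le> ennreal (C1 * (R * (\<omega> + \<alpha>1 m) powr \<mu>)) * nrm E (slice u m)"
          using m unfolding R_def by (intro mult_right_mono ennreal_leI) auto
        also have "\<dots> = ennreal C1 * (ennreal R * (nrm E (slice u m) * ennreal ((\<omega> + \<alpha>1 m) powr \<mu>)))"
          using C1 R by (simp add: ennreal_mult mult_ac)
        finally show "ennreal (1 + m powr (r + q)) * nrm E (slice u m) \<le>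
          ennreal C1 * (ennreal (1 + m powr r) * (nrm E (slice u m) * ennreal ((\<omega> + \<alpha>1 m) powr \<mu>)))" unfolding R_def .
      qed
    qed
    also have "\<dots> = ennreal C1 * interp_norm i \<Omega> r \<alpha>1 \<omega> \<mu> u"
      unfolding interp_norm_def nn_integral_dm[OF uWm]
      by (rule nn_integral_cmult[OF borel_measurable_times_ennreal[OF dm_weight_measurable uWm]])
    finally show ?thesis .
  qed
  then show ?thesis using C1 unfolding q_def by (intro exI[of _ C1]) auto
qed

end

theorem theorem3p3:
  fixes i :: nat and \<Omega> :: "(real^'n) set"
    and a :: "real^'n \<Rightarrow> real \<Rightarrow> real" and \<alpha>1 \<alpha>2 :: "real \<Rightarrow> real" and M :: real
    and b :: "real^'n \<Rightarrow> real \<Rightarrow> real \<Rightarrow> real" and \<beta> :: "real \<Rightarrow> real \<Rightarrow> real"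
    and T0 :: "real \<Rightarrow> (real^'n \<Rightarrow> real) \<Rightarrow> real^'n \<Rightarrow> real"
    and D0 :: "real \<Rightarrow> (real^'n \<Rightarrow> real) set"
    and GTm :: "real \<Rightarrow> real \<Rightarrow> (real^'n \<Rightarrow> real) \<Rightarrow> real^'n \<Rightarrow> real"
    and GF GKmaj GK :: "real \<Rightarrow> real \<Rightarrow> ((real^'n) \<times> real \<Rightarrow> real) \<Rightarrow> (real^'n) \<times> real \<Rightarrow> real"
    and b0 \<beta>0 l r0 s0 r1 :: real
  assumes "i \<in> {0, 1}"
    and "(open \<Omega> \<and> bounded \<Omega> \<and> C2_boundary \<Omega>) \<or> \<Omega> = UNIV"
    and "rate_assumption i \<Omega> a \<alpha>1 \<alpha>2 M"
    and "kernel_b \<Omega> b"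
    and "kernel_beta \<beta>"
    and "transport_assumption i \<Omega> T0 D0 GTm"
    and "assumption_A1 i \<Omega> T0 D0 GTm"
    and hyp1: "b0 \<ge> 1" "l \<ge> 0"
      "AE (x, s) in lebesgue_on (\<Omega> \<times> {0..}).
         (\<integral>\<^sup>+m\<in>{0..s}. ennreal (b x m s) \<partial>lebesgue) \<le> ennreal (b0 * (1 + s powr l))"
    and hyp2: "\<forall>s\<ge>0. (\<integral>\<^sup>+m\<in>{0..s}. ennreal (\<beta> m s) \<partial>lebesgue) \<le> ennreal (\<beta>0 * (1 + s powr l))"
    and hyp3: "r0 \<ge> 0" "s0 \<ge> 0"
      "equi_integrable {(\<lambda>z. s * z powr r0 * \<beta> (z * s) s) |s. s \<ge> s0}"
    and hyp4: "AE (x, m, s) in lebesgue_on (\<Omega> \<times> {0..} \<times> {0..}). m \<le> s \<longrightarrow> b x m s \<le> \<beta> m s"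
    and hyp5: "\<forall>m\<ge>0. \<forall>m'\<ge>0. T0 m = T0 m' \<and> D0 m = D0 m'"
    and "threshold i \<Omega> T0 D0 a b \<alpha>1 \<alpha>2 \<beta> GF GKmaj GK l r0 r1"
  shows "\<forall>r\<ge>r1. \<forall>\<omega>>1. ereal \<omega> > growth_bound (X_r i \<Omega> r) (GF r) \<longrightarrow>
    (\<exists>\<omega>r. \<forall>\<mu>\<in>{0..1}. \<exists>Mr\<ge>0.
      (\<forall>t>0. \<forall>f\<in>elems (X_r i \<Omega> r).
        (f \<in> cone (X_r i \<Omega> r) \<longrightarrow>
           interp_norm i \<Omega> r \<alpha>1 \<omega> \<mu> (GK r t f) \<le> interp_norm i \<Omega> r \<alpha>1 \<omega> \<mu> (GKmaj r t f)) \<and>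
        interp_norm i \<Omega> r \<alpha>1 \<omega> \<mu> (GK r t f)
          \<le> ennreal (Mr / t powr \<mu> * exp (\<omega>r * t)) * nrm (X_r i \<Omega> r) f \<and>
        interp_norm i \<Omega> r \<alpha>1 \<omega> \<mu> (GKmaj r t f)
          \<le> ennreal (Mr / t powr \<mu> * exp (\<omega>r * t)) * nrm (X_r i \<Omega> r) f) \<and>
      (\<forall>a0 \<gamma> m0. a0 > 0 \<longrightarrow> \<gamma> > 0 \<longrightarrow> m0 \<ge> 1 \<longrightarrow>
        (AE m in lebesgue_on {0..}. m \<ge> m0 \<longrightarrow> \<alpha>1 m \<ge> a0 * m powr \<gamma>) \<longrightarrow>
        (\<exists>C1\<ge>0. \<forall>t>0. \<forall>f\<in>elems (X_r i \<Omega> r).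
          (f \<in> cone (X_r i \<Omega> r) \<longrightarrow>
             nrm (X_r i \<Omega> (r + \<mu> * \<gamma>)) (GK r t f) \<le> nrm (X_r i \<Omega> (r + \<mu> * \<gamma>)) (GKmaj r t f)) \<and>
          nrm (X_r i \<Omega> (r + \<mu> * \<gamma>)) (GK r t f)
            \<le> ennreal (C1 * (Mr / t powr \<mu>) * exp (\<omega>r * t)) * nrm (X_r i \<Omega> r) f \<and>
          nrm (X_r i \<Omega> (r + \<mu> * \<gamma>)) (GKmaj r t f)
            \<le> ennreal C1 * interp_norm i \<Omega> r \<alpha>1 \<omega> \<mu> (GKmaj r t f) \<and>
          ennreal C1 * interp_norm i \<Omega> r \<alpha>1 \<omega> \<mu> (GKmaj r t f)
            \<le> ennreal (C1 * (Mr / t powr \<mu>) * exp (\<omega>r * t)) * nrm (X_r i \<Omega> r) f)))"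
proof (cases "\<Omega> = {}")
  case True
  \<comment> \<open>Over the empty set the integral is 0 and the supremum is the least element of
    \<open>ennreal\<close>, again 0, so all the inequalities become trivial.\<close>
  have "nrm (X_x i \<Omega>) f = 0" for f :: "real^'n \<Rightarrow> real"
    using True by (simp add: X_x_def L1_space_def C0_space_def nn_integral_empty bot_ennreal)
  then have "nrm (X_r i \<Omega> q) f = 0" "interp_norm i \<Omega> q \<alpha>1 \<omega> \<mu> f = 0" for q \<omega> \<mu> f
    by (simp_all add: X_r_def interp_norm_def)
  then show ?thesis by auto
next
  case False
  show ?thesis
  proof (intro allI impI)
    fix r \<omega> assume r: "r \<ge> r1" and \<omega>: "\<omega> > 1" "ereal \<omega> > growth_bound (X_r i \<Omega> r) (GF r)"
    interpret transport_fragmentation i \<Omega> a \<alpha>1 \<alpha>2 M b \<beta> T0 D0 GTm GF GKmaj GK \<beta>0 l r0 r1 r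
      by (intro transport_fragmentation.intro space_setting.intro transport_fragmentation_axioms.intro assms False r)
        (use assms(2) in blast)
    obtain K where K: "K \<ge> 0" "\<forall>\<mu>\<in>{0..1}. \<forall>t>0. \<forall>f\<in>elems X.
        interp_norm i \<Omega> r \<alpha>1 \<omega> \<mu> (GF r t f) \<le> ennreal (K / t powr \<mu> * exp ((\<omega> + 1) * t)) * nrm X f"
      using GF_interp_bound[OF \<omega>] by blast
    have Kmaj: "interp_norm i \<Omega> r \<alpha>1 \<omega> \<mu> (GKmaj r t f) \<le> ennreal (K / t powr \<mu> * exp ((\<omega> + 1) * t)) * nrm X f"
      if "\<mu> \<in> {0..1}" "t > 0" "f \<in> elems X" for \<mu> t f
    proof -
      have "t \<ge> 0" using that by simp
      from interp_norm_mono[OF GKmaj_slice_le[OF this that(3)]]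
      show ?thesis by (rule order_trans) (use K(2) that in blast)
    qed
    have el: "GKmaj r t f \<in> elems X" if "t > 0" "f \<in> elems X" for t f
      using XR.sgV[OF sgKm _ that(2)] that(1) by simp
    have cone_le: "AE m in Lm. nrm E (slice (GK r t f) m) \<le> nrm E (slice (GKmaj r t f) m)"
      if "t > 0" "f \<in> elems X" "f \<in> cone X" for t f
      using GK_slice_le[OF _ that(2,3)] that(1) by simp
    have abs_le: "AE m in Lm. nrm E (slice (GK r t f) m) \<le> nrm E (slice (GKmaj r t (\<lambda>p. \<bar>f p\<bar>)) m)"
      if "t > 0" "f \<in> elems X" for t f
      using GK_slice_le_abs[OF _ that(2)] that(1) by simp
    show "\<exists>\<omega>r. \<forall>\<mu>\<in>{0..1}. \<exists>Mr\<ge>0.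
      (\<forall>t>0. \<forall>f\<in>elems X.
        (f \<in> cone X \<longrightarrow>
           interp_norm i \<Omega> r \<alpha>1 \<omega> \<mu> (GK r t f) \<le> interp_norm i \<Omega> r \<alpha>1 \<omega> \<mu> (GKmaj r t f)) \<and>
        interp_norm i \<Omega> r \<alpha>1 \<omega> \<mu> (GK r t f)
          \<le> ennreal (Mr / t powr \<mu> * exp (\<omega>r * t)) * nrm X f \<and>
        interp_norm i \<Omega> r \<alpha>1 \<omega> \<mu> (GKmaj r t f)
          \<le> ennreal (Mr / t powr \<mu> * exp (\<omega>r * t)) * nrm X f) \<and>
      (\<forall>a0 \<gamma> m0. a0 > 0 \<longrightarrow> \<gamma> > 0 \<longrightarrow> m0 \<ge> 1 \<longrightarrow>
        (AE m in Lm. m \<ge> m0 \<longrightarrow> \<alpha>1 m \<ge> a0 * m powr \<gamma>) \<longrightarrow>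
        (\<exists>C1\<ge>0. \<forall>t>0. \<forall>f\<in>elems X.
          (f \<in> cone X \<longrightarrow>
             nrm (XR (r + \<mu> * \<gamma>)) (GK r t f) \<le> nrm (XR (r + \<mu> * \<gamma>)) (GKmaj r t f)) \<and>
          nrm (XR (r + \<mu> * \<gamma>)) (GK r t f)
            \<le> ennreal (C1 * (Mr / t powr \<mu>) * exp (\<omega>r * t)) * nrm X f \<and>
          nrm (XR (r + \<mu> * \<gamma>)) (GKmaj r t f)
            \<le> ennreal C1 * interp_norm i \<Omega> r \<alpha>1 \<omega> \<mu> (GKmaj r t f) \<and>
          ennreal C1 * interp_norm i \<Omega> r \<alpha>1 \<omega> \<mu> (GKmaj r t f)
            \<le> ennreal (C1 * (Mr / t powr \<mu>) * exp (\<omega>r * t)) * nrm X f))"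
    \<comment> \<open>The rate is chosen before \<mu>, as demanded; K happens to be common to all
      \<mu> as well.\<close>
    proof (rule exI[of _ "\<omega> + 1"], rule ballI, rule exI[of _ K], intro conjI allI impI ballI)
      show "0 \<le> K" by (rule K(1))
    next
      fix \<mu> t :: real and f assume \<mu>: "\<mu> \<in> {0..1}" and t: "t > 0" and f: "f \<in> elems X"
      show "interp_norm i \<Omega> r \<alpha>1 \<omega> \<mu> (GK r t f) \<le> interp_norm i \<Omega> r \<alpha>1 \<omega> \<mu> (GKmaj r t f)" if "f \<in> cone X"
        by (rule interp_norm_mono[OF cone_le[OF t f that]])
      show "interp_norm i \<Omega> r \<alpha>1 \<omega> \<mu> (GKmaj r t f) \<le> ennreal (K / t powr \<mu> * exp ((\<omega> + 1) * t)) * nrm X f"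
        by (rule Kmaj[OF \<mu> t f])
      \<comment> \<open>Without a sign condition on f the slices of G_K(t) f are compared with those
        of G_maj(t) |f|, and |f| has the same norm as f.\<close>
      have af: "(\<lambda>p. \<bar>f p\<bar>) \<in> elems X" "nrm X (\<lambda>p. \<bar>f p\<bar>) = nrm X f" using XR_abs[OF f] by auto
      show "interp_norm i \<Omega> r \<alpha>1 \<omega> \<mu> (GK r t f) \<le> ennreal (K / t powr \<mu> * exp ((\<omega> + 1) * t)) * nrm X f"
        using order_trans[OF interp_norm_mono[OF abs_le[OF t f]] Kmaj[OF \<mu> t af(1)]] af(2) by simp
    next
      fix \<mu> a0 \<gamma> m0 :: real assume \<mu>: "\<mu> \<in> {0..1}" and c: "a0 > 0" "\<gamma> > 0" "m0 \<ge> 1"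
        and low: "AE m in Lm. m \<ge> m0 \<longrightarrow> \<alpha>1 m \<ge> a0 * m powr \<gamma>"
      obtain C1 where C1: "C1 \<ge> 0" "\<And>u. u \<in> elems X \<Longrightarrow> nrm (XR (r + \<mu> * \<gamma>)) u \<le> ennreal C1 * interp_norm i \<Omega> r \<alpha>1 \<omega> \<mu> u"
        using moment_le_interp[OF \<omega>(1) \<mu> c low] by blast
      have up: "ennreal C1 * interp_norm i \<Omega> r \<alpha>1 \<omega> \<mu> (GKmaj r t f)
          \<le> ennreal (C1 * (K / t powr \<mu>) * exp ((\<omega> + 1) * t)) * nrm X f" if t: "t > 0" and f: "f \<in> elems X" for t f
      proof -
        have "ennreal C1 * interp_norm i \<Omega> r \<alpha>1 \<omega> \<mu> (GKmaj r t f) \<le>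
            ennreal C1 * (ennreal (K / t powr \<mu> * exp ((\<omega> + 1) * t)) * nrm X f)"
          by (rule mult_left_mono[OF Kmaj[OF \<mu> t f]]) simp
        also have "\<dots> = ennreal (C1 * (K / t powr \<mu> * exp ((\<omega> + 1) * t))) * nrm X f"
          by (simp only: ennreal_mult'[OF C1(1)] mult.assoc)
        finally show ?thesis by (simp only: mult.assoc)
      qed
      show "\<exists>C1\<ge>0. \<forall>t>0. \<forall>f\<in>elems X.
          (f \<in> cone X \<longrightarrow>
             nrm (XR (r + \<mu> * \<gamma>)) (GK r t f) \<le> nrm (XR (r + \<mu> * \<gamma>)) (GKmaj r t f)) \<and>
          nrm (XR (r + \<mu> * \<gamma>)) (GK r t f)
            \<le> ennreal (C1 * (K / t powr \<mu>) * exp ((\<omega> + 1) * t)) * nrm X f \<and>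
          nrm (XR (r + \<mu> * \<gamma>)) (GKmaj r t f)
            \<le> ennreal C1 * interp_norm i \<Omega> r \<alpha>1 \<omega> \<mu> (GKmaj r t f) \<and>
          ennreal C1 * interp_norm i \<Omega> r \<alpha>1 \<omega> \<mu> (GKmaj r t f)
            \<le> ennreal (C1 * (K / t powr \<mu>) * exp ((\<omega> + 1) * t)) * nrm X f"
      proof (intro exI[of _ C1] conjI allI impI ballI)
        show "0 \<le> C1" by (rule C1(1))
        fix t :: real and f assume t: "t > 0" and f: "f \<in> elems X"
        show "nrm (XR (r + \<mu> * \<gamma>)) (GK r t f) \<le> nrm (XR (r + \<mu> * \<gamma>)) (GKmaj r t f)" if "f \<in> cone X"
          by (rule nrm_mono_slices[OF cone_le[OF t f that]])
        show "nrm (XR (r + \<mu> * \<gamma>)) (GKmaj r t f) \<le> ennreal C1 * interp_norm i \<Omega> r \<alpha>1 \<omega> \<mu> (GKmaj r t f)"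
          by (rule C1(2)[OF el[OF t f]])
        show "ennreal C1 * interp_norm i \<Omega> r \<alpha>1 \<omega> \<mu> (GKmaj r t f)
            \<le> ennreal (C1 * (K / t powr \<mu>) * exp ((\<omega> + 1) * t)) * nrm X f" by (rule up[OF t f])
        \<comment> \<open>The passage to |f| precedes the change of weight, because G_maj(t) |f| is
          the function to which the moment estimate and then the intermediate bound apply.\<close>
        have af: "(\<lambda>p. \<bar>f p\<bar>) \<in> elems X" "nrm X (\<lambda>p. \<bar>f p\<bar>) = nrm X f" using XR_abs[OF f] by auto
        show "nrm (XR (r + \<mu> * \<gamma>)) (GK r t f) \<le> ennreal (C1 * (K / t powr \<mu>) * exp ((\<omega> + 1) * t)) * nrm X f"
          using order_trans[OF nrm_mono_slices[OF abs_le[OF t f]] order_trans[OF C1(2)[OF el[OF t af(1)]] up[OF t af(1)]]] af(2)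
          by simp
      qed
    qed
  qed
qed

end
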